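(* Let $R$ be a $(\varphi,\Gamma)$-ring. The functors $\mathbb{D}=R\otimes_{R[[N_1,\ell]],\ell_R}\cdot$ and $\mathbb{M}=R[[N_1,\ell]]\otimes_{R,\iota_R}\cdot$ are quasi-inverse equivalences of categories between $\mathfrak{M}(R[[N_1,\ell]],T_{+,\ell})$ and $\mathfrak{M}(R,T_{+,\ell})$.
   Context: $G$ is the group of $\mathbb{Q}_p$-points of a $\mathbb{Q}_p$-split connected reductive group over $\mathbb{Q}_p$ with connected centre; $P=TN$ is a Borel subgroup with maximal split torus $T$ and unipotent radical $N$; $\Phi^+\supseteq\Delta$ are the positive and simple roots; $N_\beta\subseteq N$ is the root subgroup of $\beta\in\Phi^+$. $N_0\subseteq N$ is a compact open subgroup that is totally decomposed: $N_0=\prod_{\beta\in\Phi^+}(N_0\cap N_\beta)$ for any total ordering of $\Phi^+$. $T_+:=\{t\in T\mid tN_0t^{-1}\subseteq N_0\}$. For $\alpha\in\Delta$ fix isomorphisms $\iota_\alpha\colon N_\alpha\cong\mathbb{Q}_p$ with $\iota_\alpha(tnt^{-1})=\alpha(t)\iota_\alpha(n)$ and $\iota_\alpha(N_0\cap N_\alpha)=\mathbb{Z}_p$. Fix a homomorphism $\ell\colon\prod_{\alpha\in\Delta}N_\alpha\to\mathbb{Q}_p$ (a linear combination of the $\iota_\alpha$), viewed as a functional on $N$ via $N\to N/[N,N]\to\prod_{\alpha\in\Delta}N_\alpha$, with $\ell(N_0)=\mathbb{Z}_p$. $N_1:=\ker(\ell|_{N_0})$. Fix a cocharacter $\xi\in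 X_*(T)$ with $\alpha\circ\xi=\mathrm{id}_{\mathbb{G}_m}$ for all $\alpha\in\Delta$; $\Gamma:=\xi(\mathbb{Z}_p^\times)$, $s:=\xi(p)$, and $\varphi=\varphi_s$ is conjugation by $s$ on $N_0$, so $\ell\circ\varphi=p\ell$. $T_{+,\ell}:=\{t\in T_+\mid tN_1t^{-1}\subseteq N_1\}$. A $\varphi$-ring over $\mathbb{Z}_p$ is a commutative ring $R$ with $1$, an injective group homomorphism $\chi\colon\mathbb{Z}_p\hookrightarrow R^\times$ and an injective ring endomorphism $\varphi$ with $\varphi(\chi(x))=\chi(px)$ and $R=\bigoplus_{i=0}^{p-1}\chi(i)\varphi(R)$. A $(\varphi,\Gamma)$-ring is a $\varphi$-ring over $\mathbb{Z}_p$ together with an action of $\Gamma\cong\mathbb{Z}_p^\times$ commuting with $\varphi$ and satisfying $\gamma(\chi(x))=\chi(\xi^{-1}(\gamma)x)$. Fix a group homomorphism $\iota\colon\mathbb{Z}_p\hookrightarrow N_0$ that is a section of $\ell$ (i.e. $\ell\circ\iota=\mathrm{id}$) and is $\varphi$-equivariant, i.e. $\iota(px)=\varphi(\iota(x))$ for all $x\in\mathbb{Z}_p$. For $k\ge1$, $N_k\lhd N_0$ is the normal subgroup of $N_0$ generated by $\varphi^{k-1}(N_1)$. $R[N_1/N_k,\ell]:=\bigoplus_{h\in N_1/N_k}Rh$ as left $R$-module; choosing $c_k\ge1$ such that $\iota(p^{c_k}\mathbb{Z}_p)$ acts trivially on $N_1/N_k$ by conjugation and writing uniquely $r_2=\sum_{i=0}^{p^{c_k}-1}\chi(i)\varphi^{c_k}(r_{i,2})$,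 the multiplication is $(r_1h_1)(r_2h_2):=\sum_ir_1\chi(i)\varphi^{c_k}(r_{i,2})(\iota(i)^{-1}h_1\iota(i)h_2)$. Up to natural isomorphism this ring does not depend on the choice of $\iota$. $R[[N_1,\ell]]:=\varprojlim_kR[N_1/N_k,\ell]$; $\ell_R\colon R[[N_1,\ell]]\to R$ is the ring homomorphism induced by the augmentation $N_1\to1$, and $\iota_R\colon R\to R[[N_1,\ell]]$ is the natural inclusion, so $\ell_R\circ\iota_R=\mathrm{id}_R$. Action of $T_{+,\ell}$ on the rings: conjugation by $t\in T_{+,\ell}$ on $N_0$ induces via $\ell$ an endomorphism of $\mathbb{Z}_p=\ell(N_0)$; this gives a monoid homomorphism $T_{+,\ell}\to\mathbb{Z}_p\setminus\{0\}\cong\varphi^{\mathbb{N}}\Gamma$, through which $T_{+,\ell}$ acts on $R$. Moreover $tN_kt^{-1}\subseteq N_k$ for $t\in T_{+,\ell}$, so $t$ acts naturally, by conjugation, on the skew group rings $R[N_1/N_k,\ell]$, and by taking the limit on $R[[N_1,\ell]]$. The map induced by $t$ on $R$ and on $R[[N_1,\ell]]$ is denoted $\varphi_t$. For $S=R$ or $R[[N_1,\ell]]$, a $T_{+,\ell}$-module over $S$ is a finitely generated free $S$-module $M$ with a semilinear action of $T_{+,\ell}$ (maps $\varphi_t\colon M\to M$) such that, for $t=s$, the map $S\otimes_{S,\varphi_s}M\to M$, $r\otimes m\mapsto r\varphi_s(m)$, is an isomorphism. $\mathfrak{M}(S,T_{+,\ell})$ is the category of these, with $S$-linear $T_{+,\ell}$-equivariant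 maps. *)

theory Defs
  imports
    "HOL-Analysis.Analysis"
    "HOL-Algebra.Solvable_Groups"
    "HOL-Algebra.Algebraic_Closure_Type"
    "HOL-Computational_Algebra.Computational_Algebra"
begin

section \<open>The $p$-adic numbers\<close>

text \<open>The prime is carried by a type parameter: $p = CARD('p)$.\<close>

class prime_type =
  assumes prime_type: "Factorial_Ring.prime CARD('a)"

typedef (overloaded) 'p zp =
  "{f :: nat \<Rightarrow> int. \<forall>n. f n = f (Suc n) mod int CARD('p :: prime_type) ^ n}"
  by (rule exI[of _ "\<lambda>_. 0"]) simp

setup_lifting type_definition_zp

lemma zp_mod_Suc: "(x mod (q :: int) ^ Suc n) mod q ^ n = x mod q ^ n"
  by (rule mod_mod_cancel) simp

lemma zp_mod_cong:
  fixes a b :: int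
  assumes "a = a' mod m" "b = b' mod m"
  shows "(a + b) mod m = (a' + b') mod m" "(a * b) mod m = (a' * b') mod m"
    "(a - b) mod m = (a' - b') mod m" "(- a) mod m = (- a') mod m"
  using assms by (simp_all add: mod_add_eq mod_mult_eq mod_diff_eq mod_minus_eq)

lemma zp_reduced: "Rep_zp a n mod int CARD('p) ^ n = Rep_zp (a :: 'p :: prime_type zp) n"
proof -
  have "Rep_zp a n = Rep_zp a (Suc n) mod int CARD('p) ^ n"
    using Rep_zp[of a] by blast
  then show ?thesis by (metis mod_mod_trivial)
qed

lemma zp_eqI: "(\<And>n. Rep_zp a n = Rep_zp b n) \<Longrightarrow> a = b"
  by (simp add: Rep_zp_inject[symmetric] fun_eq_iff)

instantiation zp :: (prime_type) comm_ring_1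
begin

lift_definition zero_zp :: "'a zp" is "\<lambda>_. 0" by simp

lift_definition one_zp :: "'a zp" is "\<lambda>n. 1 mod int CARD('a) ^ n"
  by (simp only: zp_mod_Suc)

lift_definition plus_zp :: "'a zp \<Rightarrow> 'a zp \<Rightarrow> 'a zp"
  is "\<lambda>f g n. (f n + g n) mod int CARD('a) ^ n"
  by (unfold zp_mod_Suc, rule zp_mod_cong(1); blast)

lift_definition times_zp :: "'a zp \<Rightarrow> 'a zp \<Rightarrow> 'a zp"
  is "\<lambda>f g n. (f n * g n) mod int CARD('a) ^ n"
  by (unfold zp_mod_Suc, rule zp_mod_cong(2); blast)

lift_definition uminus_zp :: "'a zp \<Rightarrow> 'a zp"
  is "\<lambda>f n. (- f n) mod int CARD('a) ^ n"
  by (unfold zp_mod_Suc, rule zp_mod_cong(4); blast)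

lift_definition minus_zp :: "'a zp \<Rightarrow> 'a zp \<Rightarrow> 'a zp"
  is "\<lambda>f g n. (f n - g n) mod int CARD('a) ^ n"
  by (unfold zp_mod_Suc, rule zp_mod_cong(3); blast)

instance
proof
  fix a b c :: "'a zp"
  note rep = zero_zp.rep_eq one_zp.rep_eq plus_zp.rep_eq times_zp.rep_eq uminus_zp.rep_eq
    minus_zp.rep_eq
  show "a * b * c = a * (b * c)"
    by (rule zp_eqI) (simp add: rep mod_mult_left_eq mod_mult_right_eq mult.assoc)
  show "a * b = b * a"
    by (rule zp_eqI) (simp add: rep mult.commute)
  show "1 * a = a"
    by (rule zp_eqI) (simp add: rep mod_mult_left_eq zp_reduced)
  show "a + b + c = a + (b + c)"
    by (rule zp_eqI) (simp add: rep mod_add_left_eq mod_add_right_eq add.assoc)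
  show "a + b = b + a"
    by (rule zp_eqI) (simp add: rep add.commute)
  show "0 + a = a"
    by (rule zp_eqI) (simp add: rep zp_reduced)
  show "- a + a = 0"
    by (rule zp_eqI) (simp add: rep mod_add_left_eq)
  show "a - b = a + - b"
    by (rule zp_eqI) (simp add: rep mod_add_right_eq)
  show "(a + b) * c = a * c + b * c"
    by (rule zp_eqI) (simp add: rep mod_mult_left_eq mod_add_eq distrib_right)
  have "int CARD('a) > 1"
    using prime_gt_1_nat[OF prime_type[where 'a = 'a]] by simp
  then have "Rep_zp (0 :: 'a zp) 1 \<noteq> Rep_zp (1 :: 'a zp) 1"
    by (simp add: rep)
  then show "(0 :: 'a zp) \<noteq> 1" by metis
qed

end

lemma zp_mod_le:
  assumes "\<forall>n. f n = f (Suc n) mod (q :: int) ^ n" and "m \<le> n"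
  shows "f n mod q ^ m = f m"
  using assms(2)
proof (induction n rule: dec_induct)
  case base
  show ?case using assms(1) by (metis mod_mod_trivial)
next
  case (step n)
  have "f (Suc n) mod q ^ m = f (Suc n) mod q ^ n mod q ^ m"
    by (rule mod_mod_cancel[symmetric]) (use step in \<open>simp add: le_imp_power_dvd\<close>)
  also have "f (Suc n) mod q ^ n = f n"
    using assms(1) by metis
  finally show ?case using step.IH by simp
qed

instance zp :: (prime_type) idom
proof
  fix a b :: "'a zp"
  assume "a \<noteq> 0" "b \<noteq> 0"
  then show "a * b \<noteq> 0"
  proof (transfer, safe)
    fix f g :: "nat \<Rightarrow> int"
    let ?q = "int CARD('a)"
    assume f: "\<forall>n. f n = f (Suc n) mod ?q ^ n" and g: "\<forall>n. g n = g (Suc n) mod ?q ^ n"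
      and nz: "f \<noteq> (\<lambda>_. 0)" "g \<noteq> (\<lambda>_. 0)"
      and eq: "(\<lambda>n. f n * g n mod ?q ^ n) = (\<lambda>_. 0)"
    from nz obtain m k where mk: "f m \<noteq> 0" "g k \<noteq> 0" by blast
    have "?q ^ (m + k) dvd f (m + k) * g (m + k)"
      using fun_cong[OF eq, of "m + k"] by (simp add: mod_eq_0_iff_dvd)
    moreover have "prime_elem ?q"
      using prime_type[where 'a = 'a] by simp
    ultimately obtain i j where ij: "i + j = m + k" "?q ^ i dvd f (m + k)" "?q ^ j dvd g (m + k)"
      using prime_elem_power_dvd_prod by blast
    then consider "m \<le> i" | "k \<le> j" by linarith
    then show False
    proof cases
      case 1
      then have "?q ^ m dvd f (m + k)" using ij by (meson dvd_trans le_imp_power_dvd)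
      then show False using zp_mod_le[OF f, of m "m + k"] mk by simp
    next
      case 2
      then have "?q ^ k dvd g (m + k)" using ij by (meson dvd_trans le_imp_power_dvd)
      then show False using zp_mod_le[OF g, of k "m + k"] mk by simp
    qed
  qed
qed

text \<open>A copy of the fraction field, so that it can carry the $p$-adic topology.\<close>

typedef (overloaded) 'p padic = "UNIV :: 'p :: prime_type zp fract set" by simp

setup_lifting type_definition_padic

instantiation padic :: (prime_type) field
begin

lift_definition zero_padic :: "'a padic" is 0 .
lift_definition one_padic :: "'a padic" is 1 .
lift_definition plus_padic :: "'a padic \<Rightarrow> 'a padic \<Rightarrow> 'a padic" is "(+)" .
lift_definition times_padic :: "'a padic \<Rightarrow> 'a padic \<Rightarrow> 'a padic" is "(*)" .
lift_definition uminus_padic :: "'a padic \<Rightarrow> 'a padic" is uminus .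
lift_definition minus_padic :: "'a padic \<Rightarrow> 'a padic \<Rightarrow> 'a padic" is "(-)" .
lift_definition inverse_padic :: "'a padic \<Rightarrow> 'a padic" is inverse .
lift_definition divide_padic :: "'a padic \<Rightarrow> 'a padic \<Rightarrow> 'a padic" is "(/)" .

instance
  by standard (transfer; simp add: algebra_simps divide_inverse)+

end

definition padic_of_zp :: "'p :: prime_type zp \<Rightarrow> 'p padic" where
  "padic_of_zp a = Abs_padic (Fract a 1)"

definition Zp :: "'p :: prime_type padic set" where
  "Zp = range padic_of_zp"

definition Zp_units :: "'p :: prime_type padic set" where
  "Zp_units = {u \<in> Zp. \<exists>v\<in>Zp. u * v = 1}"

definition pp :: "'p :: prime_type padic" where
  "pp = of_nat CARD('p)"

lemma zero_in_Zp: "0 \<in> Zp"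
proof -
  have "padic_of_zp 0 = 0" by (simp add: padic_of_zp_def zero_padic_def Zero_fract_def)
  then show ?thesis unfolding Zp_def by (metis rangeI)
qed

lemma Zp_mult: "x \<in> Zp \<Longrightarrow> y \<in> Zp \<Longrightarrow> x * y \<in> Zp"
proof -
  have *: "padic_of_zp a * padic_of_zp b = padic_of_zp (a * b)" for a b :: "'a zp"
    by (simp add: padic_of_zp_def times_padic_def Abs_padic_inverse)
  assume "x \<in> Zp" "y \<in> Zp"
  then show ?thesis unfolding Zp_def using * by blast
qed

lemma of_nat_in_Zp: "(of_nat n :: 'p :: prime_type padic) \<in> Zp"
proof -
  have *: "padic_of_zp (of_nat n :: 'p zp) = of_nat n"
  proof (induction n)
    case 0
    show ?case by (simp add: padic_of_zp_def zero_padic_def Zero_fract_def)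
  next
    case (Suc n)
    have "padic_of_zp (1 + of_nat n :: 'p zp) = 1 + padic_of_zp (of_nat n)"
      by (simp add: padic_of_zp_def plus_padic_def one_padic_def One_fract_def Abs_padic_inverse)
    then show ?case using Suc by simp
  qed
  then show ?thesis unfolding Zp_def by (metis rangeI)
qed

instantiation padic :: (prime_type) topological_space
begin

definition open_padic :: "'a padic set \<Rightarrow> bool" where
  "open_padic U \<longleftrightarrow> (\<forall>x\<in>U. \<exists>k. \<forall>z\<in>Zp. x + pp ^ k * z \<in> U)"

instance
proof
  show "open (UNIV :: 'a padic set)" by (simp add: open_padic_def)
next
  fix S T :: "'a padic set"
  assume ST: "open S" "open T"
  show "open (S \<inter> T)"
    unfolding open_padic_def
  proof
    fix x assume "x \<in> S \<inter> T"
    with ST obtain k l where kl: "\<forall>z\<in>Zp. x + pp ^ k * z \<in> S" "\<forall>z\<in>Zp. x + pp ^ l * z \<in> T"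
      unfolding open_padic_def by blast
    have pw: "(pp :: 'a padic) ^ i * z \<in> Zp" if "z \<in> Zp" for i z
      using Zp_mult[OF of_nat_in_Zp that, of "CARD('a) ^ i"] by (simp add: pp_def)
    have "x + pp ^ (k + l) * z \<in> S \<inter> T" if "z \<in> Zp" for z
      using kl(1)[rule_format, OF pw[OF that, of l]] kl(2)[rule_format, OF pw[OF that, of k]]
      by (simp add: power_add mult.assoc mult.left_commute)
    then show "\<exists>k. \<forall>z\<in>Zp. x + pp ^ k * z \<in> S \<inter> T" by blast
  qed
next
  fix K :: "'a padic set set"
  assume "\<forall>S\<in>K. open S"
  then show "open (\<Union>K)" unfolding open_padic_def by (meson Union_iff)
qed

end


section \<open>Linear algebraic groups\<close>

text \<open>
  Classical language: an algebraic group over a perfect field \<open>'k\<close> is a Zariski closed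
  subgroup of \<open>GL\<^sub>n\<close> over the algebraic closure that is cut out by polynomials with coefficients
  in \<open>'k\<close>.  Over an infinite field a polynomial is the same as the function it induces.
  The index type \<open>'n\<close> is arbitrary.
\<close>

definition GL :: "('a :: field ^ 'n ^ 'n) monoid" where
  "GL = \<lparr>carrier = {g. invertible g}, mult = (**), one = mat 1\<rparr>"

definition conjg :: "'a :: field ^ 'n ^ 'n \<Rightarrow> 'a ^ 'n ^ 'n \<Rightarrow> 'a ^ 'n ^ 'n" where
  "conjg t g = t ** g ** matrix_inv t"

inductive_set pfun :: "'a :: field set \<Rightarrow> ('a ^ 'n ^ 'n \<Rightarrow> 'a) set" for F where
  const: "a \<in> F \<Longrightarrow> (\<lambda>_. a) \<in> pfun F"
| coord: "(\<lambda>g. g $ i $ j) \<in> pfun F"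
| add: "f \<in> pfun F \<Longrightarrow> h \<in> pfun F \<Longrightarrow> (\<lambda>g. f g + h g) \<in> pfun F"
| mult: "f \<in> pfun F \<Longrightarrow> h \<in> pfun F \<Longrightarrow> (\<lambda>g. f g * h g) \<in> pfun F"

definition zclosed :: "'a :: field set \<Rightarrow> ('a ^ 'n ^ 'n) set \<Rightarrow> bool" where
  "zclosed F V \<longleftrightarrow> (\<exists>E \<subseteq> pfun F. V = {g. invertible g \<and> (\<forall>f\<in>E. f g = 0)})"

definition zconnected :: "('a :: field ^ 'n ^ 'n) set \<Rightarrow> bool" where
  "zconnected V \<longleftrightarrow>
     \<not> (\<exists>A B. zclosed UNIV A \<and> zclosed UNIV B \<and> A \<noteq> {} \<and> B \<noteq> {} \<and> A \<inter> B = {} \<and> A \<union> B = V)"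

definition alg_group :: "'a :: field set \<Rightarrow> ('a ^ 'n ^ 'n) set \<Rightarrow> bool" where
  "alg_group F H \<longleftrightarrow> subgroup H GL \<and> zclosed F H"

definition unipotent :: "'a :: field ^ 'n ^ 'n \<Rightarrow> bool" where
  "unipotent g \<longleftrightarrow> (\<exists>m. (((**) (g - mat 1)) ^^ m) (mat 1) = 0)"

definition normal_unipotent :: "('a :: field ^ 'n ^ 'n) set \<Rightarrow> ('a ^ 'n ^ 'n) set \<Rightarrow> bool" where
  "normal_unipotent G U \<longleftrightarrow> alg_group UNIV U \<and> zconnected U \<and> (\<forall>u\<in>U. unipotent u)
     \<and> U \<lhd> (GL\<lparr>carrier := G\<rparr>)"

definition unipotent_radical :: "('a :: field ^ 'n ^ 'n) set \<Rightarrow> ('a ^ 'n ^ 'n) set \<Rightarrow> bool" where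
  "unipotent_radical G U \<longleftrightarrow>
     normal_unipotent G U \<and> (\<forall>U'. normal_unipotent G U' \<longrightarrow> U' \<subseteq> U)"

definition connected_reductive :: "('a :: field ^ 'n ^ 'n) set \<Rightarrow> bool" where
  "connected_reductive G \<longleftrightarrow> alg_group UNIV G \<and> zconnected G \<and> unipotent_radical G {mat 1}"

definition alg_centre :: "('a :: field ^ 'n ^ 'n) set \<Rightarrow> ('a ^ 'n ^ 'n) set" where
  "alg_centre G = {z \<in> G. \<forall>g\<in>G. z ** g = g ** z}"

definition diagonalizable_by :: "('a :: field ^ 'n ^ 'n) set \<Rightarrow> ('a ^ 'n ^ 'n) set \<Rightarrow> bool" where
  "diagonalizable_by E T \<longleftrightarrow>
     (\<exists>g\<in>E. invertible g \<and> (\<forall>t\<in>T. \<forall>i j. i \<noteq> j \<longrightarrow> conjg g t $ i $ j = 0))"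

definition torus :: "('a :: field ^ 'n ^ 'n) set \<Rightarrow> bool" where
  "torus T \<longleftrightarrow> alg_group UNIV T \<and> zconnected T \<and> diagonalizable_by UNIV T"

definition maximal_torus :: "('a :: field ^ 'n ^ 'n) set \<Rightarrow> ('a ^ 'n ^ 'n) set \<Rightarrow> bool" where
  "maximal_torus G T \<longleftrightarrow> torus T \<and> T \<subseteq> G \<and> (\<forall>T'. torus T' \<and> T \<subseteq> T' \<and> T' \<subseteq> G \<longrightarrow> T' = T)"

type_synonym ('k, 'n) kmat = "'k alg_closure ^ 'n ^ 'n"

text \<open>The scalars of the ground field inside the algebraic closure.\<close>

abbreviation kk :: "'k :: field alg_closure set" where
  "kk \<equiv> range to_ac"

abbreviation emb :: "'k :: field ^ 'n ^ 'n \<Rightarrow> ('k, 'n) kmat" where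
  "emb \<equiv> map_matrix to_ac"

text \<open>Rational points.\<close>

definition pts :: "('k :: field, 'n :: finite) kmat set \<Rightarrow> ('k ^ 'n ^ 'n) set" where
  "pts H = {g. emb g \<in> H}"

definition split_torus :: "('k :: field, 'n :: finite) kmat set \<Rightarrow> bool" where
  "split_torus T \<longleftrightarrow> torus T \<and> alg_group kk T \<and> diagonalizable_by (range emb) T"

definition split_group :: "('k :: field, 'n :: finite) kmat set \<Rightarrow> bool" where
  "split_group G \<longleftrightarrow> (\<exists>T. maximal_torus G T \<and> split_torus T)"

definition maximal_split_torus ::
  "('k :: field, 'n :: finite) kmat set \<Rightarrow> ('k, 'n) kmat set \<Rightarrow> bool" where
  "maximal_split_torus G T \<longleftrightarrow> split_torus T \<and> T \<subseteq> G
     \<and> (\<forall>T'. split_torus T' \<and> T \<subseteq> T' \<and> T' \<subseteq> G \<longrightarrow> T' = T)"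

definition connected_solvable :: "('a :: field ^ 'n ^ 'n) set \<Rightarrow> bool" where
  "connected_solvable H \<longleftrightarrow> alg_group UNIV H \<and> zconnected H \<and> solvable (GL\<lparr>carrier := H\<rparr>)"

definition borel_subgroup ::
  "('k :: field, 'n :: finite) kmat set \<Rightarrow> ('k, 'n) kmat set \<Rightarrow> bool" where
  "borel_subgroup G P \<longleftrightarrow> alg_group kk P \<and> connected_solvable P \<and> P \<subseteq> G
     \<and> (\<forall>P'. connected_solvable P' \<and> P \<subseteq> P' \<and> P' \<subseteq> G \<longrightarrow> P' = P)"

text \<open>The tangent space at the identity, \<open>q\<close> being the restriction of \<open>f\<close> to the line
  \<open>1 + cY\<close>.\<close>

definition Lie :: "('k :: field, 'n :: finite) kmat set \<Rightarrow> ('k, 'n) kmat set" where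
  "Lie H = {Y. \<forall>f \<in> pfun UNIV. (\<forall>h\<in>H. f h = 0) \<longrightarrow>
     (\<forall>q. (\<forall>c. poly q c = f (mat 1 + map_matrix ((*) c) Y)) \<longrightarrow> Polynomial.coeff q 1 = 0)}"

text \<open>Characters are taken extensional, so that equality of characters is equality on the torus.\<close>

type_synonym ('k, 'n) character = "('k, 'n) kmat \<Rightarrow> 'k alg_closure"

definition characters :: "('k :: field, 'n :: finite) kmat set \<Rightarrow> ('k, 'n) character set" where
  "characters T = {\<alpha> \<in> extensional T.
     (\<exists>f \<in> pfun kk. \<exists>m. \<forall>t\<in>T. \<alpha> t = f t / det t ^ m)
     \<and> (\<forall>t\<in>T. \<alpha> t \<noteq> 0) \<and> (\<forall>t\<in>T. \<forall>t'\<in>T. \<alpha> (t ** t') = \<alpha> t * \<alpha> t')}"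

text \<open>Morphisms from the multiplicative group over \<open>'k\<close>, with Laurent polynomial entries.\<close>

definition cocharacters ::
  "('k :: field, 'n :: finite) kmat set \<Rightarrow> ('k alg_closure \<Rightarrow> ('k, 'n) kmat) set" where
  "cocharacters T = {\<xi> \<in> extensional (- {0}).
     (\<exists>q m. (\<forall>i j l. Polynomial.coeff (q i j) l \<in> kk)
        \<and> (\<forall>x i j. x \<noteq> 0 \<longrightarrow> \<xi> x $ i $ j = poly (q i j) x / x ^ m))
     \<and> (\<forall>x. x \<noteq> 0 \<longrightarrow> \<xi> x \<in> T)
     \<and> (\<forall>x y. x \<noteq> 0 \<longrightarrow> y \<noteq> 0 \<longrightarrow> \<xi> (x * y) = \<xi> x ** \<xi> y)}"

definition weight_space ::
  "('k :: field, 'n :: finite) kmat set \<Rightarrow> ('k, 'n) kmat set \<Rightarrow> ('k, 'n) character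
    \<Rightarrow> ('k, 'n) kmat set" where
  "weight_space H T \<alpha> = {Y \<in> Lie H. \<forall>t\<in>T. conjg t Y = map_matrix ((*) (\<alpha> t)) Y}"

text \<open>The nontrivial weights of the torus on the Lie algebra of \<open>H\<close>: all roots for \<open>H = G\<close>,
  the positive roots for \<open>H = N\<close>.\<close>

definition roots ::
  "('k :: field, 'n :: finite) kmat set \<Rightarrow> ('k, 'n) kmat set \<Rightarrow> ('k, 'n) character set" where
  "roots H T = {\<alpha> \<in> characters T. (\<exists>t\<in>T. \<alpha> t \<noteq> 1) \<and> (\<exists>Y \<in> weight_space H T \<alpha>. Y \<noteq> 0)}"

text \<open>\<open>\<Delta>\<close> is the base of the root system \<open>\<Phi>\<close> belonging to the positive system \<open>\<Phi>p\<close>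
  (characters are written multiplicatively).\<close>

definition simple_roots ::
  "('k :: field, 'n :: finite) kmat set \<Rightarrow> ('k, 'n) character set \<Rightarrow> ('k, 'n) character set
    \<Rightarrow> ('k, 'n) character set \<Rightarrow> bool" where
  "simple_roots T \<Phi> \<Phi>p \<Delta> \<longleftrightarrow> finite \<Delta> \<and> \<Delta> \<subseteq> \<Phi>p
     \<and> (\<forall>z :: _ \<Rightarrow> int. (\<forall>t\<in>T. (\<Prod>\<alpha>\<in>\<Delta>. \<alpha> t powi z \<alpha>) = 1) \<longrightarrow> (\<forall>\<alpha>\<in>\<Delta>. z \<alpha> = 0))
     \<and> \<Phi>p = {\<beta> \<in> \<Phi>. \<exists>m :: _ \<Rightarrow> nat. \<forall>t\<in>T. \<beta> t = (\<Prod>\<alpha>\<in>\<Delta>. \<alpha> t ^ m \<alpha>)}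
     \<and> (\<forall>\<beta>\<in>\<Phi>. \<beta> \<in> \<Phi>p \<or> (\<lambda>t\<in>T. inverse (\<beta> t)) \<in> \<Phi>p)"

text \<open>The root subgroup of \<open>\<beta>\<close> is the image of an isomorphism \<open>x\<close> of the additive group over \<open>'k\<close>
  onto a closed subgroup of \<open>G\<close> with \<open>t x(a) t\<inverse> = x(\<beta>(t) a)\<close>
  (Springer, Linear Algebraic Groups, Proposition 8.1.1); \<open>f\<close> is the inverse morphism.\<close>

definition root_subgroup ::
  "('k :: field, 'n :: finite) kmat set \<Rightarrow> ('k, 'n) kmat set \<Rightarrow> ('k, 'n) character
    \<Rightarrow> ('k, 'n) kmat set \<Rightarrow> bool" where
  "root_subgroup G T \<beta> U \<longleftrightarrow> alg_group kk U \<and> U \<subseteq> G \<and>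
     (\<exists>x. U = range x
        \<and> (\<exists>q. (\<forall>i j l. Polynomial.coeff (q i j) l \<in> kk) \<and> (\<forall>a i j. x a $ i $ j = poly (q i j) a))
        \<and> (\<exists>f \<in> pfun kk. \<forall>a. f (x a) = a)
        \<and> (\<forall>a b. x (a + b) = x a ** x b)
        \<and> (\<forall>t\<in>T. \<forall>a. conjg t (x a) = x (\<beta> t * a)))"


section \<open>The group-theoretic setting\<close>

text \<open>
  \<^item> \<open>grp\<close>, \<open>bor\<close>, \<open>tor\<close>, \<open>uni\<close>, \<open>rootgrp\<close> are the algebraic groups whose rational points are
    $G$, $P$, $T$, $N$ and $N_\beta$;
  \<^item> \<open>crd \<alpha>\<close> is the isomorphism $\iota_\alpha$ and \<open>cf\<close> the coefficients of $\ell$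
    with respect to the $\iota_\alpha$;
  \<^item> \<open>prj\<close> is the projection $N \to \prod_{\alpha\in\Delta} N_\alpha$ factoring over $N/[N,N]$;
  \<^item> \<open>coch\<close> is the cocharacter $\xi$.
\<close>

record (overloaded) ('p :: prime_type, 'n :: finite) datum =
  grp :: "('p padic, 'n) kmat set"
  bor :: "('p padic, 'n) kmat set"
  tor :: "('p padic, 'n) kmat set"
  uni :: "('p padic, 'n) kmat set"
  simple :: "('p padic, 'n) character set"
  rootgrp :: "('p padic, 'n) character \<Rightarrow> ('p padic, 'n) kmat set"
  N0 :: "('p padic ^ 'n ^ 'n) set"
  crd :: "('p padic, 'n) character \<Rightarrow> 'p padic ^ 'n ^ 'n \<Rightarrow> 'p padic"
  cf :: "('p padic, 'n) character \<Rightarrow> 'p padic"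
  prj :: "'p padic ^ 'n ^ 'n \<Rightarrow> ('p padic, 'n) character \<Rightarrow> 'p padic ^ 'n ^ 'n"
  coch :: "'p padic alg_closure \<Rightarrow> ('p padic, 'n) kmat"

type_synonym ('p, 'n) qmat = "'p padic ^ 'n ^ 'n"

definition pos :: "('p :: prime_type, 'n :: finite) datum \<Rightarrow> ('p padic, 'n) character set" where
  "pos \<G> = roots (uni \<G>) (tor \<G>)"

definition split_reductive_setting :: "('p :: prime_type, 'n :: finite) datum \<Rightarrow> bool" where
  "split_reductive_setting \<G> \<longleftrightarrow>
     alg_group kk (grp \<G>) \<and> connected_reductive (grp \<G>) \<and> split_group (grp \<G>)
     \<and> zconnected (alg_centre (grp \<G>))
     \<and> maximal_split_torus (grp \<G>) (tor \<G>)
     \<and> borel_subgroup (grp \<G>) (bor \<G>)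
     \<and> unipotent_radical (bor \<G>) (uni \<G>)
     \<and> bor \<G> = tor \<G> <#>\<^bsub>GL\<^esub> uni \<G>
     \<and> simple_roots (tor \<G>) (roots (grp \<G>) (tor \<G>)) (pos \<G>) (simple \<G>)
     \<and> (\<forall>\<beta> \<in> pos \<G>. root_subgroup (grp \<G>) (tor \<G>) \<beta> (rootgrp \<G> \<beta>) \<and> rootgrp \<G> \<beta> \<subseteq> uni \<G>)"

definition totally_decomposed :: "('p :: prime_type, 'n :: finite) datum \<Rightarrow> bool" where
  "totally_decomposed \<G> \<longleftrightarrow> finite (pos \<G>) \<and>
     (\<forall>bs. distinct bs \<and> set bs = pos \<G> \<longrightarrow>
        bij_betw (\<lambda>n. foldr (\<lambda>\<beta> g. n \<beta> ** g) bs (mat 1))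
          (\<Pi>\<^sub>E \<beta>\<in>pos \<G>. N0 \<G> \<inter> pts (rootgrp \<G> \<beta>)) (N0 \<G>))"

definition ell :: "('p :: prime_type, 'n :: finite) datum \<Rightarrow> ('p, 'n) qmat \<Rightarrow> 'p padic" where
  "ell \<G> n = (\<Sum>\<alpha>\<in>simple \<G>. cf \<G> \<alpha> * crd \<G> \<alpha> (prj \<G> n \<alpha>))"

definition xi :: "('p :: prime_type, 'n :: finite) datum \<Rightarrow> 'p padic \<Rightarrow> ('p, 'n) qmat" where
  "xi \<G> u = inv_into UNIV emb (coch \<G> (to_ac u))"

definition ss :: "('p :: prime_type, 'n :: finite) datum \<Rightarrow> ('p, 'n) qmat" where
  "ss \<G> = xi \<G> pp"

definition phiN :: "('p :: prime_type, 'n :: finite) datum \<Rightarrow> ('p, 'n) qmat \<Rightarrow> ('p, 'n) qmat" where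
  "phiN \<G> = conjg (ss \<G>)"

definition simple_coordinates :: "('p :: prime_type, 'n :: finite) datum \<Rightarrow> bool" where
  "simple_coordinates \<G> \<longleftrightarrow> (\<forall>\<alpha>\<in>simple \<G>.
     bij_betw (crd \<G> \<alpha>) (pts (rootgrp \<G> \<alpha>)) UNIV
     \<and> (\<forall>m \<in> pts (rootgrp \<G> \<alpha>). \<forall>n \<in> pts (rootgrp \<G> \<alpha>).
          crd \<G> \<alpha> (m ** n) = crd \<G> \<alpha> m + crd \<G> \<alpha> n)
     \<and> (\<forall>t \<in> pts (tor \<G>). \<forall>n \<in> pts (rootgrp \<G> \<alpha>).
          to_ac (crd \<G> \<alpha> (conjg t n)) = \<alpha> (emb t) * to_ac (crd \<G> \<alpha> n))
     \<and> crd \<G> \<alpha> ` (N0 \<G> \<inter> pts (rootgrp \<G> \<alpha>)) = Zp)"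

text \<open>The map $N \to N/[N,N] \to \prod_{\alpha\in\Delta} N_\alpha$: the homomorphism that is the
  identity on $N_\alpha$ for simple $\alpha$ and trivial on $N_\beta$ for the other positive
  roots.\<close>

definition simple_projection :: "('p :: prime_type, 'n :: finite) datum \<Rightarrow> bool" where
  "simple_projection \<G> \<longleftrightarrow>
     (\<forall>n \<in> pts (uni \<G>). prj \<G> n \<in> (\<Pi>\<^sub>E \<alpha>\<in>simple \<G>. pts (rootgrp \<G> \<alpha>)))
     \<and> (\<forall>m \<in> pts (uni \<G>). \<forall>n \<in> pts (uni \<G>). \<forall>\<alpha>\<in>simple \<G>.
          prj \<G> (m ** n) \<alpha> = prj \<G> m \<alpha> ** prj \<G> n \<alpha>)
     \<and> (\<forall>\<beta> \<in> pos \<G>. \<forall>n \<in> pts (rootgrp \<G> \<beta>). \<forall>\<alpha>\<in>simple \<G>.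
          prj \<G> n \<alpha> = (if \<alpha> = \<beta> then n else mat 1))"

definition group_setting :: "('p :: prime_type, 'n :: finite) datum \<Rightarrow> bool" where
  "group_setting \<G> \<longleftrightarrow> split_reductive_setting \<G>
     \<and> subgroup (N0 \<G>) (GL\<lparr>carrier := pts (uni \<G>)\<rparr>)
     \<and> compact (N0 \<G>) \<and> openin (top_of_set (pts (uni \<G>))) (N0 \<G>)
     \<and> totally_decomposed \<G>
     \<and> simple_coordinates \<G> \<and> simple_projection \<G>
     \<and> ell \<G> ` N0 \<G> = Zp
     \<and> coch \<G> \<in> cocharacters (tor \<G>)
     \<and> (\<forall>\<alpha>\<in>simple \<G>. \<forall>x. x \<noteq> 0 \<longrightarrow> \<alpha> (coch \<G> x) = x)"

definition N1 :: "('p :: prime_type, 'n :: finite) datum \<Rightarrow> ('p, 'n) qmat set" where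
  "N1 \<G> = {n \<in> N0 \<G>. ell \<G> n = 0}"

definition Nk :: "('p :: prime_type, 'n :: finite) datum \<Rightarrow> nat \<Rightarrow> ('p, 'n) qmat set" where
  "Nk \<G> k = \<Inter>{H. H \<lhd> (GL\<lparr>carrier := N0 \<G>\<rparr>) \<and> (phiN \<G> ^^ (k - 1)) ` N1 \<G> \<subseteq> H}"

definition Tplus_ell :: "('p :: prime_type, 'n :: finite) datum \<Rightarrow> ('p, 'n) qmat set" where
  "Tplus_ell \<G> = {t \<in> pts (tor \<G>). conjg t ` N0 \<G> \<subseteq> N0 \<G> \<and> conjg t ` N1 \<G> \<subseteq> N1 \<G>}"

text \<open>The element of $\mathbb{Z}_p\setminus\{0\}$ by which conjugation by \<open>t\<close> acts on
  $\ell(N_0)$.\<close>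

definition mult_of :: "('p :: prime_type, 'n :: finite) datum \<Rightarrow> ('p, 'n) qmat \<Rightarrow> 'p padic" where
  "mult_of \<G> t = (THE z. z \<in> Zp \<and> (\<forall>n \<in> N0 \<G>. ell \<G> (conjg t n) = z * ell \<G> n))"

definition equivariant_section ::
  "('p :: prime_type, 'n :: finite) datum \<Rightarrow> ('p padic \<Rightarrow> ('p, 'n) qmat) \<Rightarrow> bool" where
  "equivariant_section \<G> \<iota> \<longleftrightarrow>
     (\<forall>x\<in>Zp. \<iota> x \<in> N0 \<G> \<and> ell \<G> (\<iota> x) = x \<and> \<iota> (pp * x) = phiN \<G> (\<iota> x))
     \<and> (\<forall>x\<in>Zp. \<forall>y\<in>Zp. \<iota> (x + y) = \<iota> x ** \<iota> y)"


section \<open>$(\varphi,\Gamma)$-rings\<close>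

text \<open>\<open>gam \<gamma>\<close> is the action of \<open>\<gamma> = \<xi>(u)\<close> in $\Gamma = \xi(\mathbb{Z}_p^\times)$.\<close>

record (overloaded) ('r, 'p :: prime_type, 'n :: finite) pg_ring = "'r ring" +
  chi :: "'p padic \<Rightarrow> 'r"
  phi :: "'r \<Rightarrow> 'r"
  gam :: "'p padic ^ 'n ^ 'n \<Rightarrow> 'r \<Rightarrow> 'r"

definition phi_ring :: "('r, 'p :: prime_type, 'n :: finite) pg_ring \<Rightarrow> bool" where
  "phi_ring R \<longleftrightarrow> cring R
     \<and> chi R ` Zp \<subseteq> Units R \<and> inj_on (chi R) Zp
     \<and> (\<forall>x\<in>Zp. \<forall>y\<in>Zp. chi R (x + y) = chi R x \<otimes>\<^bsub>R\<^esub> chi R y)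
     \<and> phi R \<in> ring_hom R R \<and> inj_on (phi R) (carrier R)
     \<and> (\<forall>x\<in>Zp. phi R (chi R x) = chi R (pp * x))
     \<and> (\<forall>r \<in> carrier R. \<exists>!a. a \<in> {..<CARD('p)} \<rightarrow>\<^sub>E carrier R
          \<and> r = (\<Oplus>\<^bsub>R\<^esub>i\<in>{..<CARD('p)}. chi R (of_nat i) \<otimes>\<^bsub>R\<^esub> phi R (a i)))"

definition phi_gamma_ring ::
  "('p :: prime_type, 'n :: finite) datum \<Rightarrow> ('r, 'p, 'n) pg_ring \<Rightarrow> bool" where
  "phi_gamma_ring \<G> R \<longleftrightarrow> phi_ring R
     \<and> (\<forall>u\<in>Zp_units. gam R (xi \<G> u) \<in> ring_hom R R
          \<and> (\<forall>r \<in> carrier R. gam R (xi \<G> u) (phi R r) = phi R (gam R (xi \<G> u) r))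
          \<and> (\<forall>x\<in>Zp. gam R (xi \<G> u) (chi R x) = chi R (u * x)))
     \<and> (\<forall>u\<in>Zp_units. \<forall>v\<in>Zp_units. \<forall>r \<in> carrier R.
          gam R (xi \<G> u ** xi \<G> v) r = gam R (xi \<G> u) (gam R (xi \<G> v) r))
     \<and> (\<forall>r \<in> carrier R. gam R (mat 1) r = r)"

text \<open>The coefficients \<open>r\<^sub>i\<close> in \<open>r = \<Sum> \<chi>(i) \<phi>\<^sup>m(r\<^sub>i)\<close>, \<open>i < p\<^sup>m\<close>.\<close>

definition comps :: "('r, 'p :: prime_type, 'n :: finite) pg_ring \<Rightarrow> nat \<Rightarrow> 'r \<Rightarrow> nat \<Rightarrow> 'r" where
  "comps R m r = (THE a. a \<in> {..<CARD('p) ^ m} \<rightarrow>\<^sub>E carrier R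
     \<and> r = (\<Oplus>\<^bsub>R\<^esub>i\<in>{..<CARD('p) ^ m}. chi R (of_nat i) \<otimes>\<^bsub>R\<^esub> (phi R ^^ m) (a i)))"

definition summand :: "('r, 'p :: prime_type, 'n :: finite) pg_ring \<Rightarrow> nat \<Rightarrow> 'r \<Rightarrow> nat \<Rightarrow> 'r" where
  "summand R m r i = chi R (of_nat i) \<otimes>\<^bsub>R\<^esub> (phi R ^^ m) (comps R m r i)"

text \<open>The action on \<open>R\<close> through $\mathbb{Z}_p\setminus\{0\} \cong \varphi^{\mathbb{N}}\Gamma$.\<close>

definition phiR ::
  "('p :: prime_type, 'n :: finite) datum \<Rightarrow> ('r, 'p, 'n) pg_ring \<Rightarrow> ('p, 'n) qmat \<Rightarrow> 'r \<Rightarrow> 'r" where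
  "phiR \<G> R t r = (THE r'. \<exists>k. \<exists>u\<in>Zp_units. mult_of \<G> t = pp ^ k * u
     \<and> r' = (phi R ^^ k) (gam R (xi \<G> u) r))"


section \<open>The completed skew group ring\<close>

abbreviation Qk :: "('p :: prime_type, 'n :: finite) datum \<Rightarrow> nat \<Rightarrow> ('p, 'n) qmat set set" where
  "Qk \<G> k \<equiv> carrier (GL\<lparr>carrier := N1 \<G>\<rparr> Mod Nk \<G> k)"

definition admissible ::
  "('p :: prime_type, 'n :: finite) datum \<Rightarrow> ('p padic \<Rightarrow> ('p, 'n) qmat) \<Rightarrow> (nat \<Rightarrow> nat) \<Rightarrow> bool" where
  "admissible \<G> \<iota> c \<longleftrightarrow> (\<forall>k\<ge>1. c k \<ge> 1
     \<and> (\<forall>x\<in>Zp. \<forall>h \<in> Qk \<G> k. conjg (\<iota> (pp ^ c k * x)) ` h = h))"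

text \<open>\<open>N\<^sub>1/N\<^sub>k\<close> is finite, so the direct sum consists of all functions on the quotient.\<close>

definition skew ::
  "('p :: prime_type, 'n :: finite) datum \<Rightarrow> ('r, 'p, 'n) pg_ring \<Rightarrow> ('p padic \<Rightarrow> ('p, 'n) qmat)
    \<Rightarrow> (nat \<Rightarrow> nat) \<Rightarrow> nat \<Rightarrow> (('p, 'n) qmat set \<Rightarrow> 'r) ring" where
  "skew \<G> R \<iota> c k = \<lparr>
     carrier = Qk \<G> k \<rightarrow>\<^sub>E carrier R,
     mult = (\<lambda>f g. \<lambda>h \<in> Qk \<G> k.
       finsum R (\<lambda>(i, h1, h2). f h1 \<otimes>\<^bsub>R\<^esub> summand R (c k) (g h2) i)
         {(i, h1, h2). i < CARD('p) ^ c k \<and> h1 \<in> Qk \<G> k \<and> h2 \<in> Qk \<G> k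
            \<and> (conjg (matrix_inv (\<iota> (of_nat i))) ` h1) <#>\<^bsub>GL\<^esub> h2 = h}),
     one = (\<lambda>h \<in> Qk \<G> k. if h = Nk \<G> k then \<one>\<^bsub>R\<^esub> else \<zero>\<^bsub>R\<^esub>),
     zero = (\<lambda>h \<in> Qk \<G> k. \<zero>\<^bsub>R\<^esub>),
     add = (\<lambda>f g. \<lambda>h \<in> Qk \<G> k. f h \<oplus>\<^bsub>R\<^esub> g h)\<rparr>"

definition transition ::
  "('p :: prime_type, 'n :: finite) datum \<Rightarrow> ('r, 'p, 'n) pg_ring \<Rightarrow> nat
    \<Rightarrow> (('p, 'n) qmat set \<Rightarrow> 'r) \<Rightarrow> (('p, 'n) qmat set \<Rightarrow> 'r)" where
  "transition \<G> R k f = (\<lambda>h \<in> Qk \<G> k. (\<Oplus>\<^bsub>R\<^esub>h' \<in> {h' \<in> Qk \<G> (Suc k). h' \<subseteq> h}. f h'))"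

type_synonym ('r, 'p, 'n) compl = "nat \<Rightarrow> ('p, 'n) qmat set \<Rightarrow> 'r"

definition completed ::
  "('p :: prime_type, 'n :: finite) datum \<Rightarrow> ('r, 'p, 'n) pg_ring \<Rightarrow> ('p padic \<Rightarrow> ('p, 'n) qmat)
    \<Rightarrow> (nat \<Rightarrow> nat) \<Rightarrow> ('r, 'p, 'n) compl ring" where
  "completed \<G> R \<iota> c = \<lparr>
     carrier = {x \<in> (\<Pi>\<^sub>E k\<in>{1..}. carrier (skew \<G> R \<iota> c k)).
                  \<forall>k\<ge>1. transition \<G> R k (x (Suc k)) = x k},
     mult = (\<lambda>x y. \<lambda>k\<in>{1..}. x k \<otimes>\<^bsub>skew \<G> R \<iota> c k\<^esub> y k),
     one = (\<lambda>k\<in>{1..}. \<one>\<^bsub>skew \<G> R \<iota> c k\<^esub>),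
     zero = (\<lambda>k\<in>{1..}. \<zero>\<^bsub>skew \<G> R \<iota> c k\<^esub>),
     add = (\<lambda>x y. \<lambda>k\<in>{1..}. x k \<oplus>\<^bsub>skew \<G> R \<iota> c k\<^esub> y k)\<rparr>"

text \<open>The augmentation; by compatibility it can be read off at any level, here at \<open>k = 1\<close>.\<close>

definition ellR ::
  "('p :: prime_type, 'n :: finite) datum \<Rightarrow> ('r, 'p, 'n) pg_ring \<Rightarrow> ('r, 'p, 'n) compl \<Rightarrow> 'r" where
  "ellR \<G> R x = (\<Oplus>\<^bsub>R\<^esub>h \<in> Qk \<G> 1. x 1 h)"

definition iotaR ::
  "('p :: prime_type, 'n :: finite) datum \<Rightarrow> ('r, 'p, 'n) pg_ring \<Rightarrow> 'r \<Rightarrow> ('r, 'p, 'n) compl" where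
  "iotaR \<G> R r = (\<lambda>k\<in>{1..}. \<lambda>h \<in> Qk \<G> k. if h = Nk \<G> k then r else \<zero>\<^bsub>R\<^esub>)"

text \<open>
  The action of \<open>t\<close> by conjugation.  In the skew group ring an element
  \<open>n = \<iota>(x) h\<close> of \<open>N\<^sub>0\<close>, with \<open>x = \<ell>(n)\<close> and \<open>h \<in> N\<^sub>1\<close>, is \<open>\<chi>(x) h\<close>, and \<open>\<phi>\<^sub>t\<close> has to send
  it to the element \<open>t n t\<inverse> = \<iota>(zx) \<cdot> \<iota>(zx)\<inverse> t \<iota>(x) h t\<inverse>\<close> with \<open>z = mult_of t\<close>.  Hence
    \<open>\<phi>\<^sub>t(\<chi>(i) \<phi>\<^sup>m(r) h) = \<phi>\<^sub>t(\<chi>(i) \<phi>\<^sup>m(r)) (\<iota>(zi)\<inverse> t \<iota>(i) h t\<inverse>)\<close>.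
  This is independent of \<open>m\<close> as soon as conjugation by \<open>\<iota>(p\<^sup>m x)\<close> is trivial on \<open>N\<^sub>1/N\<^sub>k\<close> and
  \<open>t \<iota>(p\<^sup>m x) t\<inverse> \<in> \<iota>(z p\<^sup>m x) N\<^sub>k\<close>; the latter holds for \<open>m \<ge> k - 1\<close>, whence \<open>m = c\<^sub>k + k\<close>.
  If \<open>t \<iota>(x) t\<inverse> = \<iota>(zx)\<close> for all \<open>x\<close> (for instance for \<open>t = s\<close>), it is the map
  \<open>r h \<mapsto> \<phi>\<^sub>t(r) (t h t\<inverse>)\<close>; for a general \<open>\<iota>\<close> that naive formula is not multiplicative.
\<close>

definition act_skew ::
  "('p :: prime_type, 'n :: finite) datum \<Rightarrow> ('r, 'p, 'n) pg_ring \<Rightarrow> ('p padic \<Rightarrow> ('p, 'n) qmat)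
    \<Rightarrow> (nat \<Rightarrow> nat) \<Rightarrow> nat \<Rightarrow> ('p, 'n) qmat
    \<Rightarrow> (('p, 'n) qmat set \<Rightarrow> 'r) \<Rightarrow> (('p, 'n) qmat set \<Rightarrow> 'r)" where
  "act_skew \<G> R \<iota> c k t f = (\<lambda>h \<in> Qk \<G> k.
     finsum R (\<lambda>(i, h'). phiR \<G> R t (summand R (c k + k) (f h') i))
       {(i, h'). i < CARD('p) ^ (c k + k) \<and> h' \<in> Qk \<G> k
          \<and> (\<lambda>n. matrix_inv (\<iota> (mult_of \<G> t * of_nat i)) ** conjg t (\<iota> (of_nat i) ** n)) ` h'
              \<subseteq> h})"

definition phiS ::
  "('p :: prime_type, 'n :: finite) datum \<Rightarrow> ('r, 'p, 'n) pg_ring \<Rightarrow> ('p padic \<Rightarrow> ('p, 'n) qmat)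
    \<Rightarrow> (nat \<Rightarrow> nat) \<Rightarrow> ('p, 'n) qmat \<Rightarrow> ('r, 'p, 'n) compl \<Rightarrow> ('r, 'p, 'n) compl" where
  "phiS \<G> R \<iota> c t x = (\<lambda>k\<in>{1..}. act_skew \<G> R \<iota> c k t (x k))"


section \<open>Tensor products\<close>

text \<open>HOL-Algebra has modules over commutative rings only.\<close>

locale left_module = R?: ring R + M?: abelian_group M
  for R :: "('a, 'x) ring_scheme" (structure) and M :: "('a, 'b, 'y) module_scheme" (structure) +
  assumes smult_closed: "a \<in> carrier R \<Longrightarrow> x \<in> carrier M \<Longrightarrow> a \<odot>\<^bsub>M\<^esub> x \<in> carrier M"
    and smult_l_distr: "a \<in> carrier R \<Longrightarrow> b \<in> carrier R \<Longrightarrow> x \<in> carrier M \<Longrightarrow>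
      (a \<oplus>\<^bsub>R\<^esub> b) \<odot>\<^bsub>M\<^esub> x = a \<odot>\<^bsub>M\<^esub> x \<oplus>\<^bsub>M\<^esub> b \<odot>\<^bsub>M\<^esub> x"
    and smult_r_distr: "a \<in> carrier R \<Longrightarrow> x \<in> carrier M \<Longrightarrow> y \<in> carrier M \<Longrightarrow>
      a \<odot>\<^bsub>M\<^esub> (x \<oplus>\<^bsub>M\<^esub> y) = a \<odot>\<^bsub>M\<^esub> x \<oplus>\<^bsub>M\<^esub> a \<odot>\<^bsub>M\<^esub> y"
    and smult_assoc1: "a \<in> carrier R \<Longrightarrow> b \<in> carrier R \<Longrightarrow> x \<in> carrier M \<Longrightarrow>
      (a \<otimes>\<^bsub>R\<^esub> b) \<odot>\<^bsub>M\<^esub> x = a \<odot>\<^bsub>M\<^esub> (b \<odot>\<^bsub>M\<^esub> x)"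
    and smult_one: "x \<in> carrier M \<Longrightarrow> \<one>\<^bsub>R\<^esub> \<odot>\<^bsub>M\<^esub> x = x"

definition fg_free :: "('a, 'x) ring_scheme \<Rightarrow> ('a, 'b, 'y) module_scheme \<Rightarrow> bool" where
  "fg_free R M \<longleftrightarrow> (\<exists>E \<subseteq> carrier M. finite E \<and>
     (\<forall>x \<in> carrier M. \<exists>!a. a \<in> E \<rightarrow>\<^sub>E carrier R \<and> x = (\<Oplus>\<^bsub>M\<^esub>e\<in>E. a e \<odot>\<^bsub>M\<^esub> e)))"

text \<open>
  $B \otimes_{A,f} M$ for a ring homomorphism \<open>f\<close> from \<open>A\<close> to \<open>B\<close> and a left \<open>A\<close>-module \<open>M\<close>:
  the list \<open>[(b\<^sub>1, m\<^sub>1), \<dots>]\<close> stands for the sum of the \<open>b\<^sub>i \<otimes> m\<^sub>i\<close>, and the abelian group is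
  presented by the usual relations.
\<close>

inductive tens_eq ::
  "('c, 'x) ring_scheme \<Rightarrow> ('a, 'z) ring_scheme \<Rightarrow> ('a \<Rightarrow> 'c) \<Rightarrow> ('a, 'b, 'y) module_scheme
    \<Rightarrow> ('c \<times> 'b) list \<Rightarrow> ('c \<times> 'b) list \<Rightarrow> bool"
  for B A f M where
  refl: "tens_eq B A f M xs xs"
| sym: "tens_eq B A f M xs ys \<Longrightarrow> tens_eq B A f M ys xs"
| trans: "tens_eq B A f M xs ys \<Longrightarrow> tens_eq B A f M ys zs \<Longrightarrow> tens_eq B A f M xs zs"
| app: "tens_eq B A f M xs xs' \<Longrightarrow> tens_eq B A f M ys ys' \<Longrightarrow> tens_eq B A f M (xs @ ys) (xs' @ ys')"
| comm: "tens_eq B A f M (xs @ ys) (ys @ xs)"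
| zero: "m \<in> carrier M \<Longrightarrow> tens_eq B A f M [(\<zero>\<^bsub>B\<^esub>, m)] []"
| add_left: "b \<in> carrier B \<Longrightarrow> b' \<in> carrier B \<Longrightarrow> m \<in> carrier M \<Longrightarrow>
    tens_eq B A f M [(b \<oplus>\<^bsub>B\<^esub> b', m)] [(b, m), (b', m)]"
| add_right: "b \<in> carrier B \<Longrightarrow> m \<in> carrier M \<Longrightarrow> m' \<in> carrier M \<Longrightarrow>
    tens_eq B A f M [(b, m \<oplus>\<^bsub>M\<^esub> m')] [(b, m), (b, m')]"
| balanced: "b \<in> carrier B \<Longrightarrow> a \<in> carrier A \<Longrightarrow> m \<in> carrier M \<Longrightarrow>
    tens_eq B A f M [(b \<otimes>\<^bsub>B\<^esub> f a, m)] [(b, a \<odot>\<^bsub>M\<^esub> m)]"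

definition tens_rep ::
  "('c, 'x) ring_scheme \<Rightarrow> ('a, 'z) ring_scheme \<Rightarrow> ('a \<Rightarrow> 'c) \<Rightarrow> ('a, 'b, 'y) module_scheme
    \<Rightarrow> ('c \<times> 'b) list \<Rightarrow> ('c \<times> 'b) list" where
  "tens_rep B A f M xs = (SOME ys. tens_eq B A f M xs ys)"

text \<open>Classes are represented by chosen formal sums; the injection \<open>K\<close> of formal sums into the
  type \<open>'u\<close> determines where the tensor product lives.\<close>

definition tensor ::
  "(('c \<times> 'b) list \<Rightarrow> 'u) \<Rightarrow> ('c, 'x) ring_scheme \<Rightarrow> ('a, 'z) ring_scheme \<Rightarrow> ('a \<Rightarrow> 'c)
    \<Rightarrow> ('a, 'b, 'y) module_scheme \<Rightarrow> ('c, 'u) module" where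
  "tensor K B A f M = (let cl = (\<lambda>xs. K (tens_rep B A f M xs)); dec = inv_into UNIV K in \<lparr>
     carrier = cl ` {xs. set xs \<subseteq> carrier B \<times> carrier M},
     mult = undefined, one = undefined,
     zero = cl [],
     add = (\<lambda>u v. cl (dec u @ dec v)),
     smult = (\<lambda>b u. cl (map (\<lambda>(b', m). (b \<otimes>\<^bsub>B\<^esub> b', m)) (dec u)))\<rparr>)"

definition msum :: "('a, 'b, 'y) module_scheme \<Rightarrow> ('c \<Rightarrow> 'm \<Rightarrow> 'b) \<Rightarrow> ('c \<times> 'm) list \<Rightarrow> 'b" where
  "msum M g xs = foldr (\<lambda>(b, m) y. g b m \<oplus>\<^bsub>M\<^esub> y) xs \<zero>\<^bsub>M\<^esub>"


section \<open>Categories\<close>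

record ('o, 'a) category =
  Ob :: "'o set"
  Hom :: "'o \<Rightarrow> 'o \<Rightarrow> 'a set"
  Idt :: "'o \<Rightarrow> 'a"
  Cmp :: "'o \<Rightarrow> 'o \<Rightarrow> 'o \<Rightarrow> 'a \<Rightarrow> 'a \<Rightarrow> 'a"

text \<open>\<open>Cmp C U V W g f\<close> is the composite of \<open>f\<close> in \<open>Hom U V\<close> and \<open>g\<close> in \<open>Hom V W\<close>.\<close>

definition is_category :: "('o, 'a) category \<Rightarrow> bool" where
  "is_category C \<longleftrightarrow>
     (\<forall>U \<in> Ob C. Idt C U \<in> Hom C U U)
     \<and> (\<forall>U \<in> Ob C. \<forall>V \<in> Ob C. \<forall>W \<in> Ob C. \<forall>f \<in> Hom C U V. \<forall>g \<in> Hom C V W.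
          Cmp C U V W g f \<in> Hom C U W)
     \<and> (\<forall>U \<in> Ob C. \<forall>V \<in> Ob C. \<forall>f \<in> Hom C U V.
          Cmp C U U V f (Idt C U) = f \<and> Cmp C U V V (Idt C V) f = f)
     \<and> (\<forall>U \<in> Ob C. \<forall>V \<in> Ob C. \<forall>W \<in> Ob C. \<forall>Z \<in> Ob C.
          \<forall>f \<in> Hom C U V. \<forall>g \<in> Hom C V W. \<forall>h \<in> Hom C W Z.
          Cmp C U V Z (Cmp C V W Z h g) f = Cmp C U W Z h (Cmp C U V W g f))"

definition is_functor ::
  "('o, 'a) category \<Rightarrow> ('o2, 'a2) category \<Rightarrow> ('o \<Rightarrow> 'o2) \<Rightarrow> ('o \<Rightarrow> 'o \<Rightarrow> 'a \<Rightarrow> 'a2) \<Rightarrow> bool" where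
  "is_functor C D Fo Fa \<longleftrightarrow> is_category C \<and> is_category D
     \<and> (\<forall>U \<in> Ob C. Fo U \<in> Ob D)
     \<and> (\<forall>U \<in> Ob C. \<forall>V \<in> Ob C. \<forall>f \<in> Hom C U V. Fa U V f \<in> Hom D (Fo U) (Fo V))
     \<and> (\<forall>U \<in> Ob C. Fa U U (Idt C U) = Idt D (Fo U))
     \<and> (\<forall>U \<in> Ob C. \<forall>V \<in> Ob C. \<forall>W \<in> Ob C. \<forall>f \<in> Hom C U V. \<forall>g \<in> Hom C V W.
          Fa U W (Cmp C U V W g f) = Cmp D (Fo U) (Fo V) (Fo W) (Fa V W g) (Fa U V f))"

definition isomorphism_in :: "('o, 'a) category \<Rightarrow> 'o \<Rightarrow> 'o \<Rightarrow> 'a \<Rightarrow> bool" where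
  "isomorphism_in C U V f \<longleftrightarrow> f \<in> Hom C U V
     \<and> (\<exists>g \<in> Hom C V U. Cmp C U V U g f = Idt C U \<and> Cmp C V U V f g = Idt C V)"

definition naturally_isomorphic ::
  "('o, 'a) category \<Rightarrow> ('o2, 'a2) category \<Rightarrow> ('o \<Rightarrow> 'o2) \<Rightarrow> ('o \<Rightarrow> 'o \<Rightarrow> 'a \<Rightarrow> 'a2)
    \<Rightarrow> ('o \<Rightarrow> 'o2) \<Rightarrow> ('o \<Rightarrow> 'o \<Rightarrow> 'a \<Rightarrow> 'a2) \<Rightarrow> bool" where
  "naturally_isomorphic C D Fo Fa Go Ga \<longleftrightarrow> (\<exists>\<eta>.
     (\<forall>U \<in> Ob C. isomorphism_in D (Fo U) (Go U) (\<eta> U))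
     \<and> (\<forall>U \<in> Ob C. \<forall>V \<in> Ob C. \<forall>f \<in> Hom C U V.
          Cmp D (Fo U) (Fo V) (Go V) (\<eta> V) (Fa U V f)
          = Cmp D (Fo U) (Go U) (Go V) (Ga U V f) (\<eta> U)))"

definition quasi_inverse_equivalences ::
  "('o, 'a) category \<Rightarrow> ('o2, 'a2) category \<Rightarrow> ('o \<Rightarrow> 'o2) \<Rightarrow> ('o \<Rightarrow> 'o \<Rightarrow> 'a \<Rightarrow> 'a2)
    \<Rightarrow> ('o2 \<Rightarrow> 'o) \<Rightarrow> ('o2 \<Rightarrow> 'o2 \<Rightarrow> 'a2 \<Rightarrow> 'a) \<Rightarrow> bool" where
  "quasi_inverse_equivalences C D Fo Fa Go Ga \<longleftrightarrow>
     is_functor C D Fo Fa \<and> is_functor D C Go Ga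
     \<and> naturally_isomorphic C C (\<lambda>U. U) (\<lambda>U V f. f)
         (\<lambda>U. Go (Fo U)) (\<lambda>U V f. Ga (Fo U) (Fo V) (Fa U V f))
     \<and> naturally_isomorphic D D (\<lambda>U. Fo (Go U)) (\<lambda>U V f. Fa (Go U) (Go V) (Ga U V f))
         (\<lambda>U. U) (\<lambda>U V f. f)"


section \<open>The categories of modules and the two functors\<close>

record ('a, 'b, 't) tmodule = "('a, 'b) module" +
  tact :: "'t \<Rightarrow> 'b \<Rightarrow> 'b"

text \<open>\<open>\<Phi> t\<close> is the action of \<open>t\<close> on the ring \<open>S\<close>.  The last clause says that
  $S \otimes_{S,\varphi_s} M \to M$ is an isomorphism; this map is always $S$-linear.\<close>

definition T_module ::
  "('p :: prime_type, 'n :: finite) datum \<Rightarrow> ('a, 'x) ring_scheme \<Rightarrow> (('p, 'n) qmat \<Rightarrow> 'a \<Rightarrow> 'a)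
    \<Rightarrow> ('a, 'b, ('p, 'n) qmat) tmodule \<Rightarrow> bool" where
  "T_module \<G> S \<Phi> M \<longleftrightarrow> left_module S M \<and> fg_free S M
     \<and> (\<forall>t \<in> Tplus_ell \<G>.
          (\<forall>m \<in> carrier M. tact M t m \<in> carrier M)
          \<and> (\<forall>m \<in> carrier M. \<forall>m' \<in> carrier M.
               tact M t (m \<oplus>\<^bsub>M\<^esub> m') = tact M t m \<oplus>\<^bsub>M\<^esub> tact M t m')
          \<and> (\<forall>a \<in> carrier S. \<forall>m \<in> carrier M. tact M t (a \<odot>\<^bsub>M\<^esub> m) = \<Phi> t a \<odot>\<^bsub>M\<^esub> tact M t m))
     \<and> (\<forall>m \<in> carrier M. tact M (mat 1) m = m)
     \<and> (\<forall>t \<in> Tplus_ell \<G>. \<forall>t' \<in> Tplus_ell \<G>. \<forall>m \<in> carrier M.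
          tact M (t ** t') m = tact M t (tact M t' m))
     \<and> bij_betw (msum M (\<lambda>a m. a \<odot>\<^bsub>M\<^esub> tact M (ss \<G>) m))
         (carrier (tensor (\<lambda>xs. xs) S S (\<Phi> (ss \<G>)) M)) (carrier M)"

definition T_hom ::
  "('p :: prime_type, 'n :: finite) datum \<Rightarrow> ('a, 'x) ring_scheme
    \<Rightarrow> ('a, 'b, ('p, 'n) qmat) tmodule \<Rightarrow> ('a, 'b, ('p, 'n) qmat) tmodule \<Rightarrow> ('b \<Rightarrow> 'b) set" where
  "T_hom \<G> S M M' = {f \<in> carrier M \<rightarrow>\<^sub>E carrier M'.
     (\<forall>m \<in> carrier M. \<forall>m' \<in> carrier M. f (m \<oplus>\<^bsub>M\<^esub> m') = f m \<oplus>\<^bsub>M'\<^esub> f m')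
     \<and> (\<forall>a \<in> carrier S. \<forall>m \<in> carrier M. f (a \<odot>\<^bsub>M\<^esub> m) = a \<odot>\<^bsub>M'\<^esub> f m)
     \<and> (\<forall>t \<in> Tplus_ell \<G>. \<forall>m \<in> carrier M. f (tact M t m) = tact M' t (f m))}"

definition T_cat ::
  "('p :: prime_type, 'n :: finite) datum \<Rightarrow> ('a, 'x) ring_scheme \<Rightarrow> (('p, 'n) qmat \<Rightarrow> 'a \<Rightarrow> 'a)
    \<Rightarrow> (('a, 'b, ('p, 'n) qmat) tmodule, 'b \<Rightarrow> 'b) category" where
  "T_cat \<G> S \<Phi> = \<lparr>
     Ob = {M. T_module \<G> S \<Phi> M},
     Hom = T_hom \<G> S,
     Idt = (\<lambda>M. \<lambda>m \<in> carrier M. m),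
     Cmp = (\<lambda>M M' M'' g f. compose (carrier M) g f)\<rparr>"

text \<open>A universe of module elements that contains an arbitrary type \<open>'b\<close> and is closed under
  forming tensor products with coefficients from \<open>'r\<close> and from \<open>'s\<close>.\<close>

datatype ('r, 's, 'b) elt =
    Atom 'b
  | SumR "('r \<times> ('r, 's, 'b) elt) list"
  | SumS "('s \<times> ('r, 's, 'b) elt) list"

text \<open>$\mathrm{id} \otimes g$, and the diagonal action $\varphi_t \otimes \varphi_t$.\<close>

definition tens_map ::
  "(('c \<times> 'u) list \<Rightarrow> 'u) \<Rightarrow> ('c, 'x) ring_scheme \<Rightarrow> ('a, 'z) ring_scheme \<Rightarrow> ('a \<Rightarrow> 'c)
    \<Rightarrow> ('a, 'u, 't) tmodule \<Rightarrow> ('a, 'u, 't) tmodule \<Rightarrow> ('u \<Rightarrow> 'u) \<Rightarrow> 'u \<Rightarrow> 'u" where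
  "tens_map K B A f M M' g = (\<lambda>u \<in> carrier (tensor K B A f M).
     K (tens_rep B A f M' (map (\<lambda>(b, m). (b, g m)) (inv_into UNIV K u))))"

definition tens_act ::
  "(('c \<times> 'u) list \<Rightarrow> 'u) \<Rightarrow> ('c, 'x) ring_scheme \<Rightarrow> ('a, 'z) ring_scheme \<Rightarrow> ('a \<Rightarrow> 'c)
    \<Rightarrow> ('t \<Rightarrow> 'c \<Rightarrow> 'c) \<Rightarrow> ('a, 'u, 't) tmodule \<Rightarrow> 't \<Rightarrow> 'u \<Rightarrow> 'u" where
  "tens_act K B A f \<Phi> M t u =
     K (tens_rep B A f M (map (\<lambda>(b, m). (\<Phi> t b, tact M t m)) (inv_into UNIV K u)))"

type_synonym ('r, 'p, 'n, 'b) uni_elt = "('r, ('r, 'p, 'n) compl, 'b) elt"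

type_synonym ('r, 'p, 'n, 'b) Rmod = "('r, ('r, 'p, 'n, 'b) uni_elt, ('p, 'n) qmat) tmodule"

type_synonym ('r, 'p, 'n, 'b) Smod =
  "(('r, 'p, 'n) compl, ('r, 'p, 'n, 'b) uni_elt, ('p, 'n) qmat) tmodule"

definition catR ::
  "('p :: prime_type, 'n :: finite) datum \<Rightarrow> ('r, 'p, 'n) pg_ring
    \<Rightarrow> (('r, 'p, 'n, 'b) Rmod, ('r, 'p, 'n, 'b) uni_elt \<Rightarrow> ('r, 'p, 'n, 'b) uni_elt) category" where
  "catR \<G> R = T_cat \<G> R (phiR \<G> R)"

definition catS ::
  "('p :: prime_type, 'n :: finite) datum \<Rightarrow> ('r, 'p, 'n) pg_ring \<Rightarrow> ('p padic \<Rightarrow> ('p, 'n) qmat)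
    \<Rightarrow> (nat \<Rightarrow> nat)
    \<Rightarrow> (('r, 'p, 'n, 'b) Smod, ('r, 'p, 'n, 'b) uni_elt \<Rightarrow> ('r, 'p, 'n, 'b) uni_elt) category" where
  "catS \<G> R \<iota> c = T_cat \<G> (completed \<G> R \<iota> c) (phiS \<G> R \<iota> c)"

definition D_ob ::
  "('p :: prime_type, 'n :: finite) datum \<Rightarrow> ('r, 'p, 'n) pg_ring \<Rightarrow> ('p padic \<Rightarrow> ('p, 'n) qmat)
    \<Rightarrow> (nat \<Rightarrow> nat) \<Rightarrow> ('r, 'p, 'n, 'b) Smod \<Rightarrow> ('r, 'p, 'n, 'b) Rmod" where
  "D_ob \<G> R \<iota> c M = Module.module.extend (tensor SumR R (completed \<G> R \<iota> c) (ellR \<G> R) M)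
     (tmodule.fields (tens_act SumR R (completed \<G> R \<iota> c) (ellR \<G> R) (phiR \<G> R) M))"

definition D_ar ::
  "('p :: prime_type, 'n :: finite) datum \<Rightarrow> ('r, 'p, 'n) pg_ring \<Rightarrow> ('p padic \<Rightarrow> ('p, 'n) qmat)
    \<Rightarrow> (nat \<Rightarrow> nat) \<Rightarrow> ('r, 'p, 'n, 'b) Smod \<Rightarrow> ('r, 'p, 'n, 'b) Smod
    \<Rightarrow> (('r, 'p, 'n, 'b) uni_elt \<Rightarrow> ('r, 'p, 'n, 'b) uni_elt)
    \<Rightarrow> ('r, 'p, 'n, 'b) uni_elt \<Rightarrow> ('r, 'p, 'n, 'b) uni_elt" where
  "D_ar \<G> R \<iota> c = tens_map SumR R (completed \<G> R \<iota> c) (ellR \<G> R)"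

text \<open>
  The action on $R[[N_1,\ell]] \otimes_{R,\iota_R} V$.  For $t = s$ it is
  $\varphi_s \otimes \varphi_s$.  If \<open>\<iota>\<close> is equivariant for \<open>t\<close>, then so is $\iota_R$ and the
  action of \<open>t\<close> is $\varphi_t \otimes \varphi_t$; but \<open>\<iota>\<close> is only assumed to be equivariant for
  \<open>s\<close>, and for other \<open>t\<close> the expression $\varphi_t \otimes \varphi_t$ need not respect the
  tensor product over $\iota_R$.  In general the action of \<open>t\<close> is the unique $\varphi_t$-semilinear
  map that commutes with $\varphi_s \otimes \varphi_s$ and induces $\varphi_t$ on \<open>V\<close> along
  $\lambda \otimes v \mapsto \ell_R(\lambda) v$.
\<close>

definition M_act ::
  "('p :: prime_type, 'n :: finite) datum \<Rightarrow> ('r, 'p, 'n) pg_ring \<Rightarrow> ('p padic \<Rightarrow> ('p, 'n) qmat)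
    \<Rightarrow> (nat \<Rightarrow> nat) \<Rightarrow> ('r, 'p, 'n, 'b) Rmod \<Rightarrow> ('p, 'n) qmat
    \<Rightarrow> ('r, 'p, 'n, 'b) uni_elt \<Rightarrow> ('r, 'p, 'n, 'b) uni_elt" where
  "M_act \<G> R \<iota> c V t =
    (let S = completed \<G> R \<iota> c; T = tensor SumS S R (iotaR \<G> R) V;
         \<delta> = tens_act SumS S R (iotaR \<G> R) (phiS \<G> R \<iota> c) V (ss \<G>);
         aug = (\<lambda>u. msum V (\<lambda>a v. ellR \<G> R a \<odot>\<^bsub>V\<^esub> v) (inv_into UNIV SumS u))
     in THE \<Psi>. \<Psi> \<in> carrier T \<rightarrow>\<^sub>E carrier T
       \<and> (\<forall>u \<in> carrier T. \<forall>v \<in> carrier T. \<Psi> (u \<oplus>\<^bsub>T\<^esub> v) = \<Psi> u \<oplus>\<^bsub>T\<^esub> \<Psi> v)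
       \<and> (\<forall>a \<in> carrier S. \<forall>u \<in> carrier T. \<Psi> (a \<odot>\<^bsub>T\<^esub> u) = phiS \<G> R \<iota> c t a \<odot>\<^bsub>T\<^esub> \<Psi> u)
       \<and> (\<forall>u \<in> carrier T. \<Psi> (\<delta> u) = \<delta> (\<Psi> u))
       \<and> (\<forall>u \<in> carrier T. aug (\<Psi> u) = tact V t (aug u)))"

definition M_ob ::
  "('p :: prime_type, 'n :: finite) datum \<Rightarrow> ('r, 'p, 'n) pg_ring \<Rightarrow> ('p padic \<Rightarrow> ('p, 'n) qmat)
    \<Rightarrow> (nat \<Rightarrow> nat) \<Rightarrow> ('r, 'p, 'n, 'b) Rmod \<Rightarrow> ('r, 'p, 'n, 'b) Smod" where
  "M_ob \<G> R \<iota> c V = Module.module.extend (tensor SumS (completed \<G> R \<iota> c) R (iotaR \<G> R) V)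
     (tmodule.fields (M_act \<G> R \<iota> c V))"

definition M_ar ::
  "('p :: prime_type, 'n :: finite) datum \<Rightarrow> ('r, 'p, 'n) pg_ring \<Rightarrow> ('p padic \<Rightarrow> ('p, 'n) qmat)
    \<Rightarrow> (nat \<Rightarrow> nat) \<Rightarrow> ('r, 'p, 'n, 'b) Rmod \<Rightarrow> ('r, 'p, 'n, 'b) Rmod
    \<Rightarrow> (('r, 'p, 'n, 'b) uni_elt \<Rightarrow> ('r, 'p, 'n, 'b) uni_elt)
    \<Rightarrow> ('r, 'p, 'n, 'b) uni_elt \<Rightarrow> ('r, 'p, 'n, 'b) uni_elt" where
  "M_ar \<G> R \<iota> c = tens_map SumS (completed \<G> R \<iota> c) R (iotaR \<G> R)"

end

theory Submission
  imports Defs "HOL-Number_Theory.Cong"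
begin

text \<open>
  The skew group rings are generated by the elements $[a, n] = \chi(\ell(n)) \varphi^m(a) \cdot n'$,
  where $n \in N_0$, $n' = \iota(\ell(n))^{-1} n$ and \<open>m\<close> is large; they multiply by
  $[a, n] [b, n'] = [ab, nn']$ and \<open>t\<close> sends $[a, n]$ to $[\varphi_t(a), tnt^{-1}]$, which gives the
  ring laws and the action, independently of \<open>\<iota>\<close>.  As $\varphi_s$ moves the kernel of
  $R[[N_1,\ell]] \to R[N_1/N_k,\ell]$ into the next one, an etale module over $R[[N_1,\ell]]$ is
  determined by its reduction along $\ell_R$: a linear map on the reductions commuting with
  $\varphi_s$ lifts uniquely, as the limit of $\varphi_s$-conjugates of an arbitrary lift, and the
  lift commutes with all of $T_{+,\ell}$ by uniqueness.  Both \<open>U\<close> and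
  $\mathbb{M}\mathbb{D}U$ reduce to $\mathbb{D}U$, and $\mathbb{M}V$ reduces both to \<open>V\<close> and to
  $\mathbb{D}\mathbb{M}V$; the natural isomorphisms are the lifted, respectively induced, identities.
\<close>

section \<open>Semilinear maps and bases\<close>

text \<open>The section \<iota> is compatible with conjugation by \<open>s\<close> only, so for a
  general \<open>t\<close> the formula r h |-> \<phi>_t(r) (t h t^-1) need not be multiplicative and
  \<phi>_t \<otimes> \<phi>_t need not respect the tensor product over \<iota>_R. In the ring this
  is met by the exponent \<open>m\<close> of the generators: modulo N_k, conjugation by \<iota>(p^m
  x) is trivial on N_1 and t \<iota>(p^m x) t^-1 agrees with \<iota>(z p^m x) as soon as
  \<open>m\<close> is large. The exponent stays a parameter, since two levels often have to be
  compared. On modules, lifting is proved for maps that are semilinear over any ring endomorphism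
  \<theta> commuting with \<phi>_s: \<theta> = \<phi>_t yields the action of \<open>t\<close> on the
  extended module, \<theta> = id the morphisms. Being etale enters in the form that \<phi> carries a
  basis b_e to a basis. A semilinear map may therefore be prescribed on the vectors \<phi>(b_e), and
  two maps that commute with the operators and are congruent modulo J_n on the b_e are congruent
  modulo J_{n+1} on the \<phi>(b_e), hence everywhere.\<close>

definition semilin where
  "semilin A \<theta> M N g \<longleftrightarrow> g \<in> carrier M \<rightarrow> carrier N
     \<and> (\<forall>x\<in>carrier M. \<forall>y\<in>carrier M. g (x \<oplus>\<^bsub>M\<^esub> y) = g x \<oplus>\<^bsub>N\<^esub> g y)
     \<and> (\<forall>a\<in>carrier A. \<forall>x\<in>carrier M. g (a \<odot>\<^bsub>M\<^esub> x) = \<theta> a \<odot>\<^bsub>N\<^esub> g x)"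

text \<open>An indexed family and not a subset: the image of a basis under a map keeps the index set
  \<open>E\<close>, whether or not the map is known to be injective on it.\<close>

definition module_basis where
  "module_basis A M E b \<longleftrightarrow> finite E \<and> b \<in> E \<rightarrow> carrier M \<and>
     (\<forall>x \<in> carrier M. \<exists>!a. a \<in> E \<rightarrow>\<^sub>E carrier A \<and> x = (\<Oplus>\<^bsub>M\<^esub>e\<in>E. a e \<odot>\<^bsub>M\<^esub> b e))"

definition coord where
  "coord A M E b x = (THE a. a \<in> E \<rightarrow>\<^sub>E carrier A \<and> x = (\<Oplus>\<^bsub>M\<^esub>e\<in>E. a e \<odot>\<^bsub>M\<^esub> b e))"

text \<open>Zero is preserved because g(0) = g(0) + g(0); infinite index sets, whose sum is zero by
  convention, are thereby included.\<close>

lemma additive_finsum: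
  assumes "abelian_group M" "abelian_group N" "g \<in> carrier M \<rightarrow> carrier N"
    and add: "\<And>x y. x \<in> carrier M \<Longrightarrow> y \<in> carrier M \<Longrightarrow> g (x \<oplus>\<^bsub>M\<^esub> y) = g x \<oplus>\<^bsub>N\<^esub> g y"
    and "f \<in> I \<rightarrow> carrier M"
  shows "g (finsum M f I) = finsum N (\<lambda>i. g (f i)) I"
proof -
  interpret M: abelian_group M by fact
  interpret N: abelian_group N by fact
  have g0: "g \<zero>\<^bsub>M\<^esub> = \<zero>\<^bsub>N\<^esub>"
    using add[of "\<zero>\<^bsub>M\<^esub>" "\<zero>\<^bsub>M\<^esub>"] assms(3) by (auto simp: Pi_iff intro: N.add.l_cancel_one'[THEN iffD1])
  from assms(5) show ?thesis
  proof (induction I rule: infinite_finite_induct)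
    case (insert i I)
    then show ?case using assms(3) by (auto simp: add Pi_iff intro!: M.finsum_closed)
  qed (simp_all add: g0)
qed

context left_module
begin

lemma zero_smult: "x \<in> carrier M \<Longrightarrow> \<zero>\<^bsub>R\<^esub> \<odot>\<^bsub>M\<^esub> x = \<zero>\<^bsub>M\<^esub>"
  by (metis M.add.l_cancel_one' R.l_zero R.zero_closed smult_closed smult_l_distr)

lemma smult_zero: "a \<in> carrier R \<Longrightarrow> a \<odot>\<^bsub>M\<^esub> \<zero>\<^bsub>M\<^esub> = \<zero>\<^bsub>M\<^esub>"
  by (metis M.add.l_cancel_one' M.l_zero M.zero_closed smult_closed smult_r_distr)

lemma smult_minus: "x \<in> carrier M \<Longrightarrow> (\<ominus>\<^bsub>R\<^esub> \<one>\<^bsub>R\<^esub>) \<odot>\<^bsub>M\<^esub> x = \<ominus>\<^bsub>M\<^esub> x"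
proof -
  assume x: "x \<in> carrier M"
  have "(\<ominus>\<^bsub>R\<^esub> \<one>\<^bsub>R\<^esub>) \<odot>\<^bsub>M\<^esub> x \<oplus>\<^bsub>M\<^esub> x = (\<ominus>\<^bsub>R\<^esub> \<one>\<^bsub>R\<^esub> \<oplus>\<^bsub>R\<^esub> \<one>\<^bsub>R\<^esub>) \<odot>\<^bsub>M\<^esub> x"
    using x by (simp add: smult_l_distr smult_one)
  also have "\<dots> = \<zero>\<^bsub>M\<^esub>" using x by (simp add: R.l_neg zero_smult)
  finally show ?thesis using x by (simp add: M.minus_equality smult_closed)
qed

lemma finsum_smult:
  assumes "a \<in> carrier R" "f \<in> I \<rightarrow> carrier M"
  shows "a \<odot>\<^bsub>M\<^esub> finsum M f I = (\<Oplus>\<^bsub>M\<^esub>i\<in>I. a \<odot>\<^bsub>M\<^esub> f i)"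
  by (rule additive_finsum[of M M "\<lambda>x. a \<odot>\<^bsub>M\<^esub> x"])
    (use assms in \<open>auto simp: smult_closed smult_r_distr M.abelian_group_axioms\<close>)

lemma finsum_if_smult:
  assumes "finite E" "e \<in> E" "c \<in> carrier M"
    and "\<And>e'. e' \<in> E \<Longrightarrow> x e' \<in> carrier M"
    and "x e = c" "\<And>e'. e' \<in> E \<Longrightarrow> e' \<noteq> e \<Longrightarrow> x e' = \<zero>\<^bsub>M\<^esub>"
  shows "(\<Oplus>\<^bsub>M\<^esub>e'\<in>E. x e') = c"
proof -
  have "(\<Oplus>\<^bsub>M\<^esub>e'\<in>E. x e') = (\<Oplus>\<^bsub>M\<^esub>e'\<in>E. if e = e' then c else \<zero>\<^bsub>M\<^esub>)"
    using assms by (intro M.finsum_cong') auto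
  also have "\<dots> = c" using assms M.finsum_singleton[of e E "\<lambda>_. c"] by simp
  finally show ?thesis .
qed

section \<open>Coordinates with respect to a basis\<close>

lemma
  assumes "module_basis R M E b" "x \<in> carrier M"
  shows coord_funcset: "coord R M E b x \<in> E \<rightarrow>\<^sub>E carrier R"
    and coord_expand: "(\<Oplus>\<^bsub>M\<^esub>e\<in>E. coord R M E b x e \<odot>\<^bsub>M\<^esub> b e) = x"
proof -
  have "\<exists>!a. a \<in> E \<rightarrow>\<^sub>E carrier R \<and> x = (\<Oplus>\<^bsub>M\<^esub>e\<in>E. a e \<odot>\<^bsub>M\<^esub> b e)"
    using assms unfolding module_basis_def by blast
  from theI'[OF this] show "coord R M E b x \<in> E \<rightarrow>\<^sub>E carrier R"
    "(\<Oplus>\<^bsub>M\<^esub>e\<in>E. coord R M E b x e \<odot>\<^bsub>M\<^esub> b e) = x"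
    unfolding coord_def by simp_all
qed

lemma coord_closed:
  assumes "module_basis R M E b" "x \<in> carrier M" "e \<in> E"
  shows "coord R M E b x e \<in> carrier R"
  using coord_funcset[OF assms(1,2)] assms(3) by auto

lemma basis_closed: "module_basis R M E b \<Longrightarrow> e \<in> E \<Longrightarrow> b e \<in> carrier M"
  unfolding module_basis_def by blast

lemma lincomb_closed:
  assumes "b \<in> E \<rightarrow> carrier M" "a \<in> E \<rightarrow> carrier R"
  shows "(\<Oplus>\<^bsub>M\<^esub>e\<in>E. a e \<odot>\<^bsub>M\<^esub> b e) \<in> carrier M"
  using assms by (intro M.finsum_closed) (auto simp: smult_closed Pi_iff)

lemma coord_unique:
  assumes "module_basis R M E b" "a \<in> E \<rightarrow> carrier R" "x = (\<Oplus>\<^bsub>M\<^esub>e\<in>E. a e \<odot>\<^bsub>M\<^esub> b e)" "e \<in> E"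
  shows "coord R M E b x e = a e"
proof -
  have b: "b \<in> E \<rightarrow> carrier M" using assms(1) unfolding module_basis_def by blast
  have x: "x \<in> carrier M" using lincomb_closed[OF b assms(2)] assms(3) by simp
  have ex: "\<exists>!a. a \<in> E \<rightarrow>\<^sub>E carrier R \<and> x = (\<Oplus>\<^bsub>M\<^esub>e\<in>E. a e \<odot>\<^bsub>M\<^esub> b e)"
    using assms(1) x unfolding module_basis_def by blast
  have "x = (\<Oplus>\<^bsub>M\<^esub>e\<in>E. restrict a E e \<odot>\<^bsub>M\<^esub> b e)"
    unfolding assms(3) using assms(2) b
    by (intro M.finsum_cong') (auto simp: smult_closed Pi_iff)
  then have "coord R M E b x = restrict a E"
    unfolding coord_def using assms(2) by (intro the1_equality[OF ex]) auto
  then show ?thesis using assms(4) by simp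
qed

lemma coord_add:
  assumes B: "module_basis R M E b" and x: "x \<in> carrier M" and y: "y \<in> carrier M" and e: "e \<in> E"
  shows "coord R M E b (x \<oplus>\<^bsub>M\<^esub> y) e = coord R M E b x e \<oplus>\<^bsub>R\<^esub> coord R M E b y e"
proof (rule coord_unique[OF B _ _ e])
  show "(\<lambda>e. coord R M E b x e \<oplus>\<^bsub>R\<^esub> coord R M E b y e) \<in> E \<rightarrow> carrier R"
    using coord_closed[OF B] x y by auto
  have "x \<oplus>\<^bsub>M\<^esub> y = (\<Oplus>\<^bsub>M\<^esub>e\<in>E. coord R M E b x e \<odot>\<^bsub>M\<^esub> b e) \<oplus>\<^bsub>M\<^esub> (\<Oplus>\<^bsub>M\<^esub>e\<in>E. coord R M E b y e \<odot>\<^bsub>M\<^esub> b e)"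
    using coord_expand[OF B] x y by simp
  also have "\<dots> = (\<Oplus>\<^bsub>M\<^esub>e\<in>E. coord R M E b x e \<odot>\<^bsub>M\<^esub> b e \<oplus>\<^bsub>M\<^esub> coord R M E b y e \<odot>\<^bsub>M\<^esub> b e)"
    using x y by (intro M.finsum_addf[symmetric]) (auto intro!: smult_closed coord_closed[OF B] basis_closed[OF B])
  also have "\<dots> = (\<Oplus>\<^bsub>M\<^esub>e\<in>E. (coord R M E b x e \<oplus>\<^bsub>R\<^esub> coord R M E b y e) \<odot>\<^bsub>M\<^esub> b e)"
    using x y by (intro M.finsum_cong')
      (auto simp: smult_l_distr coord_closed[OF B] basis_closed[OF B] intro!: smult_closed)
  finally show "x \<oplus>\<^bsub>M\<^esub> y = \<dots>" .
qed

lemma coord_smult: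
  assumes B: "module_basis R M E b" and x: "x \<in> carrier M" and a: "a \<in> carrier R" and e: "e \<in> E"
  shows "coord R M E b (a \<odot>\<^bsub>M\<^esub> x) e = a \<otimes>\<^bsub>R\<^esub> coord R M E b x e"
proof (rule coord_unique[OF B _ _ e])
  show "(\<lambda>e. a \<otimes>\<^bsub>R\<^esub> coord R M E b x e) \<in> E \<rightarrow> carrier R"
    using coord_closed[OF B] x a by auto
  have "a \<odot>\<^bsub>M\<^esub> x = a \<odot>\<^bsub>M\<^esub> (\<Oplus>\<^bsub>M\<^esub>e\<in>E. coord R M E b x e \<odot>\<^bsub>M\<^esub> b e)"
    using coord_expand[OF B] x by simp
  also have "\<dots> = (\<Oplus>\<^bsub>M\<^esub>e\<in>E. a \<odot>\<^bsub>M\<^esub> (coord R M E b x e \<odot>\<^bsub>M\<^esub> b e))"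
    using x a by (intro finsum_smult) (auto intro!: smult_closed coord_closed[OF B] basis_closed[OF B])
  also have "\<dots> = (\<Oplus>\<^bsub>M\<^esub>e\<in>E. (a \<otimes>\<^bsub>R\<^esub> coord R M E b x e) \<odot>\<^bsub>M\<^esub> b e)"
    using x a by (intro M.finsum_cong')
      (auto simp: smult_assoc1 coord_closed[OF B] basis_closed[OF B] intro!: smult_closed)
  finally show "a \<odot>\<^bsub>M\<^esub> x = \<dots>" .
qed

lemma coord_basis:
  assumes B: "module_basis R M E b" and e: "e \<in> E" "e' \<in> E"
  shows "coord R M E b (b e) e' = (if e' = e then \<one>\<^bsub>R\<^esub> else \<zero>\<^bsub>R\<^esub>)"
proof (rule coord_unique[OF B _ _ e(2)])
  have fin: "finite E" using B unfolding module_basis_def by blast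
  show "b e = (\<Oplus>\<^bsub>M\<^esub>e'\<in>E. (if e' = e then \<one>\<^bsub>R\<^esub> else \<zero>\<^bsub>R\<^esub>) \<odot>\<^bsub>M\<^esub> b e')"
    by (rule finsum_if_smult[symmetric, OF fin e(1)])
      (auto simp: smult_one zero_smult basis_closed[OF B] e smult_closed)
qed auto

end

section \<open>Semilinear maps, prescribed on a basis and determined by it\<close>

lemma semilinD:
  assumes "semilin A \<theta> M N g"
  shows "x \<in> carrier M \<Longrightarrow> g x \<in> carrier N"
    "x \<in> carrier M \<Longrightarrow> y \<in> carrier M \<Longrightarrow> g (x \<oplus>\<^bsub>M\<^esub> y) = g x \<oplus>\<^bsub>N\<^esub> g y"
    "a \<in> carrier A \<Longrightarrow> x \<in> carrier M \<Longrightarrow> g (a \<odot>\<^bsub>M\<^esub> x) = \<theta> a \<odot>\<^bsub>N\<^esub> g x"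
  using assms unfolding semilin_def by auto

lemma semilinI:
  assumes "\<And>x. x \<in> carrier M \<Longrightarrow> g x \<in> carrier N"
    "\<And>x y. x \<in> carrier M \<Longrightarrow> y \<in> carrier M \<Longrightarrow> g (x \<oplus>\<^bsub>M\<^esub> y) = g x \<oplus>\<^bsub>N\<^esub> g y"
    "\<And>a x. a \<in> carrier A \<Longrightarrow> x \<in> carrier M \<Longrightarrow> g (a \<odot>\<^bsub>M\<^esub> x) = \<theta> a \<odot>\<^bsub>N\<^esub> g x"
  shows "semilin A \<theta> M N g"
  using assms unfolding semilin_def by auto

lemma semilin_comp:
  assumes "semilin A \<theta> M N g" "semilin B \<eta> N P h" "\<theta> \<in> carrier A \<rightarrow> carrier B"
  shows "semilin A (\<lambda>a. \<eta> (\<theta> a)) M P (\<lambda>x. h (g x))"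
  using assms unfolding semilin_def by (auto simp: Pi_iff)

lemma semilin_cong:
  assumes "semilin A \<theta> M N g" "left_module A M"
    "\<And>x. x \<in> carrier M \<Longrightarrow> g x = g' x" "\<And>a. a \<in> carrier A \<Longrightarrow> \<theta> a = \<theta>' a"
  shows "semilin A \<theta>' M N g'"
proof -
  interpret left_module A M by fact
  show ?thesis using assms(1,3,4) unfolding semilin_def by (auto simp: Pi_iff smult_closed)
qed

lemma semilin_zero:
  assumes "semilin A \<theta> M N g" "left_module A M" "left_module B N"
  shows "g \<zero>\<^bsub>M\<^esub> = \<zero>\<^bsub>N\<^esub>"
proof -
  interpret M: left_module A M by fact
  interpret N: left_module B N by fact
  show ?thesis
    using semilinD(2)[OF assms(1), of "\<zero>\<^bsub>M\<^esub>" "\<zero>\<^bsub>M\<^esub>"] semilinD(1)[OF assms(1), of "\<zero>\<^bsub>M\<^esub>"]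
    by (auto intro: N.add.l_cancel_one'[THEN iffD1])
qed

lemma semilin_minus:
  assumes "semilin A \<theta> M N g" "left_module A M" "left_module B N" "x \<in> carrier M" "y \<in> carrier M"
  shows "g (x \<ominus>\<^bsub>M\<^esub> y) = g x \<ominus>\<^bsub>N\<^esub> g y"
proof -
  interpret M: left_module A M by fact
  interpret N: left_module B N by fact
  have "g (\<ominus>\<^bsub>M\<^esub> y) \<oplus>\<^bsub>N\<^esub> g y = \<zero>\<^bsub>N\<^esub>"
    using semilinD(2)[OF assms(1), of "\<ominus>\<^bsub>M\<^esub> y" y] semilin_zero[OF assms(1-3)] assms(5)
    by (simp add: M.M.l_neg)
  then have "g (\<ominus>\<^bsub>M\<^esub> y) = \<ominus>\<^bsub>N\<^esub> g y"
    using semilinD(1)[OF assms(1)] assms(5) by (simp add: N.M.minus_equality)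
  then show ?thesis
    using semilinD(2)[OF assms(1), of x "\<ominus>\<^bsub>M\<^esub> y"] assms by (simp add: a_minus_def)
qed

lemma semilin_lincomb:
  assumes g: "semilin A \<theta> M N g" and M: "left_module A M" and N: "left_module B N"
    and \<theta>: "\<theta> \<in> carrier A \<rightarrow> carrier B"
    and b: "b \<in> E \<rightarrow> carrier M" and a: "a \<in> E \<rightarrow> carrier A"
  shows "g (\<Oplus>\<^bsub>M\<^esub>e\<in>E. a e \<odot>\<^bsub>M\<^esub> b e) = (\<Oplus>\<^bsub>N\<^esub>e\<in>E. \<theta> (a e) \<odot>\<^bsub>N\<^esub> g (b e))"
proof -
  interpret M: left_module A M by fact
  interpret N: left_module B N by fact
  have "g (\<Oplus>\<^bsub>M\<^esub>e\<in>E. a e \<odot>\<^bsub>M\<^esub> b e) = (\<Oplus>\<^bsub>N\<^esub>e\<in>E. g (a e \<odot>\<^bsub>M\<^esub> b e))"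
    using semilinD[OF g] a b
    by (intro additive_finsum) (auto simp: M.M.abelian_group_axioms N.M.abelian_group_axioms M.smult_closed Pi_iff)
  also have "\<dots> = (\<Oplus>\<^bsub>N\<^esub>e\<in>E. \<theta> (a e) \<odot>\<^bsub>N\<^esub> g (b e))"
    using semilinD[OF g] a b \<theta> by (intro N.M.finsum_cong') (auto simp: Pi_iff N.smult_closed)
  finally show ?thesis .
qed

lemma module_basis_cong:
  assumes M: "left_module A M" and b: "module_basis A M E b" and eq: "\<And>e. e \<in> E \<Longrightarrow> b' e = b e"
  shows "module_basis A M E b'"
proof -
  interpret left_module A M by (rule M)
  have bM: "b e \<in> carrier M" if "e \<in> E" for e using basis_closed[OF b that] .
  have "(\<Oplus>\<^bsub>M\<^esub>e\<in>E. a e \<odot>\<^bsub>M\<^esub> b' e) = (\<Oplus>\<^bsub>M\<^esub>e\<in>E. a e \<odot>\<^bsub>M\<^esub> b e)" if "a \<in> E \<rightarrow>\<^sub>E carrier A" for a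
    using that by (intro M.finsum_cong') (auto simp: eq bM intro!: smult_closed)
  then show ?thesis using b bM unfolding module_basis_def by (simp add: eq cong: conj_cong)
qed

text \<open>The map is x |-> sum of \<theta>(x_e) c_e, where x_e are the coordinates of
  \<open>x\<close>. Multiplicativity of \<theta> gives semilinearity, and \<theta>(1) = 1 gives the
  values on the basis.\<close>

lemma semilin_extend:
  assumes M: "left_module A M" and N: "left_module B N" and \<theta>: "\<theta> \<in> ring_hom A B"
    and b: "module_basis A M E b" and c: "c \<in> E \<rightarrow> carrier N"
  obtains g where "semilin A \<theta> M N g" "\<And>e. e \<in> E \<Longrightarrow> g (b e) = c e"
proof -
  interpret M: left_module A M by fact
  interpret N: left_module B N by fact
  have fin: "finite E" using b unfolding module_basis_def by blast
  have \<theta>0: "\<theta> \<zero>\<^bsub>A\<^esub> = \<zero>\<^bsub>B\<^esub>" using ring_hom_zero[OF \<theta>] M.R.ring_axioms N.R.ring_axioms .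
  define g where "g x = (\<Oplus>\<^bsub>N\<^esub>e\<in>E. \<theta> (coord A M E b x e) \<odot>\<^bsub>N\<^esub> c e)" for x
  have cl: "\<theta> (coord A M E b x e) \<in> carrier B" if "x \<in> carrier M" "e \<in> E" for x e
    using M.coord_closed[OF b that] \<theta> by (simp add: ring_hom_closed)
  have cc: "c e \<in> carrier N" if "e \<in> E" for e using c that by auto
  have "semilin A \<theta> M N g"
  proof (rule semilinI)
    fix x assume x: "x \<in> carrier M"
    show "g x \<in> carrier N"
      unfolding g_def using cl[OF x] cc by (intro N.lincomb_closed) auto
    fix y assume y: "y \<in> carrier M"
    have "g (x \<oplus>\<^bsub>M\<^esub> y) = (\<Oplus>\<^bsub>N\<^esub>e\<in>E. \<theta> (coord A M E b x e) \<odot>\<^bsub>N\<^esub> c e \<oplus>\<^bsub>N\<^esub> \<theta> (coord A M E b y e) \<odot>\<^bsub>N\<^esub> c e)"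
      unfolding g_def using x y cl cc
      by (intro N.M.finsum_cong')
        (auto simp: M.coord_add[OF b] ring_hom_add[OF \<theta>] M.coord_closed[OF b] N.smult_l_distr N.smult_closed)
    also have "\<dots> = g x \<oplus>\<^bsub>N\<^esub> g y"
      unfolding g_def using x y cl cc by (intro N.M.finsum_addf) (auto simp: N.smult_closed)
    finally show "g (x \<oplus>\<^bsub>M\<^esub> y) = g x \<oplus>\<^bsub>N\<^esub> g y" .
  next
    fix a x assume a: "a \<in> carrier A" and x: "x \<in> carrier M"
    have ta: "\<theta> a \<in> carrier B" using a \<theta> by (simp add: ring_hom_closed)
    have "g (a \<odot>\<^bsub>M\<^esub> x) = (\<Oplus>\<^bsub>N\<^esub>e\<in>E. \<theta> a \<odot>\<^bsub>N\<^esub> (\<theta> (coord A M E b x e) \<odot>\<^bsub>N\<^esub> c e))"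
      unfolding g_def using x a ta cl cc
      by (intro N.M.finsum_cong')
        (auto simp: M.coord_smult[OF b] ring_hom_mult[OF \<theta>] M.coord_closed[OF b] N.smult_assoc1 N.smult_closed)
    also have "\<dots> = \<theta> a \<odot>\<^bsub>N\<^esub> g x"
      unfolding g_def using x ta cl cc by (intro N.finsum_smult[symmetric]) (auto simp: N.smult_closed)
    finally show "g (a \<odot>\<^bsub>M\<^esub> x) = \<theta> a \<odot>\<^bsub>N\<^esub> g x" .
  qed
  moreover have "g (b e) = c e" if e: "e \<in> E" for e
    unfolding g_def
    by (rule N.finsum_if_smult[OF fin e])
      (use e \<theta> in \<open>auto simp: M.coord_basis[OF b] cc ring_hom_one \<theta>0 N.smult_one N.zero_smult N.smult_closed ring_hom_closed\<close>)
  ultimately show thesis using that by blast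
qed

lemma semilin_eqI:
  assumes M: "left_module A M" and N: "left_module B N" and \<theta>: "\<theta> \<in> carrier A \<rightarrow> carrier B"
    and b: "module_basis A M E b" and g: "semilin A \<theta> M N g" and h: "semilin A \<theta> M N h"
    and eq: "\<And>e. e \<in> E \<Longrightarrow> g (b e) = h (b e)" and x: "x \<in> carrier M"
  shows "g x = h x"
proof -
  interpret M: left_module A M by fact
  interpret N: left_module B N by fact
  have bE: "b \<in> E \<rightarrow> carrier M" using b unfolding module_basis_def by blast
  have cE: "coord A M E b x \<in> E \<rightarrow> carrier A" using M.coord_closed[OF b x] by auto
  have "g x = (\<Oplus>\<^bsub>N\<^esub>e\<in>E. \<theta> (coord A M E b x e) \<odot>\<^bsub>N\<^esub> g (b e))"
    using semilin_lincomb[OF g M N \<theta> bE cE] M.coord_expand[OF b x] by simp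
  also have "\<dots> = (\<Oplus>\<^bsub>N\<^esub>e\<in>E. \<theta> (coord A M E b x e) \<odot>\<^bsub>N\<^esub> h (b e))"
    using bE cE \<theta> semilinD(1)[OF h] eq by (intro N.M.finsum_cong') (auto simp: N.smult_closed Pi_iff)
  also have "\<dots> = h x"
    using semilin_lincomb[OF h M N \<theta> bE cE] M.coord_expand[OF b x] by simp
  finally show ?thesis .
qed

text \<open>Lets the etale condition, a bijection out of a tensor product, be tested on a basis. If
  the images form a basis, the inverse is the linear map that sends them back to
  \<open>b\<close>.\<close>

lemma bij_betw_iff_basis:
  assumes M: "left_module A M" and N: "left_module A N" and b: "module_basis A M E b"
    and G: "semilin A (\<lambda>a. a) M N G"
  shows "bij_betw G (carrier M) (carrier N) \<longleftrightarrow> module_basis A N E (\<lambda>e. G (b e))"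
proof
  interpret M: left_module A M by fact
  interpret N: left_module A N by fact
  have bE: "b \<in> E \<rightarrow> carrier M" and fin: "finite E" using b unfolding module_basis_def by blast+
  note Gl = semilin_lincomb[OF G M N _ bE]
  {
    assume bij: "bij_betw G (carrier M) (carrier N)"
    show "module_basis A N E (\<lambda>e. G (b e))"
      unfolding module_basis_def
    proof (intro conjI ballI fin ex_ex1I)
      show "(\<lambda>e. G (b e)) \<in> E \<rightarrow> carrier N" using bE semilinD(1)[OF G] by auto
      fix y assume y: "y \<in> carrier N"
      then obtain x where x: "x \<in> carrier M" "G x = y" using bij by (metis bij_betw_imp_surj_on imageE)
      have c: "coord A M E b x \<in> E \<rightarrow>\<^sub>E carrier A" using M.coord_funcset[OF b x(1)] .
      then have "y = (\<Oplus>\<^bsub>N\<^esub>e\<in>E. coord A M E b x e \<odot>\<^bsub>N\<^esub> G (b e))"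
        using Gl[of "coord A M E b x"] M.coord_expand[OF b x(1)] x(2) by auto
      with c show "\<exists>a. a \<in> E \<rightarrow>\<^sub>E carrier A \<and> y = (\<Oplus>\<^bsub>N\<^esub>e\<in>E. a e \<odot>\<^bsub>N\<^esub> G (b e))" by blast
      fix a a'
      assume a: "a \<in> E \<rightarrow>\<^sub>E carrier A \<and> y = (\<Oplus>\<^bsub>N\<^esub>e\<in>E. a e \<odot>\<^bsub>N\<^esub> G (b e))"
        and a': "a' \<in> E \<rightarrow>\<^sub>E carrier A \<and> y = (\<Oplus>\<^bsub>N\<^esub>e\<in>E. a' e \<odot>\<^bsub>N\<^esub> G (b e))"
      have aE: "a \<in> E \<rightarrow> carrier A" "a' \<in> E \<rightarrow> carrier A" using a a' by auto
      have "G (\<Oplus>\<^bsub>M\<^esub>e\<in>E. a e \<odot>\<^bsub>M\<^esub> b e) = G (\<Oplus>\<^bsub>M\<^esub>e\<in>E. a' e \<odot>\<^bsub>M\<^esub> b e)"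
        using Gl[of a] Gl[of a'] aE a a' by simp
      then have eq: "(\<Oplus>\<^bsub>M\<^esub>e\<in>E. a e \<odot>\<^bsub>M\<^esub> b e) = (\<Oplus>\<^bsub>M\<^esub>e\<in>E. a' e \<odot>\<^bsub>M\<^esub> b e)"
        using bij M.lincomb_closed[OF bE] aE by (meson bij_betw_imp_inj_on inj_onD)
      have "a e = a' e" if "e \<in> E" for e
        using M.coord_unique[OF b aE(1) eq[symmetric] that] M.coord_unique[OF b aE(2) HOL.refl that] by simp
      then show "a = a'" using a a' by (intro PiE_ext[of a E "\<lambda>_. carrier A" a']) auto
    qed
  next
    assume c: "module_basis A N E (\<lambda>e. G (b e))"
    obtain H where H: "semilin A (\<lambda>a. a) N M H" "\<And>e. e \<in> E \<Longrightarrow> H (G (b e)) = b e"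
      using semilin_extend[OF N M _ c bE, of "\<lambda>a. a"] by (auto simp: ring_hom_def)
    have HG: "H (G x) = x" if "x \<in> carrier M" for x
      by (rule semilin_eqI[OF M M _ b semilin_comp[OF G H(1)] _ _ that])
        (auto intro!: semilinI simp: H)
    have GH: "G (H x) = x" if "x \<in> carrier N" for x
      by (rule semilin_eqI[OF N N _ c semilin_comp[OF H(1) G] _ _ that])
        (auto intro!: semilinI simp: H)
    show "bij_betw G (carrier M) (carrier N)"
      by (rule bij_betw_byWitness[where f' = H]) (auto simp: HG GH semilinD[OF G] semilinD[OF H(1)])
  }
qed

lemma fg_free_basis: "fg_free A M \<longleftrightarrow> (\<exists>E \<subseteq> carrier M. module_basis A M E (\<lambda>e. e))"
  unfolding fg_free_def module_basis_def by (auto simp: Pi_iff)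

text \<open>\<open>fg_free\<close> asks for a set of vectors, so the indexed basis has to be
  injective: b_e has coordinate 1 at \<open>e\<close> and 0 at every other index, and 1 differs from
  0.\<close>

lemma fg_freeI:
  assumes M: "left_module A M" and b: "module_basis A M E b" and ne: "\<one>\<^bsub>A\<^esub> \<noteq> \<zero>\<^bsub>A\<^esub>"
  shows "fg_free A M"
proof -
  interpret M: left_module A M by fact
  have bE: "b \<in> E \<rightarrow> carrier M" and fin: "finite E" using b unfolding module_basis_def by blast+
  have inj: "inj_on b E"
    using M.coord_basis[OF b] ne by (intro inj_onI) (metis)
  have reindex: "(\<Oplus>\<^bsub>M\<^esub>x\<in>b ` E. a x \<odot>\<^bsub>M\<^esub> x) = (\<Oplus>\<^bsub>M\<^esub>e\<in>E. a (b e) \<odot>\<^bsub>M\<^esub> b e)"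
    if "a \<in> b ` E \<rightarrow> carrier A" for a
    using that bE by (intro M.M.finsum_reindex[OF _ inj]) (auto simp: M.smult_closed Pi_iff)
  have "module_basis A M (b ` E) (\<lambda>x. x)"
    unfolding module_basis_def
  proof (intro conjI ballI ex_ex1I)
    fix x assume x: "x \<in> carrier M"
    let ?c = "coord A M E b x"
    have c: "?c \<in> E \<rightarrow>\<^sub>E carrier A" using M.coord_funcset[OF b x] .
    define a where "a = (\<lambda>y\<in>b ` E. ?c (inv_into E b y))"
    have a: "a \<in> b ` E \<rightarrow>\<^sub>E carrier A" using c inj by (auto simp: a_def)
    have "(\<Oplus>\<^bsub>M\<^esub>x\<in>b ` E. a x \<odot>\<^bsub>M\<^esub> x) = (\<Oplus>\<^bsub>M\<^esub>e\<in>E. ?c e \<odot>\<^bsub>M\<^esub> b e)"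
      using a c bE inj by (subst reindex) (auto simp: a_def Pi_iff intro!: M.M.finsum_cong' M.smult_closed)
    then show "\<exists>a. a \<in> b ` E \<rightarrow>\<^sub>E carrier A \<and> x = (\<Oplus>\<^bsub>M\<^esub>x\<in>b ` E. a x \<odot>\<^bsub>M\<^esub> x)"
      using a M.coord_expand[OF b x] by auto
    fix a a'
    assume a: "a \<in> b ` E \<rightarrow>\<^sub>E carrier A \<and> x = (\<Oplus>\<^bsub>M\<^esub>x\<in>b ` E. a x \<odot>\<^bsub>M\<^esub> x)"
      and a': "a' \<in> b ` E \<rightarrow>\<^sub>E carrier A \<and> x = (\<Oplus>\<^bsub>M\<^esub>x\<in>b ` E. a' x \<odot>\<^bsub>M\<^esub> x)"
    have "a (b e) = a' (b e)" if "e \<in> E" for e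
    proof -
      have "coord A M E b x e = a (b e)"
        by (rule M.coord_unique[OF b _ _ that]) (use a reindex[of a] in auto)
      moreover have "coord A M E b x e = a' (b e)"
        by (rule M.coord_unique[OF b _ _ that]) (use a' reindex[of a'] in auto)
      ultimately show ?thesis by simp
    qed
    then show "a = a'" using a a' by (intro PiE_ext[of a "b ` E" "\<lambda>_. carrier A" a']) auto
  qed (use fin bE in auto)
  then show ?thesis unfolding fg_free_basis using bE by (intro exI[of _ "b ` E"]) auto
qed

section \<open>Extension of scalars\<close>

lemma left_moduleI:
  assumes "ring A" "abelian_group M"
    "\<And>a x. a \<in> carrier A \<Longrightarrow> x \<in> carrier M \<Longrightarrow> a \<odot>\<^bsub>M\<^esub> x \<in> carrier M"
    "\<And>a b x. a \<in> carrier A \<Longrightarrow> b \<in> carrier A \<Longrightarrow> x \<in> carrier M \<Longrightarrow>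
      (a \<oplus>\<^bsub>A\<^esub> b) \<odot>\<^bsub>M\<^esub> x = a \<odot>\<^bsub>M\<^esub> x \<oplus>\<^bsub>M\<^esub> b \<odot>\<^bsub>M\<^esub> x"
    "\<And>a x y. a \<in> carrier A \<Longrightarrow> x \<in> carrier M \<Longrightarrow> y \<in> carrier M \<Longrightarrow>
      a \<odot>\<^bsub>M\<^esub> (x \<oplus>\<^bsub>M\<^esub> y) = a \<odot>\<^bsub>M\<^esub> x \<oplus>\<^bsub>M\<^esub> a \<odot>\<^bsub>M\<^esub> y"
    "\<And>a b x. a \<in> carrier A \<Longrightarrow> b \<in> carrier A \<Longrightarrow> x \<in> carrier M \<Longrightarrow>
      (a \<otimes>\<^bsub>A\<^esub> b) \<odot>\<^bsub>M\<^esub> x = a \<odot>\<^bsub>M\<^esub> (b \<odot>\<^bsub>M\<^esub> x)"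
    "\<And>x. x \<in> carrier M \<Longrightarrow> \<one>\<^bsub>A\<^esub> \<odot>\<^bsub>M\<^esub> x = x"
  shows "left_module A M"
  by (intro left_module.intro left_module_axioms.intro) (fact assms)+

lemma abelian_group_cong:
  assumes "abelian_group M" "carrier N = carrier M" "zero N = zero M" "add N = add M"
  shows "abelian_group N"
proof -
  interpret abelian_group M by fact
  show ?thesis
  proof (rule abelian_groupI, unfold assms(2-4))
    show "\<exists>y\<in>carrier M. y \<oplus>\<^bsub>M\<^esub> x = \<zero>\<^bsub>M\<^esub>" if "x \<in> carrier M" for x
      using l_neg[OF that] a_inv_closed[OF that] by blast
  qed (simp_all add: a_ac)
qed

lemma extend_simps [simp]:
  "carrier (Module.module.extend T x) = carrier T"
  "zero (Module.module.extend T x) = zero T"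
  "add (Module.module.extend T x) = add T"
  "smult (Module.module.extend T x) = smult T"
  by (simp_all add: module.defs)

lemma finsum_extend [simp]: "finsum (Module.module.extend T x) = finsum T"
  by (intro ext) (simp add: finsum_def finprod_def)

lemma left_module_extend: "left_module A (Module.module.extend T x) = left_module A T"
proof -
  have "abelian_group (Module.module.extend T x) = abelian_group T"
    using abelian_group_cong[of T "Module.module.extend T x"]
      abelian_group_cong[of "Module.module.extend T x" T] by auto
  then show ?thesis unfolding left_module_def left_module_axioms_def by simp
qed

lemma module_basis_extend [simp]:
  "module_basis A (Module.module.extend T x) E b = module_basis A T E b"
  unfolding module_basis_def by simp

lemma semilin_extend_dom [simp]:
  "semilin A \<theta> (Module.module.extend T x) N g = semilin A \<theta> T N g"
  unfolding semilin_def by simp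

lemma semilin_extend_cod [simp]:
  "semilin A \<theta> M (Module.module.extend T x) g = semilin A \<theta> M T g"
  unfolding semilin_def by simp

text \<open>\<open>B\<close> as a left module over itself, the target of the coordinate functionals
  on a tensor product.\<close>

definition regular_module :: "('a, 'x) ring_scheme \<Rightarrow> ('a, 'a) module" where
  "regular_module B = \<lparr>carrier = carrier B, mult = mult B, one = one B, zero = zero B, add = add B,
     smult = mult B\<rparr>"

lemma regular_module_simps [simp]:
  "carrier (regular_module B) = carrier B" "zero (regular_module B) = zero B"
  "add (regular_module B) = add B" "smult (regular_module B) = mult B"
  by (simp_all add: regular_module_def)

lemma left_module_regular:
  assumes "ring B" shows "left_module B (regular_module B)"
proof -
  interpret ring B by fact
  have "abelian_group (regular_module B)"
    by (rule abelian_group_cong[OF abelian_group_axioms]) simp_all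
  then show ?thesis
    by (rule left_moduleI[OF assms]) (simp_all add: l_distr r_distr m_assoc)
qed

text \<open>Additivity of \<open>u\<close> and \<open>v\<close> settles every relation except
  \<open>balanced\<close>, which is therefore a hypothesis. Besides \<phi> \<otimes> \<phi> this
  covers left multiplication on the first factor, which is not a ring homomorphism.\<close>

lemma tens_eq_map:
  assumes eq: "tens_eq B A f M xs ys"
    and u: "\<And>b. b \<in> carrier B \<Longrightarrow> u b \<in> carrier B'" "u \<zero>\<^bsub>B\<^esub> = \<zero>\<^bsub>B'\<^esub>"
      "\<And>b b'. b \<in> carrier B \<Longrightarrow> b' \<in> carrier B \<Longrightarrow> u (b \<oplus>\<^bsub>B\<^esub> b') = u b \<oplus>\<^bsub>B'\<^esub> u b'"
    and v: "\<And>m. m \<in> carrier M \<Longrightarrow> v m \<in> carrier M'"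
      "\<And>m m'. m \<in> carrier M \<Longrightarrow> m' \<in> carrier M \<Longrightarrow> v (m \<oplus>\<^bsub>M\<^esub> m') = v m \<oplus>\<^bsub>M'\<^esub> v m'"
    and bal: "\<And>b a m. b \<in> carrier B \<Longrightarrow> a \<in> carrier A \<Longrightarrow> m \<in> carrier M \<Longrightarrow>
      tens_eq B' A' f' M' [(u (b \<otimes>\<^bsub>B\<^esub> f a), v m)] [(u b, v (a \<odot>\<^bsub>M\<^esub> m))]"
  shows "tens_eq B' A' f' M' (map (\<lambda>(b, m). (u b, v m)) xs) (map (\<lambda>(b, m). (u b, v m)) ys)"
  using eq
proof (induction rule: tens_eq.induct)
  case (sym xs ys) from sym.IH show ?case by (rule tens_eq.sym)
next
  case (trans xs ys zs) from trans.IH show ?case by (rule tens_eq.trans)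
next
  case (app xs xs' ys ys') from tens_eq.app[OF app.IH] show ?case by simp
qed (simp_all add: u v bal tens_eq.refl tens_eq.comm tens_eq.zero tens_eq.add_left tens_eq.add_right)

lemma tens_eq_Cons: "tens_eq B A f M xs ys \<Longrightarrow> tens_eq B A f M (z # xs) (z # ys)"
  using tens_eq.app[OF tens_eq.refl, of B A f M xs ys "[z]"] by simp

section \<open>Module structure and universal property of the tensor product\<close>

locale tensor_product =
  fixes K :: "('c \<times> 'b) list \<Rightarrow> 'u" and B :: "('c, 'x) ring_scheme" and A :: "('a, 'z) ring_scheme"
    and f :: "'a \<Rightarrow> 'c" and M :: "('a, 'b, 'y) module_scheme"
  assumes K: "inj K" and B: "ring B" and M: "left_module A M" and f: "f \<in> ring_hom A B"
begin

sublocale B: ring B by (rule B)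
sublocale M: left_module A M by (rule M)

abbreviation C where "C \<equiv> {xs. set xs \<subseteq> carrier B \<times> carrier M}"
abbreviation T where "T \<equiv> tensor K B A f M"
abbreviation teq where "teq \<equiv> tens_eq B A f M"

definition cl where "cl xs = K (tens_rep B A f M xs)"

text \<open>The canonical map m |-> 1 \<otimes> m; its values generate the tensor product over
  \<open>B\<close>.\<close>

definition tin where "tin m = cl [(\<one>\<^bsub>B\<^esub>, m)]"

lemma f_closed: "a \<in> carrier A \<Longrightarrow> f a \<in> carrier B"
  using f by (simp add: ring_hom_closed)

lemma f_zero: "f \<zero>\<^bsub>A\<^esub> = \<zero>\<^bsub>B\<^esub>"
  using ring_hom_zero[OF f M.R.ring_axioms B] .

text \<open>\<open>refl\<close> and \<open>comm\<close> hold for lists with arbitrary entries. Since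
  every relation respects \<open>C\<close> in both directions, the chosen representative of a
  well-formed sum is again well formed.\<close>

lemma teq_C: "teq xs ys \<Longrightarrow> xs \<in> C \<longleftrightarrow> ys \<in> C"
  by (induction rule: tens_eq.induct) (auto simp: f_closed M.smult_closed)

lemma teq_rep: "teq xs (tens_rep B A f M xs)"
  unfolding tens_rep_def by (rule someI, rule tens_eq.refl)

text \<open>Equivalent sums have the same predicate \<open>teq xs\<close>, hence the same chosen
  representative; conversely, \<open>K\<close> is injective and each sum is equivalent to its
  representative.\<close>

lemma cl_eq_iff: "cl xs = cl ys \<longleftrightarrow> teq xs ys"
proof
  assume "cl xs = cl ys"
  then have "tens_rep B A f M xs = tens_rep B A f M ys"
    using K unfolding cl_def by (simp add: inj_eq)
  then show "teq xs ys" using teq_rep[of xs] teq_rep[of ys] by (metis tens_eq.sym tens_eq.trans)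
next
  assume "teq xs ys"
  then have "teq xs = teq ys" by (intro ext) (metis tens_eq.sym tens_eq.trans)
  then show "cl xs = cl ys" unfolding cl_def tens_rep_def by simp
qed

lemma cl_eqI: "teq xs ys \<Longrightarrow> cl xs = cl ys"
  by (simp add: cl_eq_iff)

lemma dec_cl: "inv_into UNIV K (cl xs) = tens_rep B A f M xs"
  unfolding cl_def using K by simp

lemma dec_teq: "teq (inv_into UNIV K (cl xs)) xs"
  unfolding dec_cl using teq_rep by (rule tens_eq.sym)

lemma dec_C: "xs \<in> C \<Longrightarrow> inv_into UNIV K (cl xs) \<in> C"
  using teq_C[OF dec_teq] by blast

lemma carrier_T: "carrier T = cl ` C"
  unfolding tensor_def cl_def Let_def by simp

lemma T_cases: "u \<in> carrier T \<Longrightarrow> (\<And>xs. xs \<in> C \<Longrightarrow> u = cl xs \<Longrightarrow> thesis) \<Longrightarrow> thesis"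
  unfolding carrier_T by blast

lemma zero_T: "\<zero>\<^bsub>T\<^esub> = cl []"
  unfolding tensor_def cl_def Let_def by simp

lemma add_T: "cl xs \<oplus>\<^bsub>T\<^esub> cl ys = cl (xs @ ys)"
proof -
  have "cl xs \<oplus>\<^bsub>T\<^esub> cl ys = cl (inv_into UNIV K (cl xs) @ inv_into UNIV K (cl ys))"
    unfolding tensor_def cl_def Let_def by simp
  then show ?thesis by (simp add: cl_eq_iff tens_eq.app dec_teq)
qed

lemma teq_smult:
  assumes "b \<in> carrier B" "teq xs ys"
  shows "teq (map (\<lambda>(b', m). (b \<otimes>\<^bsub>B\<^esub> b', m)) xs) (map (\<lambda>(b', m). (b \<otimes>\<^bsub>B\<^esub> b', m)) ys)"
  using assms
  by (intro tens_eq_map[where v = "\<lambda>m. m"])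
    (auto simp: B.r_distr B.m_assoc[symmetric] f_closed tens_eq.balanced)

lemma smult_T: "b \<in> carrier B \<Longrightarrow> b \<odot>\<^bsub>T\<^esub> cl xs = cl (map (\<lambda>(b', m). (b \<otimes>\<^bsub>B\<^esub> b', m)) xs)"
proof -
  assume b: "b \<in> carrier B"
  have "b \<odot>\<^bsub>T\<^esub> cl xs = cl (map (\<lambda>(b', m). (b \<otimes>\<^bsub>B\<^esub> b', m)) (inv_into UNIV K (cl xs)))"
    unfolding tensor_def cl_def Let_def by simp
  then show ?thesis using b by (simp add: cl_eq_iff teq_smult dec_teq)
qed

lemma teq_zeros:
  "xs \<in> C \<Longrightarrow> teq (map (\<lambda>(b', m). (\<zero>\<^bsub>B\<^esub> \<otimes>\<^bsub>B\<^esub> b', m)) xs) []"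
proof (induction xs)
  case Nil show ?case by (simp add: tens_eq.refl)
next
  case (Cons x xs)
  then show ?case
    using tens_eq.app[OF tens_eq.zero[of "snd x" M B A f], of "map (\<lambda>(b', m). (\<zero>\<^bsub>B\<^esub> \<otimes>\<^bsub>B\<^esub> b', m)) xs" "[]"]
    by (auto simp: case_prod_unfold)
qed

lemma teq_l_distr:
  assumes b: "b \<in> carrier B" "b' \<in> carrier B"
  shows "xs \<in> C \<Longrightarrow> teq (map (\<lambda>(b'', m). ((b \<oplus>\<^bsub>B\<^esub> b') \<otimes>\<^bsub>B\<^esub> b'', m)) xs)
    (map (\<lambda>(b'', m). (b \<otimes>\<^bsub>B\<^esub> b'', m)) xs @ map (\<lambda>(b'', m). (b' \<otimes>\<^bsub>B\<^esub> b'', m)) xs)"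
proof (induction xs)
  case Nil show ?case by (simp add: tens_eq.refl)
next
  case (Cons x xs)
  obtain c m where x: "x = (c, m)" by force
  let ?X = "map (\<lambda>(b'', m). (b \<otimes>\<^bsub>B\<^esub> b'', m)) xs" and ?Y = "map (\<lambda>(b'', m). (b' \<otimes>\<^bsub>B\<^esub> b'', m)) xs"
  let ?u = "(b \<otimes>\<^bsub>B\<^esub> c, m)" and ?v = "(b' \<otimes>\<^bsub>B\<^esub> c, m)"
  have c: "c \<in> carrier B" "m \<in> carrier M" using Cons.prems x by auto
  have "teq [((b \<oplus>\<^bsub>B\<^esub> b') \<otimes>\<^bsub>B\<^esub> c, m)] [?u, ?v]"
    using b c by (simp add: B.l_distr tens_eq.add_left)
  from tens_eq.app[OF this Cons.IH]
  have 1: "teq (map (\<lambda>(b'', m). ((b \<oplus>\<^bsub>B\<^esub> b') \<otimes>\<^bsub>B\<^esub> b'', m)) (x # xs)) ([?u, ?v] @ ?X @ ?Y)"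
    using Cons.prems x by simp
  have "teq ([?v] @ ?X) (?X @ [?v])" by (rule tens_eq.comm)
  from tens_eq_Cons[OF tens_eq.app[OF this tens_eq.refl], of ?u ?Y]
  have "teq ([?u, ?v] @ ?X @ ?Y) (?u # ?X @ ?v # ?Y)" by simp
  with 1 show ?case unfolding x by (auto intro: tens_eq.trans)
qed

lemma cl_closed: "xs \<in> C \<Longrightarrow> cl xs \<in> carrier T"
  unfolding carrier_T by blast

lemma map_smult_C: "b \<in> carrier B \<Longrightarrow> xs \<in> C \<Longrightarrow> map (\<lambda>(b', m). (b \<otimes>\<^bsub>B\<^esub> b', m)) xs \<in> C"
  by auto

lemma T_l_distr:
  assumes "a \<in> carrier B" "b \<in> carrier B" "u \<in> carrier T"
  shows "(a \<oplus>\<^bsub>B\<^esub> b) \<odot>\<^bsub>T\<^esub> u = a \<odot>\<^bsub>T\<^esub> u \<oplus>\<^bsub>T\<^esub> b \<odot>\<^bsub>T\<^esub> u"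
  using assms(3) by (rule T_cases) (use assms(1,2) in \<open>auto simp: smult_T add_T intro!: cl_eqI teq_l_distr\<close>)

lemma T_one:
  assumes "u \<in> carrier T" shows "\<one>\<^bsub>B\<^esub> \<odot>\<^bsub>T\<^esub> u = u"
proof -
  have "map (\<lambda>(b', m). (\<one>\<^bsub>B\<^esub> \<otimes>\<^bsub>B\<^esub> b', m)) xs = xs" if "xs \<in> C" for xs
    using that by (induction xs) auto
  then show ?thesis using assms by (elim T_cases) (auto simp: smult_T)
qed

lemma T_smult_closed: "a \<in> carrier B \<Longrightarrow> u \<in> carrier T \<Longrightarrow> a \<odot>\<^bsub>T\<^esub> u \<in> carrier T"
  by (elim T_cases) (simp only: smult_T, intro cl_closed map_smult_C)

text \<open>Formal sums have no negatives. The inverse of \<open>u\<close> is (-1)u, because (-1 +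
  1)u = 0u and terms with coefficient zero may be deleted.\<close>

lemma abelian_group_T: "abelian_group T"
proof (rule abelian_groupI)
  fix u assume u: "u \<in> carrier T"
  have z: "\<zero>\<^bsub>B\<^esub> \<odot>\<^bsub>T\<^esub> u = \<zero>\<^bsub>T\<^esub>"
    using u by (rule T_cases) (auto simp: smult_T zero_T intro!: cl_eqI teq_zeros)
  have "(\<ominus>\<^bsub>B\<^esub> \<one>\<^bsub>B\<^esub>) \<odot>\<^bsub>T\<^esub> u \<oplus>\<^bsub>T\<^esub> u = (\<ominus>\<^bsub>B\<^esub> \<one>\<^bsub>B\<^esub> \<oplus>\<^bsub>B\<^esub> \<one>\<^bsub>B\<^esub>) \<odot>\<^bsub>T\<^esub> u"
    using u T_l_distr[of "\<ominus>\<^bsub>B\<^esub> \<one>\<^bsub>B\<^esub>" "\<one>\<^bsub>B\<^esub>" u] by (simp add: T_one)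
  then show "\<exists>v\<in>carrier T. v \<oplus>\<^bsub>T\<^esub> u = \<zero>\<^bsub>T\<^esub>"
    using u z by (intro bexI[of _ "(\<ominus>\<^bsub>B\<^esub> \<one>\<^bsub>B\<^esub>) \<odot>\<^bsub>T\<^esub> u"]) (auto simp: B.l_neg intro: T_smult_closed)
next
  fix u v assume "u \<in> carrier T" "v \<in> carrier T"
  then obtain xs ys where "xs \<in> C" "ys \<in> C" "u = cl xs" "v = cl ys" by (elim T_cases)
  then show "u \<oplus>\<^bsub>T\<^esub> v \<in> carrier T" using cl_closed[of "xs @ ys"] by (simp add: add_T)
qed (auto elim!: T_cases simp: add_T zero_T cl_eq_iff tens_eq.comm tens_eq.refl cl_closed)

lemma left_module_T: "left_module B T"
proof (rule left_moduleI[OF B abelian_group_T])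
  fix a b u assume a: "a \<in> carrier B" "b \<in> carrier B" and "u \<in> carrier T"
  then obtain xs where xs: "xs \<in> C" "u = cl xs" by (elim T_cases)
  have "map (\<lambda>(b', m). (a \<otimes>\<^bsub>B\<^esub> b \<otimes>\<^bsub>B\<^esub> b', m)) xs
      = map (\<lambda>(b', m). (a \<otimes>\<^bsub>B\<^esub> b', m)) (map (\<lambda>(b', m). (b \<otimes>\<^bsub>B\<^esub> b', m)) xs)"
    using a xs(1) by (auto simp: B.m_assoc)
  then show "(a \<otimes>\<^bsub>B\<^esub> b) \<odot>\<^bsub>T\<^esub> u = a \<odot>\<^bsub>T\<^esub> (b \<odot>\<^bsub>T\<^esub> u)"
    using a by (simp only: xs(2) smult_T B.m_closed)
next
  fix a u v assume "a \<in> carrier B" "u \<in> carrier T" "v \<in> carrier T"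
  then show "a \<odot>\<^bsub>T\<^esub> (u \<oplus>\<^bsub>T\<^esub> v) = a \<odot>\<^bsub>T\<^esub> u \<oplus>\<^bsub>T\<^esub> a \<odot>\<^bsub>T\<^esub> v"
    by (elim T_cases) (simp add: add_T smult_T)
qed (simp_all add: T_l_distr T_one T_smult_closed)

sublocale T: left_module B T by (rule left_module_T)

lemma smult_tin: "b \<in> carrier B \<Longrightarrow> b \<odot>\<^bsub>T\<^esub> tin m = cl [(b, m)]"
  by (simp add: tin_def smult_T)

lemma tin_semilin: "semilin A f M T tin"
proof (rule semilinI)
  fix a m assume "a \<in> carrier A" "m \<in> carrier M"
  then show "tin (a \<odot>\<^bsub>M\<^esub> m) = f a \<odot>\<^bsub>T\<^esub> tin m"
    using tens_eq.balanced[of "\<one>\<^bsub>B\<^esub>" B a A m M f]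
    by (simp add: smult_tin f_closed) (simp add: tin_def cl_eq_iff f_closed tens_eq.sym)
qed (auto simp: tin_def add_T cl_eq_iff tens_eq.add_right intro!: cl_closed)

lemmas tin_closed = semilinD(1)[OF tin_semilin]

lemma cl_Cons: "(b, m) \<in> carrier B \<times> carrier M \<Longrightarrow> cl ((b, m) # xs) = b \<odot>\<^bsub>T\<^esub> tin m \<oplus>\<^bsub>T\<^esub> cl xs"
  by (simp add: smult_tin add_T)

lemma T_induct [consumes 1, case_names zero add]:
  assumes "u \<in> carrier T" "P \<zero>\<^bsub>T\<^esub>"
    "\<And>b m u. b \<in> carrier B \<Longrightarrow> m \<in> carrier M \<Longrightarrow> u \<in> carrier T \<Longrightarrow> P u \<Longrightarrow> P (b \<odot>\<^bsub>T\<^esub> tin m \<oplus>\<^bsub>T\<^esub> u)"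
  shows "P u"
proof -
  have "P (cl xs)" if "xs \<in> C" for xs
    using that
  proof (induction xs)
    case Nil show ?case using assms(2) by (simp add: zero_T)
  next
    case (Cons x xs)
    then show ?case
      using assms(3)[of "fst x" "snd x" "cl xs"] cl_Cons[of "fst x" "snd x" xs] cl_closed[of xs] by auto
  qed
  then show ?thesis using assms(1) by (elim T_cases) auto
qed

lemma T_semilin_eqI:
  assumes N: "left_module D N" and g: "semilin B \<theta> T N g" and h: "semilin B \<theta> T N h"
    and "\<And>m. m \<in> carrier M \<Longrightarrow> g (tin m) = h (tin m)" and "u \<in> carrier T"
  shows "g u = h u"
  using assms(5)
proof (induction rule: T_induct)
  case zero
  then show ?case using semilin_zero[OF g left_module_T N] semilin_zero[OF h left_module_T N] by simp
next
  case (add b m u)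
  then show ?case
    using assms(4) by (simp add: semilinD[OF g] semilinD[OF h] tin_closed T_smult_closed)
qed

lemma msum_cong:
  fixes P :: "('d, 'e, 'k) module_scheme" and g :: "'c \<Rightarrow> 'b \<Rightarrow> 'e"
  assumes P: "abelian_group P"
    and g: "\<And>b m. b \<in> carrier B \<Longrightarrow> m \<in> carrier M \<Longrightarrow> g b m \<in> carrier P"
      "\<And>b b' m. b \<in> carrier B \<Longrightarrow> b' \<in> carrier B \<Longrightarrow> m \<in> carrier M \<Longrightarrow> g (b \<oplus>\<^bsub>B\<^esub> b') m = g b m \<oplus>\<^bsub>P\<^esub> g b' m"
      "\<And>b m m'. b \<in> carrier B \<Longrightarrow> m \<in> carrier M \<Longrightarrow> m' \<in> carrier M \<Longrightarrow> g b (m \<oplus>\<^bsub>M\<^esub> m') = g b m \<oplus>\<^bsub>P\<^esub> g b m'"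
      "\<And>b a m. b \<in> carrier B \<Longrightarrow> a \<in> carrier A \<Longrightarrow> m \<in> carrier M \<Longrightarrow> g (b \<otimes>\<^bsub>B\<^esub> f a) m = g b (a \<odot>\<^bsub>M\<^esub> m)"
  shows "xs \<in> C \<Longrightarrow> msum P g xs \<in> carrier P"
    and "xs \<in> C \<Longrightarrow> ys \<in> C \<Longrightarrow> msum P g (xs @ ys) = msum P g xs \<oplus>\<^bsub>P\<^esub> msum P g ys"
    and "teq xs ys \<Longrightarrow> xs \<in> C \<Longrightarrow> msum P g xs = msum P g ys"
proof -
  interpret P: abelian_group P by fact
  have closed: "msum P g xs \<in> carrier P" if "xs \<in> C" for xs
    using that by (induction xs) (auto simp: msum_def g)
  then show "xs \<in> C \<Longrightarrow> msum P g xs \<in> carrier P" .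
  have app: "msum P g (xs @ ys) = msum P g xs \<oplus>\<^bsub>P\<^esub> msum P g ys" if "xs \<in> C" "ys \<in> C" for xs ys
    using that closed[OF that(2)]
  proof (induction xs)
    case Nil then show ?case by (simp add: msum_def)
  next
    case (Cons x xs)
    then show ?case using closed[of xs]
      by (cases x) (auto simp: msum_def g P.a_assoc)
  qed
  then show "xs \<in> C \<Longrightarrow> ys \<in> C \<Longrightarrow> msum P g (xs @ ys) = msum P g xs \<oplus>\<^bsub>P\<^esub> msum P g ys" .
  \<comment> \<open>The relation \<open>zero\<close> has no counterpart among the hypotheses on
    \<open>g\<close>; it follows from additivity by cancellation.\<close>
  have g0: "g \<zero>\<^bsub>B\<^esub> m = \<zero>\<^bsub>P\<^esub>" if "m \<in> carrier M" for m
    using that g(1)[of "\<zero>\<^bsub>B\<^esub>" m] g(2)[of "\<zero>\<^bsub>B\<^esub>" "\<zero>\<^bsub>B\<^esub>" m]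
    by (auto intro: P.add.l_cancel_one'[THEN iffD1])
  show "msum P g xs = msum P g ys" if "teq xs ys" "xs \<in> C"
    using that
  proof (induction rule: tens_eq.induct)
    case (sym xs ys) then show ?case using teq_C by metis
  next
    case (trans xs ys zs) then show ?case using teq_C by metis
  next
    case (app xs xs' ys ys')
    then have "xs \<in> C" "ys \<in> C" "xs' \<in> C" "ys' \<in> C" using teq_C[OF app(1)] teq_C[OF app(2)] by auto
    then show ?case using app(3,4) \<open>\<And>xs ys. xs \<in> C \<Longrightarrow> ys \<in> C \<Longrightarrow> _ = _\<close> by simp
  next
    case (comm xs ys)
    then have "xs \<in> C" "ys \<in> C" by auto
    then show ?case using closed \<open>\<And>xs ys. xs \<in> C \<Longrightarrow> ys \<in> C \<Longrightarrow> _ = _\<close> by (simp add: P.a_comm)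
  qed (auto simp: msum_def g g0 M.smult_closed f_closed)
qed

text \<open>Universal property with a twist \<theta>, so that the target may be a module over
  another ring. It supplies the coordinate functionals, the map S \<otimes> M -> M of the etale
  condition and the augmentation of M(V).\<close>

lemma T_lift:
  fixes P :: "('d, 'e, 'k) module_scheme" and D :: "('d, 'l) ring_scheme" and g :: "'c \<Rightarrow> 'b \<Rightarrow> 'e"
  assumes P: "left_module D P" and \<theta>: "\<theta> \<in> carrier B \<rightarrow> carrier D"
    and g: "\<And>b m. b \<in> carrier B \<Longrightarrow> m \<in> carrier M \<Longrightarrow> g b m \<in> carrier P"
      "\<And>b b' m. b \<in> carrier B \<Longrightarrow> b' \<in> carrier B \<Longrightarrow> m \<in> carrier M \<Longrightarrow> g (b \<oplus>\<^bsub>B\<^esub> b') m = g b m \<oplus>\<^bsub>P\<^esub> g b' m"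
      "\<And>b m m'. b \<in> carrier B \<Longrightarrow> m \<in> carrier M \<Longrightarrow> m' \<in> carrier M \<Longrightarrow> g b (m \<oplus>\<^bsub>M\<^esub> m') = g b m \<oplus>\<^bsub>P\<^esub> g b m'"
      "\<And>b a m. b \<in> carrier B \<Longrightarrow> a \<in> carrier A \<Longrightarrow> m \<in> carrier M \<Longrightarrow> g (b \<otimes>\<^bsub>B\<^esub> f a) m = g b (a \<odot>\<^bsub>M\<^esub> m)"
      "\<And>b b' m. b \<in> carrier B \<Longrightarrow> b' \<in> carrier B \<Longrightarrow> m \<in> carrier M \<Longrightarrow> g (b \<otimes>\<^bsub>B\<^esub> b') m = \<theta> b \<odot>\<^bsub>P\<^esub> g b' m"
  defines "G \<equiv> \<lambda>u. msum P g (inv_into UNIV K u)"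
  shows "semilin B \<theta> T P G" and "m \<in> carrier M \<Longrightarrow> G (tin m) = g \<one>\<^bsub>B\<^esub> m"
proof -
  interpret P: left_module D P by fact
  have mc: "msum P g xs \<in> carrier P" "msum P g (xs @ ys) = msum P g xs \<oplus>\<^bsub>P\<^esub> msum P g ys"
    if "xs \<in> C" "ys \<in> C" for xs ys
    by (rule msum_cong[where g = g], fact P.M.abelian_group_axioms, (fact g that)+)+
  have mc': "msum P g xs = msum P g ys" if "teq xs ys" "xs \<in> C" for xs ys
    by (rule msum_cong(3)[where g = g], fact P.M.abelian_group_axioms, (fact g that)+)
  have G: "G (cl xs) = msum P g xs" if "xs \<in> C" for xs
    unfolding G_def using mc'[OF dec_teq dec_C] that by simp
  have sm: "msum P g (map (\<lambda>(b', m). (b \<otimes>\<^bsub>B\<^esub> b', m)) xs) = \<theta> b \<odot>\<^bsub>P\<^esub> msum P g xs"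
    if "xs \<in> C" "b \<in> carrier B" for xs b
    using that
  proof (induction xs)
    case Nil then show ?case using \<theta> by (simp add: msum_def P.smult_zero Pi_iff)
  next
    case (Cons x xs)
    then show ?case using mc(1)[of xs xs] \<theta>
      by (cases x) (auto simp: msum_def g P.smult_r_distr Pi_iff)
  qed
  show "semilin B \<theta> T P G"
  proof (rule semilinI)
    fix u assume "u \<in> carrier T"
    then show "G u \<in> carrier P" using G mc(1) by (elim T_cases) metis
    fix v assume "v \<in> carrier T"
    with \<open>u \<in> carrier T\<close> show "G (u \<oplus>\<^bsub>T\<^esub> v) = G u \<oplus>\<^bsub>P\<^esub> G v"
      using G mc(2) by (elim T_cases) (auto simp: add_T)
  next
    fix a u assume "a \<in> carrier B" "u \<in> carrier T"
    then show "G (a \<odot>\<^bsub>T\<^esub> u) = \<theta> a \<odot>\<^bsub>P\<^esub> G u"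
      by (elim T_cases) (simp only: smult_T G map_smult_C sm)
  qed
  show "G (tin m) = g \<one>\<^bsub>B\<^esub> m" if "m \<in> carrier M"
    unfolding tin_def using that by (subst G) (auto simp: msum_def g)
qed

text \<open>Base change of a free module. Independence is detected by the functionals c \<otimes> m
  |-> c f(m_e), with m_e the coordinate of \<open>m\<close> at \<open>e\<close>; they are left
  linear although \<open>B\<close> may be noncommutative.\<close>

lemma basis_T:
  assumes b: "module_basis A M E b"
  shows "module_basis B T E (\<lambda>e. tin (b e))"
proof -
  have fin: "finite E" and bE: "b \<in> E \<rightarrow> carrier M" using b unfolding module_basis_def by blast+
  have jE: "(\<lambda>e. tin (b e)) \<in> E \<rightarrow> carrier T" using bE by (auto intro: tin_closed)
  have sm: "a e \<odot>\<^bsub>T\<^esub> tin (b e) \<in> carrier T" if "a \<in> E \<rightarrow> carrier B" "e \<in> E" for a e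
    using that jE by (auto intro!: T_smult_closed)
  define \<kappa> where "\<kappa> e u = msum (regular_module B) (\<lambda>c m. c \<otimes>\<^bsub>B\<^esub> f (coord A M E b m e)) (inv_into UNIV K u)" for e u
  have \<kappa>: "semilin B (\<lambda>a. a) T (regular_module B) (\<kappa> e)"
    "m \<in> carrier M \<Longrightarrow> \<kappa> e (tin m) = f (coord A M E b m e)" if e: "e \<in> E" for e m
  proof -
    note c = M.coord_closed[OF b _ e]
    have Q: "(\<lambda>a. a) \<in> carrier B \<rightarrow> carrier B" by auto
    note L = T_lift[OF left_module_regular[OF B] Q, where g = "\<lambda>c m. c \<otimes>\<^bsub>B\<^esub> f (coord A M E b m e)"]
    show "semilin B (\<lambda>a. a) T (regular_module B) (\<kappa> e)"
      unfolding \<kappa>_def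
      by (rule L) (auto simp: c f_closed B.l_distr B.r_distr B.m_assoc M.coord_add[OF b _ _ e]
        M.coord_smult[OF b _ _ e] ring_hom_add[OF f] ring_hom_mult[OF f])
    show "m \<in> carrier M \<Longrightarrow> \<kappa> e (tin m) = f (coord A M E b m e)"
      unfolding \<kappa>_def
      by (subst L) (auto simp: c f_closed B.l_distr B.r_distr B.m_assoc M.coord_add[OF b _ _ e]
        M.coord_smult[OF b _ _ e] ring_hom_add[OF f] ring_hom_mult[OF f])
  qed
  have \<kappa>_lin: "\<kappa> e' (\<Oplus>\<^bsub>T\<^esub>e\<in>E. a e \<odot>\<^bsub>T\<^esub> tin (b e)) = a e'" if a: "a \<in> E \<rightarrow> carrier B" and e': "e' \<in> E" for a e'
  proof -
    have "\<kappa> e' (\<Oplus>\<^bsub>T\<^esub>e\<in>E. a e \<odot>\<^bsub>T\<^esub> tin (b e)) = (\<Oplus>\<^bsub>regular_module B\<^esub>e\<in>E. a e \<odot>\<^bsub>regular_module B\<^esub> \<kappa> e' (tin (b e)))"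
      by (rule semilin_lincomb[OF \<kappa>(1)[OF e'] left_module_T left_module_regular[OF B] _ jE a]) auto
    also have "\<dots> = a e'"
      by (rule left_module.finsum_if_smult[OF left_module_regular[OF B] fin e'])
        (use a e' bE in \<open>auto simp: \<kappa>(2)[OF e'] M.coord_basis[OF b] M.coord_closed[OF b] f_closed f_zero ring_hom_one[OF f] Pi_iff\<close>)
    finally show ?thesis .
  qed
  show ?thesis
    unfolding module_basis_def
  proof (intro conjI ballI fin jE ex_ex1I)
    fix u assume "u \<in> carrier T"
    then have "\<exists>a. a \<in> E \<rightarrow> carrier B \<and> u = (\<Oplus>\<^bsub>T\<^esub>e\<in>E. a e \<odot>\<^bsub>T\<^esub> tin (b e))"
    proof (induction rule: T_induct)
      case zero
      have "(\<Oplus>\<^bsub>T\<^esub>e\<in>E. \<zero>\<^bsub>B\<^esub> \<odot>\<^bsub>T\<^esub> tin (b e)) = (\<Oplus>\<^bsub>T\<^esub>e\<in>E. \<zero>\<^bsub>T\<^esub>)"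
        using jE by (intro T.M.finsum_cong') (auto simp: T.zero_smult Pi_iff)
      then show ?case by (intro exI[of _ "\<lambda>_. \<zero>\<^bsub>B\<^esub>"]) auto
    next
      case (add c m u)
      then obtain a where a: "a \<in> E \<rightarrow> carrier B" "u = (\<Oplus>\<^bsub>T\<^esub>e\<in>E. a e \<odot>\<^bsub>T\<^esub> tin (b e))" by blast
      have mE: "coord A M E b m \<in> E \<rightarrow> carrier A" using M.coord_closed[OF b add(2)] by auto
      define a' where "a' e = c \<otimes>\<^bsub>B\<^esub> f (coord A M E b m e)" for e
      have a': "a' \<in> E \<rightarrow> carrier B" using mE add(1) f_closed by (auto simp: a'_def Pi_iff)
      have "tin m = (\<Oplus>\<^bsub>T\<^esub>e\<in>E. f (coord A M E b m e) \<odot>\<^bsub>T\<^esub> tin (b e))"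
        using semilin_lincomb[OF tin_semilin M left_module_T _ bE mE] M.coord_expand[OF b add(2)] f_closed by auto
      then have "c \<odot>\<^bsub>T\<^esub> tin m = (\<Oplus>\<^bsub>T\<^esub>e\<in>E. c \<odot>\<^bsub>T\<^esub> (f (coord A M E b m e) \<odot>\<^bsub>T\<^esub> tin (b e)))"
        using mE add(1) jE by (auto intro!: T.finsum_smult T_smult_closed f_closed simp: Pi_iff)
      also have "\<dots> = (\<Oplus>\<^bsub>T\<^esub>e\<in>E. a' e \<odot>\<^bsub>T\<^esub> tin (b e))"
        using mE add(1) jE sm[OF a'] by (intro T.M.finsum_cong') (auto simp: a'_def T.smult_assoc1 f_closed Pi_iff)
      finally have "c \<odot>\<^bsub>T\<^esub> tin m \<oplus>\<^bsub>T\<^esub> u = (\<Oplus>\<^bsub>T\<^esub>e\<in>E. a' e \<odot>\<^bsub>T\<^esub> tin (b e) \<oplus>\<^bsub>T\<^esub> a e \<odot>\<^bsub>T\<^esub> tin (b e))"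
        using a sm[OF a'] sm[OF a(1)] by (simp add: T.M.finsum_addf Pi_iff)
      also have "\<dots> = (\<Oplus>\<^bsub>T\<^esub>e\<in>E. (a' e \<oplus>\<^bsub>B\<^esub> a e) \<odot>\<^bsub>T\<^esub> tin (b e))"
        using a a' jE by (intro T.M.finsum_cong') (auto simp: T_l_distr Pi_iff intro!: T_smult_closed)
      finally show ?case using a a' by (intro exI[of _ "\<lambda>e. a' e \<oplus>\<^bsub>B\<^esub> a e"]) auto
    qed
    then obtain a where a: "a \<in> E \<rightarrow> carrier B" "u = (\<Oplus>\<^bsub>T\<^esub>e\<in>E. a e \<odot>\<^bsub>T\<^esub> tin (b e))" by blast
    have "u = (\<Oplus>\<^bsub>T\<^esub>e\<in>E. restrict a E e \<odot>\<^bsub>T\<^esub> tin (b e))"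
      unfolding a(2) using sm[OF a(1)] by (intro T.M.finsum_cong') auto
    then show "\<exists>a. a \<in> E \<rightarrow>\<^sub>E carrier B \<and> u = (\<Oplus>\<^bsub>T\<^esub>e\<in>E. a e \<odot>\<^bsub>T\<^esub> tin (b e))"
      using a(1) by (intro exI[of _ "restrict a E"]) auto
    fix a a'
    assume "a \<in> E \<rightarrow>\<^sub>E carrier B \<and> u = (\<Oplus>\<^bsub>T\<^esub>e\<in>E. a e \<odot>\<^bsub>T\<^esub> tin (b e))"
      and "a' \<in> E \<rightarrow>\<^sub>E carrier B \<and> u = (\<Oplus>\<^bsub>T\<^esub>e\<in>E. a' e \<odot>\<^bsub>T\<^esub> tin (b e))"
    moreover from this have "a \<in> E \<rightarrow> carrier B" "a' \<in> E \<rightarrow> carrier B" by auto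
    ultimately show "a = a'" using \<kappa>_lin[of a] \<kappa>_lin[of a']
      by (intro PiE_ext[of a E "\<lambda>_. carrier B" a']) auto
  qed
qed

end

text \<open>u \<otimes> v respects the balanced relation because u f = f \<psi> and \<open>v\<close>
  is \<psi>-semilinear. With identities for \<open>u\<close> and \<psi> this is id \<otimes> v; with
  the two endomorphisms induced by \<open>t\<close> it is the diagonal action.\<close>

lemma tensor_map_semilin:
  assumes "tensor_product K B A f M" "tensor_product K B A f M'"
    and u: "u \<in> ring_hom B B" and \<psi>: "\<And>a. a \<in> carrier A \<Longrightarrow> \<psi> a \<in> carrier A"
    and uf: "\<And>a. a \<in> carrier A \<Longrightarrow> u (f a) = f (\<psi> a)" and v: "semilin A \<psi> M M' v"
  defines "H \<equiv> \<lambda>w. K (tens_rep B A f M' (map (\<lambda>(b, m). (u b, v m)) (inv_into UNIV K w)))"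
  shows "semilin B u (tensor K B A f M) (tensor K B A f M') H"
    and "m \<in> carrier M \<Longrightarrow> H (tensor_product.tin K B A f M m) = tensor_product.tin K B A f M' (v m)"
proof -
  interpret M: tensor_product K B A f M by fact
  interpret M': tensor_product K B A f M' by fact
  let ?h = "\<lambda>(b, m). (u b, v m)"
  have u0: "u \<zero>\<^bsub>B\<^esub> = \<zero>\<^bsub>B\<^esub>" using ring_hom_zero[OF u M.B M.B] .
  have teq: "M'.teq (map ?h xs) (map ?h ys)" if "M.teq xs ys" for xs ys
    using that
  proof (rule tens_eq_map)
    fix b a m assume *: "b \<in> carrier B" "a \<in> carrier A" "m \<in> carrier M"
    show "M'.teq [(u (b \<otimes>\<^bsub>B\<^esub> f a), v m)] [(u b, v (a \<odot>\<^bsub>M\<^esub> m))]"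
      using tens_eq.balanced[of "u b" B "\<psi> a" A "v m" M' f] * \<psi>
      by (simp add: ring_hom_mult[OF u] M.f_closed uf semilinD[OF v] ring_hom_closed[OF u])
  qed (auto simp: ring_hom_closed[OF u] ring_hom_add[OF u] u0 semilinD[OF v])
  have H: "H (M.cl xs) = M'.cl (map ?h xs)" for xs
    unfolding H_def M'.cl_def[symmetric] by (rule M'.cl_eqI, rule teq, rule M.dec_teq)
  have hC: "map ?h xs \<in> M'.C" if "xs \<in> M.C" for xs
    using that by (auto simp: ring_hom_closed[OF u] semilinD[OF v])
  show "semilin B u M.T M'.T H"
  proof (rule semilinI)
    fix w assume "w \<in> carrier M.T"
    then show "H w \<in> carrier M'.T" by (elim M.T_cases) (simp only: H M'.cl_closed hC)
    fix w' assume "w' \<in> carrier M.T"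
    with \<open>w \<in> carrier M.T\<close> show "H (w \<oplus>\<^bsub>M.T\<^esub> w') = H w \<oplus>\<^bsub>M'.T\<^esub> H w'"
      by (elim M.T_cases) (simp add: H M.add_T M'.add_T)
  next
    fix b w assume b: "b \<in> carrier B" and "w \<in> carrier M.T"
    then obtain xs where xs: "xs \<in> M.C" "w = M.cl xs" by (elim M.T_cases)
    have "map ?h (map (\<lambda>(b', m). (b \<otimes>\<^bsub>B\<^esub> b', m)) xs) = map (\<lambda>(b', m). (u b \<otimes>\<^bsub>B\<^esub> b', m)) (map ?h xs)"
      using xs(1) b by (auto simp: ring_hom_mult[OF u])
    then show "H (b \<odot>\<^bsub>M.T\<^esub> w) = u b \<odot>\<^bsub>M'.T\<^esub> H w"
      using b by (simp only: xs(2) H M.smult_T M'.smult_T ring_hom_closed[OF u])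
  qed
  show "H (M.tin m) = M'.tin (v m)" if "m \<in> carrier M"
    by (simp add: M.tin_def M'.tin_def H ring_hom_one[OF u])
qed

section \<open>Lifting along a contracting extension\<close>

lemma (in abelian_group) minus_eq_zero_iff:
  assumes "x \<in> carrier G" "y \<in> carrier G"
  shows "x \<ominus> y = \<zero> \<longleftrightarrow> x = y"
  using assms minus_equality[of x "\<ominus> y"] by (auto simp: a_minus_def r_neg)

text \<open>For the completed ring, \<open>J n\<close> will be the kernel of the projection to level
  n + 1. The two-sided ideals \<open>J n\<close> define a separated and complete topology, and
  \<phi> moves each of them into the next. Negatives belong to \<open>J n\<close> through
  multiplication by -1.\<close>

locale contracting_extension =
  fixes S :: "('a, 'x) ring_scheme" and R :: "('c, 'y) ring_scheme"
    and ell :: "'a \<Rightarrow> 'c" and \<phi> :: "'a \<Rightarrow> 'a" and J :: "nat \<Rightarrow> 'a set"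
  assumes S: "ring S" and R: "ring R" and ell: "ell \<in> ring_hom S R" and \<phi>: "\<phi> \<in> ring_hom S S"
    and J_sub: "J n \<subseteq> carrier S"
    and J_mult: "a \<in> J n \<Longrightarrow> b \<in> carrier S \<Longrightarrow> a \<otimes>\<^bsub>S\<^esub> b \<in> J n"
      "a \<in> J n \<Longrightarrow> b \<in> carrier S \<Longrightarrow> b \<otimes>\<^bsub>S\<^esub> a \<in> J n"
    and J_add: "a \<in> J n \<Longrightarrow> b \<in> J n \<Longrightarrow> a \<oplus>\<^bsub>S\<^esub> b \<in> J n"
    and J_0: "J 0 = {a \<in> carrier S. ell a = \<zero>\<^bsub>R\<^esub>}"
    and J_Suc: "J (Suc n) \<subseteq> J n"
    and J_zero: "\<zero>\<^bsub>S\<^esub> \<in> J n"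
    and J_sep: "(\<And>n. a \<in> J n) \<Longrightarrow> a = \<zero>\<^bsub>S\<^esub>"
    and J_\<phi>: "a \<in> J n \<Longrightarrow> \<phi> a \<in> J (Suc n)"
    and J_complete: "(\<And>n. x n \<in> carrier S) \<Longrightarrow> (\<And>n. x (Suc n) \<ominus>\<^bsub>S\<^esub> x n \<in> J n) \<Longrightarrow>
      \<exists>y\<in>carrier S. \<forall>n. y \<ominus>\<^bsub>S\<^esub> x n \<in> J n"
begin

sublocale S: ring S by (rule S)
sublocale R: ring R by (rule R)

section \<open>The submodules J_n N and congruence modulo them\<close>

inductive_set JM :: "('a, 'm, 'k) module_scheme \<Rightarrow> nat \<Rightarrow> 'm set" for N n where
  zero: "\<zero>\<^bsub>N\<^esub> \<in> JM N n"
| step: "a \<in> J n \<Longrightarrow> x \<in> carrier N \<Longrightarrow> y \<in> JM N n \<Longrightarrow> a \<odot>\<^bsub>N\<^esub> x \<oplus>\<^bsub>N\<^esub> y \<in> JM N n"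

lemma JS: "a \<in> J n \<Longrightarrow> a \<in> carrier S"
  using J_sub by blast

definition jcong where
  "jcong N n x y \<longleftrightarrow> x \<in> carrier N \<and> y \<in> carrier N \<and> x \<ominus>\<^bsub>N\<^esub> y \<in> JM N n"

context
  fixes N :: "('a, 'm, 'k) module_scheme"
  assumes N: "left_module S N"
begin

interpretation N: left_module S N by (rule N)

lemma JM_closed: "x \<in> JM N n \<Longrightarrow> x \<in> carrier N"
  by (induction rule: JM.induct) (auto intro: N.smult_closed JS)

lemma JM_add: "x \<in> JM N n \<Longrightarrow> y \<in> JM N n \<Longrightarrow> x \<oplus>\<^bsub>N\<^esub> y \<in> JM N n"
proof (induction rule: JM.induct)
  case zero then show ?case using JM_closed by simp
next
  case (step a x z)
  then have "a \<odot>\<^bsub>N\<^esub> x \<oplus>\<^bsub>N\<^esub> (z \<oplus>\<^bsub>N\<^esub> y) \<in> JM N n" by (intro JM.step) auto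
  then show ?case using step by (simp add: N.M.a_assoc N.smult_closed JS JM_closed)
qed

lemma JM_gen: "a \<in> J n \<Longrightarrow> x \<in> carrier N \<Longrightarrow> a \<odot>\<^bsub>N\<^esub> x \<in> JM N n"
  using JM.step[OF _ _ JM.zero, of a n x N] by (simp add: N.smult_closed JS)

lemma JM_smult: "x \<in> JM N n \<Longrightarrow> b \<in> carrier S \<Longrightarrow> b \<odot>\<^bsub>N\<^esub> x \<in> JM N n"
proof (induction rule: JM.induct)
  case zero then show ?case by (simp add: N.smult_zero JM.zero)
next
  case (step a x y)
  then show ?case using JM.step[of "b \<otimes>\<^bsub>S\<^esub> a" n x N "b \<odot>\<^bsub>N\<^esub> y"]
    by (simp add: N.smult_r_distr N.smult_assoc1 N.smult_closed JS JM_closed J_mult)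
qed

lemma JM_uminus: "x \<in> JM N n \<Longrightarrow> \<ominus>\<^bsub>N\<^esub> x \<in> JM N n"
  using JM_smult[of x n "\<ominus>\<^bsub>S\<^esub> \<one>\<^bsub>S\<^esub>"] by (simp add: N.smult_minus JM_closed)

lemma JM_Suc: "x \<in> JM N (Suc n) \<Longrightarrow> x \<in> JM N n"
  by (induction rule: JM.induct) (use J_Suc in \<open>auto intro: JM.intros\<close>)

lemma JM_finsum: "(\<And>i. i \<in> I \<Longrightarrow> x i \<in> JM N n) \<Longrightarrow> finsum N x I \<in> JM N n"
proof (induction I rule: infinite_finite_induct)
  case (insert i I)
  then show ?case by (subst N.M.finsum_insert) (auto intro: JM_add JM_closed)
qed (simp_all add: JM.zero)

lemma jcong_refl: "x \<in> carrier N \<Longrightarrow> jcong N n x x"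
  by (simp add: jcong_def N.M.r_neg a_minus_def JM.zero)

lemma jcong_sym: "jcong N n x y \<Longrightarrow> jcong N n y x"
  using JM_uminus[of "x \<ominus>\<^bsub>N\<^esub> y" n]
  by (auto simp: jcong_def a_minus_def N.M.minus_add N.M.a_comm)

lemma jcong_trans: "jcong N n x y \<Longrightarrow> jcong N n y z \<Longrightarrow> jcong N n x z"
proof -
  assume *: "jcong N n x y" "jcong N n y z"
  then have c: "x \<in> carrier N" "y \<in> carrier N" "z \<in> carrier N" by (auto simp: jcong_def)
  then have "x \<ominus>\<^bsub>N\<^esub> z = (x \<ominus>\<^bsub>N\<^esub> y) \<oplus>\<^bsub>N\<^esub> (y \<ominus>\<^bsub>N\<^esub> z)"
    by (simp add: a_minus_def N.M.a_assoc N.M.r_neg1)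
  with * c show ?thesis by (auto simp: jcong_def intro: JM_add)
qed

lemma jcong_add: "jcong N n x y \<Longrightarrow> jcong N n x' y' \<Longrightarrow> jcong N n (x \<oplus>\<^bsub>N\<^esub> x') (y \<oplus>\<^bsub>N\<^esub> y')"
proof -
  assume *: "jcong N n x y" "jcong N n x' y'"
  then have c: "x \<in> carrier N" "y \<in> carrier N" "x' \<in> carrier N" "y' \<in> carrier N" by (auto simp: jcong_def)
  then have "(x \<oplus>\<^bsub>N\<^esub> x') \<ominus>\<^bsub>N\<^esub> (y \<oplus>\<^bsub>N\<^esub> y') = (x \<ominus>\<^bsub>N\<^esub> y) \<oplus>\<^bsub>N\<^esub> (x' \<ominus>\<^bsub>N\<^esub> y')"
    by (simp add: a_minus_def N.M.minus_add N.M.a_ac)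
  with * c show ?thesis by (auto simp: jcong_def intro: JM_add)
qed

lemma jcong_smult:
  assumes "jcong N n x y" "a \<in> carrier S" shows "jcong N n (a \<odot>\<^bsub>N\<^esub> x) (a \<odot>\<^bsub>N\<^esub> y)"
proof -
  have c: "x \<in> carrier N" "y \<in> carrier N" using assms by (auto simp: jcong_def)
  have "a \<odot>\<^bsub>N\<^esub> (x \<ominus>\<^bsub>N\<^esub> y) \<oplus>\<^bsub>N\<^esub> a \<odot>\<^bsub>N\<^esub> y = a \<odot>\<^bsub>N\<^esub> x"
    using c assms(2) N.smult_r_distr[of a "x \<ominus>\<^bsub>N\<^esub> y" y]
    by (simp add: a_minus_def N.M.a_assoc N.M.l_neg)
  then have "a \<odot>\<^bsub>N\<^esub> x \<ominus>\<^bsub>N\<^esub> a \<odot>\<^bsub>N\<^esub> y = a \<odot>\<^bsub>N\<^esub> (x \<ominus>\<^bsub>N\<^esub> y)"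
    using c assms(2) by (metis N.M.add.inv_solve_right' N.M.minus_closed N.smult_closed a_minus_def)
  then show ?thesis using assms c JM_smult by (auto simp: jcong_def N.smult_closed)
qed

lemma jcong_Suc: "jcong N (Suc n) x y \<Longrightarrow> jcong N n x y"
  by (auto simp: jcong_def intro: JM_Suc)

lemma jcong_finsum:
  "(\<And>i. i \<in> I \<Longrightarrow> jcong N n (x i) (y i)) \<Longrightarrow> jcong N n (finsum N x I) (finsum N y I)"
proof (induction I rule: infinite_finite_induct)
  case (insert i I)
  then have "x \<in> I \<rightarrow> carrier N" "y \<in> I \<rightarrow> carrier N" "x i \<in> carrier N" "y i \<in> carrier N"
    by (auto simp: jcong_def)
  then show ?case using insert by (simp add: jcong_add)
qed (simp_all add: jcong_refl)

text \<open>The contraction on modules: \<delta>(a x) = \<phi>(a) \<delta>(x), and \<phi> maps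
  \<open>J n\<close> into \<open>J (Suc n)\<close>.\<close>

lemma jcong_semilin:
  assumes "semilin S \<phi> N N \<delta>" "jcong N n x y"
  shows "jcong N (Suc n) (\<delta> x) (\<delta> y)"
proof -
  have "\<delta> z \<in> JM N (Suc n)" if "z \<in> JM N n" for z
    using that
  proof (induction rule: JM.induct)
    case zero then show ?case using semilin_zero[OF assms(1) N N] by (simp add: JM.zero)
  next
    case (step a x y)
    then show ?case
      by (simp add: semilinD[OF assms(1)] N.smult_closed JS JM_closed JM.step J_\<phi>)
  qed
  with assms(2) show ?thesis
    by (auto simp: jcong_def semilinD[OF assms(1)] semilin_minus[OF assms(1) N N, symmetric])
qed

text \<open>The coordinate of a x at \<open>e\<close> is a x_e, so closure of \<open>J n\<close>
  under multiplication from the right is what counts. Together with \<open>JM_coordI\<close>, J_n N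
  consists of the vectors all of whose coordinates lie in \<open>J n\<close>.\<close>

lemma coord_JM:
  assumes b: "module_basis S N E b" and e: "e \<in> E" and x: "x \<in> JM N n"
  shows "coord S N E b x e \<in> J n"
  using x
proof (induction rule: JM.induct)
  case zero
  have "coord S N E b (\<zero>\<^bsub>S\<^esub> \<odot>\<^bsub>N\<^esub> \<zero>\<^bsub>N\<^esub>) e = \<zero>\<^bsub>S\<^esub>"
    by (subst N.coord_smult[OF b _ _ e]) (auto intro: S.l_null N.coord_closed[OF b _ e])
  then show ?case by (simp add: N.zero_smult J_zero)
next
  case (step a x y)
  then show ?case
    by (simp add: N.coord_add[OF b _ _ e] N.coord_smult[OF b _ _ e] N.coord_closed[OF b _ e] N.smult_closed
      JS JM_closed J_add J_mult)
qed

lemma JM_coordI: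
  assumes b: "module_basis S N E b" and x: "x \<in> carrier N"
    and "\<And>e. e \<in> E \<Longrightarrow> coord S N E b x e \<in> J n"
  shows "x \<in> JM N n"
  using JM_finsum[of E "\<lambda>e. coord S N E b x e \<odot>\<^bsub>N\<^esub> b e" n] assms(3) N.coord_expand[OF b x]
  by (auto intro: JM_gen N.basis_closed[OF b])

lemma JM_sep:
  assumes b: "module_basis S N E b" and x: "\<And>n. x \<in> JM N n"
  shows "x = \<zero>\<^bsub>N\<^esub>"
proof -
  have xc: "x \<in> carrier N" using x JM_closed by blast
  have "coord S N E b x e = \<zero>\<^bsub>S\<^esub>" if "e \<in> E" for e
    using J_sep coord_JM[OF b that x] by blast
  then have "(\<Oplus>\<^bsub>N\<^esub>e\<in>E. coord S N E b x e \<odot>\<^bsub>N\<^esub> b e) = (\<Oplus>\<^bsub>N\<^esub>e\<in>E. \<zero>\<^bsub>N\<^esub>)"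
    by (intro N.M.finsum_cong') (auto simp: N.zero_smult N.basis_closed[OF b])
  then show ?thesis using N.coord_expand[OF b xc] by simp
qed

lemma jcong_sep:
  assumes b: "module_basis S N E b" and x: "\<And>n. jcong N n x y"
  shows "x = y"
proof -
  have "x \<ominus>\<^bsub>N\<^esub> y = \<zero>\<^bsub>N\<^esub>" using JM_sep[OF b] x by (auto simp: jcong_def)
  then show ?thesis using x by (auto simp: jcong_def N.M.minus_eq_zero_iff)
qed

lemma coord_minus:
  assumes b: "module_basis S N E b" and e: "e \<in> E" and x: "x \<in> carrier N" "y \<in> carrier N"
  shows "coord S N E b (x \<ominus>\<^bsub>N\<^esub> y) e = coord S N E b x e \<ominus>\<^bsub>S\<^esub> coord S N E b y e"
proof -
  have "coord S N E b (x \<ominus>\<^bsub>N\<^esub> y) e = coord S N E b x e \<oplus>\<^bsub>S\<^esub> (\<ominus>\<^bsub>S\<^esub> \<one>\<^bsub>S\<^esub>) \<otimes>\<^bsub>S\<^esub> coord S N E b y e"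
    unfolding a_minus_def N.smult_minus[OF x(2), symmetric]
    using x by (simp add: N.coord_add[OF b _ _ e] N.coord_smult[OF b _ _ e] N.smult_closed)
  then show ?thesis using x N.coord_closed[OF b _ e] by (simp add: a_minus_def S.l_minus)
qed

text \<open>Completeness of \<open>S\<close>, applied to each coordinate of the sequence
  separately.\<close>

lemma jcong_complete:
  assumes b: "module_basis S N E b" and x: "\<And>n. jcong N n (x (Suc n)) (x n)"
  shows "\<exists>y. \<forall>n. jcong N n y (x n)"
proof -
  have fin: "finite E" and bE: "b \<in> E \<rightarrow> carrier N" using b unfolding module_basis_def by blast+
  have xc: "x n \<in> carrier N" for n using x[of n] by (simp add: jcong_def)
  have "\<exists>y\<in>carrier S. \<forall>n. y \<ominus>\<^bsub>S\<^esub> coord S N E b (x n) e \<in> J n" if e: "e \<in> E" for e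
  proof (rule J_complete)
    show "coord S N E b (x n) e \<in> carrier S" for n using N.coord_closed[OF b xc e] .
    show "coord S N E b (x (Suc n)) e \<ominus>\<^bsub>S\<^esub> coord S N E b (x n) e \<in> J n" for n
      using coord_JM[OF b e, of "x (Suc n) \<ominus>\<^bsub>N\<^esub> x n" n] x[of n] by (simp add: jcong_def coord_minus[OF b e xc xc])
  qed
  then obtain a where a: "\<And>e. e \<in> E \<Longrightarrow> a e \<in> carrier S"
    "\<And>e n. e \<in> E \<Longrightarrow> a e \<ominus>\<^bsub>S\<^esub> coord S N E b (x n) e \<in> J n" by metis
  let ?y = "\<Oplus>\<^bsub>N\<^esub>e\<in>E. a e \<odot>\<^bsub>N\<^esub> b e"
  have aE: "a \<in> E \<rightarrow> carrier S" using a(1) by blast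
  have y: "?y \<in> carrier N" by (rule N.lincomb_closed[OF bE aE])
  have "jcong N n ?y (x n)" for n
    unfolding jcong_def
    using N.coord_unique[OF b aE HOL.refl] a(2)
    by (auto intro!: JM_coordI[OF b] simp: y xc coord_minus[OF b _ y xc])
  then show ?thesis by blast
qed

text \<open>The images of the basis form a basis again, so in coordinates \<open>q\<close> is
  \<open>ell\<close> applied entrywise; its kernel is given by ell(x_e) = 0, that is, by x_e in
  \<open>J 0\<close>.\<close>

lemma reduction_kernel:
  assumes b: "module_basis S N E b" and Nbar: "left_module R Nbar" and q: "semilin S ell N Nbar q"
    and qb: "module_basis R Nbar E (\<lambda>e. q (b e))" and x: "x \<in> carrier N"
  shows "q x = \<zero>\<^bsub>Nbar\<^esub> \<longleftrightarrow> x \<in> JM N 0"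
proof
  interpret Nbar: left_module R Nbar by fact
  have ellc: "ell \<in> carrier S \<rightarrow> carrier R" using ell by (simp add: ring_hom_def)
  have bE: "b \<in> E \<rightarrow> carrier N" using b unfolding module_basis_def by blast
  show "q x = \<zero>\<^bsub>Nbar\<^esub>" if "x \<in> JM N 0"
    using that
  proof (induction rule: JM.induct)
    case zero then show ?case using semilin_zero[OF q N Nbar] .
  next
    case (step a x y)
    then show ?case
      using semilinD(1)[OF q, of x]
      by (simp add: semilinD(2,3)[OF q] N.smult_closed JS JM_closed J_0 Nbar.zero_smult)
  qed
  assume q0: "q x = \<zero>\<^bsub>Nbar\<^esub>"
  have cE: "coord S N E b x \<in> E \<rightarrow> carrier S" using N.coord_closed[OF b x] by blast
  have 0: "\<zero>\<^bsub>Nbar\<^esub> = (\<Oplus>\<^bsub>Nbar\<^esub>e\<in>E. ell (coord S N E b x e) \<odot>\<^bsub>Nbar\<^esub> q (b e))"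
    using semilin_lincomb[OF q N Nbar ellc bE cE] N.coord_expand[OF b x] q0 by simp
  have 1: "\<zero>\<^bsub>Nbar\<^esub> = (\<Oplus>\<^bsub>Nbar\<^esub>e\<in>E. \<zero>\<^bsub>R\<^esub> \<odot>\<^bsub>Nbar\<^esub> q (b e))"
    using semilinD(1)[OF q] bE by (subst Nbar.M.finsum_cong'[where g = "\<lambda>_. \<zero>\<^bsub>Nbar\<^esub>"]) (auto simp: Nbar.zero_smult Pi_iff)
  show "x \<in> JM N 0"
  proof (rule JM_coordI[OF b x])
    fix e assume e: "e \<in> E"
    have "ell (coord S N E b x e) = \<zero>\<^bsub>R\<^esub>"
      using Nbar.coord_unique[OF qb _ 0 e] Nbar.coord_unique[OF qb _ 1 e] cE ellc by (auto simp: Pi_iff)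
    then show "coord S N E b x e \<in> J 0" using cE e by (auto simp: J_0)
  qed
qed

lemma reduction_jcong:
  assumes b: "module_basis S N E b" and Nbar: "left_module R Nbar" and q: "semilin S ell N Nbar q"
    and qb: "module_basis R Nbar E (\<lambda>e. q (b e))" and x: "x \<in> carrier N" "y \<in> carrier N"
  shows "q x = q y \<longleftrightarrow> jcong N 0 x y"
proof -
  interpret Nbar: left_module R Nbar by fact
  have "q x = q y \<longleftrightarrow> q (x \<ominus>\<^bsub>N\<^esub> y) = \<zero>\<^bsub>Nbar\<^esub>"
    using semilinD(1)[OF q] x by (simp add: semilin_minus[OF q N Nbar x] Nbar.M.minus_eq_zero_iff)
  then show ?thesis using reduction_kernel[OF b Nbar q qb, of "x \<ominus>\<^bsub>N\<^esub> y"] x by (simp add: jcong_def)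
qed

lemma reduction_surj:
  assumes b: "module_basis S N E b" and Nbar: "left_module R Nbar" and q: "semilin S ell N Nbar q"
    and qb: "module_basis R Nbar E (\<lambda>e. q (b e))" and ell_surj: "ell ` carrier S = carrier R"
    and y: "y \<in> carrier Nbar"
  shows "\<exists>x\<in>carrier N. q x = y"
proof -
  interpret Nbar: left_module R Nbar by fact
  have ellc: "ell \<in> carrier S \<rightarrow> carrier R" using ell by (simp add: ring_hom_def)
  have bE: "b \<in> E \<rightarrow> carrier N" using b unfolding module_basis_def by blast
  define a where "a e = (SOME a. a \<in> carrier S \<and> ell a = coord R Nbar E (\<lambda>e. q (b e)) y e)" for e
  have a: "a e \<in> carrier S \<and> ell (a e) = coord R Nbar E (\<lambda>e. q (b e)) y e" if "e \<in> E" for e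
  proof -
    have "coord R Nbar E (\<lambda>e. q (b e)) y e \<in> ell ` carrier S"
      using Nbar.coord_closed[OF qb y that] ell_surj by simp
    then have "\<exists>a. a \<in> carrier S \<and> ell a = coord R Nbar E (\<lambda>e. q (b e)) y e" by (metis imageE)
    then show ?thesis unfolding a_def by (rule someI_ex)
  qed
  have aE: "a \<in> E \<rightarrow> carrier S" using a by blast
  have "q (\<Oplus>\<^bsub>N\<^esub>e\<in>E. a e \<odot>\<^bsub>N\<^esub> b e) = (\<Oplus>\<^bsub>Nbar\<^esub>e\<in>E. ell (a e) \<odot>\<^bsub>Nbar\<^esub> q (b e))"
    by (rule semilin_lincomb[OF q N Nbar ellc bE aE])
  also have "\<dots> = (\<Oplus>\<^bsub>Nbar\<^esub>e\<in>E. coord R Nbar E (\<lambda>e. q (b e)) y e \<odot>\<^bsub>Nbar\<^esub> q (b e))"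
    using a by (intro Nbar.M.finsum_cong') (auto intro!: Nbar.smult_closed Nbar.coord_closed[OF qb y] Nbar.basis_closed[OF qb])
  also have "\<dots> = y" by (rule Nbar.coord_expand[OF qb y])
  finally show ?thesis using N.lincomb_closed[OF bE aE] by blast
qed

end

text \<open>Meant for the basis \<phi>(b_e), on whose members a congruence is known one level deeper
  than on the b_e.\<close>

lemma jcong_basis:
  assumes M: "left_module S M" and N: "left_module S N" and \<theta>: "\<theta> \<in> carrier S \<rightarrow> carrier S"
    and b: "module_basis S M E b" and g: "semilin S \<theta> M N g" and h: "semilin S \<theta> M N h"
    and eq: "\<And>e. e \<in> E \<Longrightarrow> jcong N n (g (b e)) (h (b e))" and x: "x \<in> carrier M"
  shows "jcong N n (g x) (h x)"
proof -
  interpret M: left_module S M by fact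
  have bE: "b \<in> E \<rightarrow> carrier M" using b unfolding module_basis_def by blast
  have cE: "coord S M E b x \<in> E \<rightarrow> carrier S" using M.coord_closed[OF b x] by auto
  have "jcong N n (\<Oplus>\<^bsub>N\<^esub>e\<in>E. \<theta> (coord S M E b x e) \<odot>\<^bsub>N\<^esub> g (b e)) (\<Oplus>\<^bsub>N\<^esub>e\<in>E. \<theta> (coord S M E b x e) \<odot>\<^bsub>N\<^esub> h (b e))"
    using cE \<theta> by (intro jcong_finsum[OF N] jcong_smult[OF N] eq) (auto simp: Pi_iff)
  then show ?thesis
    using semilin_lincomb[OF g M N \<theta> bE cE] semilin_lincomb[OF h M N \<theta> bE cE] M.coord_expand[OF b x] by simp
qed

text \<open>An etale module is determined by its reduction: \<open>\<phi>\<close> contracts the kernel of the reduction,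
  so a map commuting with the semilinear operators is the limit of its iterated conjugates.\<close>

context
  fixes M :: "('a, 'm, 'k) module_scheme" and N :: "('a, 'n, 'l) module_scheme"
    and Nbar :: "('c, 'o, 'j) module_scheme" and \<theta> :: "'a \<Rightarrow> 'a"
    and \<phi>M :: "'m \<Rightarrow> 'm" and \<delta> :: "'n \<Rightarrow> 'n" and q :: "'n \<Rightarrow> 'o"
    and E :: "'e set" and b :: "'e \<Rightarrow> 'm" and F :: "'f set" and d :: "'f \<Rightarrow> 'n"
  assumes M: "left_module S M" and N: "left_module S N" and Nbar: "left_module R Nbar"
    and \<theta>: "\<theta> \<in> ring_hom S S"
    and b: "module_basis S M E b" and \<phi>b: "module_basis S M E (\<lambda>e. \<phi>M (b e))"
    and \<phi>M: "semilin S \<phi> M M \<phi>M" and \<delta>: "semilin S \<phi> N N \<delta>"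
    and d: "module_basis S N F d" and q: "semilin S ell N Nbar q"
    and qd: "module_basis R Nbar F (\<lambda>e. q (d e))"
begin

interpretation M: left_module S M by (rule M)
interpretation N: left_module S N by (rule N)
interpretation Nbar: left_module R Nbar by (rule Nbar)

lemma \<theta>_fun: "\<theta> \<in> carrier S \<rightarrow> carrier S"
  using \<theta> by (simp add: ring_hom_def)

text \<open>Induction on \<open>n\<close> shows agreement modulo J_n N. The assumption on
  \<open>q\<close> is the case n = 0. If the maps agree modulo J_n N on the b_e, then \<delta> makes
  them agree modulo J_{n+1} N on the vectors \<phi>M(b_e), which are a basis as well.\<close>

lemma lift_unique:
  assumes g: "semilin S \<theta> M N g" "\<And>m. m \<in> carrier M \<Longrightarrow> g (\<phi>M m) = \<delta> (g m)"
    and h: "semilin S \<theta> M N h" "\<And>m. m \<in> carrier M \<Longrightarrow> h (\<phi>M m) = \<delta> (h m)"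
    and eq: "\<And>m. m \<in> carrier M \<Longrightarrow> q (g m) = q (h m)" and m: "m \<in> carrier M"
  shows "g m = h m"
proof -
  have "\<forall>m\<in>carrier M. jcong N n (g m) (h m)" for n
  proof (induction n)
    case 0
    show ?case using eq reduction_jcong[OF N d Nbar q qd] semilinD(1)[OF g(1)] semilinD(1)[OF h(1)] by blast
  next
    case (Suc n)
    show ?case
    proof
      fix m assume "m \<in> carrier M"
      show "jcong N (Suc n) (g m) (h m)"
      proof (rule jcong_basis[OF M N \<theta>_fun \<phi>b g(1) h(1) _ \<open>m \<in> carrier M\<close>])
        fix e assume "e \<in> E"
        then have "b e \<in> carrier M" using M.basis_closed[OF b] by blast
        then show "jcong N (Suc n) (g (\<phi>M (b e))) (h (\<phi>M (b e)))"
          using jcong_semilin[OF N \<delta>] Suc by (simp add: g(2) h(2))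
      qed
    qed
  qed
  then show ?thesis using jcong_sep[OF N d] m by blast
qed

text \<open>Every approximation lifts \<open>f\<close>, and \<open>G (Suc n)\<close> is defined by
  the values \<delta>(G_n(b_e)) on the basis \<phi>M(b_e). Consecutive approximations agree to ever
  higher order, and the relation G_{n+1} \<phi>M = \<delta> G_n becomes commutation with the
  operators in the limit.\<close>

lemma lift_exists:
  assumes comm: "\<And>a. a \<in> carrier S \<Longrightarrow> \<theta> (\<phi> a) = \<phi> (\<theta> a)"
    and ell_surj: "ell ` carrier S = carrier R"
    and \<phi>bar: "\<And>x. x \<in> carrier N \<Longrightarrow> q (\<delta> x) = \<phi>bar (q x)"
    and f: "semilin S (\<lambda>a. ell (\<theta> a)) M Nbar f" "\<And>m. m \<in> carrier M \<Longrightarrow> f (\<phi>M m) = \<phi>bar (f m)"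
  shows "\<exists>g. semilin S \<theta> M N g \<and> (\<forall>m\<in>carrier M. g (\<phi>M m) = \<delta> (g m) \<and> q (g m) = f m)"
proof -
  let ?L = "\<lambda>g. semilin S \<theta> M N g \<and> (\<forall>m\<in>carrier M. q (g m) = f m)"
  let ?T = "\<lambda>g g'. \<forall>m\<in>carrier M. g' (\<phi>M m) = \<delta> (g m)"
  note \<theta>f = \<theta>_fun
  have ellc: "ell \<in> carrier S \<rightarrow> carrier R" using ell by (simp add: ring_hom_def)
  have ell\<theta>: "(\<lambda>a. ell (\<theta> a)) \<in> carrier S \<rightarrow> carrier R" using ellc \<theta>f by auto
  have ext: "?L g" if g: "semilin S \<theta> M N g" and bb: "module_basis S M E c" "\<And>e. e \<in> E \<Longrightarrow> q (g (c e)) = f (c e)" for g c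
    using g semilin_eqI[OF M Nbar ell\<theta> bb(1) semilin_comp[OF g q \<theta>f] f(1) bb(2)] by blast
  obtain u where u: "\<And>e. e \<in> E \<Longrightarrow> u e \<in> carrier N \<and> q (u e) = f (b e)"
  proof -
    have "\<exists>x\<in>carrier N. q x = f (b e)" if "e \<in> E" for e
      using reduction_surj[OF N d Nbar q qd ell_surj] semilinD(1)[OF f(1)] M.basis_closed[OF b that] by blast
    then show thesis using that by metis
  qed
  have start: "\<exists>g. ?L g"
  proof -
    obtain g where g: "semilin S \<theta> M N g" "\<And>e. e \<in> E \<Longrightarrow> g (b e) = u e"
      using semilin_extend[OF M N \<theta> b, of u] u by blast
    then show ?thesis using ext[OF g(1) b] u by auto
  qed
  have step: "\<exists>g'. ?L g' \<and> ?T g g'" if g: "?L g" for g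
  proof -
    have "(\<lambda>e. \<delta> (g (b e))) \<in> E \<rightarrow> carrier N"
      using g semilinD(1)[OF \<delta>] M.basis_closed[OF b] by (auto simp: semilin_def Pi_iff)
    then obtain g' where g': "semilin S \<theta> M N g'" "\<And>e. e \<in> E \<Longrightarrow> g' (\<phi>M (b e)) = \<delta> (g (b e))"
      using semilin_extend[OF M N \<theta> \<phi>b, of "\<lambda>e. \<delta> (g (b e))"] by blast
    have gN: "g m \<in> carrier N" if "m \<in> carrier M" for m using g that semilinD(1) by metis
    have "?L g'"
      by (rule ext[OF g'(1) \<phi>b]) (use g g'(2) gN M.basis_closed[OF b] in \<open>simp add: f(2) \<phi>bar\<close>)
    moreover have "?T g g'"
    proof
      fix m assume m: "m \<in> carrier M"
      \<comment> \<open>Since \<theta> commutes with \<phi>, both composites are semilinear over the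
        same twist, so agreement on the basis \<open>b\<close> suffices.\<close>
      have 1: "semilin S (\<lambda>a. \<phi> (\<theta> a)) M N (\<lambda>m. g' (\<phi>M m))"
        by (rule semilin_cong[OF semilin_comp[OF \<phi>M g'(1)] M]) (use \<phi> comm in \<open>auto simp: ring_hom_def\<close>)
      have 2: "semilin S (\<lambda>a. \<phi> (\<theta> a)) M N (\<lambda>m. \<delta> (g m))"
        using semilin_comp[OF _ \<delta> \<theta>f] g by blast
      show "g' (\<phi>M m) = \<delta> (g m)"
        by (rule semilin_eqI[OF M N _ b 1 2 g'(2) m]) (use \<phi> \<theta>f in \<open>auto simp: ring_hom_def Pi_iff\<close>)
    qed
    ultimately show ?thesis by blast
  qed
  obtain G where G: "\<And>n. ?L (G n)" "\<And>n. ?T (G n) (G (Suc n))"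
    using dependent_nat_choice[of "\<lambda>_. ?L" "\<lambda>_. ?T", OF start step] by blast
  have Gl: "semilin S \<theta> M N (G n)" for n using G(1) by blast
  have cong: "\<forall>m\<in>carrier M. jcong N n (G (Suc n) m) (G n m)" for n
  proof (induction n)
    case 0
    show ?case using G(1) reduction_jcong[OF N d Nbar q qd] semilinD(1)[OF Gl] by metis
  next
    case (Suc n)
    show ?case
    proof
      fix m assume "m \<in> carrier M"
      show "jcong N (Suc n) (G (Suc (Suc n)) m) (G (Suc n) m)"
      proof (rule jcong_basis[OF M N \<theta>f \<phi>b Gl Gl _ \<open>m \<in> carrier M\<close>])
        fix e assume "e \<in> E"
        then have "b e \<in> carrier M" using M.basis_closed[OF b] by blast
        then show "jcong N (Suc n) (G (Suc (Suc n)) (\<phi>M (b e))) (G (Suc n) (\<phi>M (b e)))"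
          using jcong_semilin[OF N \<delta>] Suc G(2) by simp
      qed
    qed
  qed
  obtain g where g: "\<And>m n. m \<in> carrier M \<Longrightarrow> jcong N n (g m) (G n m)"
    using jcong_complete[OF N d, of "\<lambda>n. G n _"] cong by metis
  have gN: "g m \<in> carrier N" if "m \<in> carrier M" for m using g[OF that] by (simp add: jcong_def)
  have "semilin S \<theta> M N g"
  proof (rule semilinI)
    fix x y assume x: "x \<in> carrier M" "y \<in> carrier M"
    \<comment> \<open>Identities pass to the limit: both sides are congruent to the corresponding
      expressions in \<open>G n\<close> for every \<open>n\<close>, and the filtration is
      separated.\<close>
    show "g (x \<oplus>\<^bsub>M\<^esub> y) = g x \<oplus>\<^bsub>N\<^esub> g y"
    proof (rule jcong_sep[OF N d])
      fix n
      have "jcong N n (g x \<oplus>\<^bsub>N\<^esub> g y) (G n (x \<oplus>\<^bsub>M\<^esub> y))"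
        using jcong_add[OF N g[OF x(1)] g[OF x(2)]] x by (simp add: semilinD[OF Gl])
      then show "jcong N n (g (x \<oplus>\<^bsub>M\<^esub> y)) (g x \<oplus>\<^bsub>N\<^esub> g y)"
        using jcong_trans[OF N g jcong_sym[OF N]] x by simp
    qed
  next
    fix a x assume x: "a \<in> carrier S" "x \<in> carrier M"
    show "g (a \<odot>\<^bsub>M\<^esub> x) = \<theta> a \<odot>\<^bsub>N\<^esub> g x"
    proof (rule jcong_sep[OF N d])
      fix n
      have "jcong N n (\<theta> a \<odot>\<^bsub>N\<^esub> g x) (G n (a \<odot>\<^bsub>M\<^esub> x))"
        using jcong_smult[OF N g[OF x(2)], of "\<theta> a"] x \<theta>f by (auto simp: semilinD[OF Gl])
      then show "jcong N n (g (a \<odot>\<^bsub>M\<^esub> x)) (\<theta> a \<odot>\<^bsub>N\<^esub> g x)"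
        using jcong_trans[OF N g jcong_sym[OF N]] x by (simp add: M.smult_closed)
    qed
  qed (rule gN)
  moreover have "g (\<phi>M m) = \<delta> (g m)" if m: "m \<in> carrier M" for m
  proof (rule jcong_sep[OF N d])
    fix n
    \<comment> \<open>Both sides are compared with \<open>G (Suc n)\<close>, whose relation to
      \<open>G n\<close> is an exact equality.\<close>
    have "jcong N (Suc n) (\<delta> (g m)) (G (Suc n) (\<phi>M m))"
      using jcong_semilin[OF N \<delta> g[OF m]] G(2) m by simp
    then show "jcong N n (g (\<phi>M m)) (\<delta> (g m))"
      using jcong_trans[OF N g jcong_sym[OF N]] semilinD(1)[OF \<phi>M m] jcong_Suc[OF N] by blast
  qed
  moreover have "q (g m) = f m" if m: "m \<in> carrier M" for m
    using g[OF m, of 0] reduction_jcong[OF N d Nbar q qd gN[OF m] semilinD(1)[OF Gl[of 0] m]] G(1)[of 0] m by simp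
  ultimately show ?thesis by blast
qed

end

end

section \<open>The ring $\mathbb{Z}_p$\<close>

lemma prime_card: "Factorial_Ring.prime CARD('p :: prime_type)"
  by (rule prime_type)

lemma card_gt_1: "CARD('p :: prime_type) > 1"
  using prime_gt_1_nat[OF prime_card] .

lemma Rep_zp_le: "m \<le> n \<Longrightarrow> Rep_zp a n mod int CARD('p :: prime_type) ^ m = Rep_zp (a :: 'p zp) m"
  using zp_mod_le[of "Rep_zp a" "int CARD('p)" m n] Rep_zp[of a] by blast

lemma Rep_zp_range: "0 \<le> Rep_zp (a :: 'p :: prime_type zp) n" "Rep_zp a n < int CARD('p) ^ n"
proof -
  have "int CARD('p) ^ n > 0" using card_gt_1[where 'p = 'p] by simp
  then show "0 \<le> Rep_zp a n" "Rep_zp a n < int CARD('p) ^ n"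
    using zp_reduced[of a n] pos_mod_sign pos_mod_bound by metis+
qed

lemma Rep_zp_of_nat: "Rep_zp (of_nat m :: 'p :: prime_type zp) n = int m mod int CARD('p) ^ n"
  by (induction m) (simp_all add: zero_zp.rep_eq one_zp.rep_eq plus_zp.rep_eq mod_simps)

text \<open>The quotient has the residues a_{n+k} / p^k: division by p^k costs \<open>k\<close>
  digits, hence the shifted index.\<close>

lemma zp_divisible:
  fixes a :: "'p :: prime_type zp"
  assumes "Rep_zp a k = 0"
  shows "\<exists>b. a = of_nat CARD('p) ^ k * b"
proof -
  let ?q = "int CARD('p)"
  have q: "?q > 0" using card_gt_1[where 'p = 'p] by linarith
  define f where "f n = Rep_zp a (n + k) div ?q ^ k" for n
  have "f n = f (Suc n) mod ?q ^ n" for n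
  proof -
    have "f n = (Rep_zp a (Suc n + k) mod ?q ^ (n + k)) div ?q ^ k"
      unfolding f_def using Rep_zp_le[of "n + k" "Suc n + k" a] by simp
    also have "\<dots> = f (Suc n) mod ?q ^ n"
      unfolding f_def power_add mult.commute[of "?q ^ n"] using q
      by (subst zmod_zmult2_eq) auto
    finally show ?thesis .
  qed
  then have b: "Rep_zp (Abs_zp f :: 'p zp) = f" by (intro Abs_zp_inverse) blast
  have "a = of_nat (CARD('p) ^ k) * Abs_zp f"
  proof (rule zp_eqI)
    fix n
    have "?q ^ k dvd Rep_zp a (n + k)"
      using Rep_zp_le[of k "n + k" a] assms by (simp add: mod_eq_0_iff_dvd)
    then have "?q ^ k * f n = Rep_zp a (n + k)" unfolding f_def by simp
    then have "(?q ^ k * f n) mod ?q ^ n = Rep_zp a n"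
      using Rep_zp_le[of n "n + k" a] by simp
    then show "Rep_zp a n = Rep_zp (of_nat (CARD('p) ^ k) * Abs_zp f :: 'p zp) n"
      by (simp only: times_zp.rep_eq Rep_zp_of_nat b) (simp add: mod_simps)
  qed
  then show ?thesis by auto
qed

lemma zp_p_power_nonzero: "(of_nat CARD('p) ^ k :: 'p :: prime_type zp) \<noteq> 0"
proof
  assume "(of_nat CARD('p) ^ k :: 'p zp) = 0"
  then have "Rep_zp (of_nat (CARD('p) ^ k) :: 'p zp) (Suc k) = 0" by (simp only: of_nat_power zero_zp.rep_eq)
  then have "int CARD('p) ^ k mod int CARD('p) ^ Suc k = 0" by (simp only: Rep_zp_of_nat) simp
  moreover have "int CARD('p) ^ k < int CARD('p) ^ Suc k"
    using card_gt_1[where 'p = 'p] by (intro power_strict_increasing) auto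
  ultimately have "int CARD('p) ^ k = 0" by (metis mod_pos_pos_trivial of_nat_0_le_iff of_nat_power)
  then show False using card_gt_1[where 'p = 'p] by simp
qed

text \<open>All residues are prime to \<open>p\<close>, so inverses modulo p^n exist; being unique
  in the range from 0 to p^n, they form a compatible sequence.\<close>

lemma zp_unit:
  fixes a :: "'p :: prime_type zp"
  assumes "Rep_zp a 1 \<noteq> 0"
  shows "\<exists>b. a * b = 1"
proof -
  let ?q = "int CARD('p)"
  have pq: "Factorial_Ring.prime ?q" using prime_card[where 'p = 'p] by simp
  have cop: "coprime (Rep_zp a n) (?q ^ n)" for n
  proof (cases "n = 0")
    case False
    have "\<not> ?q dvd Rep_zp a n"
      using Rep_zp_le[of 1 n a] False assms by (auto simp: mod_eq_0_iff_dvd)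
    then have "coprime ?q (Rep_zp a n)" using pq by (simp add: prime_imp_coprime)
    then show ?thesis by (simp add: coprime_commute)
  qed simp
  define P where "P n x \<longleftrightarrow> 0 \<le> x \<and> x < ?q ^ n \<and> (Rep_zp a n * x) mod ?q ^ n = 1 mod ?q ^ n" for n x
  have q: "?q ^ n > 0" for n using card_gt_1[where 'p = 'p] by simp
  have ex: "\<exists>x. P n x" for n
  proof -
    obtain y where "[Rep_zp a n * y = 1] (mod ?q ^ n)" using cong_solve_coprime_int[OF cop] by blast
    then have "P n (y mod ?q ^ n)" unfolding P_def Cong.cong_def using q[of n] by (simp add: mod_simps)
    then show ?thesis by blast
  qed
  have uniq: "x = y" if "P n x" "P n y" for n x y
  proof -
    have "[Rep_zp a n * x = Rep_zp a n * y] (mod ?q ^ n)" using that by (simp add: P_def Cong.cong_def)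
    then have "[x = y] (mod ?q ^ n)" using cong_mult_lcancel[OF cop] by blast
    then show ?thesis using that by (simp add: P_def Cong.cong_def)
  qed
  obtain f where f: "\<And>n. P n (f n)" using ex by metis
  have "f n = f (Suc n) mod ?q ^ n" for n
  proof (rule uniq[OF f])
    have "(Rep_zp a n * (f (Suc n) mod ?q ^ n)) mod ?q ^ n = (Rep_zp a (Suc n) * f (Suc n)) mod ?q ^ n"
      using Rep_zp_le[of n "Suc n" a] by (metis le_add2 mod_mult_eq mod_mult_right_eq plus_1_eq_Suc)
    also have "\<dots> = (Rep_zp a (Suc n) * f (Suc n)) mod ?q ^ Suc n mod ?q ^ n" by (simp only: zp_mod_Suc)
    also have "\<dots> = 1 mod ?q ^ n" using f[of "Suc n"] by (simp only: P_def zp_mod_Suc)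
    finally show "P n (f (Suc n) mod ?q ^ n)" using q[of n] by (simp add: P_def)
  qed
  then have b: "Rep_zp (Abs_zp f :: 'p zp) = f" by (intro Abs_zp_inverse) blast
  have "a * Abs_zp f = 1"
    using f by (intro zp_eqI) (simp add: times_zp.rep_eq one_zp.rep_eq b P_def)
  then show ?thesis by blast
qed

lemma zp_decompose:
  fixes a :: "'p :: prime_type zp"
  assumes "a \<noteq> 0"
  shows "\<exists>k u v. a = of_nat CARD('p) ^ k * u \<and> u * v = 1"
proof -
  have "\<exists>n. Rep_zp a n \<noteq> 0" using assms zp_eqI[of a 0] by (auto simp: zero_zp.rep_eq)
  \<comment> \<open>\<open>k\<close> is the last index at which the residue of \<open>a\<close>
    vanishes.\<close>
  then obtain k where k: "Rep_zp a k = 0" "Rep_zp a (Suc k) \<noteq> 0"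
    using dec_induct[of 0 _ "\<lambda>n. Rep_zp a n = 0"] Rep_zp_le[of 0 0 a]
    by (metis Rep_zp_range dual_order.strict_trans2 int_one_le_iff_zero_less linorder_not_le order_antisym_conv power_0 zero_le)
  obtain u where u: "a = of_nat CARD('p) ^ k * u" using zp_divisible[OF k(1)] by blast
  have "Rep_zp u 1 \<noteq> 0"
  proof
    assume "Rep_zp u 1 = 0"
    then obtain w where "u = of_nat CARD('p) * w" using zp_divisible[of u 1] by auto
    then have "a = of_nat (CARD('p) ^ Suc k) * w" using u by (simp add: mult.assoc mult.left_commute)
    then have "Rep_zp a (Suc k) = 0"
      by (simp only: times_zp.rep_eq Rep_zp_of_nat) simp
    then show False using k by simp
  qed
  then show ?thesis using zp_unit u by blast
qed

section \<open>The integers Z_p inside Q_p: residues, separatedness and valuation\<close>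

lemma padic_of_zp_hom [simp]:
  "padic_of_zp (a + b) = padic_of_zp a + padic_of_zp b"
  "padic_of_zp (a * b) = padic_of_zp a * padic_of_zp b"
  "padic_of_zp (- a) = - padic_of_zp a"
  "padic_of_zp (a - b) = padic_of_zp a - padic_of_zp b"
  "padic_of_zp 0 = 0" "padic_of_zp 1 = 1"
  by (simp_all add: padic_of_zp_def plus_padic_def times_padic_def uminus_padic_def minus_padic_def
    zero_padic_def one_padic_def Zero_fract_def One_fract_def Abs_padic_inverse)

lemma padic_of_zp_eq_iff [simp]: "padic_of_zp a = padic_of_zp b \<longleftrightarrow> a = b"
  by (simp add: padic_of_zp_def Abs_padic_inject eq_fract)

lemma padic_of_zp_of_nat [simp]: "padic_of_zp (of_nat n) = of_nat n"
  by (induction n) simp_all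

lemma padic_of_zp_power [simp]: "padic_of_zp (a ^ n) = padic_of_zp a ^ n"
  by (induction n) simp_all

lemma Zp_cases: "x \<in> Zp \<Longrightarrow> (\<And>a. x = padic_of_zp a \<Longrightarrow> thesis) \<Longrightarrow> thesis"
  unfolding Zp_def by blast

lemma padic_of_zp_in: "padic_of_zp a \<in> Zp" unfolding Zp_def by blast

lemma Zp_add: "x \<in> Zp \<Longrightarrow> y \<in> Zp \<Longrightarrow> x + y \<in> Zp"
  by (elim Zp_cases) (metis padic_of_zp_hom(1) padic_of_zp_in)

lemma Zp_minus: "x \<in> Zp \<Longrightarrow> - x \<in> Zp"
  by (elim Zp_cases) (metis padic_of_zp_hom(3) padic_of_zp_in)

lemma Zp_diff: "x \<in> Zp \<Longrightarrow> y \<in> Zp \<Longrightarrow> x - y \<in> Zp"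
  by (elim Zp_cases) (metis padic_of_zp_hom(4) padic_of_zp_in)

lemma one_in_Zp: "1 \<in> Zp" by (metis padic_of_zp_hom(6) padic_of_zp_in)

lemma pp_in_Zp: "pp \<in> Zp" by (simp add: pp_def of_nat_in_Zp)

lemma Zp_power: "x \<in> Zp \<Longrightarrow> x ^ n \<in> Zp"
  by (induction n) (simp_all add: one_in_Zp Zp_mult)

lemmas Zp_intros = Zp_add Zp_minus Zp_diff one_in_Zp pp_in_Zp Zp_power Zp_mult zero_in_Zp of_nat_in_Zp

lemma padic_of_zp_pp: "padic_of_zp (of_nat CARD('p) ^ k :: 'p :: prime_type zp) = pp ^ k"
  by (simp add: pp_def)

lemma pp_nonzero: "(pp :: 'p :: prime_type padic) \<noteq> 0"
proof
  assume "(pp :: 'p padic) = 0"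
  then have "padic_of_zp (of_nat CARD('p) ^ 1 :: 'p zp) = padic_of_zp 0"
    unfolding padic_of_zp_pp by simp
  then show False using zp_p_power_nonzero[where 'p = 'p, of 1] by (simp only: padic_of_zp_eq_iff)
qed

lemma Zp_residue:
  fixes x :: "'p :: prime_type padic"
  assumes "x \<in> Zp"
  shows "\<exists>i y. i < CARD('p) ^ k \<and> y \<in> Zp \<and> x = of_nat i + pp ^ k * y"
proof -
  obtain a where a: "x = padic_of_zp a" using assms by (rule Zp_cases)
  define i where "i = nat (Rep_zp a k)"
  have i: "int i = Rep_zp a k" using Rep_zp_range[of a k] by (simp add: i_def)
  have "Rep_zp (a - of_nat i) k = 0"
    by (simp add: minus_zp.rep_eq Rep_zp_of_nat i mod_simps)
  then obtain b where "a - of_nat i = of_nat CARD('p) ^ k * b" using zp_divisible by blast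
  then have "a = of_nat i + of_nat CARD('p) ^ k * b" by (simp add: algebra_simps)
  then have "x = of_nat i + pp ^ k * padic_of_zp b" by (simp only: a padic_of_zp_hom padic_of_zp_pp padic_of_zp_of_nat)
  moreover have "int i < int (CARD('p) ^ k)" using Rep_zp_range[of a k] i by simp
  ultimately show ?thesis using padic_of_zp_in by (metis of_nat_less_iff)
qed

lemma of_nat_eq_mod:
  fixes y z :: "'p :: prime_type padic"
  assumes "of_nat i + pp ^ k * y = of_nat j + pp ^ k * z" "y \<in> Zp" "z \<in> Zp"
    "i < CARD('p) ^ k" "j < CARD('p) ^ k"
  shows "i = j"
proof -
  obtain a b where ab: "y = padic_of_zp a" "z = padic_of_zp b" using assms(2,3) by (metis Zp_cases)
  have eq: "of_nat i + of_nat (CARD('p) ^ k) * a = of_nat j + of_nat (CARD('p) ^ k) * b"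
    using assms(1) by (subst padic_of_zp_eq_iff[symmetric]) (simp add: ab pp_def)
  have "Rep_zp (of_nat n + of_nat (CARD('p) ^ k) * c :: 'p zp) k = int n" if "n < CARD('p) ^ k" for n c
  proof -
    have "int n < int CARD('p) ^ k" using that by (metis of_nat_less_iff of_nat_power)
    then show ?thesis by (simp only: plus_zp.rep_eq times_zp.rep_eq Rep_zp_of_nat) (simp add: mod_simps)
  qed
  from this[OF assms(4), of a] this[OF assms(5), of b] show ?thesis using eq by simp
qed

lemma Zp_separated:
  fixes x :: "'p :: prime_type padic"
  assumes "\<And>k. \<exists>y\<in>Zp. x = pp ^ k * y"
  shows "x = 0"
proof -
  obtain a where a: "x = padic_of_zp a" using assms[of 0] by (metis Zp_cases mult_1 power_0)
  have "Rep_zp a k = 0" for k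
  proof -
    obtain y where "y \<in> Zp" "x = pp ^ k * y" using assms by blast
    then obtain b where "padic_of_zp a = padic_of_zp (of_nat CARD('p) ^ k * b)"
      unfolding a by (metis Zp_cases padic_of_zp_hom(2) padic_of_zp_pp)
    then have "a = of_nat (CARD('p) ^ k) * b" by (simp only: padic_of_zp_eq_iff of_nat_power)
    then show ?thesis by (simp only: times_zp.rep_eq Rep_zp_of_nat) simp
  qed
  then show ?thesis using a zp_eqI[of a 0] by (simp add: zero_zp.rep_eq)
qed

lemma Zp_units_mult: "u \<in> Zp_units \<Longrightarrow> v \<in> Zp_units \<Longrightarrow> u * v \<in> Zp_units"
proof -
  assume "u \<in> Zp_units" "v \<in> Zp_units"
  then obtain u' v' where "u \<in> Zp" "v \<in> Zp" "u' \<in> Zp" "v' \<in> Zp" "u * u' = 1" "v * v' = 1"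
    by (auto simp: Zp_units_def)
  moreover have "(u * v) * (u' * v') = (u * u') * (v * v')" by (simp add: mult_ac)
  ultimately show ?thesis unfolding Zp_units_def using Zp_mult by fastforce
qed

lemma Zp_units_one: "1 \<in> Zp_units"
  using one_in_Zp by (auto simp: Zp_units_def)

lemma Zp_decompose:
  fixes x :: "'p :: prime_type padic"
  assumes "x \<in> Zp" "x \<noteq> 0"
  shows "\<exists>k. \<exists>u\<in>Zp_units. x = pp ^ k * u"
proof -
  obtain a where a: "x = padic_of_zp a" using assms(1) by (rule Zp_cases)
  then have "a \<noteq> 0" using assms(2) by auto
  from zp_decompose[OF this] obtain k u v where kuv: "a = of_nat CARD('p) ^ k * u" "u * v = 1" by blast
  have "x = pp ^ k * padic_of_zp u" by (simp only: a kuv padic_of_zp_hom padic_of_zp_pp)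
  moreover have "padic_of_zp u * padic_of_zp v = 1" using kuv(2) by (metis padic_of_zp_hom(2,6))
  ultimately show ?thesis using padic_of_zp_in by (auto simp: Zp_units_def)
qed

text \<open>If k < l, then \<open>u\<close> is divisible by \<open>p\<close>, and multiplication by
  its inverse makes 1 divisible by \<open>p\<close>.\<close>

lemma Zp_decompose_unique:
  fixes u v :: "'p :: prime_type padic"
  assumes "pp ^ k * u = pp ^ l * v" "u \<in> Zp_units" "v \<in> Zp_units"
  shows "k = l \<and> u = v"
proof -
  have *: "k \<ge> l" if eq: "pp ^ k * u = pp ^ l * v" and "u \<in> Zp_units" "v \<in> Zp_units" for k l and u v :: "'p padic"
  proof (rule ccontr)
    assume "\<not> k \<ge> l"
    then obtain d where d: "l = k + Suc d" by (metis less_iff_Suc_add add_Suc_right not_le)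
    obtain u' where u': "u' \<in> Zp" "u * u' = 1" using \<open>u \<in> Zp_units\<close> by (auto simp: Zp_units_def)
    have "u = pp ^ Suc d * v"
      using eq pp_nonzero[where 'p = 'p] by (simp add: d power_add mult.assoc)
    \<comment> \<open>Divisibility of 1 by \<open>p\<close>, written as an equality of two residue
      expansions so that the residues 1 and 0 can be compared.\<close>
    then have "of_nat 1 + pp ^ 1 * 0 = (of_nat 0 :: 'p padic) + pp ^ 1 * (pp ^ d * v * u')"
      using u'(2) by (simp add: mult.assoc)
    moreover have "pp ^ d * v * u' \<in> Zp"
      using u' \<open>v \<in> Zp_units\<close> by (auto simp: Zp_units_def intro!: Zp_intros)
    ultimately show False
      using of_nat_eq_mod[of 1 1 0 0 "pp ^ d * v * u'"] zero_in_Zp card_gt_1[where 'p = 'p] by simp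
  qed
  have "k = l" using *[OF assms(1,2,3)] *[OF assms(1)[symmetric] assms(3,2)] by simp
  then show ?thesis using assms(1) pp_nonzero[where 'p = 'p] by simp
qed

text \<open>With the denominator written as p^k times a unit, only the factor p^k has to be
  multiplied away.\<close>

lemma padic_clear_denominator: "\<exists>k. pp ^ k * (x :: 'p :: prime_type padic) \<in> Zp"
proof -
  obtain a b where ab: "Rep_padic x = Fract a b" "b \<noteq> 0" by (cases "Rep_padic x") auto
  obtain k u v where kuv: "b = of_nat CARD('p) ^ k * u" "u * v = 1" using zp_decompose[OF ab(2)] by blast
  have "x = Abs_padic (Fract a b)" by (metis ab(1) Rep_padic_inverse)
  moreover have "padic_of_zp b * Abs_padic (Fract a b) = padic_of_zp a"
    using ab(2) by (simp add: padic_of_zp_def times_padic_def Abs_padic_inverse Abs_padic_inject eq_fract)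
  ultimately have "padic_of_zp b * x = padic_of_zp a" by simp
  then have "padic_of_zp v * (padic_of_zp b * x) = padic_of_zp (v * a)" by simp
  moreover have "padic_of_zp v * padic_of_zp b = pp ^ k"
    unfolding padic_of_zp_hom(2)[symmetric] padic_of_zp_pp[symmetric] padic_of_zp_eq_iff kuv(1)
    using kuv(2) by (simp add: mult.left_commute mult.commute)
  ultimately have "pp ^ k * x = padic_of_zp (v * a)" by (simp add: mult.assoc[symmetric])
  then show ?thesis using padic_of_zp_in by metis
qed

section \<open>The p-adic topology\<close>

lemma eventually_nhds_padic:
  "eventually P (nhds (x :: 'p :: prime_type padic)) \<longleftrightarrow> (\<exists>k. \<forall>z\<in>Zp. P (x + pp ^ k * z))"
proof
  assume "eventually P (nhds x)"
  then obtain U where "open U" "x \<in> U" "\<forall>y\<in>U. P y" by (auto simp: eventually_nhds)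
  then show "\<exists>k. \<forall>z\<in>Zp. P (x + pp ^ k * z)" unfolding open_padic_def by meson
next
  assume "\<exists>k. \<forall>z\<in>Zp. P (x + pp ^ k * z)"
  then obtain k where k: "\<forall>z\<in>Zp. P (x + pp ^ k * z)" by blast
  let ?U = "(\<lambda>z. x + pp ^ k * z) ` Zp"
  have "open ?U"
    unfolding open_padic_def
  proof
    fix y assume "y \<in> ?U"
    then obtain z where z: "z \<in> Zp" "y = x + pp ^ k * z" by blast
    have "y + pp ^ k * w \<in> ?U" if "w \<in> Zp" for w
      using z that by (intro image_eqI[of _ _ "z + w"]) (auto simp: algebra_simps Zp_add)
    then show "\<exists>l. \<forall>w\<in>Zp. y + pp ^ l * w \<in> ?U" by blast
  qed
  moreover have "x \<in> ?U" by (rule image_eqI[of _ _ 0]) (auto simp: zero_in_Zp)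
  ultimately show "eventually P (nhds x)" unfolding eventually_nhds using k by blast
qed

text \<open>Provides continuity of finite sums, on which continuity of multiplication by a fixed
  matrix rests.\<close>

instance padic :: (prime_type) topological_comm_monoid_add
proof
  fix a b :: "'a padic"
  show "((\<lambda>x. fst x + snd x) \<longlongrightarrow> a + b) (nhds a \<times>\<^sub>F nhds b)"
    unfolding filterlim_iff
  proof (intro allI impI)
    fix P :: "'a padic \<Rightarrow> bool"
    assume "eventually P (nhds (a + b))"
    then obtain k where k: "\<forall>z\<in>Zp. P (a + b + pp ^ k * z)" by (auto simp: eventually_nhds_padic)
    let ?Q = "\<lambda>c y. \<exists>z\<in>Zp. y = c + pp ^ k * z"
    have "eventually (?Q a) (nhds a)" "eventually (?Q b) (nhds b)" unfolding eventually_nhds_padic by blast+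
    moreover have "P (x + y)" if xy: "?Q a x" "?Q b y" for x y
    proof -
      obtain z w where "z \<in> Zp" "w \<in> Zp" "x = a + pp ^ k * z" "y = b + pp ^ k * w" using xy by blast
      then show ?thesis using k[rule_format, of "z + w"] by (simp add: Zp_add algebra_simps)
    qed
    ultimately show "\<forall>\<^sub>F x in nhds a \<times>\<^sub>F nhds b. P (fst x + snd x)"
      unfolding eventually_prod_filter by (intro exI[of _ "?Q a"] exI[of _ "?Q b"]) auto
  qed
qed

text \<open>If p^l c is integral, multiplication by \<open>c\<close> maps a + p^(k+l) Z_p into c a +
  p^k Z_p.\<close>

lemma continuous_on_padic_mult:
  fixes f :: "'a :: topological_space \<Rightarrow> 'p :: prime_type padic"
  assumes "continuous_on A f"
  shows "continuous_on A (\<lambda>x. c * f x)" "continuous_on A (\<lambda>x. f x * c)"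
proof -
  have "((*) c \<longlongrightarrow> c * a) (nhds a)" for a
    unfolding filterlim_iff
  proof (intro allI impI)
    fix P
    assume "eventually P (nhds (c * a))"
    then obtain k where k: "\<forall>z\<in>Zp. P (c * a + pp ^ k * z)" by (auto simp: eventually_nhds_padic)
    obtain l where l: "pp ^ l * c \<in> Zp" using padic_clear_denominator by blast
    have "P (c * (a + pp ^ (k + l) * z))" if "z \<in> Zp" for z
      using k[rule_format, OF Zp_mult[OF l that]] by (simp add: algebra_simps power_add)
    then show "eventually (\<lambda>x. P (c * x)) (nhds a)" unfolding eventually_nhds_padic by blast
  qed
  then have "continuous_on UNIV ((*) c)"
    unfolding continuous_on_def by (blast intro: tendsto_mono[OF at_within_le_nhds])
  from continuous_on_compose2[OF this assms] show "continuous_on A (\<lambda>x. c * f x)" by simp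
  then show "continuous_on A (\<lambda>x. f x * c)" by (simp add: mult.commute)
qed

lemma continuous_on_padic_matrix_mult:
  fixes g :: "'p :: prime_type padic ^ 'n :: finite ^ 'n"
  shows "continuous_on A (\<lambda>x. g ** x)" "continuous_on A (\<lambda>x. x ** g)"
  unfolding matrix_matrix_mult_def
  by (intro continuous_on_vec_lambda continuous_on_sum continuous_on_padic_mult continuous_on_component continuous_on_id)+

section \<open>$\varphi$-rings\<close>

lemma (in abelian_monoid) finsum_single:
  assumes "finite A" "i \<in> A" "f \<in> A \<rightarrow> carrier G" "\<And>j. j \<in> A \<Longrightarrow> j \<noteq> i \<Longrightarrow> f j = \<zero>"
  shows "finsum G f A = f i"
proof -
  have "finsum G f A = (\<Oplus>j\<in>A. if i = j then f j else \<zero>)"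
    using assms by (intro finsum_cong') auto
  also have "\<dots> = f i" using assms by (intro finsum_singleton) auto
  finally show ?thesis .
qed

lemma (in abelian_monoid) finsum_zeros:
  assumes "\<And>j. j \<in> A \<Longrightarrow> f j = \<zero>"
  shows "finsum G f A = \<zero>"
proof -
  have "finsum G f A = (\<Oplus>j\<in>A. \<zero>)" using assms by (intro finsum_cong') auto
  then show ?thesis by simp
qed

section \<open>Iterating the decomposition of a \<phi>-ring\<close>

lemma digit_less:
  fixes p :: nat
  assumes "j < p" "i < p ^ m" shows "j + p * i < p ^ Suc m"
proof -
  have "j + p * i < p * Suc i" using assms by simp
  also have "\<dots> \<le> p * p ^ m" using assms by (intro mult_le_mono2) simp
  finally show ?thesis by simp
qed

text \<open>Splits off the lowest digit \<open>j\<close> of l = j + p i, in accordance with \<chi>(j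
  + p i) \<phi>(y) = \<chi>(j) \<phi>(\<chi>(i) y).\<close>

lemma (in abelian_group) finsum_group_mod:
  fixes f :: "nat \<Rightarrow> 'a" and p :: nat
  assumes "p > 0" "f \<in> {..<p ^ Suc m} \<rightarrow> carrier G"
  shows "(\<Oplus>l\<in>{..<p ^ Suc m}. f l) = (\<Oplus>j\<in>{..<p}. \<Oplus>i\<in>{..<p ^ m}. f (j + p * i))"
proof -
  note lt = digit_less[where p = p]
  have bij: "bij_betw (\<lambda>(j, i). j + p * i) ({..<p} \<times> {..<p ^ m}) {..<p ^ Suc m}"
  proof (rule bij_betw_byWitness[where f' = "\<lambda>l. (l mod p, l div p)"])
    show "(\<lambda>l. (l mod p, l div p)) ` {..<p ^ Suc m} \<subseteq> {..<p} \<times> {..<p ^ m}"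
      using assms(1) by (auto simp: less_mult_imp_div_less mult.commute)
  qed (use assms(1) lt in auto)
  have "(\<Oplus>l\<in>{..<p ^ Suc m}. f l) = (\<Oplus>z\<in>{..<p} \<times> {..<p ^ m}. f (case z of (j, i) \<Rightarrow> j + p * i))"
    using finsum_reindex[of f "\<lambda>(j, i). j + p * i" "{..<p} \<times> {..<p ^ m}"] bij assms(2)
    by (simp add: bij_betw_def)
  also have "\<dots> = (\<Oplus>j\<in>{..<p}. \<Oplus>i\<in>{..<p ^ m}. f (j + p * i))"
  proof -
    have fc: "f (j + p * i) \<in> carrier G" if "j < p" "i < p ^ m" for i j
      using assms(2) lt[OF that] by auto
    have "(\<Oplus>z\<in>J \<times> {..<p ^ m}. f (case z of (j, i) \<Rightarrow> j + p * i)) = (\<Oplus>j\<in>J. \<Oplus>i\<in>{..<p ^ m}. f (j + p * i))"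
      if "J \<subseteq> {..<p}" for J
      using finite_subset[OF that finite_lessThan] that
    proof (induction J rule: finite_induct)
      case (insert j J)
      have ins: "(\<Oplus>j\<in>insert j J. \<Oplus>i\<in>{..<p ^ m}. f (j + p * i))
          = (\<Oplus>i\<in>{..<p ^ m}. f (j + p * i)) \<oplus> (\<Oplus>j\<in>J. \<Oplus>i\<in>{..<p ^ m}. f (j + p * i))"
        using insert fc by (intro finsum_insert) (auto intro!: finsum_closed)
      have "(\<Oplus>z\<in>insert j J \<times> {..<p ^ m}. f (case z of (j, i) \<Rightarrow> j + p * i))
          = (\<Oplus>z\<in>Pair j ` {..<p ^ m} \<union> J \<times> {..<p ^ m}. f (case z of (j, i) \<Rightarrow> j + p * i))"
        by (rule arg_cong[where f = "finsum G _"]) auto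
      also have "\<dots> = (\<Oplus>z\<in>Pair j ` {..<p ^ m}. f (case z of (j, i) \<Rightarrow> j + p * i))
          \<oplus> (\<Oplus>z\<in>J \<times> {..<p ^ m}. f (case z of (j, i) \<Rightarrow> j + p * i))"
        using insert fc by (intro finsum_Un_disjoint) auto
      also have "(\<Oplus>z\<in>Pair j ` {..<p ^ m}. f (case z of (j, i) \<Rightarrow> j + p * i)) = (\<Oplus>i\<in>{..<p ^ m}. f (j + p * i))"
        using insert fc by (subst finsum_reindex) (auto simp: inj_on_def)
      finally show ?case using insert by (simp add: ins)
    qed simp
    then show ?thesis by blast
  qed
  finally show ?thesis .
qed

locale phi_ring_setting =
  fixes R :: "('r, 'p :: prime_type, 'n :: finite) pg_ring"
  assumes phi_ring: "phi_ring R"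
begin

sublocale R: cring R
  using phi_ring unfolding phi_ring_def by blast

lemma chi_unit: "x \<in> Zp \<Longrightarrow> chi R x \<in> Units R"
  using phi_ring unfolding phi_ring_def by blast

lemma chi_closed [simp]: "x \<in> Zp \<Longrightarrow> chi R x \<in> carrier R"
  using chi_unit by blast

lemma chi_add: "x \<in> Zp \<Longrightarrow> y \<in> Zp \<Longrightarrow> chi R (x + y) = chi R x \<otimes>\<^bsub>R\<^esub> chi R y"
  using phi_ring unfolding phi_ring_def by blast

lemma chi_0: "chi R 0 = \<one>\<^bsub>R\<^esub>"
  using chi_add[of 0 0] chi_unit[of 0] zero_in_Zp
  by (metis R.Units_l_inv_ex R.l_one R.m_assoc R.Units_closed add_0)

lemma phi_hom: "phi R \<in> ring_hom R R"
  using phi_ring unfolding phi_ring_def by blast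

lemma phi_power_hom: "phi R ^^ m \<in> ring_hom R R"
proof (induction m)
  case (Suc m)
  then show ?case using phi_hom by (auto simp: ring_hom_def Pi_iff)
qed (auto simp: ring_hom_def)

lemma phi_power_closed [simp]: "a \<in> carrier R \<Longrightarrow> (phi R ^^ m) a \<in> carrier R"
  using phi_power_hom by (rule ring_hom_closed)

lemma phi_power_zero [simp]: "(phi R ^^ m) \<zero>\<^bsub>R\<^esub> = \<zero>\<^bsub>R\<^esub>"
  using ring_hom_zero[OF phi_power_hom R.ring_axioms R.ring_axioms] .

lemma phi_power_chi: "x \<in> Zp \<Longrightarrow> (phi R ^^ m) (chi R x) = chi R (pp ^ m * x)"
proof (induction m)
  case (Suc m)
  have "phi R (chi R (pp ^ m * x)) = chi R (pp * (pp ^ m * x))"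
    using phi_ring Suc.prems unfolding phi_ring_def by (blast intro: Zp_intros)
  then show ?case using Suc by (simp add: mult.assoc)
qed simp

text \<open>\<chi> is injective, which is impossible in the zero ring. That 1 differs from 0 is what
  turns indexed bases into sets of vectors.\<close>

lemma nontrivial: "\<one>\<^bsub>R\<^esub> \<noteq> \<zero>\<^bsub>R\<^esub>"
proof
  assume "\<one>\<^bsub>R\<^esub> = \<zero>\<^bsub>R\<^esub>"
  then have "carrier R = {\<zero>\<^bsub>R\<^esub>}" using R.one_zeroD by simp
  then have "chi R 0 = chi R 1" using chi_closed[OF zero_in_Zp] chi_closed[OF one_in_Zp] by auto
  moreover have "inj_on (chi R) Zp" using phi_ring unfolding phi_ring_def by blast
  ultimately show False using zero_in_Zp one_in_Zp by (auto dest: inj_onD)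
qed

lemma q_pos: "CARD('p) > 0" "CARD('p) ^ m > 0"
  using card_gt_1[where 'p = 'p] by auto

lemma chi_of_nat_add:
  assumes "y \<in> carrier R"
  shows "chi R (of_nat (j + CARD('p) * i)) \<otimes>\<^bsub>R\<^esub> phi R y = chi R (of_nat j) \<otimes>\<^bsub>R\<^esub> phi R (chi R (of_nat i) \<otimes>\<^bsub>R\<^esub> y)"
proof -
  have "chi R (of_nat (j + CARD('p) * i)) = chi R (of_nat j) \<otimes>\<^bsub>R\<^esub> chi R (pp * of_nat i)"
    using chi_add[of "of_nat j" "pp * of_nat i"] by (simp add: pp_def Zp_mult of_nat_in_Zp)
  also have "chi R (pp * of_nat i) = phi R (chi R (of_nat i))"
    using phi_power_chi[of "of_nat i" 1] by (simp add: of_nat_in_Zp)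
  finally show ?thesis
    using assms phi_power_closed[of "chi R (of_nat i)" 1] phi_power_closed[of y 1]
    by (simp add: ring_hom_mult[OF phi_hom] of_nat_in_Zp R.m_assoc)
qed

lemma decomp_Suc:
  assumes a: "\<And>l. l < CARD('p) ^ Suc m \<Longrightarrow> a l \<in> carrier R"
  shows "(\<Oplus>\<^bsub>R\<^esub>l\<in>{..<CARD('p) ^ Suc m}. chi R (of_nat l) \<otimes>\<^bsub>R\<^esub> (phi R ^^ Suc m) (a l))
    = (\<Oplus>\<^bsub>R\<^esub>j\<in>{..<CARD('p)}. chi R (of_nat j) \<otimes>\<^bsub>R\<^esub>
        phi R (\<Oplus>\<^bsub>R\<^esub>i\<in>{..<CARD('p) ^ m}. chi R (of_nat i) \<otimes>\<^bsub>R\<^esub> (phi R ^^ m) (a (j + CARD('p) * i))))"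
proof -
  note lt = digit_less[where p = "CARD('p)"]
  have "(\<Oplus>\<^bsub>R\<^esub>l\<in>{..<CARD('p) ^ Suc m}. chi R (of_nat l) \<otimes>\<^bsub>R\<^esub> (phi R ^^ Suc m) (a l))
     = (\<Oplus>\<^bsub>R\<^esub>j\<in>{..<CARD('p)}. \<Oplus>\<^bsub>R\<^esub>i\<in>{..<CARD('p) ^ m}. chi R (of_nat (j + CARD('p) * i)) \<otimes>\<^bsub>R\<^esub> (phi R ^^ Suc m) (a (j + CARD('p) * i)))"
    using a q_pos phi_power_closed[of _ "Suc m"] by (intro R.finsum_group_mod) (auto simp: of_nat_in_Zp)
  also have "\<dots> = (\<Oplus>\<^bsub>R\<^esub>j\<in>{..<CARD('p)}. chi R (of_nat j) \<otimes>\<^bsub>R\<^esub>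
        phi R (\<Oplus>\<^bsub>R\<^esub>i\<in>{..<CARD('p) ^ m}. chi R (of_nat i) \<otimes>\<^bsub>R\<^esub> (phi R ^^ m) (a (j + CARD('p) * i))))"
  proof (rule R.finsum_cong'[OF HOL.refl])
    have phic: "phi R x \<in> carrier R" if "x \<in> carrier R" for x using phi_power_closed[OF that, of 1] by simp
    have cl: "(\<Oplus>\<^bsub>R\<^esub>i\<in>{..<CARD('p) ^ m}. chi R (of_nat i) \<otimes>\<^bsub>R\<^esub> (phi R ^^ m) (a (j + CARD('p) * i))) \<in> carrier R" if "j < CARD('p)" for j
      using a lt that by (intro R.finsum_closed) (auto simp: of_nat_in_Zp)
    then show "(\<lambda>j. chi R (of_nat j) \<otimes>\<^bsub>R\<^esub>
        phi R (\<Oplus>\<^bsub>R\<^esub>i\<in>{..<CARD('p) ^ m}. chi R (of_nat i) \<otimes>\<^bsub>R\<^esub> (phi R ^^ m) (a (j + CARD('p) * i)))) \<in> {..<CARD('p)} \<rightarrow> carrier R"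
      by (auto simp: of_nat_in_Zp phic)
    fix j assume j: "j \<in> {..<CARD('p)}"
    let ?f = "\<lambda>i. chi R (of_nat i) \<otimes>\<^bsub>R\<^esub> (phi R ^^ m) (a (j + CARD('p) * i))"
    have f: "?f \<in> {..<CARD('p) ^ m} \<rightarrow> carrier R" using a lt j by (auto simp: of_nat_in_Zp)
    have "(\<Oplus>\<^bsub>R\<^esub>i\<in>{..<CARD('p) ^ m}. chi R (of_nat (j + CARD('p) * i)) \<otimes>\<^bsub>R\<^esub> (phi R ^^ Suc m) (a (j + CARD('p) * i)))
       = (\<Oplus>\<^bsub>R\<^esub>i\<in>{..<CARD('p) ^ m}. chi R (of_nat j) \<otimes>\<^bsub>R\<^esub> phi R (?f i))"
      using f j a lt
      by (intro R.finsum_cong') (auto simp: of_nat_in_Zp phic chi_of_nat_add simp del: of_nat_add of_nat_mult)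
    also have "\<dots> = chi R (of_nat j) \<otimes>\<^bsub>R\<^esub> (\<Oplus>\<^bsub>R\<^esub>i\<in>{..<CARD('p) ^ m}. phi R (?f i))"
      using f phic by (intro R.finsum_rdistr[symmetric]) (auto simp: of_nat_in_Zp)
    also have "(\<Oplus>\<^bsub>R\<^esub>i\<in>{..<CARD('p) ^ m}. phi R (?f i)) = phi R (finsum R ?f {..<CARD('p) ^ m})"
      using f phic ring_hom_add[OF phi_hom]
      by (intro additive_finsum[symmetric]) (auto simp: R.abelian_group_axioms)
    finally show "(\<Oplus>\<^bsub>R\<^esub>i\<in>{..<CARD('p) ^ m}. chi R (of_nat (j + CARD('p) * i)) \<otimes>\<^bsub>R\<^esub> (phi R ^^ Suc m) (a (j + CARD('p) * i)))
      = chi R (of_nat j) \<otimes>\<^bsub>R\<^esub> phi R (finsum R ?f {..<CARD('p) ^ m})" .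
  qed
  finally show ?thesis .
qed

lemma decomp1:
  "r \<in> carrier R \<Longrightarrow> \<exists>!a. a \<in> {..<CARD('p)} \<rightarrow>\<^sub>E carrier R
     \<and> r = (\<Oplus>\<^bsub>R\<^esub>i\<in>{..<CARD('p)}. chi R (of_nat i) \<otimes>\<^bsub>R\<^esub> phi R (a i))"
  using phi_ring unfolding phi_ring_def by blast

text \<open>The coefficient at j + p i for the exponent m + 1 is the coefficient at
  \<open>i\<close>, for the exponent \<open>m\<close>, of the j-th coefficient in the given
  decomposition.\<close>

lemma decomp_ex:
  "r \<in> carrier R \<Longrightarrow> \<exists>a. (\<forall>i < CARD('p) ^ m. a i \<in> carrier R)
     \<and> r = (\<Oplus>\<^bsub>R\<^esub>i\<in>{..<CARD('p) ^ m}. chi R (of_nat i) \<otimes>\<^bsub>R\<^esub> (phi R ^^ m) (a i))"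
proof (induction m arbitrary: r)
  case 0
  have "r = (\<Oplus>\<^bsub>R\<^esub>i\<in>{0::nat}. chi R (of_nat i) \<otimes>\<^bsub>R\<^esub> r)" using 0 by (simp add: chi_0)
  moreover have "{..<CARD('p) ^ 0} = {0}" by auto
  ultimately show ?case using 0 by (intro exI[of _ "\<lambda>_. r"]) (simp del: R.finsum_insert)
next
  case (Suc m)
  obtain b where b: "b \<in> {..<CARD('p)} \<rightarrow>\<^sub>E carrier R" "r = (\<Oplus>\<^bsub>R\<^esub>i\<in>{..<CARD('p)}. chi R (of_nat i) \<otimes>\<^bsub>R\<^esub> phi R (b i))"
    using decomp1[OF Suc.prems] by blast
  have "\<exists>a. (\<forall>i < CARD('p) ^ m. a i \<in> carrier R)
     \<and> b j = (\<Oplus>\<^bsub>R\<^esub>i\<in>{..<CARD('p) ^ m}. chi R (of_nat i) \<otimes>\<^bsub>R\<^esub> (phi R ^^ m) (a i))" if "j < CARD('p)" for j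
    using Suc.IH[of "b j"] b(1) that by auto
  then obtain a where a: "\<And>j i. j < CARD('p) \<Longrightarrow> i < CARD('p) ^ m \<Longrightarrow> a j i \<in> carrier R"
    "\<And>j. j < CARD('p) \<Longrightarrow> b j = (\<Oplus>\<^bsub>R\<^esub>i\<in>{..<CARD('p) ^ m}. chi R (of_nat i) \<otimes>\<^bsub>R\<^esub> (phi R ^^ m) (a j i))" by metis
  define c where "c l = a (l mod CARD('p)) (l div CARD('p))" for l
  have c: "c l \<in> carrier R" if "l < CARD('p) ^ Suc m" for l
    using that q_pos a by (auto simp: c_def less_mult_imp_div_less mult.commute)
  have "r = (\<Oplus>\<^bsub>R\<^esub>l\<in>{..<CARD('p) ^ Suc m}. chi R (of_nat l) \<otimes>\<^bsub>R\<^esub> (phi R ^^ Suc m) (c l))"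
    unfolding b(2)
  proof (subst decomp_Suc[OF c], assumption, rule R.finsum_cong'[OF HOL.refl])
    fix j assume j: "j \<in> {..<CARD('p)}"
    then have "(\<Oplus>\<^bsub>R\<^esub>i\<in>{..<CARD('p) ^ m}. chi R (of_nat i) \<otimes>\<^bsub>R\<^esub> (phi R ^^ m) (c (j + CARD('p) * i))) = b j"
      using a by (auto simp: c_def)
    then show "chi R (of_nat j) \<otimes>\<^bsub>R\<^esub> phi R (b j) = chi R (of_nat j) \<otimes>\<^bsub>R\<^esub>
        phi R (\<Oplus>\<^bsub>R\<^esub>i\<in>{..<CARD('p) ^ m}. chi R (of_nat i) \<otimes>\<^bsub>R\<^esub> (phi R ^^ m) (c (j + CARD('p) * i)))" by simp
  next
    have cl: "(\<Oplus>\<^bsub>R\<^esub>i\<in>{..<CARD('p) ^ m}. chi R (of_nat i) \<otimes>\<^bsub>R\<^esub> (phi R ^^ m) (c (j + CARD('p) * i))) \<in> carrier R" if "j < CARD('p)" for j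
      using a that by (intro R.finsum_closed) (auto simp: of_nat_in_Zp c_def)
    then show "(\<lambda>j. chi R (of_nat j) \<otimes>\<^bsub>R\<^esub>
        phi R (\<Oplus>\<^bsub>R\<^esub>i\<in>{..<CARD('p) ^ m}. chi R (of_nat i) \<otimes>\<^bsub>R\<^esub> (phi R ^^ m) (c (j + CARD('p) * i)))) \<in> {..<CARD('p)} \<rightarrow> carrier R"
      using phi_power_closed[of _ 1] by (auto simp: of_nat_in_Zp)
  qed
  then show ?case using c by blast
qed

text \<open>Uniqueness for the exponent 1 identifies the inner sums for each lowest digit, and the
  induction hypothesis identifies their coefficients.\<close>

lemma decomp_unique:
  assumes "\<And>i. i < CARD('p) ^ m \<Longrightarrow> a i \<in> carrier R" "\<And>i. i < CARD('p) ^ m \<Longrightarrow> b i \<in> carrier R"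
    "(\<Oplus>\<^bsub>R\<^esub>i\<in>{..<CARD('p) ^ m}. chi R (of_nat i) \<otimes>\<^bsub>R\<^esub> (phi R ^^ m) (a i))
     = (\<Oplus>\<^bsub>R\<^esub>i\<in>{..<CARD('p) ^ m}. chi R (of_nat i) \<otimes>\<^bsub>R\<^esub> (phi R ^^ m) (b i))" "i < CARD('p) ^ m"
  shows "a i = b i"
  using assms
proof (induction m arbitrary: a b i)
  case 0
  have "{..<CARD('p) ^ 0} = {0}" by auto
  then show ?case using 0 by (simp add: chi_0)
next
  case (Suc m)
  let ?s = "\<lambda>a j. \<Oplus>\<^bsub>R\<^esub>i\<in>{..<CARD('p) ^ m}. chi R (of_nat i) \<otimes>\<^bsub>R\<^esub> (phi R ^^ m) (a (j + CARD('p) * i))"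
  note lt = digit_less[where p = "CARD('p)"]
  have sc: "?s c j \<in> carrier R" if "j < CARD('p)" "\<And>l. l < CARD('p) ^ Suc m \<Longrightarrow> c l \<in> carrier R" for c j
    using that lt by (intro R.finsum_closed) (auto simp: of_nat_in_Zp)
  let ?r = "\<lambda>c. \<Oplus>\<^bsub>R\<^esub>j\<in>{..<CARD('p)}. chi R (of_nat j) \<otimes>\<^bsub>R\<^esub> phi R (?s c j)"
  have "?r a = (\<Oplus>\<^bsub>R\<^esub>i\<in>{..<CARD('p) ^ Suc m}. chi R (of_nat i) \<otimes>\<^bsub>R\<^esub> (phi R ^^ Suc m) (a i))"
    by (rule decomp_Suc[OF Suc.prems(1), symmetric])
  also note Suc.prems(3)
  also have "(\<Oplus>\<^bsub>R\<^esub>i\<in>{..<CARD('p) ^ Suc m}. chi R (of_nat i) \<otimes>\<^bsub>R\<^esub> (phi R ^^ Suc m) (b i)) = ?r b"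
    by (rule decomp_Suc[OF Suc.prems(2)])
  finally have req: "?r a = ?r b" .
  have sa: "?s a j \<in> carrier R" and sb: "?s b j \<in> carrier R" if "j < CARD('p)" for j
    using that Suc.prems(1,2) by (auto intro!: sc)
  have phic: "phi R x \<in> carrier R" if "x \<in> carrier R" for x using phi_power_closed[OF that, of 1] by simp
  have rc: "?r a \<in> carrier R" using sa by (intro R.finsum_closed) (auto simp: of_nat_in_Zp phic)
  have "?r a = (\<Oplus>\<^bsub>R\<^esub>j\<in>{..<CARD('p)}. chi R (of_nat j) \<otimes>\<^bsub>R\<^esub> phi R ((\<lambda>j\<in>{..<CARD('p)}. ?s a j) j))"
    using sa by (intro R.finsum_cong') (auto simp: of_nat_in_Zp phic)
  moreover have "?r a = (\<Oplus>\<^bsub>R\<^esub>j\<in>{..<CARD('p)}. chi R (of_nat j) \<otimes>\<^bsub>R\<^esub> phi R ((\<lambda>j\<in>{..<CARD('p)}. ?s b j) j))"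
    unfolding req using sb by (intro R.finsum_cong') (auto simp: of_nat_in_Zp phic)
  moreover have "(\<lambda>j\<in>{..<CARD('p)}. ?s a j) \<in> {..<CARD('p)} \<rightarrow>\<^sub>E carrier R"
    "(\<lambda>j\<in>{..<CARD('p)}. ?s b j) \<in> {..<CARD('p)} \<rightarrow>\<^sub>E carrier R" using sa sb by auto
  ultimately have reseq: "(\<lambda>j\<in>{..<CARD('p)}. ?s a j) = (\<lambda>j\<in>{..<CARD('p)}. ?s b j)"
    using decomp1[OF rc] by blast
  have seq: "?s a j = ?s b j" if "j < CARD('p)" for j
    using fun_cong[OF reseq, of j] that by simp
  have j: "i mod CARD('p) < CARD('p)" "i div CARD('p) < CARD('p) ^ m"
    using q_pos Suc.prems(4) by (auto simp: less_mult_imp_div_less mult.commute)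
  have "a (i mod CARD('p) + CARD('p) * (i div CARD('p))) = b (i mod CARD('p) + CARD('p) * (i div CARD('p)))"
    by (rule Suc.IH[of "\<lambda>k. a (i mod CARD('p) + CARD('p) * k)" "\<lambda>k. b (i mod CARD('p) + CARD('p) * k)", OF _ _ seq[OF j(1)] j(2)])
      (use lt[OF j(1)] Suc.prems in auto)
  then show ?case by simp
qed

lemma comps_spec:
  assumes "r \<in> carrier R"
  shows "comps R m r \<in> {..<CARD('p) ^ m} \<rightarrow>\<^sub>E carrier R"
    "(\<Oplus>\<^bsub>R\<^esub>i\<in>{..<CARD('p) ^ m}. chi R (of_nat i) \<otimes>\<^bsub>R\<^esub> (phi R ^^ m) (comps R m r i)) = r"
proof -
  obtain a where a: "\<forall>i < CARD('p) ^ m. a i \<in> carrier R"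
    "r = (\<Oplus>\<^bsub>R\<^esub>i\<in>{..<CARD('p) ^ m}. chi R (of_nat i) \<otimes>\<^bsub>R\<^esub> (phi R ^^ m) (a i))" using decomp_ex[OF assms] by blast
  have "\<exists>!a. a \<in> {..<CARD('p) ^ m} \<rightarrow>\<^sub>E carrier R \<and> r = (\<Oplus>\<^bsub>R\<^esub>i\<in>{..<CARD('p) ^ m}. chi R (of_nat i) \<otimes>\<^bsub>R\<^esub> (phi R ^^ m) (a i))"
  proof (rule ex_ex1I)
    have "r = (\<Oplus>\<^bsub>R\<^esub>i\<in>{..<CARD('p) ^ m}. chi R (of_nat i) \<otimes>\<^bsub>R\<^esub> (phi R ^^ m) (restrict a {..<CARD('p) ^ m} i))"
      unfolding a(2) using a(1) by (intro R.finsum_cong') (auto simp: of_nat_in_Zp)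
    then show "\<exists>a. a \<in> {..<CARD('p) ^ m} \<rightarrow>\<^sub>E carrier R \<and> r = (\<Oplus>\<^bsub>R\<^esub>i\<in>{..<CARD('p) ^ m}. chi R (of_nat i) \<otimes>\<^bsub>R\<^esub> (phi R ^^ m) (a i))"
      using a(1) by (intro exI[of _ "restrict a {..<CARD('p) ^ m}"]) auto
    fix a b
    assume a: "a \<in> {..<CARD('p) ^ m} \<rightarrow>\<^sub>E carrier R \<and> r = (\<Oplus>\<^bsub>R\<^esub>i\<in>{..<CARD('p) ^ m}. chi R (of_nat i) \<otimes>\<^bsub>R\<^esub> (phi R ^^ m) (a i))"
      and b: "b \<in> {..<CARD('p) ^ m} \<rightarrow>\<^sub>E carrier R \<and> r = (\<Oplus>\<^bsub>R\<^esub>i\<in>{..<CARD('p) ^ m}. chi R (of_nat i) \<otimes>\<^bsub>R\<^esub> (phi R ^^ m) (b i))"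
    have ac: "a i \<in> carrier R" "b i \<in> carrier R" if "i < CARD('p) ^ m" for i using a b that by auto
    have "a i = b i" if "i < CARD('p) ^ m" for i
      by (rule decomp_unique[OF ac(1) ac(2) _ that]) (use a b in simp_all)
    then show "a = b"
      using a b by (intro PiE_ext[of a "{..<CARD('p) ^ m}" "\<lambda>_. carrier R" b]) auto
  qed
  from theI'[OF this] show "comps R m r \<in> {..<CARD('p) ^ m} \<rightarrow>\<^sub>E carrier R"
    "(\<Oplus>\<^bsub>R\<^esub>i\<in>{..<CARD('p) ^ m}. chi R (of_nat i) \<otimes>\<^bsub>R\<^esub> (phi R ^^ m) (comps R m r i)) = r"
    unfolding comps_def[symmetric] by simp_all
qed

lemma comps_closed: "r \<in> carrier R \<Longrightarrow> i < CARD('p) ^ m \<Longrightarrow> comps R m r i \<in> carrier R"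
  using comps_spec(1) by fast

lemma comps_unique:
  assumes "\<And>i. i < CARD('p) ^ m \<Longrightarrow> a i \<in> carrier R"
    "r = (\<Oplus>\<^bsub>R\<^esub>i\<in>{..<CARD('p) ^ m}. chi R (of_nat i) \<otimes>\<^bsub>R\<^esub> (phi R ^^ m) (a i))" "i < CARD('p) ^ m"
  shows "comps R m r i = a i"
proof -
  have r: "r \<in> carrier R" unfolding assms(2) using assms(1) by (intro R.finsum_closed) (auto simp: of_nat_in_Zp)
  show ?thesis
    using decomp_unique[of m "comps R m r" a i] comps_closed[OF r] assms comps_spec(2)[OF r] by auto
qed

lemma summand_closed [simp]: "r \<in> carrier R \<Longrightarrow> i < CARD('p) ^ m \<Longrightarrow> summand R m r i \<in> carrier R"
  by (simp add: summand_def comps_closed of_nat_in_Zp)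

lemma summand_add:
  assumes "r \<in> carrier R" "r' \<in> carrier R" "i < CARD('p) ^ m"
  shows "summand R m (r \<oplus>\<^bsub>R\<^esub> r') i = summand R m r i \<oplus>\<^bsub>R\<^esub> summand R m r' i"
proof -
  let ?s = "\<lambda>c i. chi R (of_nat i) \<otimes>\<^bsub>R\<^esub> (phi R ^^ m) (c i)"
  have d: "?s (\<lambda>i. a i \<oplus>\<^bsub>R\<^esub> b i) i = ?s a i \<oplus>\<^bsub>R\<^esub> ?s b i"
    if "a i \<in> carrier R" "b i \<in> carrier R" for a b i
    using that by (simp add: ring_hom_add[OF phi_power_hom] R.r_distr of_nat_in_Zp)
  have "comps R m (r \<oplus>\<^bsub>R\<^esub> r') i = comps R m r i \<oplus>\<^bsub>R\<^esub> comps R m r' i"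
  proof (rule comps_unique[OF _ _ assms(3)])
    have "r \<oplus>\<^bsub>R\<^esub> r' = (\<Oplus>\<^bsub>R\<^esub>i\<in>{..<CARD('p) ^ m}. ?s (comps R m r) i) \<oplus>\<^bsub>R\<^esub> (\<Oplus>\<^bsub>R\<^esub>i\<in>{..<CARD('p) ^ m}. ?s (comps R m r') i)"
      using comps_spec(2) assms by simp
    also have "\<dots> = (\<Oplus>\<^bsub>R\<^esub>i\<in>{..<CARD('p) ^ m}. ?s (comps R m r) i \<oplus>\<^bsub>R\<^esub> ?s (comps R m r') i)"
      using comps_closed assms by (intro R.finsum_addf[symmetric]) (auto simp: of_nat_in_Zp)
    also have "\<dots> = (\<Oplus>\<^bsub>R\<^esub>i\<in>{..<CARD('p) ^ m}. ?s (\<lambda>i. comps R m r i \<oplus>\<^bsub>R\<^esub> comps R m r' i) i)"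
      using comps_closed assms by (intro R.finsum_cong') (auto simp: of_nat_in_Zp d)
    finally show "r \<oplus>\<^bsub>R\<^esub> r' = \<dots>" .
  qed (use comps_closed assms in auto)
  then show ?thesis unfolding summand_def using comps_closed assms by (simp add: d)
qed

lemma summand_zero: "i < CARD('p) ^ m \<Longrightarrow> summand R m \<zero>\<^bsub>R\<^esub> i = \<zero>\<^bsub>R\<^esub>"
  using summand_add[of "\<zero>\<^bsub>R\<^esub>" "\<zero>\<^bsub>R\<^esub>" i m] summand_closed[of "\<zero>\<^bsub>R\<^esub>" i m] R.add.l_cancel_one'
  by simp

text \<open>\<chi>(i + p^m y) \<phi>^m'(a) = \<chi>(i) \<phi>^m(\<chi>(y) \<phi>^(m'-m)(a)): for an
  exponent of at least \<open>m\<close>, such an element is concentrated in a single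
  summand.\<close>

lemma summand_gen:
  assumes a: "a \<in> carrier R" and y: "y \<in> Zp" and i: "i < CARD('p) ^ m" "j < CARD('p) ^ m" and "m \<le> m'"
  shows "summand R m (chi R (of_nat i + pp ^ m * y) \<otimes>\<^bsub>R\<^esub> (phi R ^^ m') a) j
    = (if j = i then chi R (of_nat i + pp ^ m * y) \<otimes>\<^bsub>R\<^esub> (phi R ^^ m') a else \<zero>\<^bsub>R\<^esub>)"
proof -
  let ?a = "(phi R ^^ (m' - m)) a"
  let ?c = "\<lambda>j. if j = i then chi R y \<otimes>\<^bsub>R\<^esub> ?a else \<zero>\<^bsub>R\<^esub>"
  let ?r = "chi R (of_nat i + pp ^ m * y) \<otimes>\<^bsub>R\<^esub> (phi R ^^ m') a"
  have "(phi R ^^ m') a = (phi R ^^ m) ?a" using \<open>m \<le> m'\<close> by (metis funpow_add le_add_diff_inverse o_apply)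
  then have r: "?r = chi R (of_nat i) \<otimes>\<^bsub>R\<^esub> (phi R ^^ m) (chi R y \<otimes>\<^bsub>R\<^esub> ?a)"
    using a y by (simp add: chi_add of_nat_in_Zp Zp_intros ring_hom_mult[OF phi_power_hom] phi_power_chi R.m_assoc)
  have "(\<Oplus>\<^bsub>R\<^esub>j\<in>{..<CARD('p) ^ m}. chi R (of_nat j) \<otimes>\<^bsub>R\<^esub> (phi R ^^ m) (?c j)) = chi R (of_nat i) \<otimes>\<^bsub>R\<^esub> (phi R ^^ m) (?c i)"
    using a y i by (intro R.finsum_single) (auto simp: of_nat_in_Zp)
  then have "comps R m ?r j = ?c j"
    using r a y i by (intro comps_unique) auto
  then show ?thesis using r a y i unfolding summand_def by (auto simp: of_nat_in_Zp)
qed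

text \<open>For every exponent the elements \<chi>(x) \<phi>^m(a) generate \<open>R\<close>
  additively, so \<open>m\<close> may be taken as large as a computation wants.\<close>

lemma R_induct [consumes 1, case_names zero gen add]:
  assumes "r \<in> carrier R" "P \<zero>\<^bsub>R\<^esub>"
    "\<And>x a. x \<in> Zp \<Longrightarrow> a \<in> carrier R \<Longrightarrow> P (chi R x \<otimes>\<^bsub>R\<^esub> (phi R ^^ m) a)"
    "\<And>r r'. r \<in> carrier R \<Longrightarrow> r' \<in> carrier R \<Longrightarrow> P r \<Longrightarrow> P r' \<Longrightarrow> P (r \<oplus>\<^bsub>R\<^esub> r')"
  shows "P r"
proof -
  obtain a where a: "\<forall>i < CARD('p) ^ m. a i \<in> carrier R"
    "r = (\<Oplus>\<^bsub>R\<^esub>i\<in>{..<CARD('p) ^ m}. chi R (of_nat i) \<otimes>\<^bsub>R\<^esub> (phi R ^^ m) (a i))" using decomp_ex[OF assms(1)] by blast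
  have "P (\<Oplus>\<^bsub>R\<^esub>i\<in>I. chi R (of_nat i) \<otimes>\<^bsub>R\<^esub> (phi R ^^ m) (a i))" if "I \<subseteq> {..<CARD('p) ^ m}" for I
    using finite_subset[OF that finite_lessThan] that
  proof (induction I rule: finite_induct)
    case (insert i I)
    then have "(\<lambda>i. chi R (of_nat i) \<otimes>\<^bsub>R\<^esub> (phi R ^^ m) (a i)) \<in> insert i I \<rightarrow> carrier R"
      using a(1) by (auto simp: of_nat_in_Zp)
    then show ?case using insert a(1) by (auto simp: of_nat_in_Zp intro!: assms(3,4) R.finsum_closed)
  qed (simp add: assms(2))
  then show ?thesis using a(2) by blast
qed

end

section \<open>Matrix groups and tori\<close>

lemma matrix_inv_mult:
  assumes "invertible (A :: 'a :: semiring_1 ^ 'n ^ 'n)"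
  shows "A ** matrix_inv A = mat 1" "matrix_inv A ** A = mat 1"
proof -
  have "\<exists>A'. A ** A' = mat 1 \<and> A' ** A = mat 1" using assms by (simp add: invertible_def)
  from someI_ex[OF this] show "A ** matrix_inv A = mat 1" "matrix_inv A ** A = mat 1"
    by (simp_all add: matrix_inv_def)
qed

lemma matrix_inv_eqI:
  assumes "A ** B = mat 1" "B ** A = mat (1 :: 'a :: semiring_1)"
  shows "matrix_inv (A :: 'a ^ 'n ^ 'n) = B"
proof -
  have "invertible A" using assms by (auto simp: invertible_def)
  then have "matrix_inv A ** (A ** B) = B" by (simp add: matrix_mul_assoc matrix_inv_mult)
  then show ?thesis using assms by simp
qed

lemma invertible_matrix_inv: "invertible A \<Longrightarrow> invertible (matrix_inv (A :: 'a :: semiring_1 ^ 'n ^ 'n))"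
  using matrix_inv_mult[of A] by (auto simp: invertible_def)

lemma invertible_matrix_mult:
  fixes A B :: "'a :: semiring_1 ^ 'n ^ 'n"
  assumes "invertible A" "invertible B"
  shows "invertible (A ** B)" "matrix_inv (A ** B) = matrix_inv B ** matrix_inv A"
proof -
  have "(A ** B) ** (matrix_inv B ** matrix_inv A) = A ** (B ** matrix_inv B) ** matrix_inv A"
    "(matrix_inv B ** matrix_inv A) ** (A ** B) = matrix_inv B ** (matrix_inv A ** A) ** B"
    by (simp_all only: matrix_mul_assoc)
  then have *: "(A ** B) ** (matrix_inv B ** matrix_inv A) = mat 1"
    "(matrix_inv B ** matrix_inv A) ** (A ** B) = mat 1"
    by (simp_all add: matrix_inv_mult assms)
  then show "invertible (A ** B)" by (auto simp: invertible_def)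
  show "matrix_inv (A ** B) = matrix_inv B ** matrix_inv A" using * by (rule matrix_inv_eqI)
qed

lemma invertible_mat1: "invertible (mat 1 :: 'a :: semiring_1 ^ 'n ^ 'n)"
  unfolding invertible_def by (intro exI[of _ "mat 1"]) simp

lemma matrix_inv_mat1 [simp]: "matrix_inv (mat 1 :: 'a :: semiring_1 ^ 'n ^ 'n) = mat 1"
  by (rule matrix_inv_eqI) simp_all

lemma GL_simps [simp]: "carrier GL = {g. invertible g}" "mult GL = (**)" "one GL = mat 1"
  by (simp_all add: GL_def)

lemma group_GL: "group (GL :: ('a :: field ^ 'n ^ 'n) monoid)"
proof (rule groupI)
  fix x :: "'a ^ 'n ^ 'n" assume "x \<in> carrier GL"
  then show "\<exists>y\<in>carrier GL. y \<otimes>\<^bsub>GL\<^esub> x = \<one>\<^bsub>GL\<^esub>"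
    by (intro bexI[of _ "matrix_inv x"]) (auto simp: matrix_inv_mult invertible_matrix_inv)
qed (auto simp: invertible_matrix_mult invertible_mat1 matrix_mul_assoc)

interpretation GL: group "GL :: ('a :: field ^ 'n ^ 'n) monoid" by (rule group_GL)

lemma inv_GL: "invertible x \<Longrightarrow> inv\<^bsub>GL\<^esub> x = matrix_inv (x :: 'a :: field ^ 'n ^ 'n)"
  by (rule GL.inv_equality) (auto simp: matrix_inv_mult invertible_matrix_inv)

lemma subgroup_GL_iff:
  "subgroup H (GL :: ('a :: field ^ 'n ^ 'n) monoid) \<longleftrightarrow>
    (\<forall>x\<in>H. invertible x \<and> matrix_inv x \<in> H) \<and> mat 1 \<in> H \<and> (\<forall>x\<in>H. \<forall>y\<in>H. x ** y \<in> H)"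
  (is "_ \<longleftrightarrow> ?R")
proof
  assume "subgroup H (GL :: ('a ^ 'n ^ 'n) monoid)"
  then interpret subgroup H "GL :: ('a ^ 'n ^ 'n) monoid" .
  show ?R using subset m_inv_closed m_closed one_closed by (auto simp: inv_GL subset_iff)
next
  assume ?R
  show "subgroup H GL"
  proof (rule GL.subgroupI)
    show "inv\<^bsub>GL\<^esub> a \<in> H" if "a \<in> H" for a
      using \<open>?R\<close> that inv_GL[of a] by simp
  qed (use \<open>?R\<close> in auto)
qed

lemma conjg_mult: "invertible t \<Longrightarrow> conjg t (x ** y) = conjg t x ** conjg t y"
proof -
  assume t: "invertible t"
  have "conjg t x ** conjg t y = t ** x ** (matrix_inv t ** t) ** y ** matrix_inv t"
    unfolding conjg_def by (simp only: matrix_mul_assoc)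
  then show ?thesis using t by (simp add: matrix_inv_mult conjg_def matrix_mul_assoc)
qed

lemma conjg_conjg: "invertible t \<Longrightarrow> invertible t' \<Longrightarrow> conjg (t ** t') x = conjg t (conjg t' x)"
  by (simp add: conjg_def invertible_matrix_mult matrix_mul_assoc)

lemma conjg_one [simp]: "conjg (mat 1) x = x" by (simp add: conjg_def)

lemma conjg_mat1 [simp]: "invertible t \<Longrightarrow> conjg t (mat 1) = mat 1"
  by (simp add: conjg_def matrix_inv_mult)

lemma conjg_inverse: "invertible t \<Longrightarrow> conjg (matrix_inv t) (conjg t x) = x"
  "invertible t \<Longrightarrow> conjg t (conjg (matrix_inv t) x) = x"
  using conjg_conjg[of "matrix_inv t" t x] conjg_conjg[of t "matrix_inv t" x]
  by (simp_all add: matrix_inv_mult invertible_matrix_inv)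

lemma conjg_eq_iff: "invertible t \<Longrightarrow> conjg t x = conjg t y \<longleftrightarrow> x = y"
  using conjg_inverse(1) by metis

lemma conjg_matrix_inv:
  assumes "invertible t" "invertible x"
  shows "conjg t (matrix_inv x) = matrix_inv (conjg t x)"
  by (rule matrix_inv_eqI[symmetric]) (simp_all add: conjg_mult[symmetric] matrix_inv_mult assms)

lemma emb_mult: "emb (A ** B) = emb A ** emb (B :: 'k :: field ^ 'n :: finite ^ 'n)"
  by (simp add: vec_eq_iff matrix_matrix_mult_def to_ac_sum)

lemma emb_mat1 [simp]: "emb (mat 1 :: 'k :: field ^ 'n :: finite ^ 'n) = mat 1"
  by (simp add: vec_eq_iff mat_def)

lemma emb_eq_iff [simp]: "emb A = emb B \<longleftrightarrow> A = B"
  by (simp add: vec_eq_iff)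

lemma det_emb: "det (emb A) = to_ac (det (A :: 'k :: field ^ 'n :: finite ^ 'n))"
  by (simp add: det_def to_ac_sum to_ac_prod)

lemma invertible_emb_iff: "invertible (emb A) \<longleftrightarrow> invertible (A :: 'k :: field ^ 'n :: finite ^ 'n)"
  by (simp add: invertible_det_nz det_emb)

lemma emb_matrix_inv: "invertible A \<Longrightarrow> emb (matrix_inv A) = matrix_inv (emb (A :: 'k :: field ^ 'n :: finite ^ 'n))"
  by (rule matrix_inv_eqI[symmetric]) (simp_all add: emb_mult[symmetric] matrix_inv_mult)

lemma emb_conjg: "invertible t \<Longrightarrow> emb (conjg t g) = conjg (emb t) (emb (g :: 'k :: field ^ 'n :: finite ^ 'n))"
  by (simp add: conjg_def emb_mult emb_matrix_inv)

lemma subgroup_pts: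
  assumes "subgroup H GL" shows "subgroup (pts H) (GL :: ('k :: field ^ 'n :: finite ^ 'n) monoid)"
  using assms unfolding subgroup_GL_iff pts_def
  by (auto simp: emb_mult emb_matrix_inv invertible_emb_iff)

lemma diagonal_mult:
  fixes A B :: "'a :: comm_ring_1 ^ 'n ^ 'n"
  assumes "\<And>i j. i \<noteq> j \<Longrightarrow> vec_nth (vec_nth A i) j = 0" "\<And>i j. i \<noteq> j \<Longrightarrow> vec_nth (vec_nth B i) j = 0"
  shows "A ** B = (\<chi> i j. if i = j then vec_nth (vec_nth A i) i * vec_nth (vec_nth B i) i else 0)"
proof -
  have "vec_nth (vec_nth (A ** B) i) j = (\<Sum>k\<in>UNIV. if k = i then vec_nth (vec_nth A i) i * vec_nth (vec_nth B i) j else 0)" for i j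
  proof -
    have "vec_nth (vec_nth (A ** B) i) j = (\<Sum>k\<in>UNIV. vec_nth (vec_nth A i) k * vec_nth (vec_nth B k) j)"
      by (simp add: matrix_matrix_mult_def)
    also have "\<dots> = (\<Sum>k\<in>UNIV. if k = i then vec_nth (vec_nth A i) i * vec_nth (vec_nth B i) j else 0)"
      using assms(1)[of i] by (intro sum.cong) (metis mult_zero_left)+
    finally show ?thesis .
  qed
  then show ?thesis using assms by (auto simp: vec_eq_iff)
qed

text \<open>One change of basis makes all of \<open>T\<close> diagonal. The resulting commutativity
  of the torus is what lets every \<open>t\<close> commute with \<open>s\<close>.\<close>

lemma diagonalizable_commute:
  assumes "diagonalizable_by E T" "t \<in> T" "t' \<in> T"
  shows "t ** t' = t' ** t"
proof -
  obtain g where g: "invertible g" "\<forall>t\<in>T. \<forall>i j. i \<noteq> j \<longrightarrow> vec_nth (vec_nth (conjg g t) i) j = 0"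
    using assms(1) unfolding diagonalizable_by_def by (elim bexE conjE)
  have d: "vec_nth (vec_nth (conjg g t) i) j = 0" "vec_nth (vec_nth (conjg g t') i) j = 0" if "i \<noteq> j" for i j
    using g(2) assms(2,3) that by blast+
  have "conjg g t ** conjg g t' = conjg g t' ** conjg g t"
    using diagonal_mult[of "conjg g t" "conjg g t'"] diagonal_mult[of "conjg g t'" "conjg g t"] d
    by (auto simp: vec_eq_iff mult.commute)
  then show ?thesis using g(1) by (simp add: conjg_mult[symmetric] conjg_eq_iff)
qed

lemma root_subgroupE:
  assumes "root_subgroup G T \<beta> U"
  obtains x where "U = range x" "\<forall>a b. x (a + b) = x a ** x b"
    "\<forall>t\<in>T. \<forall>a. conjg t (x a) = x (\<beta> t * a)"
proof -
  note * = assms[unfolded root_subgroup_def, THEN conjunct2, THEN conjunct2]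
  from * show thesis
  proof (rule exE)
    fix x
    assume x: "U = range x
        \<and> (\<exists>q. (\<forall>i j l. Polynomial.coeff (q i j) l \<in> kk) \<and> (\<forall>a i j. vec_nth (vec_nth (x a) i) j = poly (q i j) a))
        \<and> (\<exists>f \<in> pfun kk. \<forall>a. f (x a) = a)
        \<and> (\<forall>a b. x (a + b) = x a ** x b)
        \<and> (\<forall>t\<in>T. \<forall>a. conjg t (x a) = x (\<beta> t * a))"
    show thesis
      by (rule that[OF x[THEN conjunct1] x[THEN conjunct2, THEN conjunct2, THEN conjunct2, THEN conjunct1]
        x[THEN conjunct2, THEN conjunct2, THEN conjunct2, THEN conjunct2]])
  qed
qed

section \<open>The torus, the functional \<ell> and conjugation by \<open>s\<close> on N_0\<close>

locale group_data =
  fixes \<G> :: "('p :: prime_type, 'n :: finite) datum"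
  assumes group_setting: "group_setting \<G>"
begin

lemma setting:
  "split_reductive_setting \<G>" "subgroup (N0 \<G>) (GL\<lparr>carrier := pts (uni \<G>)\<rparr>)" "compact (N0 \<G>)"
  "openin (top_of_set (pts (uni \<G>))) (N0 \<G>)" "totally_decomposed \<G>" "simple_coordinates \<G>"
  "simple_projection \<G>" "ell \<G> ` N0 \<G> = Zp" "coch \<G> \<in> cocharacters (tor \<G>)"
  by (insert group_setting[unfolded group_setting_def], (elim conjE, assumption)+)

lemma simple_coch: "\<alpha> \<in> simple \<G> \<Longrightarrow> x \<noteq> 0 \<Longrightarrow> \<alpha> (coch \<G> x) = x"
  by (insert group_setting[unfolded group_setting_def], elim conjE) simp

lemma reductive:
  "maximal_split_torus (grp \<G>) (tor \<G>)" "borel_subgroup (grp \<G>) (bor \<G>)"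
  "unipotent_radical (bor \<G>) (uni \<G>)" "bor \<G> = tor \<G> <#>\<^bsub>GL\<^esub> uni \<G>"
  "simple_roots (tor \<G>) (roots (grp \<G>) (tor \<G>)) (pos \<G>) (simple \<G>)"
  by (insert setting(1)[unfolded split_reductive_setting_def], (elim conjE, assumption)+)

lemma root_subgroup: "\<beta> \<in> pos \<G> \<Longrightarrow> root_subgroup (grp \<G>) (tor \<G>) \<beta> (rootgrp \<G> \<beta>)"
  by (insert setting(1)[unfolded split_reductive_setting_def], elim conjE, simp)

lemma tor_subgroup: "subgroup (tor \<G>) GL" and tor_diag: "diagonalizable_by (range emb) (tor \<G>)"
  using reductive(1) by (simp_all add: maximal_split_torus_def split_torus_def alg_group_def)

lemma bor_subgroup: "subgroup (bor \<G>) GL"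
  using reductive(2) by (simp add: borel_subgroup_def alg_group_def)

lemma uni_subgroup: "subgroup (uni \<G>) GL" and uni_normal: "uni \<G> \<lhd> GL\<lparr>carrier := bor \<G>\<rparr>"
  using reductive(3) by (simp_all add: unipotent_radical_def normal_unipotent_def alg_group_def)

lemma pts_uni_subgroup: "subgroup (pts (uni \<G>)) GL" by (rule subgroup_pts[OF uni_subgroup])
lemma pts_tor_subgroup: "subgroup (pts (tor \<G>)) GL" by (rule subgroup_pts[OF tor_subgroup])

lemma N0_subgroup: "subgroup (N0 \<G>) GL"
  by (rule GL.incl_subgroup[OF pts_uni_subgroup setting(2)])

lemma N0_uni: "N0 \<G> \<subseteq> pts (uni \<G>)"
  using subgroup.subset[OF setting(2)] by simp

lemma tor_bor: "tor \<G> \<subseteq> bor \<G>"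
proof -
  have "mat 1 \<in> uni \<G>" using uni_subgroup by (simp add: subgroup_GL_iff)
  then show ?thesis unfolding reductive(4) set_mult_def by force
qed

lemma conjg_uni: "t \<in> tor \<G> \<Longrightarrow> u \<in> uni \<G> \<Longrightarrow> conjg t u \<in> uni \<G>"
proof -
  assume t: "t \<in> tor \<G>" and u: "u \<in> uni \<G>"
  have tb: "t \<in> bor \<G>" using t tor_bor by blast
  have "t \<otimes>\<^bsub>GL\<lparr>carrier := bor \<G>\<rparr>\<^esub> u \<otimes>\<^bsub>GL\<lparr>carrier := bor \<G>\<rparr>\<^esub> inv\<^bsub>GL\<lparr>carrier := bor \<G>\<rparr>\<^esub> t \<in> uni \<G>"
    using normal.inv_op_closed2[OF uni_normal, of t u] tb u by simp
  moreover have "inv\<^bsub>GL\<lparr>carrier := bor \<G>\<rparr>\<^esub> t = matrix_inv t"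
    using GL.m_inv_consistent[OF bor_subgroup tb] bor_subgroup tb by (simp add: inv_GL subgroup_GL_iff)
  ultimately show ?thesis by (simp add: conjg_def)
qed

lemma tor_invertible: "t \<in> pts (tor \<G>) \<Longrightarrow> invertible t"
  using pts_tor_subgroup by (simp add: subgroup_GL_iff)

lemma tor_commute: "t \<in> pts (tor \<G>) \<Longrightarrow> t' \<in> pts (tor \<G>) \<Longrightarrow> t ** t' = t' ** t"
  using diagonalizable_commute[OF tor_diag, of "emb t" "emb t'"]
  by (simp add: pts_def emb_mult[symmetric])

lemma conjg_pts_uni: "t \<in> pts (tor \<G>) \<Longrightarrow> u \<in> pts (uni \<G>) \<Longrightarrow> conjg t u \<in> pts (uni \<G>)"
  using conjg_uni tor_invertible by (auto simp: pts_def emb_conjg)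

lemma N0_invertible: "n \<in> N0 \<G> \<Longrightarrow> invertible n"
  and N0_inv: "n \<in> N0 \<G> \<Longrightarrow> matrix_inv n \<in> N0 \<G>"
  and N0_one: "mat 1 \<in> N0 \<G>"
  and N0_mult: "m \<in> N0 \<G> \<Longrightarrow> n \<in> N0 \<G> \<Longrightarrow> m ** n \<in> N0 \<G>"
  using N0_subgroup by (simp_all add: subgroup_GL_iff)

text \<open>The entries are Laurent polynomials with coefficients in the ground field. Hence the
  inverse of \<open>emb\<close> in the definition of \<open>xi\<close> is applied inside the range
  of \<open>emb\<close>.\<close>

lemma coch_rational: "u \<noteq> 0 \<Longrightarrow> coch \<G> (to_ac u) \<in> range emb"
proof -
  assume u: "u \<noteq> 0"
  have "\<exists>q m. (\<forall>i j l. Polynomial.coeff (q i j) l \<in> kk)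
      \<and> (\<forall>x i j. x \<noteq> 0 \<longrightarrow> vec_nth (vec_nth (coch \<G> x) i) j = poly (q i j) x / x ^ m)"
    using setting(9) unfolding cocharacters_def by (elim CollectE conjE)
  then obtain q m where q: "\<forall>i j l. Polynomial.coeff (q i j) l \<in> kk"
    "\<forall>x i j. x \<noteq> 0 \<longrightarrow> vec_nth (vec_nth (coch \<G> x) i) j = poly (q i j) x / x ^ m"
    by (elim exE conjE)
  have "poly (q i j) (to_ac u) \<in> kk" for i j
  proof -
    define a where "a l = inv_into UNIV to_ac (Polynomial.coeff (q i j) l)" for l
    have a: "Polynomial.coeff (q i j) l = to_ac (a l)" for l
      unfolding a_def using f_inv_into_f[of "Polynomial.coeff (q i j) l" to_ac UNIV] q(1) by simp
    have "poly (q i j) (to_ac u) = to_ac (\<Sum>l\<le>Polynomial.degree (q i j). a l * u ^ l)"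
      by (simp add: poly_altdef a to_ac_sum)
    then show ?thesis by blast
  qed
  then have b: "poly (q i j) (to_ac u) = to_ac (inv_into UNIV to_ac (poly (q i j) (to_ac u)))" for i j
    by (simp add: f_inv_into_f)
  define b where "b i j = inv_into UNIV to_ac (poly (q i j) (to_ac u))" for i j
  have "coch \<G> (to_ac u) = emb (\<chi> i j. b i j / u ^ m)"
    using u q(2) b by (simp add: vec_eq_iff b_def)
  then show ?thesis by blast
qed

lemma emb_xi: "u \<noteq> 0 \<Longrightarrow> emb (xi \<G> u) = coch \<G> (to_ac u)"
  unfolding xi_def using coch_rational by (simp add: f_inv_into_f)

lemma xi_tor: "u \<noteq> 0 \<Longrightarrow> xi \<G> u \<in> pts (tor \<G>)"
  using setting(9) unfolding pts_def cocharacters_def by (simp add: emb_xi)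

lemma xi_mult: "u \<noteq> 0 \<Longrightarrow> v \<noteq> 0 \<Longrightarrow> xi \<G> (u * v) = xi \<G> u ** xi \<G> v"
  using setting(9) unfolding cocharacters_def
  by (subst emb_eq_iff[symmetric]) (simp add: emb_xi emb_mult del: emb_eq_iff)

lemma xi_1: "xi \<G> 1 = mat 1"
proof -
  have i: "invertible (xi \<G> 1)" using tor_invertible[OF xi_tor] by simp
  have "matrix_inv (xi \<G> 1) ** (xi \<G> 1 ** xi \<G> 1) = matrix_inv (xi \<G> 1) ** xi \<G> 1"
    using xi_mult[of 1 1] by simp
  then show ?thesis using i by (simp add: matrix_mul_assoc matrix_inv_mult)
qed

lemma ss_tor: "ss \<G> \<in> pts (tor \<G>)" unfolding ss_def by (rule xi_tor[OF pp_nonzero])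

lemma emb_ss: "emb (ss \<G>) = coch \<G> (to_ac pp)" unfolding ss_def by (rule emb_xi[OF pp_nonzero])

lemma simple_pos: "simple \<G> \<subseteq> pos \<G>" and finite_simple: "finite (simple \<G>)"
  by (insert reductive(5)[unfolded simple_roots_def], (elim conjE, assumption)+)

lemma rootgrp_subgroup: "\<beta> \<in> pos \<G> \<Longrightarrow> subgroup (pts (rootgrp \<G> \<beta>)) GL"
  using root_subgroup by (intro subgroup_pts) (auto simp: root_subgroup_def alg_group_def)

lemma crd_add: "\<alpha> \<in> simple \<G> \<Longrightarrow> m \<in> pts (rootgrp \<G> \<alpha>) \<Longrightarrow> n \<in> pts (rootgrp \<G> \<alpha>) \<Longrightarrow>
    crd \<G> \<alpha> (m ** n) = crd \<G> \<alpha> m + crd \<G> \<alpha> n"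
  using setting(6) unfolding simple_coordinates_def by blast

lemma crd_one: "\<alpha> \<in> simple \<G> \<Longrightarrow> crd \<G> \<alpha> (mat 1) = 0"
proof -
  assume \<alpha>: "\<alpha> \<in> simple \<G>"
  then have "\<alpha> \<in> pos \<G>" using simple_pos by blast
  then have "mat 1 \<in> pts (rootgrp \<G> \<alpha>)" using rootgrp_subgroup by (simp add: subgroup_GL_iff)
  from crd_add[OF \<alpha> this this] have "crd \<G> \<alpha> (mat 1) + 0 = crd \<G> \<alpha> (mat 1) + crd \<G> \<alpha> (mat 1)" by simp
  then show ?thesis by (metis add_left_cancel)
qed

lemma prj_in: "n \<in> pts (uni \<G>) \<Longrightarrow> \<alpha> \<in> simple \<G> \<Longrightarrow> prj \<G> n \<alpha> \<in> pts (rootgrp \<G> \<alpha>)"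
  and prj_mult: "m \<in> pts (uni \<G>) \<Longrightarrow> n \<in> pts (uni \<G>) \<Longrightarrow> \<alpha> \<in> simple \<G> \<Longrightarrow>
    prj \<G> (m ** n) \<alpha> = prj \<G> m \<alpha> ** prj \<G> n \<alpha>"
  and prj_root: "\<beta> \<in> pos \<G> \<Longrightarrow> n \<in> pts (rootgrp \<G> \<beta>) \<Longrightarrow> \<alpha> \<in> simple \<G> \<Longrightarrow>
    prj \<G> n \<alpha> = (if \<alpha> = \<beta> then n else mat 1)"
  using setting(7) unfolding simple_projection_def by blast+

lemma ell_mult_uni: "m \<in> pts (uni \<G>) \<Longrightarrow> n \<in> pts (uni \<G>) \<Longrightarrow> ell \<G> (m ** n) = ell \<G> m + ell \<G> n"
  unfolding ell_def by (simp add: prj_mult prj_in crd_add sum.distrib distrib_left)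

lemma ell_mult: "m \<in> N0 \<G> \<Longrightarrow> n \<in> N0 \<G> \<Longrightarrow> ell \<G> (m ** n) = ell \<G> m + ell \<G> n"
  using ell_mult_uni N0_uni by blast

lemma ell_one: "ell \<G> (mat 1) = 0"
  using ell_mult[OF N0_one N0_one] add_left_cancel[of "ell \<G> (mat 1)" 0 "ell \<G> (mat 1)"] by simp

lemma ell_inv: "n \<in> N0 \<G> \<Longrightarrow> ell \<G> (matrix_inv n) = - ell \<G> n"
  using ell_mult[of n "matrix_inv n"] N0_inv by (simp add: matrix_inv_mult N0_invertible ell_one add_eq_0_iff)

lemma ell_Zp: "n \<in> N0 \<G> \<Longrightarrow> ell \<G> n \<in> Zp"
  using setting(8) by blast

lemma ell_root:
  assumes "\<beta> \<in> pos \<G>" "n \<in> pts (rootgrp \<G> \<beta>)"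
  shows "ell \<G> n = (if \<beta> \<in> simple \<G> then cf \<G> \<beta> * crd \<G> \<beta> n else 0)"
proof -
  have "ell \<G> n = (\<Sum>\<alpha>\<in>simple \<G>. if \<alpha> = \<beta> then cf \<G> \<beta> * crd \<G> \<beta> n else 0)"
    unfolding ell_def using assms by (intro sum.cong) (auto simp: prj_root crd_one)
  then show ?thesis using finite_simple by simp
qed

text \<open>A positive root is a product of simple roots with natural exponents, and each simple
  root takes the value \<open>p\<close> at s = \<xi>(p). That the value is a natural number turns
  conjugation by \<open>s\<close> into a power map on each root subgroup.\<close>

lemma root_value_ss:
  assumes "\<beta> \<in> pos \<G>"
  shows "\<exists>k. \<beta> (emb (ss \<G>)) = of_nat k \<and> (\<beta> \<in> simple \<G> \<longrightarrow> k = CARD('p))"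
proof -
  have simple: "\<alpha> (emb (ss \<G>)) = of_nat CARD('p)" if "\<alpha> \<in> simple \<G>" for \<alpha>
  proof -
    have "\<alpha> (emb (ss \<G>)) = to_ac pp"
      unfolding emb_ss using simple_coch[OF that, of "to_ac pp"] pp_nonzero[where 'p = 'p] by simp
    then show ?thesis by (simp add: pp_def)
  qed
  show ?thesis
proof (cases "\<beta> \<in> simple \<G>")
  case True
  then show ?thesis using simple by blast
next
  case False
  have "pos \<G> = {\<beta> \<in> roots (grp \<G>) (tor \<G>). \<exists>m :: _ \<Rightarrow> nat. \<forall>t\<in>tor \<G>. \<beta> t = (\<Prod>\<alpha>\<in>simple \<G>. \<alpha> t ^ m \<alpha>)}"
    by (insert reductive(5)[unfolded simple_roots_def], elim conjE, assumption)
  with assms have "\<exists>m :: _ \<Rightarrow> nat. \<forall>t\<in>tor \<G>. \<beta> t = (\<Prod>\<alpha>\<in>simple \<G>. \<alpha> t ^ m \<alpha>)" by simp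
  then obtain m :: "_ \<Rightarrow> nat" where m: "\<forall>t\<in>tor \<G>. \<beta> t = (\<Prod>\<alpha>\<in>simple \<G>. \<alpha> t ^ m \<alpha>)" ..
  have "\<beta> (emb (ss \<G>)) = (\<Prod>\<alpha>\<in>simple \<G>. of_nat (CARD('p) ^ m \<alpha>))"
    using m ss_tor simple by (simp add: pts_def)
  then show ?thesis using False by (metis of_nat_prod)
qed
qed

text \<open>s x(a) s^-1 = x(k a) = x(a)^k: conjugation by \<open>s\<close> raises \<open>n\<close>
  to the power \<open>k\<close>, which stays in N_0 and multiplies \<ell>(n) by \<open>k\<close>.
  For a simple root k = p; for any other root \<ell>(n) = 0.\<close>

lemma conjg_ss_root:
  assumes \<beta>: "\<beta> \<in> pos \<G>" and n: "n \<in> N0 \<G>" "n \<in> pts (rootgrp \<G> \<beta>)"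
  shows "conjg (ss \<G>) n \<in> N0 \<G> \<and> ell \<G> (conjg (ss \<G>) n) = pp * ell \<G> n"
proof -
  obtain x where x: "rootgrp \<G> \<beta> = range x" "\<forall>a b. x (a + b) = x a ** x b"
    "\<forall>t\<in>tor \<G>. \<forall>a. conjg t (x a) = x (\<beta> t * a)"
    by (rule root_subgroupE[OF root_subgroup[OF \<beta>]])
  obtain a where a: "emb n = x a" using n(2) x(1) by (auto simp: pts_def)
  obtain k where k: "\<beta> (emb (ss \<G>)) = of_nat k" "\<beta> \<in> simple \<G> \<longrightarrow> k = CARD('p)"
    using root_value_ss[OF \<beta>] by blast
  let ?pw = "\<lambda>k. ((**) n ^^ k) (mat 1)"
  have x0: "x 0 = mat 1"
  proof -
    have i: "invertible (x 0)"
      using root_subgroup[OF \<beta>] x(1) by (simp add: root_subgroup_def alg_group_def subgroup_GL_iff)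
    have "matrix_inv (x 0) ** (x 0 ** x 0) = matrix_inv (x 0) ** x 0" using x(2)[rule_format, of 0 0] by simp
    then show ?thesis using i by (simp add: matrix_mul_assoc matrix_inv_mult)
  qed
  have pw: "?pw k \<in> N0 \<G> \<and> emb (?pw k) = x (of_nat k * a) \<and> ell \<G> (?pw k) = of_nat k * ell \<G> n" for k
    by (induction k) (simp_all add: N0_one x0 ell_one N0_mult n emb_mult a x(2) ell_mult distrib_right)
  have "emb (conjg (ss \<G>) n) = emb (?pw k)"
    using ss_tor pw[of k] by (simp add: emb_conjg tor_invertible a x(3) k(1) pts_def)
  then have c: "conjg (ss \<G>) n = ?pw k" by simp
  show ?thesis
  proof (cases "\<beta> \<in> simple \<G>")
    case True then show ?thesis using c pw k(2) by (simp add: pp_def)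
  next
    case False then show ?thesis using c pw ell_root[OF \<beta> n(2)] by simp
  qed
qed

text \<open>Total decomposability writes \<open>n\<close> as a product of elements of N_0 in root
  subgroups, and both claims pass to products.\<close>

lemma conjg_ss:
  assumes "n \<in> N0 \<G>"
  shows "conjg (ss \<G>) n \<in> N0 \<G>" "ell \<G> (conjg (ss \<G>) n) = pp * ell \<G> n"
proof -
  have fin: "finite (pos \<G>)" using setting(5) unfolding totally_decomposed_def by blast
  obtain bs where bs: "set bs = pos \<G>" "distinct bs" using finite_distinct_list[OF fin] by blast
  let ?f = "\<lambda>n bs. foldr (\<lambda>\<beta> g. n \<beta> ** g) bs (mat 1)"
  have "bij_betw (\<lambda>n. ?f n bs) (\<Pi>\<^sub>E \<beta>\<in>pos \<G>. N0 \<G> \<inter> pts (rootgrp \<G> \<beta>)) (N0 \<G>)"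
    using setting(5) bs unfolding totally_decomposed_def by blast
  then obtain m where m: "m \<in> (\<Pi>\<^sub>E \<beta>\<in>pos \<G>. N0 \<G> \<inter> pts (rootgrp \<G> \<beta>))" "n = ?f m bs"
    using assms by (metis (no_types, lifting) bij_betw_imp_surj_on imageE)
  have *: "?f m cs \<in> N0 \<G> \<and> conjg (ss \<G>) (?f m cs) \<in> N0 \<G> \<and> ell \<G> (conjg (ss \<G>) (?f m cs)) = pp * ell \<G> (?f m cs)"
    if "set cs \<subseteq> pos \<G>" for cs
    using that
  proof (induction cs)
    case Nil then show ?case by (simp add: N0_one ell_one tor_invertible[OF ss_tor])
  next
    case (Cons \<beta> cs)
    then have "m \<beta> \<in> N0 \<G>" "m \<beta> \<in> pts (rootgrp \<G> \<beta>)" using m(1) by auto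
    then show ?case using Cons conjg_ss_root[of \<beta> "m \<beta>"]
      by (auto simp: conjg_mult tor_invertible[OF ss_tor] N0_mult ell_mult algebra_simps)
  qed
  from *[of bs] show "conjg (ss \<G>) n \<in> N0 \<G>" "ell \<G> (conjg (ss \<G>) n) = pp * ell \<G> n"
    using bs m(2) by auto
qed

lemma N1_iff: "n \<in> N1 \<G> \<longleftrightarrow> n \<in> N0 \<G> \<and> ell \<G> n = 0"
  by (simp add: N1_def)

lemma ss_Tplus: "ss \<G> \<in> Tplus_ell \<G>"
  unfolding Tplus_ell_def using ss_tor conjg_ss by (auto simp: N1_iff)

lemma TplusD: "t \<in> Tplus_ell \<G> \<Longrightarrow> t \<in> pts (tor \<G>)"
  "t \<in> Tplus_ell \<G> \<Longrightarrow> n \<in> N0 \<G> \<Longrightarrow> conjg t n \<in> N0 \<G>"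
  "t \<in> Tplus_ell \<G> \<Longrightarrow> n \<in> N1 \<G> \<Longrightarrow> conjg t n \<in> N1 \<G>"
  unfolding Tplus_ell_def by blast+

lemma Tplus_invertible: "t \<in> Tplus_ell \<G> \<Longrightarrow> invertible t"
  using TplusD(1) tor_invertible by blast

lemma Tplus_mult: "t \<in> Tplus_ell \<G> \<Longrightarrow> t' \<in> Tplus_ell \<G> \<Longrightarrow> t ** t' \<in> Tplus_ell \<G>"
  using pts_tor_subgroup unfolding Tplus_ell_def subgroup_GL_iff by (auto simp: conjg_conjg image_subset_iff)

lemma Tplus_one: "mat 1 \<in> Tplus_ell \<G>"
  using pts_tor_subgroup unfolding Tplus_ell_def subgroup_GL_iff by auto

lemma Tplus_commute: "t \<in> Tplus_ell \<G> \<Longrightarrow> t' \<in> Tplus_ell \<G> \<Longrightarrow> t ** t' = t' ** t"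
  using TplusD(1) tor_commute by blast

end

section \<open>The quotients $N_1/N_k$\<close>

locale section_data = group_data \<G> for \<G> :: "('p :: prime_type, 'n :: finite) datum" +
  fixes \<iota> :: "'p padic \<Rightarrow> 'p padic ^ 'n ^ 'n" and c :: "nat \<Rightarrow> nat"
  assumes equivariant_section: "equivariant_section \<G> \<iota>" and admissible: "admissible \<G> \<iota> c"
begin

lemma iota_N0: "x \<in> Zp \<Longrightarrow> \<iota> x \<in> N0 \<G>" and ell_iota: "x \<in> Zp \<Longrightarrow> ell \<G> (\<iota> x) = x"
  and iota_pp: "x \<in> Zp \<Longrightarrow> \<iota> (pp * x) = phiN \<G> (\<iota> x)"
  and iota_add: "x \<in> Zp \<Longrightarrow> y \<in> Zp \<Longrightarrow> \<iota> (x + y) = \<iota> x ** \<iota> y"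
  using equivariant_section unfolding equivariant_section_def by simp_all

lemma N0_inv_cancel:
  assumes "a \<in> N0 \<G>"
  shows "matrix_inv a ** a = mat 1" "a ** matrix_inv a = mat 1"
    "matrix_inv a ** (a ** x) = x" "a ** (matrix_inv a ** x) = x" "matrix_inv (matrix_inv a) = a"
  using assms N0_invertible[OF assms]
  by (simp_all add: matrix_inv_mult matrix_mul_assoc) (rule matrix_inv_eqI; simp add: matrix_inv_mult)

lemma N0_inv_mult: "a \<in> N0 \<G> \<Longrightarrow> b \<in> N0 \<G> \<Longrightarrow> matrix_inv (a ** b) = matrix_inv b ** matrix_inv a"
  by (simp add: invertible_matrix_mult N0_invertible)

lemmas N0_group = N0_inv_cancel N0_inv_mult N0_mult N0_inv N0_one matrix_mul_assoc[symmetric]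

lemma conjg_N0: "a \<in> N0 \<G> \<Longrightarrow> b \<in> N0 \<G> \<Longrightarrow> conjg a b \<in> N0 \<G>"
  by (simp add: conjg_def N0_mult N0_inv)

lemma iota_0: "\<iota> 0 = mat 1"
  using iota_add[OF zero_in_Zp zero_in_Zp] N0_inv_cancel(3)[OF iota_N0[OF zero_in_Zp], of "\<iota> 0"]
    N0_inv_cancel(1)[OF iota_N0[OF zero_in_Zp]] by simp

lemma iota_minus: "x \<in> Zp \<Longrightarrow> \<iota> (- x) = matrix_inv (\<iota> x)"
  using iota_add[of x "- x"] iota_add[of "- x" x]
  by (intro matrix_inv_eqI[symmetric]) (simp_all add: iota_0 Zp_minus)

lemma iota_commute: "x \<in> Zp \<Longrightarrow> y \<in> Zp \<Longrightarrow> \<iota> x ** \<iota> y = \<iota> y ** \<iota> x"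
  using iota_add[of x y] iota_add[of y x] by (simp add: add.commute)

text \<open>The factor of \<open>n\<close> in N_1 when N_0 is viewed as the semidirect product of
  \<iota>(Z_p) and N_1.\<close>

definition part where "part n = matrix_inv (\<iota> (ell \<G> n)) ** n"

lemma N1_N0: "n \<in> N1 \<G> \<Longrightarrow> n \<in> N0 \<G>" by (simp add: N1_iff)

lemma N1_group: "mat 1 \<in> N1 \<G>" "m \<in> N1 \<G> \<Longrightarrow> n \<in> N1 \<G> \<Longrightarrow> m ** n \<in> N1 \<G>"
  "n \<in> N1 \<G> \<Longrightarrow> matrix_inv n \<in> N1 \<G>" "x \<in> N0 \<G> \<Longrightarrow> n \<in> N1 \<G> \<Longrightarrow> conjg x n \<in> N1 \<G>"
  by (simp_all add: N1_iff N0_group ell_mult ell_inv ell_one conjg_def)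

lemma part_N1: "n \<in> N0 \<G> \<Longrightarrow> part n \<in> N1 \<G>"
  by (simp add: part_def N1_iff N0_group iota_N0 ell_Zp ell_mult ell_inv ell_iota)

lemma iota_part: "n \<in> N0 \<G> \<Longrightarrow> \<iota> (ell \<G> n) ** part n = n"
  by (simp add: part_def N0_group iota_N0 ell_Zp)

text \<open>The multiplication of the semidirect product; its conjugation is the one built into the
  skew multiplication.\<close>

lemma part_mult:
  assumes "m \<in> N0 \<G>" "n \<in> N0 \<G>"
  shows "part (m ** n) = conjg (matrix_inv (\<iota> (ell \<G> n))) (part m) ** part n"
proof -
  have i: "\<iota> (ell \<G> m) \<in> N0 \<G>" "\<iota> (ell \<G> n) \<in> N0 \<G>" using assms by (simp_all add: iota_N0 ell_Zp)
  have "\<iota> (ell \<G> m + ell \<G> n) = \<iota> (ell \<G> m) ** \<iota> (ell \<G> n)" using assms by (simp add: iota_add ell_Zp)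
  then show ?thesis
    using assms i by (simp add: part_def ell_mult conjg_def N0_group)
qed

lemma part_iota: "x \<in> Zp \<Longrightarrow> part (\<iota> x) = mat 1"
  by (simp add: part_def ell_iota N0_group iota_N0)

text \<open>As \<open>t\<close> preserves N_1, \<ell>(t n t^-1) is an additive function
  \<open>f\<close> of \<ell>(n). An additive map from Z_p to itself is linear: for x = i + p^k y
  both f(x) and x f(1) are congruent to i f(1) modulo p^k, for every \<open>k\<close>.\<close>

lemma ell_conjg_exists:
  assumes t: "t \<in> Tplus_ell \<G>"
  shows "\<exists>z\<in>Zp. \<forall>n\<in>N0 \<G>. ell \<G> (conjg t n) = z * ell \<G> n"
proof -
  define f where "f x = ell \<G> (conjg t (\<iota> x))" for x
  note inv = Tplus_invertible[OF t]
  have fZ: "f x \<in> Zp" if "x \<in> Zp" for x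
    unfolding f_def using ell_Zp TplusD(2)[OF t] iota_N0 that by blast
  have fn: "ell \<G> (conjg t n) = f (ell \<G> n)" if n: "n \<in> N0 \<G>" for n
  proof -
    have "conjg t (part n) \<in> N1 \<G>" using TplusD(3)[OF t part_N1[OF n]] .
    then have "ell \<G> (conjg t (\<iota> (ell \<G> n)) ** conjg t (part n)) = f (ell \<G> n)"
      using TplusD(2)[OF t iota_N0[OF ell_Zp[OF n]]] by (simp add: ell_mult N1_iff f_def)
    then show ?thesis using iota_part[OF n] by (simp add: conjg_mult[OF inv, symmetric])
  qed
  have fadd: "f (x + y) = f x + f y" if "x \<in> Zp" "y \<in> Zp" for x y
    unfolding f_def using that by (simp add: iota_add conjg_mult[OF inv] ell_mult TplusD(2)[OF t] iota_N0)
  have f0: "f 0 = 0" by (simp add: f_def iota_0 inv ell_one)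
  have fnat: "f (of_nat k * y) = of_nat k * f y" if "y \<in> Zp" for k y
    by (induction k) (simp_all add: f0 distrib_right fadd that Zp_mult of_nat_in_Zp)
  have lin: "f x = x * f 1" if x: "x \<in> Zp" for x
  proof -
    have "\<exists>y\<in>Zp. f x - x * f 1 = pp ^ k * y" for k
    proof -
      obtain i y where iy: "y \<in> Zp" "x = of_nat i + pp ^ k * y" using Zp_residue[OF x] by blast
      have "f (of_nat i * 1) = of_nat i * f 1" "f (of_nat (CARD('p) ^ k) * y) = of_nat (CARD('p) ^ k) * f y"
        using fnat one_in_Zp iy(1) by blast+
      then have "f x = of_nat i * f 1 + pp ^ k * f y"
        unfolding iy(2) using iy(1) by (simp add: fadd of_nat_in_Zp Zp_intros pp_def)
      then have "f x - x * f 1 = pp ^ k * (f y - y * f 1)" by (simp add: iy(2) algebra_simps)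
      then show ?thesis using iy(1) fZ one_in_Zp by (blast intro: Zp_intros)
    qed
    then show ?thesis using Zp_separated[of "f x - x * f 1"] by simp
  qed
  show ?thesis
    using fn lin ell_Zp fZ[OF one_in_Zp] by (intro bexI[of _ "f 1"]) (simp_all add: mult.commute)
qed

lemma mult_of_unique:
  assumes "z \<in> Zp" "\<And>n. n \<in> N0 \<G> \<Longrightarrow> ell \<G> (conjg t n) = z * ell \<G> n"
  shows "mult_of \<G> t = z"
  unfolding mult_of_def
proof (rule the_equality)
  fix z' assume z': "z' \<in> Zp \<and> (\<forall>n\<in>N0 \<G>. ell \<G> (conjg t n) = z' * ell \<G> n)"
  have "z' * ell \<G> (\<iota> 1) = z * ell \<G> (\<iota> 1)" using z' assms(2) iota_N0[OF one_in_Zp] by metis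
  then show "z' = z" by (simp add: ell_iota one_in_Zp)
qed (use assms in blast)

lemma mult_of_spec:
  assumes t: "t \<in> Tplus_ell \<G>"
  shows "mult_of \<G> t \<in> Zp" "n \<in> N0 \<G> \<Longrightarrow> ell \<G> (conjg t n) = mult_of \<G> t * ell \<G> n"
proof -
  obtain z where z: "z \<in> Zp" "\<forall>n\<in>N0 \<G>. ell \<G> (conjg t n) = z * ell \<G> n"
    using ell_conjg_exists[OF t] by blast
  then have "mult_of \<G> t = z" by (intro mult_of_unique) auto
  with z show "mult_of \<G> t \<in> Zp" "n \<in> N0 \<G> \<Longrightarrow> ell \<G> (conjg t n) = mult_of \<G> t * ell \<G> n" by auto
qed

lemma mult_of_one: "mult_of \<G> (mat 1) = 1"
  by (rule mult_of_unique) (simp_all add: one_in_Zp)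

lemma mult_of_ss: "mult_of \<G> (ss \<G>) = pp"
  by (rule mult_of_unique) (simp_all add: pp_in_Zp conjg_ss)

lemma mult_of_mult:
  assumes "t \<in> Tplus_ell \<G>" "t' \<in> Tplus_ell \<G>"
  shows "mult_of \<G> (t ** t') = mult_of \<G> t * mult_of \<G> t'"
  using assms
  by (intro mult_of_unique) (simp_all add: mult_of_spec Zp_mult conjg_conjg Tplus_invertible TplusD(2))

text \<open>Take a simple \<alpha> with nonzero coefficient in \<ell> and \<open>n\<close> in its
  root subgroup with coordinate 1. There \<ell> is a nonzero multiple of the coordinate, and
  \<open>t\<close> scales the coordinate by \<alpha>(t), which is not zero.\<close>

lemma mult_of_nonzero:
  assumes t: "t \<in> Tplus_ell \<G>"
  shows "mult_of \<G> t \<noteq> 0"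
proof
  assume z: "mult_of \<G> t = 0"
  \<comment> \<open>Otherwise \<ell> would vanish identically, while \<ell>(\<iota>(1)) = 1.\<close>
  have "\<exists>\<alpha>\<in>simple \<G>. cf \<G> \<alpha> \<noteq> 0"
  proof (rule ccontr)
    assume "\<not> (\<exists>\<alpha>\<in>simple \<G>. cf \<G> \<alpha> \<noteq> 0)"
    then have "ell \<G> (\<iota> 1) = 0" by (simp add: ell_def)
    then show False using ell_iota[OF one_in_Zp] by simp
  qed
  then obtain \<alpha> where \<alpha>: "\<alpha> \<in> simple \<G>" "cf \<G> \<alpha> \<noteq> 0" by blast
  have \<alpha>p: "\<alpha> \<in> pos \<G>" using \<alpha>(1) simple_pos by blast
  have crd: "crd \<G> \<alpha> ` (N0 \<G> \<inter> pts (rootgrp \<G> \<alpha>)) = Zp"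
    and crdt: "\<forall>t \<in> pts (tor \<G>). \<forall>n \<in> pts (rootgrp \<G> \<alpha>).
          to_ac (crd \<G> \<alpha> (conjg t n)) = \<alpha> (emb t) * to_ac (crd \<G> \<alpha> n)"
    using setting(6) \<alpha>(1) unfolding simple_coordinates_def by simp_all
  have "1 \<in> crd \<G> \<alpha> ` (N0 \<G> \<inter> pts (rootgrp \<G> \<alpha>))" using crd one_in_Zp by simp
  then obtain n where n: "n \<in> N0 \<G>" "n \<in> pts (rootgrp \<G> \<alpha>)" "crd \<G> \<alpha> n = 1" by auto
  obtain x where x: "rootgrp \<G> \<alpha> = range x" "\<forall>t\<in>tor \<G>. \<forall>a. conjg t (x a) = x (\<alpha> t * a)"
    by (rule root_subgroupE[OF root_subgroup[OF \<alpha>p]])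
  have tt: "t \<in> pts (tor \<G>)" using TplusD(1)[OF t] .
  have "conjg t n \<in> pts (rootgrp \<G> \<alpha>)"
    using n(2) x tt by (auto simp: pts_def emb_conjg tor_invertible)
  then have "ell \<G> (conjg t n) = cf \<G> \<alpha> * crd \<G> \<alpha> (conjg t n)" using ell_root[OF \<alpha>p] \<alpha>(1) by simp
  moreover have "ell \<G> (conjg t n) = 0" using mult_of_spec(2)[OF t n(1)] z by simp
  ultimately have "crd \<G> \<alpha> (conjg t n) = 0" using \<alpha>(2) by simp
  then have "\<alpha> (emb t) = 0" using crdt[rule_format, OF tt n(2)] n(3) by simp
  moreover have "\<alpha> \<in> characters (tor \<G>)" using \<alpha>p by (simp add: pos_def roots_def)
  ultimately show False using tt by (simp add: characters_def pts_def)
qed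

section \<open>The normal subgroups N_k\<close>

definition normalN0 where
  "normalN0 H \<longleftrightarrow> H \<subseteq> N0 \<G> \<and> mat 1 \<in> H \<and> (\<forall>x\<in>H. \<forall>y\<in>H. x ** y \<in> H) \<and> (\<forall>x\<in>H. matrix_inv x \<in> H)
    \<and> (\<forall>x\<in>N0 \<G>. \<forall>h\<in>H. conjg x h \<in> H)"

lemma normal_iff: "H \<lhd> GL\<lparr>carrier := N0 \<G>\<rparr> \<longleftrightarrow> normalN0 H"
proof -
  have g: "group (GL\<lparr>carrier := N0 \<G>\<rparr>)" using GL.subgroup_imp_group[OF N0_subgroup] .
  have "subgroup H (GL\<lparr>carrier := N0 \<G>\<rparr>) \<longleftrightarrow> subgroup H GL \<and> H \<subseteq> N0 \<G>"
    using GL.incl_subgroup[OF N0_subgroup, of H] GL.subgroup_incl[OF _ N0_subgroup, of H]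
      subgroup.subset[of H "GL\<lparr>carrier := N0 \<G>\<rparr>"] by auto
  moreover have "inv\<^bsub>GL\<lparr>carrier := N0 \<G>\<rparr>\<^esub> x = matrix_inv x" if "x \<in> N0 \<G>" for x
    using GL.m_inv_consistent[OF N0_subgroup that] N0_invertible[OF that] by (simp add: inv_GL)
  ultimately show ?thesis
    unfolding group.normal_inv_iff[OF g] normalN0_def subgroup_GL_iff
    using N0_invertible by (auto simp: conjg_def)
qed

lemma Nk_eq: "Nk \<G> k = \<Inter>{H. normalN0 H \<and> (phiN \<G> ^^ (k - 1)) ` N1 \<G> \<subseteq> H}"
  unfolding Nk_def normal_iff by simp

lemma normalN0D:
  assumes "normalN0 H"
  shows "x \<in> H \<Longrightarrow> x \<in> N0 \<G>" "mat 1 \<in> H" "x \<in> H \<Longrightarrow> y \<in> H \<Longrightarrow> x ** y \<in> H" "x \<in> H \<Longrightarrow> matrix_inv x \<in> H"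
    "n \<in> N0 \<G> \<Longrightarrow> x \<in> H \<Longrightarrow> conjg n x \<in> H"
  using assms unfolding normalN0_def by auto

lemma normalN0_N1: "normalN0 (N1 \<G>)"
  unfolding normalN0_def using N1_group N1_N0 by blast

lemma phiN_hom: "m \<in> N0 \<G> \<Longrightarrow> n \<in> N0 \<G> \<Longrightarrow> (phiN \<G> ^^ j) (m ** n) = (phiN \<G> ^^ j) m ** (phiN \<G> ^^ j) n"
  by (induction j) (simp_all add: phiN_def conjg_mult tor_invertible ss_tor)

lemma phiN_N0: "n \<in> N0 \<G> \<Longrightarrow> (phiN \<G> ^^ j) n \<in> N0 \<G>" and ell_phiN: "n \<in> N0 \<G> \<Longrightarrow> ell \<G> ((phiN \<G> ^^ j) n) = pp ^ j * ell \<G> n"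
proof -
  have "n \<in> N0 \<G> \<Longrightarrow> (phiN \<G> ^^ j) n \<in> N0 \<G> \<and> ell \<G> ((phiN \<G> ^^ j) n) = pp ^ j * ell \<G> n"
    by (induction j) (simp_all add: phiN_def conjg_ss)
  then show "n \<in> N0 \<G> \<Longrightarrow> (phiN \<G> ^^ j) n \<in> N0 \<G>" "n \<in> N0 \<G> \<Longrightarrow> ell \<G> ((phiN \<G> ^^ j) n) = pp ^ j * ell \<G> n" by auto
qed

lemma phiN_N1: "n \<in> N1 \<G> \<Longrightarrow> (phiN \<G> ^^ j) n \<in> N1 \<G>"
  by (simp add: N1_iff phiN_N0 ell_phiN)

lemma normalN0_Inter:
  assumes H: "H0 \<in> S" and S: "\<And>H. H \<in> S \<Longrightarrow> normalN0 H"
  shows "normalN0 (\<Inter>S)"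
proof -
  have "\<Inter>S \<subseteq> N0 \<G>" using normalN0D(1)[OF S[OF H]] H by blast
  moreover have "mat 1 \<in> \<Inter>S" using normalN0D(2)[OF S] by (rule InterI)
  moreover have "x ** y \<in> \<Inter>S" if "x \<in> \<Inter>S" "y \<in> \<Inter>S" for x y
    by (rule InterI, rule normalN0D(3)[OF S]) (use that in auto)
  moreover have "matrix_inv x \<in> \<Inter>S" if "x \<in> \<Inter>S" for x
    by (rule InterI, rule normalN0D(4)[OF S]) (use that in auto)
  moreover have "conjg n x \<in> \<Inter>S" if "n \<in> N0 \<G>" "x \<in> \<Inter>S" for n x
    by (rule InterI, rule normalN0D(5)[OF S]) (use that in auto)
  ultimately show ?thesis unfolding normalN0_def by (intro conjI ballI)
qed

text \<open>The family that is intersected is nonempty, \<open>N1\<close> being a member.\<close>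

lemma normalN0_Nk: "normalN0 (Nk \<G> k)"
  unfolding Nk_eq using normalN0_N1 phiN_N1 by (intro normalN0_Inter[of "N1 \<G>"]) auto

lemmas NkD = normalN0D[OF normalN0_Nk]

lemma phiN_Nk: "n \<in> N1 \<G> \<Longrightarrow> k - 1 \<le> j \<Longrightarrow> (phiN \<G> ^^ j) n \<in> Nk \<G> k"
proof -
  assume n: "n \<in> N1 \<G>" and j: "k - 1 \<le> j"
  have "(phiN \<G> ^^ j) n = (phiN \<G> ^^ (k - 1)) ((phiN \<G> ^^ (j - (k - 1))) n)"
    using j by (metis funpow_add le_add_diff_inverse o_apply)
  then show ?thesis unfolding Nk_eq using phiN_N1[OF n] by auto
qed

lemma Nk_min: "normalN0 H \<Longrightarrow> (\<And>n. n \<in> N1 \<G> \<Longrightarrow> (phiN \<G> ^^ (k - 1)) n \<in> H) \<Longrightarrow> Nk \<G> k \<subseteq> H"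
  unfolding Nk_eq by auto

lemma Nk_N1: "Nk \<G> k \<subseteq> N1 \<G>"
  by (rule Nk_min[OF normalN0_N1 phiN_N1])

lemma Nk_1: "Nk \<G> 1 = N1 \<G>"
  using Nk_N1[of 1] phiN_Nk[of _ 1 0] by auto

lemma Nk_Suc: "Nk \<G> (Suc k) \<subseteq> Nk \<G> k"
  by (rule Nk_min[OF normalN0_Nk]) (simp add: phiN_Nk)

text \<open>Preimages of N_k under conjugation by \<open>t\<close> are normal in N_0. By minimality,
  an inclusion of some N_j in such a preimage then has to be checked on the generators of N_j
  only.\<close>

lemma normalN0_preimage:
  assumes t: "t \<in> Tplus_ell \<G>"
  shows "normalN0 {n \<in> N0 \<G>. conjg t n \<in> Nk \<G> k}"
  unfolding normalN0_def
proof (intro conjI ballI)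
  fix x h assume x: "x \<in> N0 \<G>" and h: "h \<in> {n \<in> N0 \<G>. conjg t n \<in> Nk \<G> k}"
  have "conjg t (conjg x h) = conjg (conjg t x) (conjg t h)"
    using x Tplus_invertible[OF t] by (simp add: conjg_def[of x] conjg_def[of "conjg t x"] conjg_mult conjg_matrix_inv N0_invertible)
  then show "conjg x h \<in> {n \<in> N0 \<G>. conjg t n \<in> Nk \<G> k}"
    using x h TplusD(2)[OF t x] NkD(5) by (simp add: conjg_N0)
qed (use Tplus_invertible[OF t] NkD in \<open>auto simp: conjg_mult conjg_matrix_inv N0_invertible N0_group\<close>)

lemma conjg_phiN:
  assumes t: "t \<in> Tplus_ell \<G>"
  shows "conjg t ((phiN \<G> ^^ j) n) = (phiN \<G> ^^ j) (conjg t n)"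
proof (induction j)
  case (Suc j)
  have "conjg t (conjg (ss \<G>) x) = conjg (ss \<G>) (conjg t x)" for x
    using Tplus_commute[OF t ss_Tplus] Tplus_invertible[OF t] Tplus_invertible[OF ss_Tplus]
    by (metis conjg_conjg)
  then show ?case using Suc by (simp add: phiN_def)
qed simp

lemma conjg_Nk: "t \<in> Tplus_ell \<G> \<Longrightarrow> h \<in> Nk \<G> k \<Longrightarrow> conjg t h \<in> Nk \<G> k"
proof -
  assume t: "t \<in> Tplus_ell \<G>" and h: "h \<in> Nk \<G> k"
  have "Nk \<G> k \<subseteq> {n \<in> N0 \<G>. conjg t n \<in> Nk \<G> k}"
    by (rule Nk_min[OF normalN0_preimage[OF t]])
      (simp add: conjg_phiN[OF t] phiN_Nk TplusD(3)[OF t] phiN_N0 N1_N0)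
  then show ?thesis using h by blast
qed

text \<open>The origin of all contraction: \<phi> takes the generators \<phi>^(k-1)(N_1) of N_k to
  generators \<phi>^k(N_1) of N_{k+1}.\<close>

lemma conjg_ss_Nk: "k \<ge> 1 \<Longrightarrow> h \<in> Nk \<G> k \<Longrightarrow> conjg (ss \<G>) h \<in> Nk \<G> (Suc k)"
proof -
  assume k: "k \<ge> 1" and h: "h \<in> Nk \<G> k"
  have "Nk \<G> k \<subseteq> {n \<in> N0 \<G>. conjg (ss \<G>) n \<in> Nk \<G> (Suc k)}"
  proof (rule Nk_min[OF normalN0_preimage[OF ss_Tplus]])
    fix n assume n: "n \<in> N1 \<G>"
    have "conjg (ss \<G>) ((phiN \<G> ^^ (k - 1)) n) = (phiN \<G> ^^ Suc (k - 1)) n" by (simp add: phiN_def)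
    then show "(phiN \<G> ^^ (k - 1)) n \<in> {n \<in> N0 \<G>. conjg (ss \<G>) n \<in> Nk \<G> (Suc k)}"
      using k n phiN_Nk[OF n, of "Suc k" k] by (simp add: phiN_N0 N1_N0)
  qed
  then show ?thesis using h by blast
qed

section \<open>Congruence modulo N_k on N_0\<close>

definition eqv where "eqv k a b \<longleftrightarrow> a \<in> N0 \<G> \<and> b \<in> N0 \<G> \<and> matrix_inv a ** b \<in> Nk \<G> k"

definition cs where "cs k a = {x. eqv k a x}"

lemma eqv_N0: "eqv k a b \<Longrightarrow> a \<in> N0 \<G>" "eqv k a b \<Longrightarrow> b \<in> N0 \<G>"
  by (simp_all add: eqv_def)

lemma eqv_refl: "a \<in> N0 \<G> \<Longrightarrow> eqv k a a"
  by (simp add: eqv_def N0_group NkD)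

lemma eqv_sym: "eqv k a b \<Longrightarrow> eqv k b a"
  using NkD(4)[of "matrix_inv a ** b" k] by (auto simp: eqv_def N0_group)

lemma eqv_trans: "eqv k a b \<Longrightarrow> eqv k b d \<Longrightarrow> eqv k a d"
  using NkD(3)[of "matrix_inv a ** b" k "matrix_inv b ** d"] by (auto simp: eqv_def N0_group)

lemma eqv_mult: "eqv k a a' \<Longrightarrow> eqv k b b' \<Longrightarrow> eqv k (a ** b) (a' ** b')"
proof -
  assume a: "eqv k a a'" and b: "eqv k b b'"
  note n = eqv_N0[OF a] eqv_N0[OF b]
  have "conjg (matrix_inv b) (matrix_inv a ** a') ** (matrix_inv b ** b') \<in> Nk \<G> k"
    by (rule NkD(3)[OF NkD(5)]) (use a b n in \<open>auto simp: eqv_def N0_inv\<close>)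
  then show ?thesis using n by (simp add: eqv_def conjg_def N0_group)
qed

lemma eqv_conjg: "x \<in> N0 \<G> \<Longrightarrow> eqv k a b \<Longrightarrow> eqv k (conjg x a) (conjg x b)"
  unfolding conjg_def by (intro eqv_mult) (auto intro: eqv_refl N0_inv)

lemma eqv_conjg_T: "t \<in> Tplus_ell \<G> \<Longrightarrow> eqv k a b \<Longrightarrow> eqv k (conjg t a) (conjg t b)"
  using conjg_Nk[of t "matrix_inv a ** b" k] Tplus_invertible[of t] TplusD(2)[of t]
  by (auto simp: eqv_def conjg_mult conjg_matrix_inv N0_invertible)

lemma eqv_conjg_ss: "k \<ge> 1 \<Longrightarrow> eqv k a b \<Longrightarrow> eqv (Suc k) (conjg (ss \<G>) a) (conjg (ss \<G>) b)"
  using conjg_ss_Nk[of k "matrix_inv a ** b"] Tplus_invertible[OF ss_Tplus] TplusD(2)[OF ss_Tplus]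
  by (auto simp: eqv_def conjg_mult conjg_matrix_inv N0_invertible)

lemma eqv_Suc: "eqv (Suc k) a b \<Longrightarrow> eqv k a b"
  using Nk_Suc by (auto simp: eqv_def)

lemma cs_eq_iff: "a \<in> N0 \<G> \<Longrightarrow> b \<in> N0 \<G> \<Longrightarrow> cs k a = cs k b \<longleftrightarrow> eqv k a b"
  unfolding cs_def using eqv_refl eqv_sym eqv_trans by (blast dest: eqv_sym eqv_trans)

lemma cs_eqI: "eqv k a b \<Longrightarrow> cs k a = cs k b"
  using cs_eq_iff eqv_N0 by blast

lemma cs_self: "a \<in> N0 \<G> \<Longrightarrow> a \<in> cs k a"
  by (simp add: cs_def eqv_refl)

text \<open>The quotient consists of right cosets N_k a; by normality these are the left cosets,
  which are the classes of \<open>eqv\<close>.\<close>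

lemma Qk_eq: "Qk \<G> k = cs k ` N1 \<G>"
proof -
  have "(\<Union>h\<in>Nk \<G> k. {h ** a}) = cs k a" if a: "a \<in> N1 \<G>" for a
  proof (intro Set.set_eqI iffI)
    note aN = N1_N0[OF a]
    fix x assume "x \<in> (\<Union>h\<in>Nk \<G> k. {h ** a})"
    then obtain h where h: "h \<in> Nk \<G> k" "x = h ** a" by blast
    then have "conjg (matrix_inv a) h \<in> Nk \<G> k" using NkD(5) aN N0_inv by blast
    then show "x \<in> cs k a" using h aN NkD(1)[OF h(1)] by (simp add: cs_def eqv_def conjg_def N0_group)
  next
    note aN = N1_N0[OF a]
    fix x assume "x \<in> cs k a"
    then have x: "x \<in> N0 \<G>" "matrix_inv a ** x \<in> Nk \<G> k" by (auto simp: cs_def eqv_def)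
    then have "conjg a (matrix_inv a ** x) \<in> Nk \<G> k" using NkD(5) aN by blast
    then have "x ** matrix_inv a \<in> Nk \<G> k" using aN x by (simp add: conjg_def N0_group)
    then show "x \<in> (\<Union>h\<in>Nk \<G> k. {h ** a})" using aN x(1) by (intro UN_I) (auto simp: N0_group)
  qed
  then show ?thesis by (auto simp: FactGroup_def RCOSETS_def r_coset_def image_def)
qed

lemma Nk_cs: "Nk \<G> k = cs k (mat 1)"
  using NkD(1) by (auto simp: cs_def eqv_def N0_one)

text \<open>Admissibility speaks of the exponent c_k and of cosets as sets. A larger exponent is
  absorbed into \<open>x\<close>, and a coset contains its representative.\<close>

lemma eqv_central:
  assumes k: "k \<ge> 1" and m: "m \<ge> c k" and x: "x \<in> Zp" and a: "a \<in> N1 \<G>"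
  shows "eqv k a (conjg (\<iota> (pp ^ m * x)) a)"
proof -
  have "pp ^ m * x = pp ^ c k * (pp ^ (m - c k) * x)"
    using m by (simp add: mult.assoc[symmetric] power_add[symmetric])
  moreover have "pp ^ (m - c k) * x \<in> Zp" using x by (intro Zp_intros)
  moreover have "cs k a \<in> Qk \<G> k" using a by (simp add: Qk_eq)
  ultimately have "conjg (\<iota> (pp ^ m * x)) ` cs k a = cs k a"
    using admissible k unfolding admissible_def by metis
  then have "conjg (\<iota> (pp ^ m * x)) a \<in> cs k a" using cs_self[OF N1_N0[OF a]] by blast
  then show ?thesis by (simp add: cs_def)
qed

lemma iota_pp_power: "x \<in> Zp \<Longrightarrow> \<iota> (pp ^ m * x) = (phiN \<G> ^^ m) (\<iota> x)"
proof (induction m)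
  case (Suc m)
  have "\<iota> (pp * (pp ^ m * x)) = phiN \<G> (\<iota> (pp ^ m * x))" using Suc.prems by (intro iota_pp Zp_intros)
  then show ?case using Suc by (simp add: mult.assoc)
qed simp

text \<open>The defect \<iota>(z x)^-1 t \<iota>(x) t^-1 lies in N_1. Since \<iota> is
  \<phi>-equivariant and \<open>t\<close> commutes with \<open>s\<close>, replacing \<open>x\<close>
  by p^m x applies \<phi>^m to the defect, which puts it into N_k once m \<ge> k - 1.\<close>

lemma eqv_twist:
  assumes t: "t \<in> Tplus_ell \<G>" and m: "k - 1 \<le> m" and x: "x \<in> Zp"
  shows "eqv k (\<iota> (mult_of \<G> t * (pp ^ m * x))) (conjg t (\<iota> (pp ^ m * x)))"
proof -
  let ?z = "mult_of \<G> t"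
  have zx: "?z * x \<in> Zp" using mult_of_spec(1)[OF t] x by (rule Zp_mult)
  have n: "\<iota> (?z * x) \<in> N0 \<G>" "\<iota> x \<in> N0 \<G>" "conjg t (\<iota> x) \<in> N0 \<G>"
    using zx x TplusD(2)[OF t] iota_N0 by auto
  have "matrix_inv (\<iota> (?z * x)) ** conjg t (\<iota> x) \<in> N1 \<G>"
    using n zx x by (simp add: N1_iff N0_group ell_mult ell_inv ell_iota mult_of_spec[OF t])
  then have "(phiN \<G> ^^ m) (matrix_inv (\<iota> (?z * x)) ** conjg t (\<iota> x)) \<in> Nk \<G> k" by (rule phiN_Nk[OF _ m])
  moreover have "(phiN \<G> ^^ m) (\<iota> (?z * x)) ** (phiN \<G> ^^ m) (matrix_inv (\<iota> (?z * x)) ** conjg t (\<iota> x))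
    = (phiN \<G> ^^ m) (conjg t (\<iota> x))"
    using n by (simp add: phiN_hom[symmetric] N0_group)
  moreover have "(phiN \<G> ^^ m) (\<iota> (?z * x)) = \<iota> (?z * (pp ^ m * x))"
    using iota_pp_power[OF zx] by (simp add: mult.left_commute)
  moreover have "(phiN \<G> ^^ m) (conjg t (\<iota> x)) = conjg t (\<iota> (pp ^ m * x))"
    by (simp add: iota_pp_power[OF x] conjg_phiN[OF t])
  ultimately have "matrix_inv (\<iota> (?z * (pp ^ m * x))) ** conjg t (\<iota> (pp ^ m * x)) \<in> Nk \<G> k"
    using phiN_N0[OF n(1), of m] by (metis N0_inv_cancel(3))
  moreover have "pp ^ m * x \<in> Zp" using x by (intro Zp_mult Zp_power pp_in_Zp)
  ultimately show ?thesis
    using TplusD(2)[OF t iota_N0] iota_N0 Zp_mult[OF mult_of_spec(1)[OF t]] by (simp add: eqv_def)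
qed

section \<open>Finiteness of N_1/N_k from the compactness of N_0\<close>

lemma openin_phiN: "openin (top_of_set (pts (uni \<G>))) ((phiN \<G> ^^ j) ` N0 \<G>)"
proof (induction j)
  case 0 show ?case using setting(4) by simp
next
  case (Suc j)
  let ?U = "(phiN \<G> ^^ j) ` N0 \<G>" and ?s = "ss \<G>"
  have s: "invertible ?s" "matrix_inv ?s \<in> pts (tor \<G>)"
    using ss_tor tor_invertible pts_tor_subgroup by (auto simp: subgroup_GL_iff)
  \<comment> \<open>Conjugation by s^-1 is continuous and preserves the rational points of the
    unipotent radical, so the image under \<phi> is written as a preimage under it.\<close>
  have "(phiN \<G> ^^ Suc j) ` N0 \<G> = pts (uni \<G>) \<inter> conjg (matrix_inv ?s) -` ?U"
  proof (intro Set.set_eqI iffI)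
    fix y assume "y \<in> (phiN \<G> ^^ Suc j) ` N0 \<G>"
    then show "y \<in> pts (uni \<G>) \<inter> conjg (matrix_inv ?s) -` ?U"
      using phiN_N0[of _ "Suc j"] N0_uni by (auto simp: phiN_def conjg_inverse s)
  next
    fix y assume "y \<in> pts (uni \<G>) \<inter> conjg (matrix_inv ?s) -` ?U"
    then obtain n where n: "n \<in> N0 \<G>" "conjg (matrix_inv ?s) y = (phiN \<G> ^^ j) n" by auto
    then have "y = (phiN \<G> ^^ Suc j) n" using conjg_inverse(2)[OF s(1), of y] by (simp add: phiN_def)
    then show "y \<in> (phiN \<G> ^^ Suc j) ` N0 \<G>" using n by blast
  qed
  moreover have "openin (top_of_set (pts (uni \<G>))) (pts (uni \<G>) \<inter> conjg (matrix_inv ?s) -` ?U)"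
  proof (rule continuous_openin_preimage[OF _ _ Suc])
    have "continuous_on UNIV (\<lambda>x :: 'p padic ^ 'n ^ 'n. matrix_inv ?s ** x)"
      "continuous_on UNIV (\<lambda>x :: 'p padic ^ 'n ^ 'n. x ** matrix_inv (matrix_inv ?s))"
      by (simp_all add: continuous_on_padic_matrix_mult)
    from continuous_on_compose2[OF this(2,1)]
    show "continuous_on (pts (uni \<G>)) (conjg (matrix_inv ?s))"
      unfolding conjg_def by (auto intro: continuous_on_subset)
    show "conjg (matrix_inv ?s) \<in> pts (uni \<G>) \<rightarrow> pts (uni \<G>)" using conjg_pts_uni[OF s(2)] by blast
  qed
  ultimately show ?case by simp
qed

lemma openin_coset:
  assumes n: "n \<in> N0 \<G>"
  shows "openin (top_of_set (N0 \<G>)) ((**) n ` (phiN \<G> ^^ j) ` N0 \<G>)"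
proof -
  let ?U = "(phiN \<G> ^^ j) ` N0 \<G>"
  have "openin (top_of_set (N0 \<G>)) (N0 \<G> \<inter> (**) (matrix_inv n) -` ?U)"
  proof (rule continuous_openin_preimage)
    show "continuous_on (N0 \<G>) ((**) (matrix_inv n))" by (rule continuous_on_padic_matrix_mult)
    show "(**) (matrix_inv n) \<in> N0 \<G> \<rightarrow> N0 \<G>" using n by (auto intro!: N0_mult N0_inv)
    show "openin (top_of_set (N0 \<G>)) ?U"
      using openin_phiN[of j] phiN_N0 N0_uni
      by (intro openin_subset_trans[OF _ _ N0_uni]) auto
  qed
  moreover have "N0 \<G> \<inter> (**) (matrix_inv n) -` ?U = (**) n ` ?U"
  proof (intro Set.set_eqI iffI)
    fix y assume "y \<in> N0 \<G> \<inter> (**) (matrix_inv n) -` ?U"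
    then have "matrix_inv n ** y \<in> ?U" by blast
    moreover have "y = n ** (matrix_inv n ** y)" using n by (simp add: N0_inv_cancel)
    ultimately show "y \<in> (**) n ` ?U" by (rule image_eqI[rotated])
  next
    fix y assume "y \<in> (**) n ` ?U"
    then obtain u where "u \<in> ?U" "y = n ** u" by blast
    then show "y \<in> N0 \<G> \<inter> (**) (matrix_inv n) -` ?U" using n phiN_N0 by (auto simp: N0_group)
  qed
  ultimately show ?thesis by simp
qed

text \<open>N_0 is covered by finitely many of the open cosets n \<phi>^(k-1)(N_0). Two elements of
  N_1 in the same coset differ by some \<phi>^(k-1)(w); as p^(k-1) \<ell>(w) = 0, \<open>w\<close>
  lies in N_1 and the difference in N_k.\<close>

lemma finite_Qk: "finite (Qk \<G> k)"
proof -
  define j where "j = k - 1"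
  let ?cos = "\<lambda>n. (**) n ` (phiN \<G> ^^ j) ` N0 \<G>"
  have phi1: "(phiN \<G> ^^ j) (mat 1) = mat 1"
    by (induction j) (simp_all add: phiN_def tor_invertible[OF ss_tor])
  have "\<forall>C. (\<forall>c\<in>C. openin (top_of_set (N0 \<G>)) c) \<and> N0 \<G> \<subseteq> \<Union>C \<longrightarrow> (\<exists>D\<subseteq>C. finite D \<and> N0 \<G> \<subseteq> \<Union>D)"
    using setting(3) unfolding compact_eq_openin_cover .
  moreover have "N0 \<G> \<subseteq> \<Union>(?cos ` N0 \<G>)"
  proof
    fix n assume n: "n \<in> N0 \<G>"
    have "n \<in> ?cos n" using phi1 N0_one by (intro image_eqI[of _ _ "mat 1"]) (auto intro: image_eqI[of _ _ "mat 1"])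
    then show "n \<in> \<Union>(?cos ` N0 \<G>)" using n by blast
  qed
  ultimately have "\<exists>D\<subseteq>?cos ` N0 \<G>. finite D \<and> N0 \<G> \<subseteq> \<Union>D"
    using openin_coset by (elim allE[of _ "?cos ` N0 \<G>"]) auto
  then obtain D where D: "D \<subseteq> ?cos ` N0 \<G>" "finite D" "N0 \<G> \<subseteq> \<Union>D" by blast
  have same: "cs k a = cs k b" if d: "d \<in> D" "a \<in> d" "b \<in> d" and ab: "a \<in> N1 \<G>" "b \<in> N1 \<G>" for a b d
  proof -
    obtain n x y where n: "n \<in> N0 \<G>" and x: "x \<in> N0 \<G>" "a = n ** (phiN \<G> ^^ j) x"
      and y: "y \<in> N0 \<G>" "b = n ** (phiN \<G> ^^ j) y" using D(1) d by blast
    have "(phiN \<G> ^^ j) x ** (phiN \<G> ^^ j) (matrix_inv x ** y) = (phiN \<G> ^^ j) y"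
      using x(1) y(1) by (simp add: phiN_hom[symmetric] N0_group)
    then have w: "matrix_inv a ** b = (phiN \<G> ^^ j) (matrix_inv x ** y)"
      using n x y phiN_N0[OF x(1), of j] by (simp add: N0_group) (metis N0_inv_cancel(3))
    have "matrix_inv a ** b \<in> N1 \<G>" using ab N1_group by blast
    then have "pp ^ j * ell \<G> (matrix_inv x ** y) = 0"
      unfolding w N1_iff using x(1) y(1) by (simp add: ell_phiN N0_group)
    then have "matrix_inv x ** y \<in> N1 \<G>" using pp_nonzero[where 'p = 'p] x(1) y(1) by (simp add: N1_iff N0_group)
    then have "matrix_inv a ** b \<in> Nk \<G> k" unfolding w by (rule phiN_Nk) (simp add: j_def)
    then show ?thesis using ab by (intro cs_eqI) (simp add: eqv_def N1_N0)
  qed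
  have "Qk \<G> k \<subseteq> (\<lambda>d. cs k (SOME a. a \<in> d \<inter> N1 \<G>)) ` D"
  proof
    fix h assume "h \<in> Qk \<G> k"
    then obtain a where a: "a \<in> N1 \<G>" "h = cs k a" by (auto simp: Qk_eq)
    then obtain d where d: "d \<in> D" "a \<in> d" using D(3) N1_N0 by blast
    have s: "(SOME a. a \<in> d \<inter> N1 \<G>) \<in> d \<inter> N1 \<G>" by (rule someI[of "\<lambda>a. a \<in> d \<inter> N1 \<G>" a]) (use a d in simp)
    have "h = cs k (SOME a. a \<in> d \<inter> N1 \<G>)" unfolding a(2) by (rule same[OF d]) (use s a in auto)
    then show "h \<in> (\<lambda>d. cs k (SOME a. a \<in> d \<inter> N1 \<G>)) ` D" using d by blast
  qed
  then show ?thesis using D(2) finite_surj by blast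
qed

end

section \<open>The skew group rings\<close>

locale skew_data = section_data \<G> \<iota> c + phi_ring_setting R
  for \<G> :: "('p :: prime_type, 'n :: finite) datum" and \<iota> c and R :: "('r, 'p, 'n) pg_ring" +
  assumes phi_gamma: "phi_gamma_ring \<G> R"
begin

section \<open>The action of \<open>t\<close> on \<open>R\<close>\<close>

lemma gam_hom: "u \<in> Zp_units \<Longrightarrow> gam R (xi \<G> u) \<in> ring_hom R R"
  and gam_phi: "u \<in> Zp_units \<Longrightarrow> r \<in> carrier R \<Longrightarrow> gam R (xi \<G> u) (phi R r) = phi R (gam R (xi \<G> u) r)"
  and gam_chi: "u \<in> Zp_units \<Longrightarrow> x \<in> Zp \<Longrightarrow> gam R (xi \<G> u) (chi R x) = chi R (u * x)"
  and gam_mult: "u \<in> Zp_units \<Longrightarrow> v \<in> Zp_units \<Longrightarrow> r \<in> carrier R \<Longrightarrow>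
    gam R (xi \<G> u ** xi \<G> v) r = gam R (xi \<G> u) (gam R (xi \<G> v) r)"
  and gam_one: "r \<in> carrier R \<Longrightarrow> gam R (mat 1) r = r"
  using phi_gamma unfolding phi_gamma_ring_def by simp_all

lemma gam_closed: "u \<in> Zp_units \<Longrightarrow> r \<in> carrier R \<Longrightarrow> gam R (xi \<G> u) r \<in> carrier R"
  using gam_hom ring_hom_closed by fast

lemma gam_phi_power: "u \<in> Zp_units \<Longrightarrow> r \<in> carrier R \<Longrightarrow>
    gam R (xi \<G> u) ((phi R ^^ m) r) = (phi R ^^ m) (gam R (xi \<G> u) r)"
  by (induction m) (simp_all add: gam_phi)

text \<open>The multiplier determines the exponent of \<open>p\<close> and the unit, so the definite
  description in \<open>phiR\<close> has a unique solution.\<close>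

lemma phiR_eq:
  assumes "mult_of \<G> t = pp ^ k * u" "u \<in> Zp_units"
  shows "phiR \<G> R t r = (phi R ^^ k) (gam R (xi \<G> u) r)"
  unfolding phiR_def
proof (rule the_equality)
  fix r' assume "\<exists>k. \<exists>u\<in>Zp_units. mult_of \<G> t = pp ^ k * u \<and> r' = (phi R ^^ k) (gam R (xi \<G> u) r)"
  then obtain l v where lv: "v \<in> Zp_units" "mult_of \<G> t = pp ^ l * v" "r' = (phi R ^^ l) (gam R (xi \<G> v) r)" by blast
  from lv(2) assms(1) have "pp ^ l * v = pp ^ k * u" by (rule subst)
  from Zp_decompose_unique[OF this lv(1) assms(2)] have "l = k \<and> v = u" .
  then show "r' = (phi R ^^ k) (gam R (xi \<G> u) r)" using lv by simp
qed (use assms in blast)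

lemma phiR_cases:
  assumes "t \<in> Tplus_ell \<G>"
  obtains k u where "u \<in> Zp_units" "mult_of \<G> t = pp ^ k * u" "phiR \<G> R t = (\<lambda>r. (phi R ^^ k) (gam R (xi \<G> u) r))"
proof -
  obtain k u where "u \<in> Zp_units" "mult_of \<G> t = pp ^ k * u"
    using Zp_decompose[OF mult_of_spec(1)[OF assms] mult_of_nonzero[OF assms]] by blast
  then show thesis using that phiR_eq by blast
qed

lemma phiR_hom: "t \<in> Tplus_ell \<G> \<Longrightarrow> phiR \<G> R t \<in> ring_hom R R"
proof -
  assume t: "t \<in> Tplus_ell \<G>"
  obtain k u where ku: "u \<in> Zp_units" "phiR \<G> R t = (\<lambda>r. (phi R ^^ k) (gam R (xi \<G> u) r))"
    by (rule phiR_cases[OF t])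
  show ?thesis unfolding ku(2)
    by (rule ring_hom_memI)
      (simp_all add: gam_closed[OF ku(1)] ring_hom_mult[OF gam_hom[OF ku(1)]] ring_hom_mult[OF phi_power_hom]
        ring_hom_add[OF gam_hom[OF ku(1)]] ring_hom_add[OF phi_power_hom]
        ring_hom_one[OF gam_hom[OF ku(1)]] ring_hom_one[OF phi_power_hom])
qed

lemma phiR_closed [simp]: "t \<in> Tplus_ell \<G> \<Longrightarrow> r \<in> carrier R \<Longrightarrow> phiR \<G> R t r \<in> carrier R"
  using phiR_hom ring_hom_closed by fast

lemma phiR_zero [simp]: "t \<in> Tplus_ell \<G> \<Longrightarrow> phiR \<G> R t \<zero>\<^bsub>R\<^esub> = \<zero>\<^bsub>R\<^esub>"
  using ring_hom_zero[OF phiR_hom R.ring_axioms R.ring_axioms] .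

lemma phiR_chi: "t \<in> Tplus_ell \<G> \<Longrightarrow> x \<in> Zp \<Longrightarrow> phiR \<G> R t (chi R x) = chi R (mult_of \<G> t * x)"
proof -
  assume t: "t \<in> Tplus_ell \<G>" and x: "x \<in> Zp"
  obtain k u where ku: "u \<in> Zp_units" "mult_of \<G> t = pp ^ k * u" "phiR \<G> R t = (\<lambda>r. (phi R ^^ k) (gam R (xi \<G> u) r))"
    by (rule phiR_cases[OF t])
  have "u * x \<in> Zp" using ku(1) x by (simp add: Zp_units_def Zp_mult)
  then show ?thesis by (simp add: ku gam_chi x phi_power_chi mult.assoc)
qed

lemma phiR_phi: "t \<in> Tplus_ell \<G> \<Longrightarrow> r \<in> carrier R \<Longrightarrow> phiR \<G> R t ((phi R ^^ m) r) = (phi R ^^ m) (phiR \<G> R t r)"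
proof -
  assume t: "t \<in> Tplus_ell \<G>" and r: "r \<in> carrier R"
  obtain k u where ku: "u \<in> Zp_units" "phiR \<G> R t = (\<lambda>r. (phi R ^^ k) (gam R (xi \<G> u) r))"
    by (rule phiR_cases[OF t])
  have "(phi R ^^ k) ((phi R ^^ m) y) = (phi R ^^ m) ((phi R ^^ k) y)" for y
    by (metis add.commute funpow_add o_apply)
  then show ?thesis by (simp add: ku gam_phi_power r)
qed

lemma Zp_units_nonzero: "u \<in> Zp_units \<Longrightarrow> u \<noteq> 0"
  by (auto simp: Zp_units_def)

lemma phiR_mult:
  assumes t: "t \<in> Tplus_ell \<G>" "t' \<in> Tplus_ell \<G>" and r: "r \<in> carrier R"
  shows "phiR \<G> R (t ** t') r = phiR \<G> R t (phiR \<G> R t' r)"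
proof -
  obtain k u where ku: "u \<in> Zp_units" "mult_of \<G> t = pp ^ k * u" "phiR \<G> R t = (\<lambda>r. (phi R ^^ k) (gam R (xi \<G> u) r))"
    by (rule phiR_cases[OF t(1)])
  obtain l v where lv: "v \<in> Zp_units" "mult_of \<G> t' = pp ^ l * v" "phiR \<G> R t' = (\<lambda>r. (phi R ^^ l) (gam R (xi \<G> v) r))"
    by (rule phiR_cases[OF t(2)])
  have "mult_of \<G> (t ** t') = pp ^ (k + l) * (u * v)"
    using mult_of_mult[OF t] by (simp add: ku lv power_add mult_ac)
  then have "phiR \<G> R (t ** t') r = (phi R ^^ (k + l)) (gam R (xi \<G> (u * v)) r)"
    using Zp_units_mult[OF ku(1) lv(1)] by (rule phiR_eq)
  also have "\<dots> = (phi R ^^ k) ((phi R ^^ l) (gam R (xi \<G> u) (gam R (xi \<G> v) r)))"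
    using ku(1) lv(1) r by (simp add: funpow_add xi_mult Zp_units_nonzero gam_mult)
  also have "\<dots> = phiR \<G> R t (phiR \<G> R t' r)"
    using ku(1) lv(1) r by (simp add: ku(3) lv(3) gam_phi_power gam_closed)
  finally show ?thesis .
qed

lemma phiR_one: "r \<in> carrier R \<Longrightarrow> phiR \<G> R (mat 1) r = r"
  using phiR_eq[of "mat 1" 0 1 r] by (simp add: mult_of_one Zp_units_one xi_1 gam_one)

section \<open>Additive structure and distributivity of the skew multiplication\<close>

abbreviation SK where "SK k \<equiv> skew \<G> R \<iota> c k"

lemma skew_simps:
  "carrier (SK k) = Qk \<G> k \<rightarrow>\<^sub>E carrier R"
  "\<one>\<^bsub>SK k\<^esub> = (\<lambda>h \<in> Qk \<G> k. if h = Nk \<G> k then \<one>\<^bsub>R\<^esub> else \<zero>\<^bsub>R\<^esub>)"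
  "\<zero>\<^bsub>SK k\<^esub> = (\<lambda>h \<in> Qk \<G> k. \<zero>\<^bsub>R\<^esub>)"
  "f \<oplus>\<^bsub>SK k\<^esub> g = (\<lambda>h \<in> Qk \<G> k. f h \<oplus>\<^bsub>R\<^esub> g h)"
  by (simp_all only: skew_def ring.simps monoid.simps partial_object.simps)

definition IX where
  "IX k h = {(i, h1, h2). i < CARD('p) ^ c k \<and> h1 \<in> Qk \<G> k \<and> h2 \<in> Qk \<G> k
            \<and> (conjg (matrix_inv (\<iota> (of_nat i))) ` h1) <#>\<^bsub>GL\<^esub> h2 = h}"

lemma skew_mult_eq:
  "h \<in> Qk \<G> k \<Longrightarrow> (f \<otimes>\<^bsub>SK k\<^esub> g) h = finsum R (\<lambda>(i, h1, h2). f h1 \<otimes>\<^bsub>R\<^esub> summand R (c k) (g h2) i) (IX k h)"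
  by (simp only: skew_def ring.simps monoid.simps partial_object.simps IX_def restrict_apply' if_True)

lemma skew_mult_ext: "f \<otimes>\<^bsub>SK k\<^esub> g \<in> extensional (Qk \<G> k)"
  by (simp only: skew_def ring.simps monoid.simps partial_object.simps restrict_extensional)

lemma finite_IX: "finite (IX k h)"
  by (rule finite_subset[of _ "{..<CARD('p) ^ c k} \<times> Qk \<G> k \<times> Qk \<G> k"]) (auto simp: IX_def finite_Qk)

lemma skew_apply: "f \<in> carrier (SK k) \<Longrightarrow> h \<in> Qk \<G> k \<Longrightarrow> f h \<in> carrier R"
  unfolding skew_simps by (rule PiE_mem)

lemma skew_eqI:
  assumes "f \<in> carrier (SK k)" "g \<in> carrier (SK k)" "\<And>h. h \<in> Qk \<G> k \<Longrightarrow> f h = g h"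
  shows "f = g"
  using assms unfolding skew_simps by (rule PiE_ext)

lemma IX_term_closed:
  assumes "f \<in> carrier (SK k)" "g \<in> carrier (SK k)"
  shows "(\<lambda>(i, h1, h2). f h1 \<otimes>\<^bsub>R\<^esub> summand R (c k) (g h2) i) \<in> IX k h \<rightarrow> carrier R"
  using skew_apply[OF assms(1)] skew_apply[OF assms(2)] by (auto simp: IX_def)

lemma skew_mult_closed: "f \<in> carrier (SK k) \<Longrightarrow> g \<in> carrier (SK k) \<Longrightarrow> f \<otimes>\<^bsub>SK k\<^esub> g \<in> carrier (SK k)"
proof -
  assume fg: "f \<in> carrier (SK k)" "g \<in> carrier (SK k)"
  have "(f \<otimes>\<^bsub>SK k\<^esub> g) h \<in> carrier R" if "h \<in> Qk \<G> k" for h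
    unfolding skew_mult_eq[OF that] by (rule R.finsum_closed[OF IX_term_closed[OF fg]])
  then show ?thesis using skew_mult_ext unfolding skew_simps(1) PiE_def by blast
qed

lemma skew_zero_closed: "\<zero>\<^bsub>SK k\<^esub> \<in> carrier (SK k)" by (auto simp: skew_simps)

lemma skew_add_closed: "f \<in> carrier (SK k) \<Longrightarrow> g \<in> carrier (SK k) \<Longrightarrow> f \<oplus>\<^bsub>SK k\<^esub> g \<in> carrier (SK k)"
  using skew_apply by (auto simp: skew_simps)

lemma skew_add_apply: "h \<in> Qk \<G> k \<Longrightarrow> (f \<oplus>\<^bsub>SK k\<^esub> g) h = f h \<oplus>\<^bsub>R\<^esub> g h"
  and skew_zero_apply: "h \<in> Qk \<G> k \<Longrightarrow> \<zero>\<^bsub>SK k\<^esub> h = \<zero>\<^bsub>R\<^esub>"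
  by (simp_all add: skew_simps)

lemma abelian_group_skew: "abelian_group (SK k)"
proof (rule abelian_groupI)
  fix f g h assume "f \<in> carrier (SK k)" "g \<in> carrier (SK k)" "h \<in> carrier (SK k)"
  then show "f \<oplus>\<^bsub>SK k\<^esub> g \<oplus>\<^bsub>SK k\<^esub> h = f \<oplus>\<^bsub>SK k\<^esub> (g \<oplus>\<^bsub>SK k\<^esub> h)"
    by (intro skew_eqI[where k = k] skew_add_closed) (simp_all add: skew_add_apply skew_apply R.a_assoc)
next
  fix f g assume "f \<in> carrier (SK k)" "g \<in> carrier (SK k)"
  then show "f \<oplus>\<^bsub>SK k\<^esub> g = g \<oplus>\<^bsub>SK k\<^esub> f"
    by (intro skew_eqI[where k = k] skew_add_closed) (simp_all add: skew_add_apply skew_apply R.a_comm)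
next
  fix f assume f: "f \<in> carrier (SK k)"
  then show "\<zero>\<^bsub>SK k\<^esub> \<oplus>\<^bsub>SK k\<^esub> f = f"
    by (intro skew_eqI[where k = k] skew_add_closed skew_zero_closed) (simp_all add: skew_add_apply skew_zero_apply skew_apply)
  have n: "(\<lambda>h\<in>Qk \<G> k. \<ominus>\<^bsub>R\<^esub> f h) \<in> carrier (SK k)" using skew_apply[OF f] by (auto simp: skew_simps)
  have "(\<lambda>h\<in>Qk \<G> k. \<ominus>\<^bsub>R\<^esub> f h) \<oplus>\<^bsub>SK k\<^esub> f = \<zero>\<^bsub>SK k\<^esub>"
    by (rule skew_eqI[OF skew_add_closed[OF n f] skew_zero_closed])
      (simp add: skew_add_apply skew_zero_apply skew_apply[OF f] R.l_neg)
  then show "\<exists>g\<in>carrier (SK k). g \<oplus>\<^bsub>SK k\<^esub> f = \<zero>\<^bsub>SK k\<^esub>" using n by blast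
qed (simp_all add: skew_add_closed skew_zero_closed)

lemma skew_distr:
  assumes f: "f \<in> carrier (SK k)" and f': "f' \<in> carrier (SK k)" and g: "g \<in> carrier (SK k)"
  shows "(f \<oplus>\<^bsub>SK k\<^esub> f') \<otimes>\<^bsub>SK k\<^esub> g = f \<otimes>\<^bsub>SK k\<^esub> g \<oplus>\<^bsub>SK k\<^esub> f' \<otimes>\<^bsub>SK k\<^esub> g"
    and "g \<otimes>\<^bsub>SK k\<^esub> (f \<oplus>\<^bsub>SK k\<^esub> f') = g \<otimes>\<^bsub>SK k\<^esub> f \<oplus>\<^bsub>SK k\<^esub> g \<otimes>\<^bsub>SK k\<^esub> f'"
proof -
  note ap = skew_apply[OF f] skew_apply[OF f'] skew_apply[OF g]
  note cl = skew_mult_closed skew_add_closed f f' g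
  show "(f \<oplus>\<^bsub>SK k\<^esub> f') \<otimes>\<^bsub>SK k\<^esub> g = f \<otimes>\<^bsub>SK k\<^esub> g \<oplus>\<^bsub>SK k\<^esub> f' \<otimes>\<^bsub>SK k\<^esub> g"
  proof (rule skew_eqI[where k = k])
    fix h assume h: "h \<in> Qk \<G> k"
    have "((f \<oplus>\<^bsub>SK k\<^esub> f') \<otimes>\<^bsub>SK k\<^esub> g) h
      = finsum R (\<lambda>z. (case z of (i, h1, h2) \<Rightarrow> f h1 \<otimes>\<^bsub>R\<^esub> summand R (c k) (g h2) i)
          \<oplus>\<^bsub>R\<^esub> (case z of (i, h1, h2) \<Rightarrow> f' h1 \<otimes>\<^bsub>R\<^esub> summand R (c k) (g h2) i)) (IX k h)"
      unfolding skew_mult_eq[OF h]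
      by (rule R.finsum_cong') (auto simp: IX_def skew_add_apply ap R.l_distr)
    also have "\<dots> = (f \<otimes>\<^bsub>SK k\<^esub> g \<oplus>\<^bsub>SK k\<^esub> f' \<otimes>\<^bsub>SK k\<^esub> g) h"
      unfolding skew_add_apply[OF h] skew_mult_eq[OF h]
      by (rule R.finsum_addf) (rule IX_term_closed[OF f g], rule IX_term_closed[OF f' g])
    finally show "((f \<oplus>\<^bsub>SK k\<^esub> f') \<otimes>\<^bsub>SK k\<^esub> g) h = (f \<otimes>\<^bsub>SK k\<^esub> g \<oplus>\<^bsub>SK k\<^esub> f' \<otimes>\<^bsub>SK k\<^esub> g) h" .
  qed (intro cl)+
  show "g \<otimes>\<^bsub>SK k\<^esub> (f \<oplus>\<^bsub>SK k\<^esub> f') = g \<otimes>\<^bsub>SK k\<^esub> f \<oplus>\<^bsub>SK k\<^esub> g \<otimes>\<^bsub>SK k\<^esub> f'"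
  proof (rule skew_eqI[where k = k])
    fix h assume h: "h \<in> Qk \<G> k"
    have "(g \<otimes>\<^bsub>SK k\<^esub> (f \<oplus>\<^bsub>SK k\<^esub> f')) h
      = finsum R (\<lambda>z. (case z of (i, h1, h2) \<Rightarrow> g h1 \<otimes>\<^bsub>R\<^esub> summand R (c k) (f h2) i)
          \<oplus>\<^bsub>R\<^esub> (case z of (i, h1, h2) \<Rightarrow> g h1 \<otimes>\<^bsub>R\<^esub> summand R (c k) (f' h2) i)) (IX k h)"
      unfolding skew_mult_eq[OF h]
      by (rule R.finsum_cong') (auto simp: IX_def skew_add_apply ap summand_add R.r_distr)
    also have "\<dots> = (g \<otimes>\<^bsub>SK k\<^esub> f \<oplus>\<^bsub>SK k\<^esub> g \<otimes>\<^bsub>SK k\<^esub> f') h"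
      unfolding skew_add_apply[OF h] skew_mult_eq[OF h]
      by (rule R.finsum_addf) (rule IX_term_closed[OF g f], rule IX_term_closed[OF g f'])
    finally show "(g \<otimes>\<^bsub>SK k\<^esub> (f \<oplus>\<^bsub>SK k\<^esub> f')) h = (g \<otimes>\<^bsub>SK k\<^esub> f \<oplus>\<^bsub>SK k\<^esub> g \<otimes>\<^bsub>SK k\<^esub> f') h" .
  qed (intro cl)+
qed

section \<open>Generators [a, n] and the ring laws\<close>

definition single where
  "single k n r = (\<lambda>h\<in>Qk \<G> k. if h = cs k n then r else \<zero>\<^bsub>R\<^esub>)"

text \<open>The exponent \<open>m\<close> is an argument because its required size varies: the
  product formula is proved for m \<ge> c_k, the formula for the action for m \<ge> c_k + k, and a
  comparison of two levels takes an exponent that serves both.\<close>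

definition gen where
  "gen k m a n = single k (part n) (chi R (ell \<G> n) \<otimes>\<^bsub>R\<^esub> (phi R ^^ m) a)"

lemma gen_value_closed [simp]:
  "n \<in> N0 \<G> \<Longrightarrow> a \<in> carrier R \<Longrightarrow> chi R (ell \<G> n) \<otimes>\<^bsub>R\<^esub> (phi R ^^ m) a \<in> carrier R"
  by (simp add: ell_Zp)

lemma single_closed: "r \<in> carrier R \<Longrightarrow> single k n r \<in> carrier (SK k)"
  by (auto simp: single_def skew_simps)

lemma gen_closed: "n \<in> N0 \<G> \<Longrightarrow> a \<in> carrier R \<Longrightarrow> gen k m a n \<in> carrier (SK k)"
  unfolding gen_def by (rule single_closed) simp

lemma single_apply: "h \<in> Qk \<G> k \<Longrightarrow> single k n r h = (if h = cs k n then r else \<zero>\<^bsub>R\<^esub>)"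
  by (simp add: single_def)

lemma single_add: "r \<in> carrier R \<Longrightarrow> r' \<in> carrier R \<Longrightarrow> single k n (r \<oplus>\<^bsub>R\<^esub> r') = single k n r \<oplus>\<^bsub>SK k\<^esub> single k n r'"
  by (intro skew_eqI[of _ k] single_closed skew_add_closed) (simp_all add: single_apply skew_add_apply)

lemma single_zero: "single k n \<zero>\<^bsub>R\<^esub> = \<zero>\<^bsub>SK k\<^esub>"
  by (intro skew_eqI[of _ k] single_closed skew_zero_closed) (simp_all add: single_apply skew_zero_apply)

lemma single_eqv: "eqv k n n' \<Longrightarrow> single k n r = single k n' r"
  using cs_eqI[of k n n'] by (simp add: single_def)

lemma eqv_ell: "eqv k n n' \<Longrightarrow> ell \<G> n = ell \<G> n'"
proof -
  assume e: "eqv k n n'"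
  then have "matrix_inv n ** n' \<in> N1 \<G>" using Nk_N1 by (auto simp: eqv_def)
  then have "ell \<G> (matrix_inv n ** n') = 0" by (simp add: N1_iff)
  then show ?thesis using eqv_N0[OF e] by (simp add: ell_mult ell_inv N0_inv)
qed

lemma eqv_part: "eqv k n n' \<Longrightarrow> eqv k (part n) (part n')"
  unfolding part_def using eqv_ell[of k n n'] eqv_N0[of k n n']
  by (metis N0_inv ell_Zp eqv_mult eqv_refl iota_N0)

lemma gen_eqv: "eqv k n n' \<Longrightarrow> gen k m a n = gen k m a n'"
  unfolding gen_def using single_eqv[OF eqv_part] eqv_ell by metis

lemma gen_iota_mult:
  assumes "x \<in> Zp" "n \<in> N1 \<G>"
  shows "gen k m a (\<iota> x ** n) = single k n (chi R x \<otimes>\<^bsub>R\<^esub> (phi R ^^ m) a)"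
proof -
  have "ell \<G> (\<iota> x ** n) = x" using assms by (simp add: ell_mult iota_N0 N1_N0 ell_iota) (simp add: N1_iff)
  moreover from this have "part (\<iota> x ** n) = n" using assms by (simp add: part_def N0_group iota_N0)
  ultimately show ?thesis by (simp add: gen_def)
qed

text \<open>Generators of exponent \<open>m\<close> produce every element supported on one class, by
  the decomposition of its coefficient in \<open>R\<close>; N_1/N_k being finite, these elements add
  up to \<open>f\<close>.\<close>

lemma skew_induct [consumes 1, case_names zero gen add]:
  assumes f: "f \<in> carrier (SK k)" and zero: "P \<zero>\<^bsub>SK k\<^esub>"
    and gen: "\<And>n a. n \<in> N0 \<G> \<Longrightarrow> a \<in> carrier R \<Longrightarrow> P (gen k m a n)"
    and add: "\<And>f g. f \<in> carrier (SK k) \<Longrightarrow> g \<in> carrier (SK k) \<Longrightarrow> P f \<Longrightarrow> P g \<Longrightarrow> P (f \<oplus>\<^bsub>SK k\<^esub> g)"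
  shows "P f"
proof -
  have s: "P (single k n r)" if "r \<in> carrier R" "n \<in> N1 \<G>" for r n
    using that(1)
  proof (induction rule: R_induct[where m = m])
    case zero show ?case using \<open>P \<zero>\<^bsub>SK k\<^esub>\<close> by (simp add: single_zero)
  next
    case (gen x a)
    then show ?case
      using that(2) assms(3)[of "\<iota> x ** n" a] by (simp add: gen_iota_mult N0_mult iota_N0 N1_N0)
  next
    case (add r r')
    then show ?case using assms(4) by (simp add: single_add single_closed)
  qed
  \<comment> \<open>\<open>f\<close> cut off outside a set \<open>A\<close> of classes; the
    induction enlarges \<open>A\<close> up to the whole quotient.\<close>
  let ?f = "\<lambda>A. (\<lambda>h\<in>Qk \<G> k. if h \<in> A then f h else \<zero>\<^bsub>R\<^esub>)"
  have fc: "?f A \<in> carrier (SK k)" for A using skew_apply[OF f] by (auto simp: skew_simps)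
  have all: "P (?f A)" if "A \<subseteq> Qk \<G> k" for A
    using finite_subset[OF that finite_Qk] that
  proof (induction A rule: finite_induct)
    case empty show ?case using zero by (simp add: skew_simps restrict_def)
  next
    case (insert h A)
    then obtain n where n: "n \<in> N1 \<G>" "h = cs k n" by (auto simp: Qk_eq)
    have fh: "f h \<in> carrier R" using insert.prems skew_apply[OF f] by blast
    have eq: "?f (insert h A) = single k n (f h) \<oplus>\<^bsub>SK k\<^esub> ?f A"
      by (rule skew_eqI[OF fc skew_add_closed[OF single_closed[OF fh] fc]])
        (use fh insert.hyps skew_apply[OF f] in \<open>auto simp: skew_add_apply single_apply n(2)[symmetric]\<close>)
    have "P (?f A)" using insert.IH insert.prems by blast
    then show ?case unfolding eq by (rule add[OF single_closed[OF fh] fc s[OF fh n(1)]])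
  qed
  have ff: "?f (Qk \<G> k) = f"
    by (rule skew_eqI[OF fc f]) simp
  show ?thesis using all[OF subset_refl] unfolding ff .
qed

lemma cs_mult:
  assumes x: "x \<in> N0 \<G>" and a: "a \<in> N0 \<G>" and b: "b \<in> N0 \<G>"
  shows "(conjg x ` cs k a) <#>\<^bsub>GL\<^esub> cs k b = cs k (conjg x a ** b)"
proof (intro Set.set_eqI iffI)
  fix y assume "y \<in> (conjg x ` cs k a) <#>\<^bsub>GL\<^esub> cs k b"
  then obtain a' b' where "eqv k a a'" "eqv k b b'" "y = conjg x a' ** b'"
    by (auto simp: set_mult_def cs_def)
  then show "y \<in> cs k (conjg x a ** b)" using eqv_mult eqv_conjg[OF x] by (simp add: cs_def)
next
  fix y assume "y \<in> cs k (conjg x a ** b)"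
  then have y: "eqv k (conjg x a ** b) y" by (simp add: cs_def)
  have xa: "conjg x a \<in> N0 \<G>" using x a by (rule conjg_N0)
  have "eqv k (matrix_inv (conjg x a) ** (conjg x a ** b)) (matrix_inv (conjg x a) ** y)"
    using y xa by (intro eqv_mult eqv_refl N0_inv)
  then have "matrix_inv (conjg x a) ** y \<in> cs k b" using xa by (simp add: cs_def N0_inv_cancel)
  moreover have "y = conjg x a ** (matrix_inv (conjg x a) ** y)" using xa by (simp add: N0_inv_cancel)
  ultimately show "y \<in> (conjg x ` cs k a) <#>\<^bsub>GL\<^esub> cs k b"
    using cs_self[OF a] by (auto simp: set_mult_def)
qed

lemma cs_Qk: "n \<in> N1 \<G> \<Longrightarrow> cs k n \<in> Qk \<G> k" by (simp add: Qk_eq)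

text \<open>Since m \<ge> c_k, the coefficient of the second factor is concentrated in the residue
  \<open>i\<close> of \<ell>(n') modulo p^(c_k), so at most one index triple contributes. By
  \<open>part_mult\<close> its coset is that of the product. Commutativity of \<open>R\<close>
  brings the coefficients into the right order.\<close>

lemma gen_mult:
  assumes k: "k \<ge> 1" and m: "m \<ge> c k" and n: "n \<in> N0 \<G>" "n' \<in> N0 \<G>"
    and a: "a \<in> carrier R" "b \<in> carrier R"
  shows "gen k m a n \<otimes>\<^bsub>SK k\<^esub> gen k m b n' = gen k m (a \<otimes>\<^bsub>R\<^esub> b) (n ** n')"
proof (rule skew_eqI[where k = k])
  let ?x = "ell \<G> n'"
  let ?va = "chi R (ell \<G> n) \<otimes>\<^bsub>R\<^esub> (phi R ^^ m) a" and ?vb = "chi R ?x \<otimes>\<^bsub>R\<^esub> (phi R ^^ m) b"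
  obtain i y where i: "i < CARD('p) ^ c k" "y \<in> Zp" "?x = of_nat i + pp ^ c k * y"
    using Zp_residue[OF ell_Zp[OF n(2)]] by blast
  have pp: "pp ^ c k * y \<in> Zp" using i(2) by (intro Zp_mult Zp_power pp_in_Zp)
  have sm: "summand R (c k) ?vb j = (if j = i then ?vb else \<zero>\<^bsub>R\<^esub>)" if "j < CARD('p) ^ c k" for j
    using summand_gen[OF a(2) i(2,1) that m] i(3) by simp
  note pN = part_N1[OF n(1)] part_N1[OF n(2)]
  let ?t = "(i, cs k (part n), cs k (part n'))"
  let ?F = "\<lambda>(i, h1, h2). gen k m a n h1 \<otimes>\<^bsub>R\<^esub> summand R (c k) (gen k m b n' h2) i"
  let ?i = "\<iota> (of_nat i)"
  have iN: "?i \<in> N0 \<G>" by (simp add: iota_N0 of_nat_in_Zp)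
  have F0: "?F z = \<zero>\<^bsub>R\<^esub>" if "z \<in> IX k h" "z \<noteq> ?t" for z h
  proof -
    obtain j h1 h2 where z: "z = (j, h1, h2)" by (cases z) auto
    have zz: "j < CARD('p) ^ c k" "h1 \<in> Qk \<G> k" "h2 \<in> Qk \<G> k" using that(1) z by (auto simp: IX_def)
    show ?thesis
    proof (cases "h1 = cs k (part n) \<and> h2 = cs k (part n')")
      case True
      then have "j \<noteq> i" using that(2) z by auto
      then show ?thesis using True zz z n a by (simp add: gen_def single_apply sm)
    next
      case False
      then show ?thesis using zz z n a by (auto simp: gen_def single_apply summand_zero)
    qed
  qed
  have Ft: "?F ?t = ?va \<otimes>\<^bsub>R\<^esub> ?vb"
    using pN i(1) by (simp add: gen_def single_apply cs_Qk sm)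
  have chi: "?va \<otimes>\<^bsub>R\<^esub> ?vb = chi R (ell \<G> (n ** n')) \<otimes>\<^bsub>R\<^esub> (phi R ^^ m) (a \<otimes>\<^bsub>R\<^esub> b)"
    using n a by (simp add: ell_mult chi_add ell_Zp ring_hom_mult[OF phi_power_hom] R.m_ac)
  \<comment> \<open>\<iota>(\<ell>(n')) is the product of \<iota>(i) and \<iota>(p^(c_k) y), and
    conjugation by the latter is trivial on N_1/N_k.\<close>
  have cos: "cs k (conjg (matrix_inv ?i) (part n) ** part n') = cs k (part (n ** n'))"
  proof -
    have "\<iota> ?x = ?i ** \<iota> (pp ^ c k * y)" using i(3) pp by (simp add: iota_add of_nat_in_Zp)
    moreover have "eqv k (part n) (conjg (\<iota> (pp ^ c k * (- y))) (part n))"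
      by (rule eqv_central[OF k order_refl Zp_minus[OF i(2)] pN(1)])
    then have e: "eqv k (part n) (conjg (matrix_inv (\<iota> (pp ^ c k * y))) (part n))"
      using iota_minus[OF pp] by simp
    have iy: "\<iota> (pp ^ c k * y) \<in> N0 \<G>" using iota_N0[OF pp] .
    have "?i ** \<iota> (pp ^ c k * y) = \<iota> (pp ^ c k * y) ** ?i" by (rule iota_commute[OF of_nat_in_Zp pp])
    ultimately have "conjg (matrix_inv (\<iota> ?x)) (part n) = conjg (matrix_inv ?i) (conjg (matrix_inv (\<iota> (pp ^ c k * y))) (part n))"
      using iN iy by (simp add: conjg_def N0_group)
    then have "eqv k (conjg (matrix_inv ?i) (part n)) (conjg (matrix_inv (\<iota> ?x)) (part n))"
      using eqv_conjg[OF N0_inv[OF iN] e] by simp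
    then show ?thesis
      unfolding part_mult[OF n] using pN by (intro cs_eqI eqv_mult eqv_refl) (auto simp: N1_N0)
  qed
  fix h assume h: "h \<in> Qk \<G> k"
  have cl: "?F \<in> IX k h \<rightarrow> carrier R" by (rule IX_term_closed[OF gen_closed[OF n(1) a(1)] gen_closed[OF n(2) a(2)]])
  have t_iff: "?t \<in> IX k h \<longleftrightarrow> h = cs k (part (n ** n'))"
    using i(1) pN cos cs_mult[OF N0_inv[OF iN] N1_N0[OF pN(1)] N1_N0[OF pN(2)], of k]
    by (auto simp: IX_def cs_Qk)
  show "(gen k m a n \<otimes>\<^bsub>SK k\<^esub> gen k m b n') h = gen k m (a \<otimes>\<^bsub>R\<^esub> b) (n ** n') h"
  proof (cases "h = cs k (part (n ** n'))")
    case True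
    then have t: "?t \<in> IX k h" using t_iff by blast
    have "(gen k m a n \<otimes>\<^bsub>SK k\<^esub> gen k m b n') h = ?F ?t"
      unfolding skew_mult_eq[OF h] by (rule R.finsum_single[OF finite_IX t cl F0])
    then show ?thesis unfolding Ft chi using True h by (simp add: gen_def single_apply)
  next
    case False
    then have t: "?t \<notin> IX k h" using t_iff by blast
    have "(gen k m a n \<otimes>\<^bsub>SK k\<^esub> gen k m b n') h = \<zero>\<^bsub>R\<^esub>"
      unfolding skew_mult_eq[OF h] by (rule R.finsum_zeros) (use F0 t in blast)
    then show ?thesis using False h by (simp add: gen_def single_apply)
  qed
qed (use n a in \<open>simp_all add: skew_mult_closed gen_closed N0_mult\<close>)

lemma skew_one: "\<one>\<^bsub>SK k\<^esub> = gen k m \<one>\<^bsub>R\<^esub> (mat 1)"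
  using part_iota[OF zero_in_Zp]
  by (simp add: gen_def single_def skew_simps ell_one chi_0 ring_hom_one[OF phi_power_hom] Nk_cs iota_0)

lemma skew_one_closed: "\<one>\<^bsub>SK k\<^esub> \<in> carrier (SK k)"
  unfolding skew_one[where m = 0] by (simp add: gen_closed N0_one)

lemma skew_mult_zero:
  assumes f: "f \<in> carrier (SK k)"
  shows "\<zero>\<^bsub>SK k\<^esub> \<otimes>\<^bsub>SK k\<^esub> f = \<zero>\<^bsub>SK k\<^esub>" "f \<otimes>\<^bsub>SK k\<^esub> \<zero>\<^bsub>SK k\<^esub> = \<zero>\<^bsub>SK k\<^esub>"
proof -
  interpret K: abelian_group "SK k" by (rule abelian_group_skew)
  show "\<zero>\<^bsub>SK k\<^esub> \<otimes>\<^bsub>SK k\<^esub> f = \<zero>\<^bsub>SK k\<^esub>"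
    using skew_distr(1)[of "\<zero>\<^bsub>SK k\<^esub>" k "\<zero>\<^bsub>SK k\<^esub>" f] f skew_mult_closed[OF K.zero_closed f]
    by (simp add: K.add.l_cancel_one')
  show "f \<otimes>\<^bsub>SK k\<^esub> \<zero>\<^bsub>SK k\<^esub> = \<zero>\<^bsub>SK k\<^esub>"
    using skew_distr(2)[of "\<zero>\<^bsub>SK k\<^esub>" k "\<zero>\<^bsub>SK k\<^esub>" f] f skew_mult_closed[OF f K.zero_closed]
    by (simp add: K.add.l_cancel_one')
qed

text \<open>By additivity all three factors may be taken to be generators, where associativity is
  that of N_0 and of \<open>R\<close>. The factors are replaced one at a time, beginning on the
  right.\<close>

lemma skew_assoc:
  assumes k: "k \<ge> 1" and f: "f \<in> carrier (SK k)" and g: "g \<in> carrier (SK k)" and h: "h \<in> carrier (SK k)"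
  shows "f \<otimes>\<^bsub>SK k\<^esub> g \<otimes>\<^bsub>SK k\<^esub> h = f \<otimes>\<^bsub>SK k\<^esub> (g \<otimes>\<^bsub>SK k\<^esub> h)"
proof -
  note cl = skew_mult_closed gen_closed skew_mult_zero
  note G = gen_mult[OF k order_refl]
  have 1: "gen k (c k) a n \<otimes>\<^bsub>SK k\<^esub> gen k (c k) b n' \<otimes>\<^bsub>SK k\<^esub> h = gen k (c k) a n \<otimes>\<^bsub>SK k\<^esub> (gen k (c k) b n' \<otimes>\<^bsub>SK k\<^esub> h)"
    if n: "n \<in> N0 \<G>" "n' \<in> N0 \<G>" "a \<in> carrier R" "b \<in> carrier R" for a b n n'
    using h
  proof (induction rule: skew_induct[where m = "c k"])
    case (gen m d)
    then show ?case using n by (simp add: G N0_mult R.m_assoc matrix_mul_assoc)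
  qed (use n in \<open>simp_all add: cl skew_distr\<close>)
  have 2: "gen k (c k) a n \<otimes>\<^bsub>SK k\<^esub> g \<otimes>\<^bsub>SK k\<^esub> h = gen k (c k) a n \<otimes>\<^bsub>SK k\<^esub> (g \<otimes>\<^bsub>SK k\<^esub> h)"
    if n: "n \<in> N0 \<G>" "a \<in> carrier R" for a n
    using g
  proof (induction rule: skew_induct[where m = "c k"])
    case (gen m d)
    then show ?case using n 1 by simp
  qed (use n h in \<open>simp_all add: cl skew_distr\<close>)
  show ?thesis
    using f
  proof (induction rule: skew_induct[where m = "c k"])
    case (gen m d)
    then show ?case using 2 by simp
  qed (use g h in \<open>simp_all add: cl skew_distr\<close>)
qed

lemma skew_one_mult:
  assumes k: "k \<ge> 1" and f: "f \<in> carrier (SK k)"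
  shows "\<one>\<^bsub>SK k\<^esub> \<otimes>\<^bsub>SK k\<^esub> f = f" "f \<otimes>\<^bsub>SK k\<^esub> \<one>\<^bsub>SK k\<^esub> = f"
proof -
  note G = gen_mult[OF k order_refl]
  show "\<one>\<^bsub>SK k\<^esub> \<otimes>\<^bsub>SK k\<^esub> f = f"
    using f
  proof (induction rule: skew_induct[where m = "c k"])
    case (gen m d)
    then show ?case by (simp add: skew_one[of k "c k"] G N0_one)
  qed (simp_all add: skew_mult_zero skew_one_closed skew_distr)
  show "f \<otimes>\<^bsub>SK k\<^esub> \<one>\<^bsub>SK k\<^esub> = f"
    using f
  proof (induction rule: skew_induct[where m = "c k"])
    case (gen m d)
    then show ?case by (simp add: skew_one[of k "c k"] G N0_one)
  qed (simp_all add: skew_mult_zero skew_one_closed skew_distr)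
qed

lemma ring_skew: "k \<ge> 1 \<Longrightarrow> ring (SK k)"
  by (rule ringI[OF abelian_group_skew monoidI])
    (simp_all add: skew_mult_closed skew_one_closed skew_assoc skew_one_mult skew_distr)

end

section \<open>Conjugation and transition maps on the skew group rings\<close>

lemma ring_hom_minus:
  assumes "f \<in> ring_hom A B" "ring A" "ring B" "x \<in> carrier A" "y \<in> carrier A"
  shows "f (x \<ominus>\<^bsub>A\<^esub> y) = f x \<ominus>\<^bsub>B\<^esub> f y"
proof -
  interpret A: ring A by fact
  interpret B: ring B by fact
  have "f (\<ominus>\<^bsub>A\<^esub> y) \<oplus>\<^bsub>B\<^esub> f y = \<zero>\<^bsub>B\<^esub>"
    using ring_hom_add[OF assms(1), of "\<ominus>\<^bsub>A\<^esub> y" y] ring_hom_zero[OF assms(1-3)] assms(5) by (simp add: A.l_neg)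
  then have "\<ominus>\<^bsub>B\<^esub> f y = f (\<ominus>\<^bsub>A\<^esub> y)"
    using ring_hom_closed[OF assms(1)] assms(5) by (intro B.minus_equality) auto
  then show ?thesis
    using ring_hom_add[OF assms(1), of x "\<ominus>\<^bsub>A\<^esub> y"] assms(4,5) by (simp add: a_minus_def)
qed

context skew_data
begin

section \<open>The action of \<open>t\<close> at level \<open>k\<close>\<close>

definition AX where
  "AX k t h = {(i, h'). i < CARD('p) ^ (c k + k) \<and> h' \<in> Qk \<G> k
     \<and> (\<lambda>n. matrix_inv (\<iota> (mult_of \<G> t * of_nat i)) ** conjg t (\<iota> (of_nat i) ** n)) ` h' \<subseteq> h}"

lemma act_eq:
  "h \<in> Qk \<G> k \<Longrightarrow> act_skew \<G> R \<iota> c k t f h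
    = finsum R (\<lambda>(i, h'). phiR \<G> R t (summand R (c k + k) (f h') i)) (AX k t h)"
  unfolding act_skew_def AX_def by (rule restrict_apply')

lemma finite_AX: "finite (AX k t h)"
  by (rule finite_subset[of _ "{..<CARD('p) ^ (c k + k)} \<times> Qk \<G> k"]) (auto simp: AX_def finite_Qk)

lemma AX_term_closed:
  assumes "t \<in> Tplus_ell \<G>" "f \<in> carrier (SK k)"
  shows "(\<lambda>(i, h'). phiR \<G> R t (summand R (c k + k) (f h') i)) \<in> AX k t h \<rightarrow> carrier R"
  using skew_apply[OF assms(2)] assms(1) by (auto simp: AX_def)

lemma act_closed: "t \<in> Tplus_ell \<G> \<Longrightarrow> f \<in> carrier (SK k) \<Longrightarrow> act_skew \<G> R \<iota> c k t f \<in> carrier (SK k)"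
proof -
  assume tf: "t \<in> Tplus_ell \<G>" "f \<in> carrier (SK k)"
  have "act_skew \<G> R \<iota> c k t f h \<in> carrier R" if "h \<in> Qk \<G> k" for h
    unfolding act_eq[OF that] by (rule R.finsum_closed[OF AX_term_closed[OF tf]])
  moreover have "act_skew \<G> R \<iota> c k t f \<in> extensional (Qk \<G> k)"
    unfolding act_skew_def by (rule restrict_extensional)
  ultimately show ?thesis unfolding skew_simps(1) PiE_def by blast
qed

lemma act_add:
  assumes t: "t \<in> Tplus_ell \<G>" and f: "f \<in> carrier (SK k)" and g: "g \<in> carrier (SK k)"
  shows "act_skew \<G> R \<iota> c k t (f \<oplus>\<^bsub>SK k\<^esub> g) = act_skew \<G> R \<iota> c k t f \<oplus>\<^bsub>SK k\<^esub> act_skew \<G> R \<iota> c k t g"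
proof (rule skew_eqI[where k = k])
  fix h assume h: "h \<in> Qk \<G> k"
  have "act_skew \<G> R \<iota> c k t (f \<oplus>\<^bsub>SK k\<^esub> g) h
    = finsum R (\<lambda>z. (case z of (i, h') \<Rightarrow> phiR \<G> R t (summand R (c k + k) (f h') i))
        \<oplus>\<^bsub>R\<^esub> (case z of (i, h') \<Rightarrow> phiR \<G> R t (summand R (c k + k) (g h') i))) (AX k t h)"
    unfolding act_eq[OF h]
    by (rule R.finsum_cong')
      (use t in \<open>auto simp: AX_def skew_add_apply skew_apply[OF f] skew_apply[OF g] summand_add ring_hom_add[OF phiR_hom]\<close>)
  also have "\<dots> = (act_skew \<G> R \<iota> c k t f \<oplus>\<^bsub>SK k\<^esub> act_skew \<G> R \<iota> c k t g) h"
    unfolding skew_add_apply[OF h] act_eq[OF h]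
    by (rule R.finsum_addf) (rule AX_term_closed[OF t f], rule AX_term_closed[OF t g])
  finally show "act_skew \<G> R \<iota> c k t (f \<oplus>\<^bsub>SK k\<^esub> g) h = (act_skew \<G> R \<iota> c k t f \<oplus>\<^bsub>SK k\<^esub> act_skew \<G> R \<iota> c k t g) h" .
qed (intro act_closed skew_add_closed t f g)+

lemma act_zero: "t \<in> Tplus_ell \<G> \<Longrightarrow> act_skew \<G> R \<iota> c k t \<zero>\<^bsub>SK k\<^esub> = \<zero>\<^bsub>SK k\<^esub>"
proof -
  assume t: "t \<in> Tplus_ell \<G>"
  interpret K: abelian_group "SK k" by (rule abelian_group_skew)
  show ?thesis
    using act_add[OF t K.zero_closed K.zero_closed] act_closed[OF t K.zero_closed]
    by (simp add: K.add.l_cancel_one')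
qed

text \<open>Multiplication and conjugation preserve congruence modulo N_k, so the inclusion of sets
  in the definition of the action only records the class of the image of one representative.\<close>

lemma AX_image_iff:
  assumes t: "t \<in> Tplus_ell \<G>" and x: "x \<in> Zp" and a: "a \<in> N1 \<G>" and b: "b \<in> N1 \<G>"
  shows "(\<lambda>n. matrix_inv (\<iota> (mult_of \<G> t * x)) ** conjg t (\<iota> x ** n)) ` cs k a \<subseteq> cs k b
    \<longleftrightarrow> cs k b = cs k (matrix_inv (\<iota> (mult_of \<G> t * x)) ** conjg t (\<iota> x ** a))"
proof -
  let ?w = "\<lambda>n. matrix_inv (\<iota> (mult_of \<G> t * x)) ** conjg t (\<iota> x ** n)"
  have zx: "mult_of \<G> t * x \<in> Zp" using mult_of_spec(1)[OF t] x by (rule Zp_mult)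
  have w: "eqv k (?w a) (?w n)" if "eqv k a n" for n
    using that zx x by (intro eqv_mult eqv_conjg_T[OF t] eqv_refl N0_inv iota_N0)
  have wa: "?w a \<in> N0 \<G>" using eqv_N0(1)[OF w[OF eqv_refl[OF N1_N0[OF a]]]] .
  have "?w ` cs k a \<subseteq> cs k b \<longleftrightarrow> eqv k b (?w a)"
  proof
    assume "?w ` cs k a \<subseteq> cs k b"
    then have "?w a \<in> cs k b" using cs_self[OF N1_N0[OF a]] by blast
    then show "eqv k b (?w a)" by (simp add: cs_def)
  next
    assume e: "eqv k b (?w a)"
    show "?w ` cs k a \<subseteq> cs k b"
    proof
      fix y assume "y \<in> ?w ` cs k a"
      then obtain n where "eqv k a n" "y = ?w n" by (auto simp: cs_def)
      then show "y \<in> cs k b" using eqv_trans[OF e w] by (simp add: cs_def)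
    qed
  qed
  then show ?thesis using cs_eq_iff[OF N1_N0[OF b] wa] by blast
qed

text \<open>At most one index pair contributes. Write n = \<iota>(i) \<iota>(P) n' with n' the part
  of \<open>n\<close> in N_1, P = p^M y and M = c_k + k. Modulo N_k, n' commutes with \<iota>(P), t
  \<iota>(P) t^-1 equals \<iota>(z P), and \<iota>(z P) commutes with the resulting element of N_1.
  The summand c_k of \<open>M\<close> serves the two commutations, the summand \<open>k\<close> the
  equality.\<close>

lemma act_gen:
  assumes k: "k \<ge> 1" and m: "m \<ge> c k + k" and t: "t \<in> Tplus_ell \<G>" and n: "n \<in> N0 \<G>" and a: "a \<in> carrier R"
  shows "act_skew \<G> R \<iota> c k t (gen k m a n) = gen k m (phiR \<G> R t a) (conjg t n)"
proof (rule skew_eqI[where k = k])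
  let ?M = "c k + k" and ?x = "ell \<G> n" and ?z = "mult_of \<G> t"
  let ?v = "chi R ?x \<otimes>\<^bsub>R\<^esub> (phi R ^^ m) a"
  obtain i y where i: "i < CARD('p) ^ ?M" "y \<in> Zp" "?x = of_nat i + pp ^ ?M * y"
    using Zp_residue[OF ell_Zp[OF n]] by blast
  have sm: "summand R ?M ?v j = (if j = i then ?v else \<zero>\<^bsub>R\<^esub>)" if "j < CARD('p) ^ ?M" for j
    using summand_gen[OF a i(2,1) that m] i(3) by simp
  note p = part_N1[OF n]
  let ?P = "pp ^ ?M * y"
  have P: "?P \<in> Zp" using i(2) by (intro Zp_mult Zp_power pp_in_Zp)
  have zZ: "?z \<in> Zp" by (rule mult_of_spec(1)[OF t])
  let ?i = "of_nat i :: 'p padic"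
  let ?w = "matrix_inv (\<iota> (?z * ?i)) ** conjg t (\<iota> ?i ** part n)"
  have N: "\<iota> ?i \<in> N0 \<G>" "\<iota> ?P \<in> N0 \<G>" "\<iota> (?z * ?i) \<in> N0 \<G>" "\<iota> (?z * ?P) \<in> N0 \<G>" "part n \<in> N0 \<G>"
    using P zZ p by (simp_all add: iota_N0 of_nat_in_Zp Zp_mult N1_N0)
  have tn: "conjg t (\<iota> ?i ** part n) \<in> N0 \<G>" "conjg t (\<iota> ?P) \<in> N0 \<G>"
    using TplusD(2)[OF t] N by (simp_all add: N0_mult)
  have w: "?w \<in> N1 \<G>"
  proof -
    have "ell \<G> (part n) = 0" using p by (simp add: N1_iff)
    then show ?thesis
      using N tn by (simp add: N1_iff N0_mult N0_inv ell_mult ell_inv ell_iota mult_of_spec(2)[OF t]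
        zZ Zp_mult of_nat_in_Zp)
  qed
  have coset: "eqv k ?w (part (conjg t n))"
  proof -
    \<comment> \<open>This allows \<iota>(P) to be moved to the right of the part of
      \<open>n\<close> in N_1.\<close>
    have "eqv k (part n) (conjg (\<iota> ?P) (part n))" by (rule eqv_central[OF k _ i(2) p]) simp
    then have "eqv k (part n ** \<iota> ?P) (conjg (\<iota> ?P) (part n) ** \<iota> ?P)" using N by (intro eqv_mult eqv_refl)
    then have "eqv k (part n ** \<iota> ?P) (\<iota> ?P ** part n)" using N by (simp add: conjg_def N0_group)
    from eqv_mult[OF eqv_refl[OF N(1)] this]
    have "eqv k (\<iota> ?i ** (part n ** \<iota> ?P)) (\<iota> ?i ** (\<iota> ?P ** part n))" .
    moreover have "\<iota> ?i ** (\<iota> ?P ** part n) = n"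
      using iota_part[OF n] P by (simp add: i(3) iota_add of_nat_in_Zp matrix_mul_assoc)
    ultimately have "eqv k (\<iota> ?i ** part n ** \<iota> ?P) n" by (simp add: matrix_mul_assoc)
    then have 1: "eqv k (conjg t (\<iota> ?i ** part n) ** conjg t (\<iota> ?P)) (conjg t n)"
      using eqv_conjg_T[OF t] by (simp add: conjg_mult[OF Tplus_invertible[OF t], symmetric])
    \<comment> \<open>The failure of \<iota> to commute with conjugation by \<open>t\<close> is
      absorbed here.\<close>
    have "eqv k (conjg t (\<iota> ?i ** part n) ** \<iota> (?z * ?P)) (conjg t (\<iota> ?i ** part n) ** conjg t (\<iota> ?P))"
      using eqv_twist[OF t _ i(2), of k ?M] tn by (intro eqv_mult eqv_refl) simp_all
    from eqv_trans[OF this 1]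
    have "eqv k (matrix_inv (\<iota> (?z * ?P)) ** (matrix_inv (\<iota> (?z * ?i)) ** (conjg t (\<iota> ?i ** part n) ** \<iota> (?z * ?P))))
        (matrix_inv (\<iota> (?z * ?P)) ** (matrix_inv (\<iota> (?z * ?i)) ** conjg t n))"
      using N by (intro eqv_mult eqv_refl N0_inv)
    moreover have "matrix_inv (\<iota> (?z * ?P)) ** (matrix_inv (\<iota> (?z * ?i)) ** conjg t n) = part (conjg t n)"
    proof -
      have "\<iota> (?z * ?x) = \<iota> (?z * ?i) ** \<iota> (?z * ?P)"
        using zZ P by (simp add: i(3) distrib_left iota_add Zp_mult of_nat_in_Zp)
      then show ?thesis using N by (simp add: part_def mult_of_spec(2)[OF t n] N0_inv_mult matrix_mul_assoc)
    qed
    moreover have "matrix_inv (\<iota> (?z * ?P)) ** (matrix_inv (\<iota> (?z * ?i)) ** (conjg t (\<iota> ?i ** part n) ** \<iota> (?z * ?P)))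
        = conjg (matrix_inv (\<iota> (?z * ?P))) ?w"
      using N by (simp add: conjg_def N0_inv_cancel matrix_mul_assoc)
    ultimately have 2: "eqv k (conjg (matrix_inv (\<iota> (?z * ?P))) ?w) (part (conjg t n))" by simp
    have zy: "?z * (- y) \<in> Zp" using zZ i(2) by (simp add: Zp_mult Zp_minus)
    \<comment> \<open>The remaining conjugating element is \<iota>(p^M (-z y)), which again acts
      trivially on N_1/N_k.\<close>
    have "eqv k ?w (conjg (\<iota> (pp ^ ?M * (?z * (- y)))) ?w)" by (rule eqv_central[OF k _ zy w]) simp
    moreover have "\<iota> (pp ^ ?M * (?z * (- y))) = matrix_inv (\<iota> (?z * ?P))"
      using iota_minus[of "?z * ?P"] zZ P by (simp add: Zp_mult mult.left_commute)
    ultimately show ?thesis using eqv_trans[OF _ 2] by simp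
  qed
  let ?t = "(i, cs k (part n))"
  let ?F = "\<lambda>(i, h'). phiR \<G> R t (summand R ?M (gen k m a n h') i)"
  have F0: "?F z = \<zero>\<^bsub>R\<^esub>" if "z \<in> AX k t h" "z \<noteq> ?t" for z h
  proof -
    obtain j h1 where z: "z = (j, h1)" by (cases z) auto
    have zz: "j < CARD('p) ^ ?M" "h1 \<in> Qk \<G> k" using that(1) z by (auto simp: AX_def)
    show ?thesis
    proof (cases "h1 = cs k (part n)")
      case True
      then have "j \<noteq> i" using that(2) z by auto
      then show ?thesis using True zz z n a t by (simp add: gen_def single_apply sm)
    next
      case False
      then show ?thesis using zz z n a t by (auto simp: gen_def single_apply summand_zero)
    qed
  qed
  have Ft: "?F ?t = chi R (ell \<G> (conjg t n)) \<otimes>\<^bsub>R\<^esub> (phi R ^^ m) (phiR \<G> R t a)"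
    using p i(1) n a t
    by (simp add: gen_def single_apply cs_Qk sm ring_hom_mult[OF phiR_hom] phiR_chi phiR_phi ell_Zp mult_of_spec(2))
  fix h assume h: "h \<in> Qk \<G> k"
  then obtain b where b: "b \<in> N1 \<G>" "h = cs k b" by (auto simp: Qk_eq)
  have t_iff: "?t \<in> AX k t h \<longleftrightarrow> h = cs k (part (conjg t n))"
    using AX_image_iff[OF t of_nat_in_Zp[of i] p b(1), of k] i(1) p cs_eqI[OF coset]
    by (simp add: AX_def cs_Qk b(2))
  show "act_skew \<G> R \<iota> c k t (gen k m a n) h = gen k m (phiR \<G> R t a) (conjg t n) h"
  proof (cases "h = cs k (part (conjg t n))")
    case True
    then have tt: "?t \<in> AX k t h" using t_iff by blast
    have "act_skew \<G> R \<iota> c k t (gen k m a n) h = ?F ?t"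
      unfolding act_eq[OF h] by (rule R.finsum_single[OF finite_AX tt AX_term_closed[OF t gen_closed[OF n a]] F0])
    then show ?thesis unfolding Ft using True h by (simp add: gen_def single_apply)
  next
    case False
    then have tt: "?t \<notin> AX k t h" using t_iff by blast
    have "act_skew \<G> R \<iota> c k t (gen k m a n) h = \<zero>\<^bsub>R\<^esub>"
      unfolding act_eq[OF h] by (rule R.finsum_zeros) (use F0 tt in blast)
    then show ?thesis using False h by (simp add: gen_def single_apply)
  qed
qed (intro act_closed gen_closed TplusD(2)[OF t] phiR_closed t n a)+

lemma act_mult:
  assumes k: "k \<ge> 1" and t: "t \<in> Tplus_ell \<G>" and f: "f \<in> carrier (SK k)" and g: "g \<in> carrier (SK k)"
  shows "act_skew \<G> R \<iota> c k t (f \<otimes>\<^bsub>SK k\<^esub> g) = act_skew \<G> R \<iota> c k t f \<otimes>\<^bsub>SK k\<^esub> act_skew \<G> R \<iota> c k t g"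
proof -
  note cl = skew_mult_closed gen_closed skew_mult_zero skew_distr act_closed[OF t] act_zero[OF t] act_add[OF t]
  have m: "c k \<le> c k + k" by simp
  note G = gen_mult[OF k m] act_gen[OF k order_refl t]
  have 1: "act_skew \<G> R \<iota> c k t (gen k (c k + k) a n \<otimes>\<^bsub>SK k\<^esub> g)
      = act_skew \<G> R \<iota> c k t (gen k (c k + k) a n) \<otimes>\<^bsub>SK k\<^esub> act_skew \<G> R \<iota> c k t g"
    if n: "n \<in> N0 \<G>" "a \<in> carrier R" for a n
    using g
  proof (induction rule: skew_induct[where m = "c k + k"])
    case (gen m d)
    then show ?case
      using n t by (simp add: G N0_mult TplusD(2)[OF t] ring_hom_mult[OF phiR_hom] conjg_mult[OF Tplus_invertible[OF t]])
  qed (use n in \<open>simp_all add: cl\<close>)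
  show ?thesis
    using f
  proof (induction rule: skew_induct[where m = "c k + k"])
    case (gen m d)
    then show ?case using 1 by simp
  qed (use g in \<open>simp_all add: cl\<close>)
qed

lemma act_one:
  assumes k: "k \<ge> 1" and t: "t \<in> Tplus_ell \<G>"
  shows "act_skew \<G> R \<iota> c k t \<one>\<^bsub>SK k\<^esub> = \<one>\<^bsub>SK k\<^esub>"
  unfolding skew_one[where m = "c k + k"]
  by (simp add: act_gen[OF k order_refl t] N0_one ring_hom_one[OF phiR_hom[OF t]] Tplus_invertible[OF t])

lemma act_comp:
  assumes k: "k \<ge> 1" and t: "t \<in> Tplus_ell \<G>" and t': "t' \<in> Tplus_ell \<G>" and f: "f \<in> carrier (SK k)"
  shows "act_skew \<G> R \<iota> c k (t ** t') f = act_skew \<G> R \<iota> c k t (act_skew \<G> R \<iota> c k t' f)"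
  using f
proof (induction rule: skew_induct[where m = "c k + k"])
  case (gen n a)
  then show ?case
    using t t' by (simp add: act_gen[OF k order_refl] Tplus_mult TplusD(2) phiR_mult conjg_conjg Tplus_invertible)
qed (use t t' in \<open>simp_all add: act_zero act_add act_closed Tplus_mult\<close>)

lemma act_id:
  assumes k: "k \<ge> 1" and f: "f \<in> carrier (SK k)"
  shows "act_skew \<G> R \<iota> c k (mat 1) f = f"
  using f
proof (induction rule: skew_induct[where m = "c k + k"])
  case (gen n a)
  then show ?case by (simp add: act_gen[OF k order_refl] Tplus_one phiR_one)
qed (simp_all add: act_zero act_add Tplus_one)

section \<open>Transition maps between the levels\<close>

lemma transition_eq:
  "h \<in> Qk \<G> k \<Longrightarrow> transition \<G> R k f h = finsum R f {h' \<in> Qk \<G> (Suc k). h' \<subseteq> h}"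
  unfolding transition_def by (rule restrict_apply')

lemma transition_closed: "f \<in> carrier (SK (Suc k)) \<Longrightarrow> transition \<G> R k f \<in> carrier (SK k)"
proof -
  assume f: "f \<in> carrier (SK (Suc k))"
  have "transition \<G> R k f h \<in> carrier R" if "h \<in> Qk \<G> k" for h
    unfolding transition_eq[OF that] using skew_apply[OF f] by (intro R.finsum_closed) auto
  then show ?thesis unfolding skew_simps(1) transition_def by auto
qed

lemma transition_add:
  assumes f: "f \<in> carrier (SK (Suc k))" and g: "g \<in> carrier (SK (Suc k))"
  shows "transition \<G> R k (f \<oplus>\<^bsub>SK (Suc k)\<^esub> g) = transition \<G> R k f \<oplus>\<^bsub>SK k\<^esub> transition \<G> R k g"
proof (rule skew_eqI[where k = k])
  fix h assume h: "h \<in> Qk \<G> k"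
  have "transition \<G> R k (f \<oplus>\<^bsub>SK (Suc k)\<^esub> g) h = finsum R (\<lambda>h. f h \<oplus>\<^bsub>R\<^esub> g h) {h' \<in> Qk \<G> (Suc k). h' \<subseteq> h}"
    unfolding transition_eq[OF h] using skew_apply[OF f] skew_apply[OF g]
    by (intro R.finsum_cong') (auto simp: skew_add_apply)
  also have "\<dots> = (transition \<G> R k f \<oplus>\<^bsub>SK k\<^esub> transition \<G> R k g) h"
    unfolding skew_add_apply[OF h] transition_eq[OF h] using skew_apply[OF f] skew_apply[OF g]
    by (intro R.finsum_addf) auto
  finally show "transition \<G> R k (f \<oplus>\<^bsub>SK (Suc k)\<^esub> g) h = (transition \<G> R k f \<oplus>\<^bsub>SK k\<^esub> transition \<G> R k g) h" .
qed (intro transition_closed skew_add_closed f g)+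

lemma transition_zero: "transition \<G> R k \<zero>\<^bsub>SK (Suc k)\<^esub> = \<zero>\<^bsub>SK k\<^esub>"
proof -
  interpret K: abelian_group "SK k" by (rule abelian_group_skew)
  show ?thesis
    using transition_add[OF skew_zero_closed skew_zero_closed, of k] transition_closed[OF skew_zero_closed, of k]
      abelian_group.axioms(1)[OF abelian_group_skew, of "Suc k"]
    by (simp add: K.add.l_cancel_one' abelian_monoid.l_zero skew_zero_closed)
qed

lemma transition_single:
  assumes n: "n \<in> N1 \<G>" and r: "r \<in> carrier R"
  shows "transition \<G> R k (single (Suc k) n r) = single k n r"
proof (rule skew_eqI[where k = k])
  fix h assume h: "h \<in> Qk \<G> k"
  then obtain b where b: "b \<in> N1 \<G>" "h = cs k b" by (auto simp: Qk_eq)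
  let ?H = "{h' \<in> Qk \<G> (Suc k). h' \<subseteq> h}"
  have iff: "cs (Suc k) n \<in> ?H \<longleftrightarrow> h = cs k n"
  proof
    assume "cs (Suc k) n \<in> ?H"
    then have "n \<in> cs k b" using cs_self[OF N1_N0[OF n]] b(2) by blast
    then show "h = cs k n" unfolding b(2) by (intro cs_eqI) (simp add: cs_def)
  next
    assume "h = cs k n"
    moreover have "cs (Suc k) n \<subseteq> cs k n" using eqv_Suc by (auto simp: cs_def)
    ultimately show "cs (Suc k) n \<in> ?H" using n by (simp add: cs_Qk)
  qed
  have cl: "single (Suc k) n r \<in> ?H \<rightarrow> carrier R" using r by (auto simp: single_apply)
  have fin: "finite ?H" using finite_Qk by simp
  show "transition \<G> R k (single (Suc k) n r) h = single k n r h"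
  proof (cases "h = cs k n")
    case True
    then have t: "cs (Suc k) n \<in> ?H" using iff by blast
    have "finsum R (single (Suc k) n r) ?H = single (Suc k) n r (cs (Suc k) n)"
      by (rule R.finsum_single[OF fin t cl]) (simp add: single_apply)
    then show ?thesis unfolding transition_eq[OF h] using True h n by (simp add: single_apply cs_Qk)
  next
    case False
    then have t: "cs (Suc k) n \<notin> ?H" using iff by blast
    have "finsum R (single (Suc k) n r) ?H = \<zero>\<^bsub>R\<^esub>"
      by (rule R.finsum_zeros) (use t in \<open>auto simp: single_apply\<close>)
    then show ?thesis unfolding transition_eq[OF h] using False h by (simp add: single_apply)
  qed
qed (intro transition_closed single_closed r)+

lemma transition_gen:
  "n \<in> N0 \<G> \<Longrightarrow> a \<in> carrier R \<Longrightarrow> transition \<G> R k (gen (Suc k) m a n) = gen k m a n"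
  unfolding gen_def by (rule transition_single[OF part_N1]) simp_all

lemma transition_one: "transition \<G> R k \<one>\<^bsub>SK (Suc k)\<^esub> = \<one>\<^bsub>SK k\<^esub>"
  unfolding skew_one[where m = 0] by (rule transition_gen) (simp_all add: N0_one)

lemma transition_mult:
  assumes k: "k \<ge> 1" and f: "f \<in> carrier (SK (Suc k))" and g: "g \<in> carrier (SK (Suc k))"
  shows "transition \<G> R k (f \<otimes>\<^bsub>SK (Suc k)\<^esub> g) = transition \<G> R k f \<otimes>\<^bsub>SK k\<^esub> transition \<G> R k g"
proof -
  \<comment> \<open>An exponent for which the product formula holds at both levels.\<close>
  define M where "M = c k + c (Suc k)"
  note cl = skew_mult_closed gen_closed skew_mult_zero skew_distr transition_closed transition_zero transition_add
  have m: "c k \<le> M" "c (Suc k) \<le> M" and k': "1 \<le> Suc k" by (simp_all add: M_def)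
  note G = gen_mult[OF k m(1)] gen_mult[OF k' m(2)] transition_gen
  have 1: "transition \<G> R k (gen (Suc k) M a n \<otimes>\<^bsub>SK (Suc k)\<^esub> g)
      = transition \<G> R k (gen (Suc k) M a n) \<otimes>\<^bsub>SK k\<^esub> transition \<G> R k g"
    if n: "n \<in> N0 \<G>" "a \<in> carrier R" for a n
    using g
  proof (induction rule: skew_induct[where m = M])
    case (gen m d)
    then show ?case using n by (simp add: G N0_mult)
  qed (use n in \<open>simp_all add: cl\<close>)
  show ?thesis
    using f
  proof (induction rule: skew_induct[where m = M])
    case (gen m d)
    then show ?case using 1 by simp
  qed (use g in \<open>simp_all add: cl\<close>)
qed

lemma transition_act:
  assumes k: "k \<ge> 1" and t: "t \<in> Tplus_ell \<G>" and f: "f \<in> carrier (SK (Suc k))"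
  shows "transition \<G> R k (act_skew \<G> R \<iota> c (Suc k) t f) = act_skew \<G> R \<iota> c k t (transition \<G> R k f)"
proof -
  define m where "m = c k + k + (c (Suc k) + Suc k)"
  have m: "c k + k \<le> m" "c (Suc k) + Suc k \<le> m" and k': "1 \<le> Suc k" by (simp_all add: m_def)
  show ?thesis
    using f
  proof (induction rule: skew_induct[where m = m])
    case (gen n a)
    then show ?case
      by (simp add: transition_gen act_gen[OF k m(1) t] act_gen[OF k' m(2) t] TplusD(2)[OF t] t)
  qed (simp_all add: act_closed[OF t] act_zero[OF t] act_add[OF t] transition_closed transition_zero transition_add)
qed

text \<open>Since \<open>\<phi>\<close> maps \<open>N\<^sub>k\<close> into \<open>N\<^sub>k\<^sub>+\<^sub>1\<close>, the action of \<open>s\<close> at level \<open>k + 1\<close> factors through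
  the transition map to level \<open>k\<close>; \<open>lft k\<close> is an additive right inverse of the latter.\<close>

definition repr where "repr k h = (SOME a. a \<in> N1 \<G> \<and> cs k a = h)"

definition lft where
  "lft k g = (\<lambda>h\<in>Qk \<G> (Suc k).
     if h = cs (Suc k) (repr k (cs k (repr (Suc k) h))) then g (cs k (repr (Suc k) h)) else \<zero>\<^bsub>R\<^esub>)"

lemma repr_spec: "a \<in> N1 \<G> \<Longrightarrow> repr k (cs k a) \<in> N1 \<G> \<and> eqv k a (repr k (cs k a))"
proof -
  assume a: "a \<in> N1 \<G>"
  have "repr k (cs k a) \<in> N1 \<G> \<and> cs k (repr k (cs k a)) = cs k a"
    unfolding repr_def by (rule someI[of "\<lambda>b. b \<in> N1 \<G> \<and> cs k b = cs k a" a]) (simp add: a)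
  then show ?thesis using a cs_eq_iff[of a "repr k (cs k a)" k] by (auto simp: N1_N0)
qed

lemma lft_closed: "g \<in> carrier (SK k) \<Longrightarrow> lft k g \<in> carrier (SK (Suc k))"
proof -
  assume g: "g \<in> carrier (SK k)"
  have "cs k (repr (Suc k) h) \<in> Qk \<G> k" if "h \<in> Qk \<G> (Suc k)" for h
    using that repr_spec[of _ "Suc k"] by (auto simp: Qk_eq)
  then show ?thesis unfolding skew_simps(1) lft_def using skew_apply[OF g] by auto
qed

lemma lft_add: "lft k (f \<oplus>\<^bsub>SK k\<^esub> g) = lft k f \<oplus>\<^bsub>SK (Suc k)\<^esub> lft k g"
proof -
  have "cs k (repr (Suc k) h) \<in> Qk \<G> k" if "h \<in> Qk \<G> (Suc k)" for h
    using that repr_spec[of _ "Suc k"] by (auto simp: Qk_eq)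
  then show ?thesis unfolding skew_simps(4) lft_def by (intro restrict_ext) auto
qed

lemma lft_zero: "lft k \<zero>\<^bsub>SK k\<^esub> = \<zero>\<^bsub>SK (Suc k)\<^esub>"
proof -
  have "cs k (repr (Suc k) h) \<in> Qk \<G> k" if "h \<in> Qk \<G> (Suc k)" for h
    using that repr_spec[of _ "Suc k"] by (auto simp: Qk_eq)
  then show ?thesis unfolding skew_simps(3) lft_def by (intro restrict_ext) auto
qed

text \<open>Lifting keeps the coefficient and passes from the class of \<open>n\<close> modulo N_k
  to the class of its fixed representative modulo N_{k+1}. A generator therefore lifts to a
  generator whose group element is congruent modulo N_k.\<close>

lemma lft_single:
  assumes n: "n \<in> N1 \<G>"
  shows "lft k (single k n r) = single (Suc k) (repr k (cs k n)) r"
proof -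
  have "(if h = cs (Suc k) (repr k (cs k (repr (Suc k) h))) then single k n r (cs k (repr (Suc k) h)) else \<zero>\<^bsub>R\<^esub>)
      = (if h = cs (Suc k) (repr k (cs k n)) then r else \<zero>\<^bsub>R\<^esub>)" if h: "h \<in> Qk \<G> (Suc k)" for h
  proof -
    obtain a where a: "a \<in> N1 \<G>" "h = cs (Suc k) a" using h by (auto simp: Qk_eq)
    have rh: "repr (Suc k) h \<in> N1 \<G>" "eqv (Suc k) a (repr (Suc k) h)"
      using repr_spec[OF a(1), of "Suc k"] a(2) by simp_all
    have up: "cs k (repr (Suc k) h) = cs k a" using cs_eqI[OF eqv_Suc[OF rh(2)]] by simp
    have down: "cs k a = cs k n" if "h = cs (Suc k) (repr k (cs k n))"
    proof -
      have "eqv (Suc k) a (repr k (cs k n))"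
        using that a repr_spec[OF n, of k] cs_eq_iff[of a "repr k (cs k n)" "Suc k"] by (simp add: N1_N0)
      then have "eqv k a n" using eqv_Suc eqv_sym eqv_trans repr_spec[OF n, of k] by blast
      then show ?thesis by (rule cs_eqI)
    qed
    have sa: "single k n r (cs k a) = (if cs k a = cs k n then r else \<zero>\<^bsub>R\<^esub>)"
      using a(1) by (simp add: single_apply cs_Qk)
    show ?thesis
    proof (cases "cs k a = cs k n")
      case True
      show ?thesis unfolding up sa unfolding True by simp
    next
      case False
      then have "h \<noteq> cs (Suc k) (repr k (cs k n))" using down by blast
      then show ?thesis unfolding up sa using False by simp
    qed
  qed
  then show ?thesis unfolding lft_def single_def[of "Suc k"] by (intro restrict_ext) simp
qed

text \<open>Projecting and lifting back changes the group element of a generator by a congruence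
  modulo N_k only, which conjugation by \<open>s\<close> sharpens to a congruence modulo
  N_{k+1}.\<close>

lemma act_ss_lft:
  assumes k: "k \<ge> 1" and f: "f \<in> carrier (SK (Suc k))"
  shows "act_skew \<G> R \<iota> c (Suc k) (ss \<G>) (lft k (transition \<G> R k f)) = act_skew \<G> R \<iota> c (Suc k) (ss \<G>) f"
proof -
  have k': "1 \<le> Suc k" by simp
  note s = ss_Tplus
  define M where "M = c (Suc k) + Suc k"
  note ag = act_gen[OF k' eq_refl[OF M_def[symmetric]] s]
  show ?thesis
    using f
  proof (induction rule: skew_induct[where m = M])
    case (gen n a)
    let ?p = "repr k (cs k (part n))" and ?x = "ell \<G> n"
    have p: "?p \<in> N1 \<G>" "eqv k (part n) ?p" using repr_spec[OF part_N1[OF gen(1)]] by simp_all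
    have x: "?x \<in> Zp" using ell_Zp[OF gen(1)] .
    have "lft k (transition \<G> R k (gen (Suc k) M a n)) = gen (Suc k) M a (\<iota> ?x ** ?p)"
      using gen x p(1) by (simp add: transition_gen) (simp add: gen_def[of k] lft_single part_N1 gen_iota_mult)
    moreover have "eqv k n (\<iota> ?x ** ?p)"
      using eqv_mult[OF eqv_refl[OF iota_N0[OF x]] p(2)] iota_part[OF gen(1)] by simp
    from gen_eqv[OF eqv_conjg_ss[OF k this]]
    have "gen (Suc k) M (phiR \<G> R (ss \<G>) a) (conjg (ss \<G>) (\<iota> ?x ** ?p)) = gen (Suc k) M (phiR \<G> R (ss \<G>) a) (conjg (ss \<G>) n)"
      by simp
    moreover have "\<iota> ?x ** ?p \<in> N0 \<G>" using iota_N0[OF x] p(1) by (simp add: N0_mult N1_N0)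
    ultimately show ?case using gen by (simp add: ag)
  qed (simp_all add: transition_zero transition_add transition_closed lft_zero lft_add lft_closed act_zero[OF s] act_add[OF s])
qed

end

section \<open>The completed skew group ring\<close>

context skew_data
begin

abbreviation CS where "CS \<equiv> completed \<G> R \<iota> c"

lemma CS_iff: "x \<in> carrier CS \<longleftrightarrow> x \<in> extensional {1..} \<and> (\<forall>k\<ge>1. x k \<in> carrier (SK k))
    \<and> (\<forall>k\<ge>1. transition \<G> R k (x (Suc k)) = x k)"
  unfolding completed_def partial_object.simps PiE_def by auto

lemma CS_restrict_iff: "(\<lambda>k\<in>{1..}. f k) \<in> carrier CS \<longleftrightarrow>
    (\<forall>k\<ge>1. f k \<in> carrier (SK k)) \<and> (\<forall>k\<ge>1. transition \<G> R k (f (Suc k)) = f k)"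
  unfolding CS_iff by simp

lemma CS_ops:
  "x \<otimes>\<^bsub>CS\<^esub> y = (\<lambda>k\<in>{1..}. x k \<otimes>\<^bsub>SK k\<^esub> y k)" "\<one>\<^bsub>CS\<^esub> = (\<lambda>k\<in>{1..}. \<one>\<^bsub>SK k\<^esub>)"
  "\<zero>\<^bsub>CS\<^esub> = (\<lambda>k\<in>{1..}. \<zero>\<^bsub>SK k\<^esub>)" "x \<oplus>\<^bsub>CS\<^esub> y = (\<lambda>k\<in>{1..}. x k \<oplus>\<^bsub>SK k\<^esub> y k)"
  by (simp_all only: completed_def ring.simps monoid.simps partial_object.simps)

lemma CS_level: "x \<in> carrier CS \<Longrightarrow> k \<ge> 1 \<Longrightarrow> x k \<in> carrier (SK k)"
  and CS_transition: "x \<in> carrier CS \<Longrightarrow> k \<ge> 1 \<Longrightarrow> transition \<G> R k (x (Suc k)) = x k"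
  unfolding CS_iff by simp_all

lemma CS_apply:
  assumes "k \<ge> 1"
  shows "(x \<otimes>\<^bsub>CS\<^esub> y) k = x k \<otimes>\<^bsub>SK k\<^esub> y k" "\<one>\<^bsub>CS\<^esub> k = \<one>\<^bsub>SK k\<^esub>" "\<zero>\<^bsub>CS\<^esub> k = \<zero>\<^bsub>SK k\<^esub>"
    "(x \<oplus>\<^bsub>CS\<^esub> y) k = x k \<oplus>\<^bsub>SK k\<^esub> y k"
  using assms by (simp_all add: CS_ops)

lemma CS_eqI:
  assumes "x \<in> carrier CS" "y \<in> carrier CS" "\<And>k. k \<ge> 1 \<Longrightarrow> x k = y k"
  shows "x = y"
  by (rule extensionalityI[of _ "{1..}"]) (use assms in \<open>auto simp: CS_iff\<close>)

lemma CS_closed: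
  "\<zero>\<^bsub>CS\<^esub> \<in> carrier CS" "\<one>\<^bsub>CS\<^esub> \<in> carrier CS"
  "x \<in> carrier CS \<Longrightarrow> y \<in> carrier CS \<Longrightarrow> x \<oplus>\<^bsub>CS\<^esub> y \<in> carrier CS"
  "x \<in> carrier CS \<Longrightarrow> y \<in> carrier CS \<Longrightarrow> x \<otimes>\<^bsub>CS\<^esub> y \<in> carrier CS"
  unfolding CS_ops CS_restrict_iff
  by (auto simp: skew_zero_closed skew_one_closed skew_add_closed skew_mult_closed transition_zero transition_one
    transition_add transition_mult CS_level CS_transition)

lemma abelian_group_CS: "abelian_group CS"
proof (rule abelian_groupI)
  fix x y z assume "x \<in> carrier CS" "y \<in> carrier CS" "z \<in> carrier CS"
  then show "x \<oplus>\<^bsub>CS\<^esub> y \<oplus>\<^bsub>CS\<^esub> z = x \<oplus>\<^bsub>CS\<^esub> (y \<oplus>\<^bsub>CS\<^esub> z)"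
    by (intro CS_eqI CS_closed)
      (simp_all add: CS_apply CS_level abelian_monoid.a_assoc[OF abelian_group.axioms(1)[OF abelian_group_skew]])
next
  fix x y assume "x \<in> carrier CS" "y \<in> carrier CS"
  then show "x \<oplus>\<^bsub>CS\<^esub> y = y \<oplus>\<^bsub>CS\<^esub> x"
    by (intro CS_eqI CS_closed)
      (simp_all add: CS_apply CS_level abelian_monoid.a_comm[OF abelian_group.axioms(1)[OF abelian_group_skew]])
next
  fix x assume x: "x \<in> carrier CS"
  then show "\<zero>\<^bsub>CS\<^esub> \<oplus>\<^bsub>CS\<^esub> x = x"
    by (intro CS_eqI CS_closed)
      (simp_all add: CS_apply CS_level abelian_monoid.l_zero[OF abelian_group.axioms(1)[OF abelian_group_skew]])
  let ?y = "\<lambda>k\<in>{1..}. \<ominus>\<^bsub>SK k\<^esub> x k"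
  have "transition \<G> R k (\<ominus>\<^bsub>SK (Suc k)\<^esub> x (Suc k)) = \<ominus>\<^bsub>SK k\<^esub> x k" if k: "k \<ge> 1" for k
  proof -
    interpret K: abelian_group "SK k" by (rule abelian_group_skew)
    interpret K': abelian_group "SK (Suc k)" by (rule abelian_group_skew)
    have xs: "x (Suc k) \<in> carrier (SK (Suc k))" using CS_level[OF x] by simp
    have "transition \<G> R k (\<ominus>\<^bsub>SK (Suc k)\<^esub> x (Suc k)) \<oplus>\<^bsub>SK k\<^esub> transition \<G> R k (x (Suc k)) = \<zero>\<^bsub>SK k\<^esub>"
      using transition_add[of "\<ominus>\<^bsub>SK (Suc k)\<^esub> x (Suc k)" k "x (Suc k)"] xs
      by (simp add: K'.l_neg transition_zero)
    then show ?thesis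
      using CS_transition[OF x k] CS_level[OF x k] transition_closed[of "\<ominus>\<^bsub>SK (Suc k)\<^esub> x (Suc k)" k] xs
      by (intro K.minus_equality[symmetric]) auto
  qed
  then have y: "?y \<in> carrier CS"
    unfolding CS_restrict_iff using CS_level[OF x] by (simp add: abelian_group.a_inv_closed[OF abelian_group_skew])
  have "?y \<oplus>\<^bsub>CS\<^esub> x = \<zero>\<^bsub>CS\<^esub>"
    by (intro CS_eqI CS_closed y x)
      (simp add: CS_apply abelian_group.l_neg[OF abelian_group_skew] CS_level[OF x])
  then show "\<exists>y\<in>carrier CS. y \<oplus>\<^bsub>CS\<^esub> x = \<zero>\<^bsub>CS\<^esub>" using y by blast
qed (simp_all add: CS_closed)

lemma ring_CS: "ring CS"
proof (rule ringI[OF abelian_group_CS monoidI])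
  fix x y z assume *: "x \<in> carrier CS" "y \<in> carrier CS" "z \<in> carrier CS"
  then show "x \<otimes>\<^bsub>CS\<^esub> y \<otimes>\<^bsub>CS\<^esub> z = x \<otimes>\<^bsub>CS\<^esub> (y \<otimes>\<^bsub>CS\<^esub> z)"
    by (intro CS_eqI CS_closed) (simp_all add: CS_apply CS_level skew_assoc)
  from * show "(x \<oplus>\<^bsub>CS\<^esub> y) \<otimes>\<^bsub>CS\<^esub> z = x \<otimes>\<^bsub>CS\<^esub> z \<oplus>\<^bsub>CS\<^esub> y \<otimes>\<^bsub>CS\<^esub> z"
    by (intro CS_eqI CS_closed) (simp_all add: CS_apply CS_level skew_distr)
  from * show "z \<otimes>\<^bsub>CS\<^esub> (x \<oplus>\<^bsub>CS\<^esub> y) = z \<otimes>\<^bsub>CS\<^esub> x \<oplus>\<^bsub>CS\<^esub> z \<otimes>\<^bsub>CS\<^esub> y"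
    by (intro CS_eqI CS_closed) (simp_all add: CS_apply CS_level skew_distr)
next
  fix x assume "x \<in> carrier CS"
  then show "\<one>\<^bsub>CS\<^esub> \<otimes>\<^bsub>CS\<^esub> x = x" "x \<otimes>\<^bsub>CS\<^esub> \<one>\<^bsub>CS\<^esub> = x"
    by (intro CS_eqI CS_closed; simp add: CS_apply CS_level skew_one_mult)+
qed (simp_all add: CS_closed)

sublocale S: ring CS by (rule ring_CS)

lemma CS_level_hom: "k \<ge> 1 \<Longrightarrow> (\<lambda>x. x k) \<in> ring_hom CS (SK k)"
  by (rule ring_hom_memI) (simp_all add: CS_level CS_apply)

lemma CS_minus_apply:
  "k \<ge> 1 \<Longrightarrow> x \<in> carrier CS \<Longrightarrow> y \<in> carrier CS \<Longrightarrow> (x \<ominus>\<^bsub>CS\<^esub> y) k = x k \<ominus>\<^bsub>SK k\<^esub> y k"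
  using ring_hom_minus[OF CS_level_hom ring_CS ring_skew] by simp

section \<open>Level one and the augmentation\<close>

lemma Qk_1: "Qk \<G> 1 = {cs 1 (mat 1)}"
proof -
  have e: "cs 1 n = cs 1 (mat 1)" if "n \<in> N1 \<G>" for n
    using that N1_group(3)[OF that] by (intro cs_eqI) (simp add: eqv_def N1_N0 N0_one Nk_1 del: One_nat_def)
  show ?thesis
    unfolding Qk_eq
  proof (rule subset_antisym)
    show "cs 1 ` N1 \<G> \<subseteq> {cs 1 (mat 1)}" using e by blast
    show "{cs 1 (mat 1)} \<subseteq> cs 1 ` N1 \<G>" using N1_group(1) by blast
  qed
qed

lemma ellR_eq: "x \<in> carrier CS \<Longrightarrow> ellR \<G> R x = x 1 (cs 1 (mat 1))"
  using skew_apply[OF CS_level[of x 1], of "cs 1 (mat 1)"] cs_Qk[OF N1_group(1), of 1]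
  unfolding ellR_def Qk_1 by (subst R.finsum_insert) auto

lemma aug_gen: "n \<in> N0 \<G> \<Longrightarrow> gen 1 m a n (cs 1 (mat 1)) = chi R (ell \<G> n) \<otimes>\<^bsub>R\<^esub> (phi R ^^ m) a"
proof -
  assume n: "n \<in> N0 \<G>"
  have q: "cs 1 (mat 1) \<in> Qk \<G> 1" by (rule cs_Qk[OF N1_group(1)])
  have "cs 1 (part n) \<in> Qk \<G> 1" by (rule cs_Qk[OF part_N1[OF n]])
  then have e: "cs 1 (part n) = cs 1 (mat 1)" unfolding Qk_1 by (rule singletonD)
  show ?thesis unfolding gen_def single_apply[OF q] e by (simp only: if_True HOL.refl)
qed

lemma aug_ops:
  "(f \<oplus>\<^bsub>SK 1\<^esub> g) (cs 1 (mat 1)) = f (cs 1 (mat 1)) \<oplus>\<^bsub>R\<^esub> g (cs 1 (mat 1))"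
  "\<zero>\<^bsub>SK 1\<^esub> (cs 1 (mat 1)) = \<zero>\<^bsub>R\<^esub>"
  using cs_Qk[OF N1_group(1), of 1] by (simp_all add: skew_add_apply skew_zero_apply)

lemma aug_closed: "f \<in> carrier (SK 1) \<Longrightarrow> f (cs 1 (mat 1)) \<in> carrier R"
  using skew_apply cs_Qk[OF N1_group(1)] by blast

text \<open>At level one a generator [a, n] becomes \<chi>(\<ell>(n)) \<phi>^m(a), and \<ell> is
  additive on products.\<close>

lemma aug_mult:
  assumes f: "f \<in> carrier (SK 1)" and g: "g \<in> carrier (SK 1)"
  shows "(f \<otimes>\<^bsub>SK 1\<^esub> g) (cs 1 (mat 1)) = f (cs 1 (mat 1)) \<otimes>\<^bsub>R\<^esub> g (cs 1 (mat 1))"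
proof -
  note cl = skew_mult_closed gen_closed aug_closed aug_ops
  have 1: "(gen 1 (c 1) a n \<otimes>\<^bsub>SK 1\<^esub> g) (cs 1 (mat 1)) = gen 1 (c 1) a n (cs 1 (mat 1)) \<otimes>\<^bsub>R\<^esub> g (cs 1 (mat 1))"
    if n: "n \<in> N0 \<G>" "a \<in> carrier R" for a n
    using g
  proof (induction rule: skew_induct[where m = "c 1"])
    case (gen n' b)
    have "gen 1 (c 1) a n \<otimes>\<^bsub>SK 1\<^esub> gen 1 (c 1) b n' = gen 1 (c 1) (a \<otimes>\<^bsub>R\<^esub> b) (n ** n')"
      by (rule gen_mult[OF order_refl order_refl n(1) gen(1) n(2) gen(2)])
    then show ?case
      using n gen by (simp only: aug_gen N0_mult)
        (simp add: ell_mult chi_add ell_Zp ring_hom_mult[OF phi_power_hom] R.m_ac)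
  next
    case zero
    show ?case using n by (simp only: skew_mult_zero(2)[OF gen_closed] aug_ops R.r_null[OF aug_closed[OF gen_closed]])
  next
    case (add f g)
    then show ?case using n by (simp only: skew_distr(2) cl R.r_distr)
  qed
  show ?thesis
    using f
  proof (induction rule: skew_induct[where m = "c 1"])
    case (gen n' b)
    then show ?case by (simp only: 1)
  next
    case zero
    show ?case using g by (simp only: skew_mult_zero aug_ops R.l_null[OF aug_closed])
  next
    case (add f f')
    then show ?case using g by (simp only: skew_distr(1) cl R.l_distr)
  qed
qed

lemma aug_one: "\<one>\<^bsub>SK 1\<^esub> (cs 1 (mat 1)) = \<one>\<^bsub>R\<^esub>"
  unfolding skew_one[where m = 0] aug_gen[OF N0_one] by (simp add: ell_one chi_0)

lemma aug_act:
  assumes t: "t \<in> Tplus_ell \<G>" and f: "f \<in> carrier (SK 1)"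
  shows "act_skew \<G> R \<iota> c 1 t f (cs 1 (mat 1)) = phiR \<G> R t (f (cs 1 (mat 1)))"
proof -
  define M where "M = c 1 + 1"
  note ag = act_gen[OF order_refl eq_refl[OF M_def[symmetric]] t]
  show ?thesis
    using f
  proof (induction rule: skew_induct[where m = M])
    case (gen n a)
    then show ?case
      using t by (simp only: ag aug_gen TplusD(2)[OF t])
        (simp add: ell_Zp mult_of_spec(2) ring_hom_mult[OF phiR_hom] phiR_chi phiR_phi)
  next
    case zero
    show ?case by (simp only: act_zero[OF t] aug_ops phiR_zero[OF t])
  next
    case (add f g)
    then show ?case by (simp only: act_add[OF t] aug_ops ring_hom_add[OF phiR_hom[OF t]] aug_closed)
  qed
qed

lemma ellR_hom: "ellR \<G> R \<in> ring_hom CS R"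
proof (rule ring_hom_memI)
  fix x y assume x: "x \<in> carrier CS" and y: "y \<in> carrier CS"
  note l = CS_level[OF x order_refl] CS_level[OF y order_refl]
  show "ellR \<G> R x \<in> carrier R" using l(1) by (simp only: ellR_eq[OF x] aug_closed)
  show "ellR \<G> R (x \<otimes>\<^bsub>CS\<^esub> y) = ellR \<G> R x \<otimes>\<^bsub>R\<^esub> ellR \<G> R y"
    using x y l by (simp only: ellR_eq CS_closed CS_apply[OF order_refl] aug_mult)
  show "ellR \<G> R (x \<oplus>\<^bsub>CS\<^esub> y) = ellR \<G> R x \<oplus>\<^bsub>R\<^esub> ellR \<G> R y"
    using x y l by (simp only: ellR_eq CS_closed CS_apply[OF order_refl] aug_ops)
next
  show "ellR \<G> R \<one>\<^bsub>CS\<^esub> = \<one>\<^bsub>R\<^esub>"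
    by (simp only: ellR_eq CS_closed CS_apply[OF order_refl] aug_one)
qed

section \<open>The action on the completed ring and the embedding of \<open>R\<close>\<close>

lemma phiS_apply: "k \<ge> 1 \<Longrightarrow> phiS \<G> R \<iota> c t x k = act_skew \<G> R \<iota> c k t (x k)"
  by (simp add: phiS_def)

lemma phiS_closed: "t \<in> Tplus_ell \<G> \<Longrightarrow> x \<in> carrier CS \<Longrightarrow> phiS \<G> R \<iota> c t x \<in> carrier CS"
  unfolding phiS_def CS_restrict_iff by (simp add: act_closed CS_level transition_act CS_transition)

lemma phiS_hom: "t \<in> Tplus_ell \<G> \<Longrightarrow> phiS \<G> R \<iota> c t \<in> ring_hom CS CS"
proof (rule ring_hom_memI)
  assume t: "t \<in> Tplus_ell \<G>"
  fix x y assume x: "x \<in> carrier CS" and y: "y \<in> carrier CS"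
  show "phiS \<G> R \<iota> c t x \<in> carrier CS" using phiS_closed[OF t x] .
  show "phiS \<G> R \<iota> c t (x \<otimes>\<^bsub>CS\<^esub> y) = phiS \<G> R \<iota> c t x \<otimes>\<^bsub>CS\<^esub> phiS \<G> R \<iota> c t y"
    by (intro CS_eqI CS_closed phiS_closed t x y) (simp add: CS_apply phiS_apply act_mult t CS_level x y)
  show "phiS \<G> R \<iota> c t (x \<oplus>\<^bsub>CS\<^esub> y) = phiS \<G> R \<iota> c t x \<oplus>\<^bsub>CS\<^esub> phiS \<G> R \<iota> c t y"
    by (intro CS_eqI CS_closed phiS_closed t x y) (simp add: CS_apply phiS_apply act_add t CS_level x y)
next
  assume t: "t \<in> Tplus_ell \<G>"
  show "phiS \<G> R \<iota> c t \<one>\<^bsub>CS\<^esub> = \<one>\<^bsub>CS\<^esub>"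
    by (intro CS_eqI CS_closed phiS_closed t) (simp add: CS_apply phiS_apply act_one t)
qed

lemma phiS_mult:
  assumes t: "t \<in> Tplus_ell \<G>" "t' \<in> Tplus_ell \<G>" and x: "x \<in> carrier CS"
  shows "phiS \<G> R \<iota> c (t ** t') x = phiS \<G> R \<iota> c t (phiS \<G> R \<iota> c t' x)"
  by (intro CS_eqI phiS_closed Tplus_mult t x) (simp add: phiS_apply act_comp t CS_level x)

lemma phiS_one: "x \<in> carrier CS \<Longrightarrow> phiS \<G> R \<iota> c (mat 1) x = x"
  by (intro CS_eqI phiS_closed Tplus_one) (simp_all add: phiS_apply act_id CS_level)

lemma phiS_commute:
  assumes t: "t \<in> Tplus_ell \<G>" "t' \<in> Tplus_ell \<G>" and x: "x \<in> carrier CS"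
  shows "phiS \<G> R \<iota> c t (phiS \<G> R \<iota> c t' x) = phiS \<G> R \<iota> c t' (phiS \<G> R \<iota> c t x)"
  using phiS_mult[OF t x] phiS_mult[OF t(2,1) x] Tplus_commute[OF t] by simp

lemma ellR_phiS: "t \<in> Tplus_ell \<G> \<Longrightarrow> x \<in> carrier CS \<Longrightarrow> ellR \<G> R (phiS \<G> R \<iota> c t x) = phiR \<G> R t (ellR \<G> R x)"
  using aug_act[OF _ CS_level[OF _ order_refl], of t x]
  by (simp only: ellR_eq phiS_closed phiS_apply[OF order_refl])

lemma iotaR_apply: "k \<ge> 1 \<Longrightarrow> iotaR \<G> R r k = single k (mat 1) r"
  by (simp add: iotaR_def single_def Nk_cs)

lemma iotaR_closed: "r \<in> carrier R \<Longrightarrow> iotaR \<G> R r \<in> carrier CS"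
proof -
  assume r: "r \<in> carrier R"
  have "iotaR \<G> R r = (\<lambda>k\<in>{1..}. single k (mat 1) r)"
    unfolding iotaR_def single_def Nk_cs ..
  then show ?thesis
    using r by (simp only: CS_restrict_iff) (simp add: single_closed transition_single N1_group)
qed

lemma single_one_gen: "x \<in> Zp \<Longrightarrow> single k (mat 1) (chi R x \<otimes>\<^bsub>R\<^esub> (phi R ^^ m) a) = gen k m a (\<iota> x)"
  using gen_iota_mult[of x "mat 1" k m a] N1_group(1) by simp

text \<open>The generators with group element \<iota>(x) multiply exactly as the elements \<chi>(x)
  \<phi>^m(a) of \<open>R\<close> do.\<close>

lemma single_one_mult:
  assumes k: "k \<ge> 1" and r: "r \<in> carrier R" and r': "r' \<in> carrier R"
  shows "single k (mat 1) (r \<otimes>\<^bsub>R\<^esub> r') = single k (mat 1) r \<otimes>\<^bsub>SK k\<^esub> single k (mat 1) r'"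
proof -
  let ?m = "c k"
  have 1: "single k (mat 1) (chi R x \<otimes>\<^bsub>R\<^esub> (phi R ^^ ?m) a \<otimes>\<^bsub>R\<^esub> r')
      = single k (mat 1) (chi R x \<otimes>\<^bsub>R\<^esub> (phi R ^^ ?m) a) \<otimes>\<^bsub>SK k\<^esub> single k (mat 1) r'"
    if x: "x \<in> Zp" "a \<in> carrier R" for x a
    using r'
  proof (induction rule: R_induct[where m = ?m])
    case zero
    then show ?case using x by (simp add: single_zero skew_mult_zero single_closed)
  next
    case (gen y b)
    have "chi R x \<otimes>\<^bsub>R\<^esub> (phi R ^^ ?m) a \<otimes>\<^bsub>R\<^esub> (chi R y \<otimes>\<^bsub>R\<^esub> (phi R ^^ ?m) b) = chi R (x + y) \<otimes>\<^bsub>R\<^esub> (phi R ^^ ?m) (a \<otimes>\<^bsub>R\<^esub> b)"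
      using x gen by (simp add: chi_add ring_hom_mult[OF phi_power_hom] R.m_ac)
    then show ?case
      using x gen by (simp add: single_one_gen Zp_add gen_mult[OF k order_refl] iota_N0 iota_add)
  next
    case (add s s')
    then show ?case using x by (simp add: R.r_distr single_add skew_distr single_closed)
  qed
  show ?thesis
    using r
  proof (induction rule: R_induct[where m = ?m])
    case zero
    then show ?case using r' by (simp add: single_zero skew_mult_zero single_closed)
  next
    case (gen y b)
    then show ?case by (rule 1)
  next
    case (add s s')
    then show ?case using r' by (simp add: R.l_distr single_add skew_distr single_closed)
  qed
qed

lemma iotaR_hom: "iotaR \<G> R \<in> ring_hom R CS"
proof (rule ring_hom_memI)
  fix x y assume x: "x \<in> carrier R" and y: "y \<in> carrier R"
  show "iotaR \<G> R x \<in> carrier CS" using iotaR_closed[OF x] .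
  show "iotaR \<G> R (x \<otimes>\<^bsub>R\<^esub> y) = iotaR \<G> R x \<otimes>\<^bsub>CS\<^esub> iotaR \<G> R y"
    by (intro CS_eqI CS_closed iotaR_closed R.m_closed x y) (simp add: CS_apply iotaR_apply single_one_mult x y)
  show "iotaR \<G> R (x \<oplus>\<^bsub>R\<^esub> y) = iotaR \<G> R x \<oplus>\<^bsub>CS\<^esub> iotaR \<G> R y"
    by (intro CS_eqI CS_closed iotaR_closed R.a_closed x y) (simp add: CS_apply iotaR_apply single_add x y)
next
  show "iotaR \<G> R \<one>\<^bsub>R\<^esub> = \<one>\<^bsub>CS\<^esub>"
    by (intro CS_eqI CS_closed iotaR_closed R.one_closed) (simp add: CS_apply iotaR_apply single_def skew_simps Nk_cs)
qed

lemma ellR_iotaR: "r \<in> carrier R \<Longrightarrow> ellR \<G> R (iotaR \<G> R r) = r"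
  using cs_Qk[OF N1_group(1), of 1]
  by (simp only: ellR_eq iotaR_closed iotaR_apply[OF order_refl] single_apply if_True HOL.refl)

text \<open>Rests on \<iota>(p x) = \<phi>(\<iota>(x)): the generators at \<iota>(x) are sent to
  generators at \<iota>(p x). Nothing of the kind is assumed about t \<iota>(x) t^-1 for other
  \<open>t\<close>.\<close>

lemma phiS_iotaR:
  assumes r: "r \<in> carrier R"
  shows "phiS \<G> R \<iota> c (ss \<G>) (iotaR \<G> R r) = iotaR \<G> R (phiR \<G> R (ss \<G>) r)"
proof (intro CS_eqI phiS_closed iotaR_closed ss_Tplus phiR_closed r)
  note s = ss_Tplus
  fix k :: nat assume k: "k \<ge> 1"
  define m where "m = c k + k"
  note ag = act_gen[OF k eq_refl[OF m_def[symmetric]] s]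
  have "act_skew \<G> R \<iota> c k (ss \<G>) (single k (mat 1) r) = single k (mat 1) (phiR \<G> R (ss \<G>) r)"
    using r
  proof (induction rule: R_induct[where m = m])
    case zero
    then show ?case by (simp add: single_zero act_zero s)
  next
    case (gen x a)
    have "phiR \<G> R (ss \<G>) (chi R x \<otimes>\<^bsub>R\<^esub> (phi R ^^ m) a) = chi R (pp * x) \<otimes>\<^bsub>R\<^esub> (phi R ^^ m) (phiR \<G> R (ss \<G>) a)"
      using gen s by (simp add: ring_hom_mult[OF phiR_hom] phiR_chi phiR_phi mult_of_ss)
    then show ?case
      using gen s by (simp add: single_one_gen ag iota_N0 iota_pp phiN_def Zp_mult pp_in_Zp)
  next
    case (add r r')
    then show ?case using s by (simp add: single_add act_add single_closed ring_hom_add[OF phiR_hom])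
  qed
  then show "phiS \<G> R \<iota> c (ss \<G>) (iotaR \<G> R r) k = iotaR \<G> R (phiR \<G> R (ss \<G>) r) k"
    using k by (simp add: phiS_apply iotaR_apply)
qed

text \<open>The kernel of the projection to level n + 1. The shift makes \<open>JS 0\<close> the
  kernel of the augmentation, level one being \<open>R\<close>.\<close>

definition JS :: "nat \<Rightarrow> ('r, 'p, 'n) compl set" where
  "JS n = {x \<in> carrier CS. x (Suc n) = \<zero>\<^bsub>SK (Suc n)\<^esub>}"

lemma JS_minus_iff:
  assumes "x \<in> carrier CS" "y \<in> carrier CS"
  shows "x \<ominus>\<^bsub>CS\<^esub> y \<in> JS n \<longleftrightarrow> x (Suc n) = y (Suc n)"
proof -
  interpret K: ring "SK (Suc n)" by (rule ring_skew) simp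
  have "x (Suc n) \<in> carrier (SK (Suc n))" "y (Suc n) \<in> carrier (SK (Suc n))" using assms by (simp_all add: CS_level)
  then show ?thesis
    using assms by (simp add: JS_def CS_minus_apply K.minus_eq_zero_iff)
qed

lemma contracting_extension: "contracting_extension CS R (ellR \<G> R) (phiS \<G> R \<iota> c (ss \<G>)) JS"
proof (rule contracting_extension.intro[OF ring_CS R.ring_axioms ellR_hom phiS_hom[OF ss_Tplus]])
  show "JS n \<subseteq> carrier CS" for n by (auto simp: JS_def)
  show "a \<otimes>\<^bsub>CS\<^esub> b \<in> JS n" "b \<otimes>\<^bsub>CS\<^esub> a \<in> JS n" if "a \<in> JS n" "b \<in> carrier CS" for a b n
    using that by (simp_all add: JS_def CS_closed CS_apply skew_mult_zero CS_level)
  show "a \<oplus>\<^bsub>CS\<^esub> b \<in> JS n" if "a \<in> JS n" "b \<in> JS n" for a b n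
    using that abelian_monoid.l_zero[OF abelian_group.axioms(1)[OF abelian_group_skew], OF skew_zero_closed]
    by (simp add: JS_def CS_closed CS_apply)
  show "\<zero>\<^bsub>CS\<^esub> \<in> JS n" for n by (simp add: JS_def CS_closed CS_apply)
  show "JS 0 = {a \<in> carrier CS. ellR \<G> R a = \<zero>\<^bsub>R\<^esub>}"
  proof -
    have "a 1 = \<zero>\<^bsub>SK 1\<^esub> \<longleftrightarrow> ellR \<G> R a = \<zero>\<^bsub>R\<^esub>" if a: "a \<in> carrier CS" for a
    proof
      assume "a 1 = \<zero>\<^bsub>SK 1\<^esub>"
      then show "ellR \<G> R a = \<zero>\<^bsub>R\<^esub>" by (simp only: ellR_eq[OF a] aug_ops)
    next
      assume e: "ellR \<G> R a = \<zero>\<^bsub>R\<^esub>"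
      show "a 1 = \<zero>\<^bsub>SK 1\<^esub>"
      proof (rule skew_eqI[OF CS_level[OF a order_refl] skew_zero_closed])
        fix h assume "h \<in> Qk \<G> 1"
        then have "h = cs 1 (mat 1)" unfolding Qk_1 by simp
        then show "a 1 h = \<zero>\<^bsub>SK 1\<^esub> h" using e by (simp only: ellR_eq[OF a] aug_ops)
      qed
    qed
    then show ?thesis unfolding JS_def by auto
  qed
  show "JS (Suc n) \<subseteq> JS n" for n
  proof
    fix x assume "x \<in> JS (Suc n)"
    then show "x \<in> JS n" using CS_transition[of x "Suc n"] by (simp add: JS_def transition_zero)
  qed
  show "a = \<zero>\<^bsub>CS\<^esub>" if "\<And>n. a \<in> JS n" for a
  proof (rule CS_eqI[OF _ CS_closed(1)])
    show "a \<in> carrier CS" using that[of 0] by (simp add: JS_def)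
    fix k :: nat assume "k \<ge> 1"
    then show "a k = \<zero>\<^bsub>CS\<^esub> k" using that[of "k - 1"] by (simp add: JS_def CS_apply)
  qed
  show "phiS \<G> R \<iota> c (ss \<G>) a \<in> JS (Suc n)" if "a \<in> JS n" for a n
  proof -
    have a: "a \<in> carrier CS" "a (Suc n) = \<zero>\<^bsub>SK (Suc n)\<^esub>" using that by (simp_all add: JS_def)
    have l: "a (Suc (Suc n)) \<in> carrier (SK (Suc (Suc n)))" using CS_level[OF a(1)] by simp
    \<comment> \<open>By \<open>act_ss_lft\<close>, level n + 2 of \<phi>_s(a) depends only on level
      n + 1 of \<open>a\<close>, which is zero.\<close>
    have "lft (Suc n) (transition \<G> R (Suc n) (a (Suc (Suc n)))) = \<zero>\<^bsub>SK (Suc (Suc n))\<^esub>"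
      using CS_transition[OF a(1), of "Suc n"] a(2) by (simp add: lft_zero)
    then have "act_skew \<G> R \<iota> c (Suc (Suc n)) (ss \<G>) (a (Suc (Suc n))) = \<zero>\<^bsub>SK (Suc (Suc n))\<^esub>"
      using act_ss_lft[OF _ l] by (simp add: act_zero ss_Tplus)
    then show ?thesis using phiS_closed[OF ss_Tplus a(1)] by (simp add: JS_def phiS_apply)
  qed
  show "\<exists>y\<in>carrier CS. \<forall>n. y \<ominus>\<^bsub>CS\<^esub> x n \<in> JS n"
    if x: "\<And>n. x n \<in> carrier CS" "\<And>n. x (Suc n) \<ominus>\<^bsub>CS\<^esub> x n \<in> JS n" for x
  proof -
    \<comment> \<open>Diagonal limit: at level \<open>k\<close> the sequence is constant from the
      index k - 1 on.\<close>
    let ?y = "\<lambda>k\<in>{1..}. x (k - 1) k"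
    have step: "x (Suc n) (Suc n) = x n (Suc n)" for n using x(2)[of n] by (simp add: JS_minus_iff x(1))
    have y: "?y \<in> carrier CS"
      unfolding CS_restrict_iff
    proof (intro conjI allI impI)
      fix k :: nat assume k: "1 \<le> k"
      show "x (k - 1) k \<in> carrier (SK k)" using CS_level[OF x(1) k] .
      show "transition \<G> R k (x (Suc k - 1) (Suc k)) = x (k - 1) k"
        using CS_transition[OF x(1) k, of k] step[of "k - 1"] k by simp
    qed
    have "?y \<ominus>\<^bsub>CS\<^esub> x n \<in> JS n" for n unfolding JS_minus_iff[OF y x(1)] by simp
    then show ?thesis using y by blast
  qed
qed

lemma ellR_surj: "ellR \<G> R ` carrier CS = carrier R"
  using ring_hom_closed[OF ellR_hom] iotaR_closed ellR_iotaR by (auto simp: image_iff) metis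

lemma CS_nontrivial: "\<one>\<^bsub>CS\<^esub> \<noteq> \<zero>\<^bsub>CS\<^esub>"
  using nontrivial ring_hom_one[OF ellR_hom] ring_hom_zero[OF ellR_hom ring_CS R.ring_axioms] by metis

end

section \<open>Reduction of modules\<close>

lemma inv_into_ident: "inv_into UNIV (\<lambda>x. x) u = u"
  by (rule inv_into_f_eq) auto

text \<open>The map takes 1 \<otimes> b_e to g(b_e), and the vectors 1 \<otimes> b_e form a basis of
  the tensor product. A linear map is bijective exactly if it carries this basis to a basis.\<close>

lemma etale_iff:
  assumes M: "left_module A M" and \<phi>: "\<phi> \<in> ring_hom A A" and g: "semilin A \<phi> M M g"
    and b: "module_basis A M E b"
  shows "bij_betw (msum M (\<lambda>a m. a \<odot>\<^bsub>M\<^esub> g m)) (carrier (tensor (\<lambda>xs. xs) A A \<phi> M)) (carrier M)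
    \<longleftrightarrow> module_basis A M E (\<lambda>e. g (b e))"
proof -
  interpret M: left_module A M by (rule M)
  interpret T: tensor_product "\<lambda>xs. xs" A A \<phi> M
    by (rule tensor_product.intro[OF _ M.R.ring_axioms M \<phi>]) (simp add: inj_on_def)
  have idf: "(\<lambda>a. a) \<in> carrier A \<rightarrow> carrier A" by simp
  note gc = semilinD[OF g]
  let ?g = "\<lambda>a m. a \<odot>\<^bsub>M\<^esub> g m"
  note gs = gc M.smult_closed M.smult_l_distr M.smult_r_distr M.smult_assoc1 ring_hom_closed[OF \<phi>]
  have "semilin A (\<lambda>a. a) T.T M (\<lambda>u. msum M ?g (inv_into UNIV (\<lambda>xs. xs) u))"
    by (rule T.T_lift(1)[OF M idf]) (simp_all add: gs)
  then have L: "semilin A (\<lambda>a. a) T.T M (msum M ?g)" by (simp only: inv_into_ident)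
  have tin: "msum M ?g (T.tin m) = g m" if "m \<in> carrier M" for m
  proof -
    have "msum M ?g (inv_into UNIV (\<lambda>xs. xs) (T.tin m)) = \<one>\<^bsub>A\<^esub> \<odot>\<^bsub>M\<^esub> g m"
      by (rule T.T_lift(2)[OF M idf]) (simp_all add: that gs)
    then show ?thesis using gc(1)[OF that] by (simp only: inv_into_ident M.smult_one)
  qed
  have "module_basis A M E (\<lambda>e. msum M (\<lambda>a m. a \<odot>\<^bsub>M\<^esub> g m) (T.tin (b e))) \<longleftrightarrow> module_basis A M E (\<lambda>e. g (b e))"
  proof -
    have c: "(\<Oplus>\<^bsub>M\<^esub>e\<in>E. a e \<odot>\<^bsub>M\<^esub> msum M (\<lambda>a m. a \<odot>\<^bsub>M\<^esub> g m) (T.tin (b e))) = (\<Oplus>\<^bsub>M\<^esub>e\<in>E. a e \<odot>\<^bsub>M\<^esub> g (b e))"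
      if "a \<in> E \<rightarrow>\<^sub>E carrier A" for a
      using that by (intro M.M.finsum_cong') (auto simp: tin M.basis_closed[OF b] gc intro!: M.smult_closed)
    have "(\<lambda>e. msum M (\<lambda>a m. a \<odot>\<^bsub>M\<^esub> g m) (T.tin (b e))) \<in> E \<rightarrow> carrier M" "(\<lambda>e. g (b e)) \<in> E \<rightarrow> carrier M"
      by (auto simp: tin M.basis_closed[OF b] gc)
    then show ?thesis unfolding module_basis_def using c by (simp cong: conj_cong)
  qed
  then show ?thesis using bij_betw_iff_basis[OF T.left_module_T M T.basis_T[OF b] L] by simp
qed

section \<open>Modules with an action of \<open>t\<close> and their category\<close>

lemma T_moduleD:
  assumes "T_module \<G> S \<Phi> M"
  shows "left_module S M" "fg_free S M" "t \<in> Tplus_ell \<G> \<Longrightarrow> semilin S (\<Phi> t) M M (tact M t)"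
    "m \<in> carrier M \<Longrightarrow> tact M (mat 1) m = m"
    "t \<in> Tplus_ell \<G> \<Longrightarrow> t' \<in> Tplus_ell \<G> \<Longrightarrow> m \<in> carrier M \<Longrightarrow> tact M (t ** t') m = tact M t (tact M t' m)"
    "bij_betw (msum M (\<lambda>a m. a \<odot>\<^bsub>M\<^esub> tact M (ss \<G>) m)) (carrier (tensor (\<lambda>xs. xs) S S (\<Phi> (ss \<G>)) M)) (carrier M)"
  using assms unfolding T_module_def semilin_def by auto

lemma T_moduleI:
  assumes "left_module S M" "fg_free S M" "\<And>t. t \<in> Tplus_ell \<G> \<Longrightarrow> semilin S (\<Phi> t) M M (tact M t)"
    "\<And>m. m \<in> carrier M \<Longrightarrow> tact M (mat 1) m = m"
    "\<And>t t' m. t \<in> Tplus_ell \<G> \<Longrightarrow> t' \<in> Tplus_ell \<G> \<Longrightarrow> m \<in> carrier M \<Longrightarrow> tact M (t ** t') m = tact M t (tact M t' m)"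
    "bij_betw (msum M (\<lambda>a m. a \<odot>\<^bsub>M\<^esub> tact M (ss \<G>) m)) (carrier (tensor (\<lambda>xs. xs) S S (\<Phi> (ss \<G>)) M)) (carrier M)"
  shows "T_module \<G> S \<Phi> M"
  unfolding T_module_def using assms semilinD[OF assms(3)] by blast

lemma T_homD:
  assumes "f \<in> T_hom \<G> S M M'"
  shows "f \<in> extensional (carrier M)" "semilin S (\<lambda>a. a) M M' f"
    "t \<in> Tplus_ell \<G> \<Longrightarrow> m \<in> carrier M \<Longrightarrow> f (tact M t m) = tact M' t (f m)"
  using assms unfolding T_hom_def semilin_def PiE_def by auto

lemma T_homI:
  assumes "f \<in> extensional (carrier M)" "semilin S (\<lambda>a. a) M M' f"
    "\<And>t m. t \<in> Tplus_ell \<G> \<Longrightarrow> m \<in> carrier M \<Longrightarrow> f (tact M t m) = tact M' t (f m)"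
  shows "f \<in> T_hom \<G> S M M'"
  using assms unfolding T_hom_def semilin_def PiE_def by auto

lemma T_hom_restrict:
  assumes M: "left_module S M" and f: "semilin S (\<lambda>a. a) M M' f"
    and t: "\<And>t m. t \<in> Tplus_ell \<G> \<Longrightarrow> m \<in> carrier M \<Longrightarrow> tact M t m \<in> carrier M"
    "\<And>t m. t \<in> Tplus_ell \<G> \<Longrightarrow> m \<in> carrier M \<Longrightarrow> f (tact M t m) = tact M' t (f m)"
  shows "restrict f (carrier M) \<in> T_hom \<G> S M M'"
  by (rule T_homI[OF restrict_extensional semilin_cong[OF f M]]) (simp_all add: t)

lemma T_hom_eqI:
  assumes "f \<in> T_hom \<G> S M M'" "g \<in> T_hom \<G> S M M'" "\<And>m. m \<in> carrier M \<Longrightarrow> f m = g m"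
  shows "f = g"
  using T_homD(1)[OF assms(1)] T_homD(1)[OF assms(2)] assms(3) by (rule extensionalityI)

lemma T_cat_simps:
  "Ob (T_cat \<G> S \<Phi>) = {M. T_module \<G> S \<Phi> M}" "Hom (T_cat \<G> S \<Phi>) = T_hom \<G> S"
  "Idt (T_cat \<G> S \<Phi>) M = (\<lambda>m \<in> carrier M. m)" "Cmp (T_cat \<G> S \<Phi>) M M' M'' g f = compose (carrier M) g f"
  by (simp_all add: T_cat_def)

lemma T_hom_id:
  assumes "T_module \<G> S \<Phi> M" shows "(\<lambda>m \<in> carrier M. m) \<in> T_hom \<G> S M M"
  by (rule T_hom_restrict[OF T_moduleD(1)[OF assms]])
    (auto intro!: semilinI simp: semilinD(1)[OF T_moduleD(3)[OF assms]])

lemma T_hom_compose: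
  assumes M: "T_module \<G> S \<Phi> M" and f: "f \<in> T_hom \<G> S M M'" and g: "g \<in> T_hom \<G> S M' M''"
  shows "compose (carrier M) g f \<in> T_hom \<G> S M M''"
  unfolding compose_def
  by (rule T_hom_restrict[OF T_moduleD(1)[OF M]], rule semilin_comp[OF T_homD(2)[OF f] T_homD(2)[OF g]])
    (simp_all add: semilinD(1)[OF T_moduleD(3)[OF M]] T_homD(3)[OF f] T_homD(3)[OF g] semilinD(1)[OF T_homD(2)[OF f]])

lemma is_category_T_cat: "is_category (T_cat \<G> S \<Phi>)"
  unfolding is_category_def T_cat_simps mem_Collect_eq
proof (intro conjI ballI allI impI)
  fix U V f assume U: "U \<in> {M. T_module \<G> S \<Phi> M}" and f: "f \<in> T_hom \<G> S U V"
  have fU: "f m \<in> carrier V" if "m \<in> carrier U" for m using semilinD(1)[OF T_homD(2)[OF f] that] .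
  have fe: "f m = undefined" if "m \<notin> carrier U" for m using T_homD(1)[OF f] that by (simp add: extensional_def)
  show "compose (carrier U) f (\<lambda>m\<in>carrier U. m) = f"
    by (rule ext) (simp add: compose_def fe)
  show "compose (carrier U) (\<lambda>m\<in>carrier V. m) f = f"
    by (rule ext) (simp add: compose_def fe fU)
next
  fix U V W Z f g h assume f: "f \<in> T_hom \<G> S U V"
  have fU: "f m \<in> carrier V" if "m \<in> carrier U" for m using semilinD(1)[OF T_homD(2)[OF f] that] .
  show "compose (carrier U) (compose (carrier V) h g) f = compose (carrier U) h (compose (carrier U) g f)"
    by (rule ext) (simp add: compose_def fU)
qed (auto intro: T_hom_id T_hom_compose)

section \<open>Reductions of modules along \<ell>_R\<close>

context skew_data
begin

sublocale CE: contracting_extension CS R "ellR \<G> R" "phiS \<G> R \<iota> c (ss \<G>)" JS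
  by (rule contracting_extension)

abbreviation TmS where "TmS \<equiv> T_module \<G> CS (phiS \<G> R \<iota> c)"
abbreviation TmR where "TmR \<equiv> T_module \<G> R (phiR \<G> R)"

lemma ellR_fun: "ellR \<G> R \<in> carrier CS \<rightarrow> carrier R"
  and phiS_fun: "t \<in> Tplus_ell \<G> \<Longrightarrow> phiS \<G> R \<iota> c t \<in> carrier CS \<rightarrow> carrier CS"
  and phiR_fun: "t \<in> Tplus_ell \<G> \<Longrightarrow> phiR \<G> R t \<in> carrier R \<rightarrow> carrier R"
  using ellR_hom phiS_hom phiR_hom by (auto simp: ring_hom_def)

lemma T_module_basis_S:
  assumes "TmS M"
  shows "\<exists>E\<subseteq>carrier M. module_basis CS M E (\<lambda>e. e) \<and> module_basis CS M E (\<lambda>e. tact M (ss \<G>) e)"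
proof -
  obtain E where E: "E \<subseteq> carrier M" "module_basis CS M E (\<lambda>e. e)"
    using T_moduleD(2)[OF assms] unfolding fg_free_basis by blast
  with etale_iff[OF T_moduleD(1)[OF assms] phiS_hom[OF ss_Tplus] T_moduleD(3)[OF assms ss_Tplus] E(2)]
    T_moduleD(6)[OF assms] show ?thesis by blast
qed

lemma T_module_basis_R:
  assumes "TmR M"
  shows "\<exists>E\<subseteq>carrier M. module_basis R M E (\<lambda>e. e) \<and> module_basis R M E (\<lambda>e. tact M (ss \<G>) e)"
proof -
  obtain E where E: "E \<subseteq> carrier M" "module_basis R M E (\<lambda>e. e)"
    using T_moduleD(2)[OF assms] unfolding fg_free_basis by blast
  with etale_iff[OF T_moduleD(1)[OF assms] phiR_hom[OF ss_Tplus] T_moduleD(3)[OF assms ss_Tplus] E(2)]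
    T_moduleD(6)[OF assms] show ?thesis by blast
qed

text \<open>Expresses that \<open>V\<close> is the base change of \<open>U\<close> along \<ell>_R
  without mentioning a tensor product. Thus the constructed module D(U) under \<open>U\<close> and
  the given module \<open>V\<close> under M(V) are treated alike, and both natural isomorphisms come
  from the same few facts.\<close>

definition reduction ::
  "(('r, 'p, 'n) compl, 'u, ('p, 'n) qmat) tmodule \<Rightarrow> ('r, 'u, ('p, 'n) qmat) tmodule \<Rightarrow> ('u \<Rightarrow> 'u) \<Rightarrow> bool" where
  "reduction U V q \<longleftrightarrow> TmS U \<and> TmR V \<and> semilin CS (ellR \<G> R) U V q
     \<and> (\<forall>t\<in>Tplus_ell \<G>. \<forall>u\<in>carrier U. q (tact U t u) = tact V t (q u))
     \<and> (\<exists>(E :: 'u set) b. module_basis CS U E b \<and> module_basis R V E (\<lambda>e. q (b e)))"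

lemma reductionD:
  fixes U :: "(('r, 'p, 'n) compl, 'u, ('p, 'n) qmat) tmodule"
  assumes "reduction U V q"
  shows "TmS U" "TmR V" "semilin CS (ellR \<G> R) U V q"
    "t \<in> Tplus_ell \<G> \<Longrightarrow> u \<in> carrier U \<Longrightarrow> q (tact U t u) = tact V t (q u)"
    "\<exists>(E :: 'u set) b. module_basis CS U E b \<and> module_basis R V E (\<lambda>e. q (b e))"
  using assms unfolding reduction_def by blast+

lemma reduction_surj:
  fixes U :: "(('r, 'p, 'n) compl, 'u, ('p, 'n) qmat) tmodule"
  assumes r: "reduction U V q" and v: "v \<in> carrier V"
  shows "\<exists>u\<in>carrier U. q u = v"
proof -
  obtain E :: "'u set" and b where E: "module_basis CS U E b" "module_basis R V E (\<lambda>e. q (b e))"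
    using reductionD(5)[OF r] by blast
  show ?thesis
    by (rule CE.reduction_surj[OF T_moduleD(1)[OF reductionD(1)[OF r]] E(1) T_moduleD(1)[OF reductionD(2)[OF r]]
      reductionD(3)[OF r] E(2) ellR_surj v])
qed

lemma reduction_lift_unique:
  fixes U' :: "(('r, 'p, 'n) compl, 'u, ('p, 'n) qmat) tmodule"
  assumes r: "reduction U' V' q'" and U: "TmS U" and \<theta>: "\<theta> \<in> ring_hom CS CS"
    and g: "semilin CS \<theta> U U' g" "\<And>u. u \<in> carrier U \<Longrightarrow> g (tact U (ss \<G>) u) = tact U' (ss \<G>) (g u)"
    and h: "semilin CS \<theta> U U' h" "\<And>u. u \<in> carrier U \<Longrightarrow> h (tact U (ss \<G>) u) = tact U' (ss \<G>) (h u)"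
    and eq: "\<And>u. u \<in> carrier U \<Longrightarrow> q' (g u) = q' (h u)" and u: "u \<in> carrier U"
  shows "g u = h u"
proof -
  obtain E where E: "module_basis CS U E (\<lambda>e. e)" "module_basis CS U E (\<lambda>e. tact U (ss \<G>) e)"
    using T_module_basis_S[OF U] by blast
  obtain F :: "'u set" and d where F: "module_basis CS U' F d" "module_basis R V' F (\<lambda>e. q' (d e))"
    using reductionD(5)[OF r] by blast
  show ?thesis
    by (rule CE.lift_unique[OF T_moduleD(1)[OF U] T_moduleD(1)[OF reductionD(1)[OF r]] T_moduleD(1)[OF reductionD(2)[OF r]]
          \<theta> E T_moduleD(3)[OF U ss_Tplus] T_moduleD(3)[OF reductionD(1)[OF r] ss_Tplus] F(1) reductionD(3)[OF r] F(2) g h eq u])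
qed

text \<open>Lifting with \<theta> = id gives a linear \<open>g\<close> that commutes with
  \<open>s\<close>. For any other \<open>t\<close>, the maps g t and t g are both
  \<phi>_t-semilinear, commute with \<open>s\<close> because the torus is commutative, and have the
  same reduction; uniqueness with \<theta> = \<phi>_t makes them equal.\<close>

lemma reduction_lift_exists:
  fixes U' :: "(('r, 'p, 'n) compl, 'u, ('p, 'n) qmat) tmodule"
  assumes r: "reduction U V q" and r': "reduction U' V' q'" and f: "f \<in> T_hom \<G> R V V'"
  shows "\<exists>g\<in>T_hom \<G> CS U U'. \<forall>u\<in>carrier U. q' (g u) = f (q u)"
proof -
  note U = reductionD(1)[OF r] and U' = reductionD(1)[OF r']
  obtain E where E: "module_basis CS U E (\<lambda>e. e)" "module_basis CS U E (\<lambda>e. tact U (ss \<G>) e)"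
    using T_module_basis_S[OF U] by blast
  obtain F :: "'u set" and d where F: "module_basis CS U' F d" "module_basis R V' F (\<lambda>e. q' (d e))"
    using reductionD(5)[OF r'] by blast
  have idh: "(\<lambda>a. a) \<in> ring_hom CS CS" by (simp add: ring_hom_def)
  have fq: "semilin CS (\<lambda>a. ellR \<G> R a) U V' (\<lambda>u. f (q u))"
    by (rule semilin_comp[OF reductionD(3)[OF r] T_homD(2)[OF f] ellR_fun])
  note qc = semilinD(1)[OF reductionD(3)[OF r]]
  have "\<exists>g. semilin CS (\<lambda>a. a) U U' g \<and> (\<forall>u\<in>carrier U. g (tact U (ss \<G>) u) = tact U' (ss \<G>) (g u) \<and> q' (g u) = f (q u))"
    by (rule CE.lift_exists[OF T_moduleD(1)[OF U] T_moduleD(1)[OF U'] T_moduleD(1)[OF reductionD(2)[OF r']]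
          idh E T_moduleD(3)[OF U ss_Tplus] T_moduleD(3)[OF U' ss_Tplus] F(1) reductionD(3)[OF r'] F(2) _ ellR_surj
          reductionD(4)[OF r' ss_Tplus] fq])
      (simp_all add: reductionD(4)[OF r ss_Tplus] T_homD(3)[OF f ss_Tplus] qc)
  then obtain g where g: "semilin CS (\<lambda>a. a) U U' g" "\<And>u. u \<in> carrier U \<Longrightarrow> g (tact U (ss \<G>) u) = tact U' (ss \<G>) (g u)"
    "\<And>u. u \<in> carrier U \<Longrightarrow> q' (g u) = f (q u)" by blast
  note gc = semilinD(1)[OF g(1)]
  have eqv: "g (tact U t u) = tact U' t (g u)" if t: "t \<in> Tplus_ell \<G>" and u: "u \<in> carrier U" for t u
  proof (rule reduction_lift_unique[OF r' U phiS_hom[OF t] _ _ _ _ _ u])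
    note tU = semilinD(1)[OF T_moduleD(3)[OF U t]] semilinD(1)[OF T_moduleD(3)[OF U ss_Tplus]]
    have tc: "tact U t (tact U (ss \<G>) u) = tact U (ss \<G>) (tact U t u)" if "u \<in> carrier U" for u
      using T_moduleD(5)[OF U t ss_Tplus that] T_moduleD(5)[OF U ss_Tplus t that] Tplus_commute[OF t ss_Tplus] by simp
    have tc': "tact U' t (tact U' (ss \<G>) u) = tact U' (ss \<G>) (tact U' t u)" if "u \<in> carrier U'" for u
      using T_moduleD(5)[OF U' t ss_Tplus that] T_moduleD(5)[OF U' ss_Tplus t that] Tplus_commute[OF t ss_Tplus] by simp
    show "semilin CS (phiS \<G> R \<iota> c t) U U' (\<lambda>u. g (tact U t u))"
      by (rule semilin_comp[OF T_moduleD(3)[OF U t] g(1) phiS_fun[OF t]])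
    show "semilin CS (phiS \<G> R \<iota> c t) U U' (\<lambda>u. tact U' t (g u))"
      by (rule semilin_comp[OF g(1) T_moduleD(3)[OF U' t]]) simp
    show "g (tact U t (tact U (ss \<G>) u)) = tact U' (ss \<G>) (g (tact U t u))" if "u \<in> carrier U" for u
      using that by (simp add: tc g(2) tU)
    show "tact U' t (g (tact U (ss \<G>) u)) = tact U' (ss \<G>) (tact U' t (g u))" if "u \<in> carrier U" for u
      using that by (simp add: tc' g(2) gc)
    show "q' (g (tact U t u)) = q' (tact U' t (g u))" if "u \<in> carrier U" for u
      using that t by (simp add: g(3) tU reductionD(4)[OF r] reductionD(4)[OF r'] gc T_homD(3)[OF f] qc)
  qed
  have "restrict g (carrier U) \<in> T_hom \<G> CS U U'"
    by (rule T_hom_restrict[OF T_moduleD(1)[OF U] g(1)]) (simp_all add: eqv semilinD(1)[OF T_moduleD(3)[OF U]])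
  then show ?thesis using g(3) by (intro bexI[of _ "restrict g (carrier U)"]) auto
qed

lemma T_hom_lift_unique:
  assumes r: "reduction U' V' q'" and U: "TmS U" and g: "g \<in> T_hom \<G> CS U U'" and h: "h \<in> T_hom \<G> CS U U'"
    and eq: "\<And>u. u \<in> carrier U \<Longrightarrow> q' (g u) = q' (h u)"
  shows "g = h"
  by (rule T_hom_eqI[OF g h], rule reduction_lift_unique[OF r U _ T_homD(2)[OF g] T_homD(3)[OF g ss_Tplus] T_homD(2)[OF h] T_homD(3)[OF h ss_Tplus] eq])
    (simp_all add: ring_hom_def)

text \<open>The q(b_e) form a basis, so q(b_e) |-> q'(b_e) extends to a linear map. Surjectivity of
  \<open>q\<close> transfers its equivariance from \<open>U\<close>.\<close>

lemma reduction_descend: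
  fixes U :: "(('r, 'p, 'n) compl, 'u, ('p, 'n) qmat) tmodule"
  assumes r: "reduction U V q" and r': "reduction U V' q'"
  shows "\<exists>f\<in>T_hom \<G> R V V'. \<forall>u\<in>carrier U. f (q u) = q' u"
proof -
  note V = reductionD(2)[OF r] and V' = reductionD(2)[OF r'] and U = reductionD(1)[OF r]
  note qc = semilinD(1)[OF reductionD(3)[OF r]] and qc' = semilinD(1)[OF reductionD(3)[OF r']]
  obtain E :: "'u set" and b where E: "module_basis CS U E b" "module_basis R V E (\<lambda>e. q (b e))"
    using reductionD(5)[OF r] by blast
  have bU: "b e \<in> carrier U" if "e \<in> E" for e using E(1) that unfolding module_basis_def by blast
  obtain f where f: "semilin R (\<lambda>a. a) V V' f" "\<And>e. e \<in> E \<Longrightarrow> f (q (b e)) = q' (b e)"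
    using semilin_extend[OF T_moduleD(1)[OF V] T_moduleD(1)[OF V'] _ E(2), of "\<lambda>a. a" "\<lambda>e. q' (b e)"] bU qc'
    by (auto simp: ring_hom_def)
  have fq: "f (q u) = q' u" if "u \<in> carrier U" for u
    by (rule semilin_eqI[OF T_moduleD(1)[OF U] T_moduleD(1)[OF V'] ellR_fun E(1)
          semilin_comp[OF reductionD(3)[OF r] f(1) ellR_fun] reductionD(3)[OF r'] f(2) that])
  have eqv: "f (tact V t v) = tact V' t (f v)" if t: "t \<in> Tplus_ell \<G>" and v: "v \<in> carrier V" for t v
  proof -
    obtain u where u: "u \<in> carrier U" "q u = v" using reduction_surj[OF r v] by blast
    then show ?thesis
      using reductionD(4)[OF r t u(1)] reductionD(4)[OF r' t u(1)] fq[OF u(1)] fq[OF semilinD(1)[OF T_moduleD(3)[OF U t] u(1)]] by simp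
  qed
  have "restrict f (carrier V) \<in> T_hom \<G> R V V'"
    by (rule T_hom_restrict[OF T_moduleD(1)[OF V] f(1)]) (simp_all add: eqv semilinD(1)[OF T_moduleD(3)[OF V]])
  then show ?thesis using fq qc by (intro bexI[of _ "restrict f (carrier V)"]) auto
qed

lemma T_hom_descend_unique:
  assumes r: "reduction U V q" and f: "f \<in> T_hom \<G> R V V'" and h: "h \<in> T_hom \<G> R V V'"
    and eq: "\<And>u. u \<in> carrier U \<Longrightarrow> f (q u) = h (q u)"
  shows "f = h"
  by (rule T_hom_eqI[OF f h]) (use reduction_surj[OF r] eq in metis)

end

section \<open>The two functors\<close>

text \<open>One basis whose image under \<open>s\<close> is again a basis yields both freeness and
  the etale condition.\<close>

lemma T_moduleI_basis:
  assumes M: "left_module S M" and ne: "\<one>\<^bsub>S\<^esub> \<noteq> \<zero>\<^bsub>S\<^esub>" and \<Phi>: "\<Phi> (ss \<G>) \<in> ring_hom S S" "ss \<G> \<in> Tplus_ell \<G>"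
    and sl: "\<And>t. t \<in> Tplus_ell \<G> \<Longrightarrow> semilin S (\<Phi> t) M M (tact M t)"
    and one: "\<And>m. m \<in> carrier M \<Longrightarrow> tact M (mat 1) m = m"
    and mult: "\<And>t t' m. t \<in> Tplus_ell \<G> \<Longrightarrow> t' \<in> Tplus_ell \<G> \<Longrightarrow> m \<in> carrier M \<Longrightarrow>
      tact M (t ** t') m = tact M t (tact M t' m)"
    and b: "module_basis S M E b" "module_basis S M E (\<lambda>e. tact M (ss \<G>) (b e))"
  shows "T_module \<G> S \<Phi> M"
  by (rule T_moduleI[OF M fg_freeI[OF M b(1) ne] sl one mult])
    (use etale_iff[OF M \<Phi>(1) sl[OF \<Phi>(2)] b(1)] b(2) in simp_all)

lemma inj_SumR: "inj SumR" and inj_SumS: "inj SumS"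
  by (simp_all add: inj_on_def)

context skew_data
begin

section \<open>The functor D\<close>

abbreviation DO :: "('r, 'p, 'n, 'b) Smod \<Rightarrow> ('r, 'p, 'n, 'b) Rmod" where "DO \<equiv> D_ob \<G> R \<iota> c"
abbreviation MO :: "('r, 'p, 'n, 'b) Rmod \<Rightarrow> ('r, 'p, 'n, 'b) Smod" where "MO \<equiv> M_ob \<G> R \<iota> c"
abbreviation tinD :: "('r, 'p, 'n, 'b) Smod \<Rightarrow> ('r, 'p, 'n, 'b) uni_elt \<Rightarrow> ('r, 'p, 'n, 'b) uni_elt" where
  "tinD \<equiv> tensor_product.tin SumR R CS (ellR \<G> R)"

lemma tact_D_ob: "tact (DO U) = tens_act SumR R CS (ellR \<G> R) (phiR \<G> R) U"
  by (simp add: D_ob_def Module.module.extend_def tmodule.fields_def)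

lemma tact_M_ob: "tact (MO V) = M_act \<G> R \<iota> c V"
  by (simp add: M_ob_def Module.module.extend_def tmodule.fields_def)

lemma tensor_product_D: "left_module CS U \<Longrightarrow> tensor_product SumR R CS (ellR \<G> R) U"
  by (rule tensor_product.intro[OF inj_SumR R.ring_axioms _ ellR_hom])

lemma tensor_product_M: "left_module R V \<Longrightarrow> tensor_product SumS CS R (iotaR \<G> R) V"
  by (rule tensor_product.intro[OF inj_SumS ring_CS _ iotaR_hom])

text \<open>\<ell>_R intertwines the actions of every \<open>t\<close>, so the diagonal action is
  well defined. A basis of \<open>U\<close> induces one of D(U), and the monoid laws need to be
  checked on the elements 1 \<otimes> u only.\<close>

lemma reduction_D:
  fixes U :: "('r, 'p, 'n, 'b) Smod"
  assumes U: "TmS U"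
  shows "reduction U (DO U) (tinD U)"
proof -
  note M = T_moduleD(1)[OF U]
  interpret T: tensor_product SumR R CS "ellR \<G> R" U by (rule tensor_product_D[OF M])
  have act: "semilin R (phiR \<G> R t) T.T T.T (tact (DO U) t)"
      "m \<in> carrier U \<Longrightarrow> tact (DO U) t (T.tin m) = T.tin (tact U t m)" if t: "t \<in> Tplus_ell \<G>" for t m
  proof -
    note L = tensor_map_semilin[OF T.tensor_product_axioms T.tensor_product_axioms phiR_hom[OF t], of "phiS \<G> R \<iota> c t"]
    show "semilin R (phiR \<G> R t) T.T T.T (tact (DO U) t)"
      using L(1)[OF phiS_closed[OF t] ellR_phiS[OF t, symmetric] T_moduleD(3)[OF U t]]
      unfolding tact_D_ob tens_act_def by simp
    show "m \<in> carrier U \<Longrightarrow> tact (DO U) t (T.tin m) = T.tin (tact U t m)"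
      using L(2)[OF phiS_closed[OF t] ellR_phiS[OF t, symmetric] T_moduleD(3)[OF U t]]
      unfolding tact_D_ob tens_act_def by simp
  qed
  note actc = semilinD(1)[OF act(1)]
  obtain E where E: "module_basis CS U E (\<lambda>e. e)" "module_basis CS U E (\<lambda>e. tact U (ss \<G>) e)"
    using T_module_basis_S[OF U] by blast
  have EU: "e \<in> carrier U" if "e \<in> E" for e using T.M.basis_closed[OF E(1) that] .
  note B = T.basis_T[OF E(1)] T.basis_T[OF E(2)]
  have B2: "module_basis R T.T E (\<lambda>e. tact (DO U) (ss \<G>) (T.tin e))"
    by (rule module_basis_cong[OF T.left_module_T B(2)]) (simp add: act(2)[OF ss_Tplus] EU)
  have V: "TmR (DO U)"
  proof (rule T_moduleI_basis[where \<Phi> = "phiR \<G> R", OF _ nontrivial phiR_hom[OF ss_Tplus] ss_Tplus])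
    show "left_module R (DO U)" unfolding D_ob_def left_module_extend by (rule T.left_module_T)
    show "semilin R (phiR \<G> R t) (DO U) (DO U) (tact (DO U) t)" if "t \<in> Tplus_ell \<G>" for t
      using act(1)[OF that] by (simp add: D_ob_def)
    show "tact (DO U) (mat 1) m = m" if "m \<in> carrier (DO U)" for m
    proof (rule T.T_semilin_eqI[OF T.left_module_T])
      show "semilin R (\<lambda>a. a) T.T T.T (tact (DO U) (mat 1))"
        by (rule semilin_cong[OF act(1)[OF Tplus_one] T.left_module_T]) (simp_all add: phiR_one)
      show "semilin R (\<lambda>a. a) T.T T.T (\<lambda>m. m)" by (rule semilinI) simp_all
      show "tact (DO U) (mat 1) (T.tin m) = T.tin m" if "m \<in> carrier U" for m
        using that by (simp add: act(2)[OF Tplus_one] T_moduleD(4)[OF U])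
      show "m \<in> carrier T.T" using that by (simp add: D_ob_def)
    qed
    show "tact (DO U) (t ** t') m = tact (DO U) t (tact (DO U) t' m)"
      if t: "t \<in> Tplus_ell \<G>" "t' \<in> Tplus_ell \<G>" and m: "m \<in> carrier (DO U)" for t t' m
    proof (rule T.T_semilin_eqI[where g = "tact (DO U) (t ** t')" and h = "\<lambda>m. tact (DO U) t (tact (DO U) t' m)", OF T.left_module_T])
      show "semilin R (\<lambda>a. phiR \<G> R t (phiR \<G> R t' a)) T.T T.T (tact (DO U) (t ** t'))"
        by (rule semilin_cong[OF act(1)[OF Tplus_mult[OF t]] T.left_module_T]) (simp_all add: phiR_mult t)
      show "semilin R (\<lambda>a. phiR \<G> R t (phiR \<G> R t' a)) T.T T.T (\<lambda>m. tact (DO U) t (tact (DO U) t' m))"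
        by (rule semilin_comp[OF act(1)[OF t(2)] act(1)[OF t(1)] phiR_fun[OF t(2)]])
      show "tact (DO U) (t ** t') (T.tin m) = tact (DO U) t (tact (DO U) t' (T.tin m))" if "m \<in> carrier U" for m
        using that t by (simp add: act(2) Tplus_mult T_moduleD(5)[OF U] semilinD(1)[OF T_moduleD(3)[OF U]])
      show "m \<in> carrier T.T" using m by (simp add: D_ob_def)
    qed
    show "module_basis R (DO U) E T.tin" "module_basis R (DO U) E (\<lambda>e. tact (DO U) (ss \<G>) (T.tin e))"
      using B(1) B2 by (simp_all add: D_ob_def)
  qed
  show ?thesis
    unfolding reduction_def
  proof (intro conjI ballI U V)
    show "semilin CS (ellR \<G> R) U (DO U) T.tin" using T.tin_semilin by (simp add: D_ob_def)
    show "T.tin (tact U t u) = tact (DO U) t (T.tin u)" if "t \<in> Tplus_ell \<G>" "u \<in> carrier U" for t u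
      using act(2)[OF that] by simp
    show "\<exists>(E :: ('r, 'p, 'n, 'b) uni_elt set) b. module_basis CS U E b \<and> module_basis R (DO U) E (\<lambda>e. T.tin (b e))"
      using E(1) B(1) by (intro exI[of _ E] exI[of _ "\<lambda>e. e"]) (simp add: D_ob_def)
  qed
qed

lemma D_ar_hom:
  assumes U: "TmS U" and U': "TmS U'" and f: "f \<in> T_hom \<G> CS U U'"
  shows "D_ar \<G> R \<iota> c U U' f \<in> T_hom \<G> R (DO U) (DO U')"
    and "u \<in> carrier U \<Longrightarrow> D_ar \<G> R \<iota> c U U' f (tinD U u) = tinD U' (f u)"
proof -
  interpret T: tensor_product SumR R CS "ellR \<G> R" U by (rule tensor_product_D[OF T_moduleD(1)[OF U]])
  interpret T': tensor_product SumR R CS "ellR \<G> R" U' by (rule tensor_product_D[OF T_moduleD(1)[OF U']])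
  note r = reduction_D[OF U] and r' = reduction_D[OF U']
  have idh: "(\<lambda>a. a) \<in> ring_hom R R" by (simp add: ring_hom_def)
  define H where "H = (\<lambda>w. SumR (tens_rep R CS (ellR \<G> R) U' (map (\<lambda>(b, m). (b, f m)) (inv_into UNIV SumR w))))"
  note L = tensor_map_semilin[OF T.tensor_product_axioms T'.tensor_product_axioms idh, of "\<lambda>a. a", OF _ _ T_homD(2)[OF f]]
  have H: "semilin R (\<lambda>a. a) (DO U) (DO U') H" "\<And>m. m \<in> carrier U \<Longrightarrow> H (T.tin m) = T'.tin (f m)"
    using L unfolding H_def by (simp_all add: D_ob_def)
  have D: "D_ar \<G> R \<iota> c U U' f = restrict H (carrier (DO U))"
    by (simp add: D_ar_def tens_map_def H_def D_ob_def)
  have eqv: "H (tact (DO U) t m) = tact (DO U') t (H m)" if t: "t \<in> Tplus_ell \<G>" and m: "m \<in> carrier (DO U)" for t m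
  proof -
    obtain u where u: "u \<in> carrier U" "T.tin u = m" using reduction_surj[OF r m] by blast
    show ?thesis
      using t u(1) by (simp add: u(2)[symmetric] reductionD(4)[OF r, symmetric] reductionD(4)[OF r', symmetric] H(2)
          semilinD(1)[OF T_moduleD(3)[OF U]] semilinD(1)[OF T_homD(2)[OF f]] T_homD(3)[OF f])
  qed
  note tc = semilinD(1)[OF T_moduleD(3)[OF reductionD(2)[OF r]]]
  show "D_ar \<G> R \<iota> c U U' f \<in> T_hom \<G> R (DO U) (DO U')"
    unfolding D by (rule T_hom_restrict[OF T_moduleD(1)[OF reductionD(2)[OF r]] H(1) tc eqv])
  show "u \<in> carrier U \<Longrightarrow> D_ar \<G> R \<iota> c U U' f (T.tin u) = T'.tin (f u)"
    using H(2) semilinD(1)[OF reductionD(3)[OF r]] by (simp add: D)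
qed

section \<open>The functor M\<close>

abbreviation tinM :: "('r, 'p, 'n, 'b) Rmod \<Rightarrow> ('r, 'p, 'n, 'b) uni_elt \<Rightarrow> ('r, 'p, 'n, 'b) uni_elt" where
  "tinM \<equiv> tensor_product.tin SumS CS R (iotaR \<G> R)"

definition augM :: "('r, 'p, 'n, 'b) Rmod \<Rightarrow> ('r, 'p, 'n, 'b) uni_elt \<Rightarrow> ('r, 'p, 'n, 'b) uni_elt" where
  "augM V u = msum V (\<lambda>a v. ellR \<G> R a \<odot>\<^bsub>V\<^esub> v) (inv_into UNIV SumS u)"

text \<open>The assignment a \<otimes> v |-> \<ell>_R(a) v is balanced because \<ell>_R \<iota>_R =
  id.\<close>

lemma augM:
  assumes V: "left_module R V"
  shows "semilin CS (ellR \<G> R) (tensor SumS CS R (iotaR \<G> R) V) V (augM V)"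
    and "v \<in> carrier V \<Longrightarrow> augM V (tinM V v) = v"
proof -
  interpret T: tensor_product SumS CS R "iotaR \<G> R" V by (rule tensor_product_M[OF V])
  note e = ring_hom_closed[OF ellR_hom] ring_hom_add[OF ellR_hom] ring_hom_mult[OF ellR_hom] ring_hom_one[OF ellR_hom]
    T.M.smult_closed T.M.smult_l_distr T.M.smult_r_distr T.M.smult_assoc1 T.M.smult_one ellR_iotaR iotaR_closed
  note L = T.T_lift[OF V ellR_fun, where g = "\<lambda>a v. ellR \<G> R a \<odot>\<^bsub>V\<^esub> v"]
  show "semilin CS (ellR \<G> R) T.T V (augM V)"
    unfolding augM_def by (rule L(1)) (simp_all add: e)
  have "augM V (T.tin v) = ellR \<G> R \<one>\<^bsub>CS\<^esub> \<odot>\<^bsub>V\<^esub> v" if "v \<in> carrier V"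
    unfolding augM_def by (rule L(2)) (simp_all add: e that)
  then show "v \<in> carrier V \<Longrightarrow> augM V (T.tin v) = v" by (simp add: e)
qed

text \<open>The lifting statements with the extended module as source and target and \<theta> =
  \<phi>_t show that the definite description in \<open>M_act\<close> has exactly one solution.
  Uniqueness also yields the monoid laws and identifies the action of \<open>s\<close> with \<phi>_s
  \<otimes> \<phi>_s, from which the etale condition is read off on the basis 1 \<otimes> e.\<close>

lemma reduction_M:
  fixes V :: "('r, 'p, 'n, 'b) Rmod"
  assumes V: "TmR V"
  shows "reduction (MO V) V (augM V)"
    and "v \<in> carrier V \<Longrightarrow> tact (MO V) (ss \<G>) (tinM V v) = tinM V (tact V (ss \<G>) v)"
proof -
  note M = T_moduleD(1)[OF V]
  interpret T: tensor_product SumS CS R "iotaR \<G> R" V by (rule tensor_product_M[OF M])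
  note aug = augM[OF M] and s = ss_Tplus
  define \<delta> where "\<delta> = tens_act SumS CS R (iotaR \<G> R) (phiS \<G> R \<iota> c) V (ss \<G>)"
  note L = tensor_map_semilin[OF T.tensor_product_axioms T.tensor_product_axioms phiS_hom[OF s] phiR_closed[OF s] phiS_iotaR
      T_moduleD(3)[OF V s]]
  have \<delta>: "semilin CS (phiS \<G> R \<iota> c (ss \<G>)) T.T T.T \<delta>"
    using L(1) unfolding \<delta>_def tens_act_def by simp
  have \<delta>_tin: "\<delta> (T.tin v) = T.tin (tact V (ss \<G>) v)" if "v \<in> carrier V" for v
    using L(2) that unfolding \<delta>_def tens_act_def by simp
  note ac = semilinD(1)[OF aug(1)] and \<delta>c = semilinD(1)[OF \<delta>]
  have aug_\<delta>: "augM V (\<delta> u) = tact V (ss \<G>) (augM V u)" if u: "u \<in> carrier T.T" for u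
  proof (rule T.T_semilin_eqI[where g = "\<lambda>u. augM V (\<delta> u)" and h = "\<lambda>u. tact V (ss \<G>) (augM V u)", OF M _ _ _ u])
    show "semilin CS (\<lambda>a. ellR \<G> R (phiS \<G> R \<iota> c (ss \<G>) a)) T.T V (\<lambda>u. augM V (\<delta> u))"
      by (rule semilin_comp[OF \<delta> aug(1) phiS_fun[OF s]])
    show "semilin CS (\<lambda>a. ellR \<G> R (phiS \<G> R \<iota> c (ss \<G>) a)) T.T V (\<lambda>u. tact V (ss \<G>) (augM V u))"
      by (rule semilin_cong[OF semilin_comp[OF aug(1) T_moduleD(3)[OF V s] ellR_fun] T.left_module_T]) (simp_all add: ellR_phiS s)
    show "augM V (\<delta> (T.tin m)) = tact V (ss \<G>) (augM V (T.tin m))" if "m \<in> carrier V" for m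
      using that by (simp add: \<delta>_tin aug(2) semilinD(1)[OF T_moduleD(3)[OF V s]])
  qed
  obtain E where E: "module_basis R V E (\<lambda>e. e)" "module_basis R V E (\<lambda>e. tact V (ss \<G>) e)"
    using T_module_basis_R[OF V] by blast
  have EV: "e \<in> carrier V" if "e \<in> E" for e using T.M.basis_closed[OF E(1) that] .
  note B = T.basis_T[OF E(1)]
  have B2: "module_basis CS T.T E (\<lambda>e. \<delta> (T.tin e))"
    by (rule module_basis_cong[OF T.left_module_T T.basis_T[OF E(2)]]) (simp add: \<delta>_tin EV)
  have B3: "module_basis R V E (\<lambda>e. augM V (T.tin e))"
    by (rule module_basis_cong[OF M E(1)]) (simp add: aug(2) EV)
  note unique = CE.lift_unique[OF T.left_module_T T.left_module_T M _ B B2 \<delta> \<delta> B aug(1) B3]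
  have act: "semilin CS (phiS \<G> R \<iota> c t) T.T T.T (M_act \<G> R \<iota> c V t)"
      "u \<in> carrier T.T \<Longrightarrow> M_act \<G> R \<iota> c V t (\<delta> u) = \<delta> (M_act \<G> R \<iota> c V t u)"
      "u \<in> carrier T.T \<Longrightarrow> augM V (M_act \<G> R \<iota> c V t u) = tact V t (augM V u)" if t: "t \<in> Tplus_ell \<G>" for t u
  proof -
    \<comment> \<open>The conditions in the definite description of \<open>M_act\<close>.
      Extensionality is part of them, since lifts are unique only on the carrier.\<close>
    define P where "P \<Psi> \<longleftrightarrow> \<Psi> \<in> carrier T.T \<rightarrow>\<^sub>E carrier T.T
       \<and> (\<forall>u \<in> carrier T.T. \<forall>v \<in> carrier T.T. \<Psi> (u \<oplus>\<^bsub>T.T\<^esub> v) = \<Psi> u \<oplus>\<^bsub>T.T\<^esub> \<Psi> v)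
       \<and> (\<forall>a \<in> carrier CS. \<forall>u \<in> carrier T.T. \<Psi> (a \<odot>\<^bsub>T.T\<^esub> u) = phiS \<G> R \<iota> c t a \<odot>\<^bsub>T.T\<^esub> \<Psi> u)
       \<and> (\<forall>u \<in> carrier T.T. \<Psi> (\<delta> u) = \<delta> (\<Psi> u))
       \<and> (\<forall>u \<in> carrier T.T. augM V (\<Psi> u) = tact V t (augM V u))" for \<Psi>
    have P: "P \<Psi> \<longleftrightarrow> \<Psi> \<in> extensional (carrier T.T) \<and> semilin CS (phiS \<G> R \<iota> c t) T.T T.T \<Psi>
       \<and> (\<forall>u \<in> carrier T.T. \<Psi> (\<delta> u) = \<delta> (\<Psi> u)) \<and> (\<forall>u \<in> carrier T.T. augM V (\<Psi> u) = tact V t (augM V u))" for \<Psi>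
      unfolding P_def semilin_def PiE_def by blast
    have "\<exists>g. semilin CS (phiS \<G> R \<iota> c t) T.T T.T g \<and>
        (\<forall>u\<in>carrier T.T. g (\<delta> u) = \<delta> (g u) \<and> augM V (g u) = tact V t (augM V u))"
    proof (rule CE.lift_exists[OF T.left_module_T T.left_module_T M phiS_hom[OF t] B B2 \<delta> \<delta> B aug(1) B3
          phiS_commute[OF t s] ellR_surj aug_\<delta>])
      show "semilin CS (\<lambda>a. ellR \<G> R (phiS \<G> R \<iota> c t a)) T.T V (\<lambda>u. tact V t (augM V u))"
        by (rule semilin_cong[OF semilin_comp[OF aug(1) T_moduleD(3)[OF V t] ellR_fun] T.left_module_T]) (simp_all add: ellR_phiS t)
      show "tact V t (augM V (\<delta> u)) = tact V (ss \<G>) (tact V t (augM V u))" if "u \<in> carrier T.T" for u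
        using T_moduleD(5)[OF V t s ac[OF that]] T_moduleD(5)[OF V s t ac[OF that]] Tplus_commute[OF t s] that
        by (simp add: aug_\<delta>)
    qed
    then obtain g where g: "semilin CS (phiS \<G> R \<iota> c t) T.T T.T g" "\<And>u. u \<in> carrier T.T \<Longrightarrow> g (\<delta> u) = \<delta> (g u)"
      "\<And>u. u \<in> carrier T.T \<Longrightarrow> augM V (g u) = tact V t (augM V u)" by blast
    let ?g = "restrict g (carrier T.T)"
    have "P ?g"
      unfolding P using semilin_cong[OF g(1) T.left_module_T, of ?g "phiS \<G> R \<iota> c t"] g \<delta>c by simp
    moreover have "\<Psi> = ?g" if "P \<Psi>" for \<Psi>
    proof (rule extensionalityI[OF _ restrict_extensional])
      show "\<Psi> \<in> extensional (carrier T.T)" using that unfolding P by blast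
      show "\<Psi> u = ?g u" if u: "u \<in> carrier T.T" for u
        using unique[OF phiS_hom[OF t] _ _ g(1) g(2) _ u, of \<Psi>] \<open>P \<Psi>\<close> g(3) u unfolding P by simp
    qed
    ultimately have "\<exists>!\<Psi>. P \<Psi>" by (rule ex1I)
    then have "P (THE \<Psi>. P \<Psi>)" by (rule theI')
    moreover have "M_act \<G> R \<iota> c V t = (THE \<Psi>. P \<Psi>)"
      unfolding M_act_def Let_def P_def augM_def \<delta>_def ..
    ultimately have "P (M_act \<G> R \<iota> c V t)" by (simp only:)
    then show "semilin CS (phiS \<G> R \<iota> c t) T.T T.T (M_act \<G> R \<iota> c V t)"
      "u \<in> carrier T.T \<Longrightarrow> M_act \<G> R \<iota> c V t (\<delta> u) = \<delta> (M_act \<G> R \<iota> c V t u)"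
      "u \<in> carrier T.T \<Longrightarrow> augM V (M_act \<G> R \<iota> c V t u) = tact V t (augM V u)"
      unfolding P by blast+
  qed
  note actc = semilinD(1)[OF act(1)]
  have act_ss: "M_act \<G> R \<iota> c V (ss \<G>) u = \<delta> u" if u: "u \<in> carrier T.T" for u
    by (rule unique[OF phiS_hom[OF s] act(1)[OF s] act(2)[OF s] \<delta> _ _ u]) (simp_all add: act(3)[OF s] aug_\<delta>)
  have U: "TmS (MO V)"
  proof (rule T_moduleI_basis[where \<Phi> = "phiS \<G> R \<iota> c", OF _ CS_nontrivial phiS_hom[OF s] s])
    show "left_module CS (MO V)" unfolding M_ob_def left_module_extend by (rule T.left_module_T)
    show "semilin CS (phiS \<G> R \<iota> c t) (MO V) (MO V) (tact (MO V) t)" if "t \<in> Tplus_ell \<G>" for t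
      using act(1)[OF that] unfolding tact_M_ob by (simp add: M_ob_def)
    show "tact (MO V) (mat 1) m = m" if "m \<in> carrier (MO V)" for m
    proof -
      have m: "m \<in> carrier T.T" using that by (simp add: M_ob_def)
      have i: "semilin CS (phiS \<G> R \<iota> c (mat 1)) T.T T.T (\<lambda>m. m)"
        by (rule semilinI) (simp_all add: phiS_one)
      show ?thesis
        unfolding tact_M_ob
        by (rule unique[where h = "\<lambda>m. m", OF phiS_hom[OF Tplus_one] act(1)[OF Tplus_one] act(2)[OF Tplus_one] i _ _ m])
          (simp_all add: act(3)[OF Tplus_one] T_moduleD(4)[OF V] ac)
    qed
    show "tact (MO V) (t ** t') m = tact (MO V) t (tact (MO V) t' m)"
      if t: "t \<in> Tplus_ell \<G>" "t' \<in> Tplus_ell \<G>" and "m \<in> carrier (MO V)" for t t' m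
    proof -
      have m: "m \<in> carrier T.T" using that by (simp add: M_ob_def)
      have i: "semilin CS (phiS \<G> R \<iota> c (t ** t')) T.T T.T (\<lambda>m. M_act \<G> R \<iota> c V t (M_act \<G> R \<iota> c V t' m))"
        by (rule semilin_cong[OF semilin_comp[OF act(1)[OF t(2)] act(1)[OF t(1)] phiS_fun[OF t(2)]] T.left_module_T])
          (simp_all add: phiS_mult t)
      note tt = Tplus_mult[OF t]
      show ?thesis
        unfolding tact_M_ob
        by (rule unique[where h = "\<lambda>m. M_act \<G> R \<iota> c V t (M_act \<G> R \<iota> c V t' m)", OF phiS_hom[OF tt] act(1)[OF tt] act(2)[OF tt] i _ _ m])
          (simp_all add: act(2,3) tt t T_moduleD(5)[OF V] ac actc)
    qed
    show "module_basis CS (MO V) E T.tin" using B by (simp add: M_ob_def)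
    have "module_basis CS T.T E (\<lambda>e. M_act \<G> R \<iota> c V (ss \<G>) (T.tin e))"
      by (rule module_basis_cong[OF T.left_module_T B2]) (simp add: act_ss EV T.tin_closed)
    then show "module_basis CS (MO V) E (\<lambda>e. tact (MO V) (ss \<G>) (T.tin e))"
      unfolding tact_M_ob by (simp add: M_ob_def)
  qed
  show "v \<in> carrier V \<Longrightarrow> tact (MO V) (ss \<G>) (T.tin v) = T.tin (tact V (ss \<G>) v)"
    unfolding tact_M_ob by (simp add: act_ss \<delta>_tin T.tin_closed)
  show "reduction (MO V) V (augM V)"
    unfolding reduction_def
  proof (intro conjI ballI U V)
    show "semilin CS (ellR \<G> R) (MO V) V (augM V)" using aug(1) by (simp add: M_ob_def)
    show "augM V (tact (MO V) t u) = tact V t (augM V u)" if "t \<in> Tplus_ell \<G>" "u \<in> carrier (MO V)" for t u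
      using act(3)[OF that(1)] that(2) unfolding tact_M_ob by (simp add: M_ob_def)
    show "\<exists>(E :: ('r, 'p, 'n, 'b) uni_elt set) b. module_basis CS (MO V) E b \<and> module_basis R V E (\<lambda>e. augM V (b e))"
      using B B3 by (intro exI[of _ E] exI[of _ T.tin]) (simp add: M_ob_def)
  qed
qed

text \<open>On formal sums only compatibility with \<open>s\<close> is visible for id \<otimes> f.
  But id \<otimes> f reduces to \<open>f\<close>, as does the equivariant lift provided by
  \<open>reduction_lift_exists\<close>; the two therefore coincide, which gives equivariance for all
  \<open>t\<close>.\<close>

lemma M_ar_hom:
  fixes V V' :: "('r, 'p, 'n, 'b) Rmod"
  assumes V: "TmR V" and V': "TmR V'" and f: "f \<in> T_hom \<G> R V V'"
  shows "M_ar \<G> R \<iota> c V V' f \<in> T_hom \<G> CS (MO V) (MO V')"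
    and "u \<in> carrier (MO V) \<Longrightarrow> augM V' (M_ar \<G> R \<iota> c V V' f u) = f (augM V u)"
proof -
  interpret T: tensor_product SumS CS R "iotaR \<G> R" V by (rule tensor_product_M[OF T_moduleD(1)[OF V]])
  interpret T': tensor_product SumS CS R "iotaR \<G> R" V' by (rule tensor_product_M[OF T_moduleD(1)[OF V']])
  note r = reduction_M(1)[OF V] and r' = reduction_M(1)[OF V'] and s = ss_Tplus
  note U = reductionD(1)[OF r] and U' = reductionD(1)[OF r']
  have idh: "(\<lambda>a. a) \<in> ring_hom CS CS" by (simp add: ring_hom_def)
  define H where "H = (\<lambda>w. SumS (tens_rep CS R (iotaR \<G> R) V' (map (\<lambda>(b, m). (b, f m)) (inv_into UNIV SumS w))))"
  note L = tensor_map_semilin[OF T.tensor_product_axioms T'.tensor_product_axioms idh, of "\<lambda>a. a", OF _ _ T_homD(2)[OF f]]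
  have H: "semilin CS (\<lambda>a. a) T.T (MO V') H" "\<And>v. v \<in> carrier V \<Longrightarrow> H (T.tin v) = T'.tin (f v)"
    using L unfolding H_def by (simp_all add: M_ob_def)
  have HU: "semilin CS (\<lambda>a. a) (MO V) (MO V') H" using H(1) by (simp add: M_ob_def)
  have cT: "carrier (MO V) = carrier T.T" by (simp add: M_ob_def)
  have red: "augM V' (H u) = f (augM V u)" if u: "u \<in> carrier (MO V)" for u
  proof (rule T.T_semilin_eqI[where g = "\<lambda>u. augM V' (H u)" and h = "\<lambda>u. f (augM V u)", OF T_moduleD(1)[OF V']])
    show "semilin CS (ellR \<G> R) T.T V' (\<lambda>u. augM V' (H u))"
      by (rule semilin_comp[OF H(1) reductionD(3)[OF r']]) simp
    show "semilin CS (ellR \<G> R) T.T V' (\<lambda>u. f (augM V u))"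
      by (rule semilin_comp[OF augM(1)[OF T_moduleD(1)[OF V]] T_homD(2)[OF f] ellR_fun])
    show "augM V' (H (T.tin m)) = f (augM V (T.tin m))" if "m \<in> carrier V" for m
      using that by (simp add: H(2) augM(2)[OF T_moduleD(1)[OF V]] augM(2)[OF T_moduleD(1)[OF V']] semilinD(1)[OF T_homD(2)[OF f]])
    show "u \<in> carrier T.T" using u by (simp add: cT)
  qed
  have eqv: "H (tact (MO V) (ss \<G>) u) = tact (MO V') (ss \<G>) (H u)" if u: "u \<in> carrier (MO V)" for u
  proof (rule T.T_semilin_eqI[where g = "\<lambda>u. H (tact (MO V) (ss \<G>) u)" and h = "\<lambda>u. tact (MO V') (ss \<G>) (H u)",
        OF T_moduleD(1)[OF U']])
    have "semilin CS (phiS \<G> R \<iota> c (ss \<G>)) (MO V) (MO V') (\<lambda>u. H (tact (MO V) (ss \<G>) u))"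
      by (rule semilin_comp[OF T_moduleD(3)[OF U s] HU phiS_fun[OF s]])
    then show "semilin CS (phiS \<G> R \<iota> c (ss \<G>)) T.T (MO V') (\<lambda>u. H (tact (MO V) (ss \<G>) u))"
      by (simp add: M_ob_def)
    show "semilin CS (phiS \<G> R \<iota> c (ss \<G>)) T.T (MO V') (\<lambda>u. tact (MO V') (ss \<G>) (H u))"
      by (rule semilin_comp[OF H(1) T_moduleD(3)[OF U' s]]) simp
    show "H (tact (MO V) (ss \<G>) (T.tin m)) = tact (MO V') (ss \<G>) (H (T.tin m))" if "m \<in> carrier V" for m
      using that by (simp add: H(2) reduction_M(2)[OF V] reduction_M(2)[OF V'] semilinD(1)[OF T_homD(2)[OF f]]
          semilinD(1)[OF T_moduleD(3)[OF V s]] T_homD(3)[OF f s])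
    show "u \<in> carrier T.T" using u by (simp add: cT)
  qed
  have M: "M_ar \<G> R \<iota> c V V' f = restrict H (carrier (MO V))"
    by (simp add: M_ar_def tens_map_def H_def M_ob_def)
  then show "u \<in> carrier (MO V) \<Longrightarrow> augM V' (M_ar \<G> R \<iota> c V V' f u) = f (augM V u)" by (simp add: red)
  obtain g where g: "g \<in> T_hom \<G> CS (MO V) (MO V')" "\<And>u. u \<in> carrier (MO V) \<Longrightarrow> augM V' (g u) = f (augM V u)"
    using reduction_lift_exists[OF r r' f] by blast
  have "H u = g u" if u: "u \<in> carrier (MO V)" for u
    by (rule reduction_lift_unique[OF r' U idh HU eqv T_homD(2)[OF g(1)] T_homD(3)[OF g(1) s] _ u]) (simp_all add: red g(2))
  then have "M_ar \<G> R \<iota> c V V' f = g"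
    using T_homD(1)[OF g(1)] unfolding M by (intro extensionalityI[OF restrict_extensional]) auto
  then show "M_ar \<G> R \<iota> c V V' f \<in> T_hom \<G> CS (MO V) (MO V')" using g(1) by simp
qed

end

section \<open>Functor laws and the two natural isomorphisms\<close>

context skew_data
begin

text \<open>A map out of D(U) is determined by its values at the elements 1 \<otimes> u, so both
  laws reduce to equations in \<open>U\<close>.\<close>

lemma is_functor_D: "is_functor (catS \<G> R \<iota> c) (catR \<G> R) DO (D_ar \<G> R \<iota> c)"
  unfolding is_functor_def catS_def catR_def T_cat_simps mem_Collect_eq
proof (intro conjI ballI is_category_T_cat; (unfold mem_Collect_eq)?)
  show "TmR (DO U)" if "TmS U" for U using reductionD(2)[OF reduction_D[OF that]] .
  show "D_ar \<G> R \<iota> c U V f \<in> T_hom \<G> R (DO U) (DO V)" if "TmS U" "TmS V" "f \<in> T_hom \<G> CS U V" for U V f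
    using D_ar_hom(1)[OF that] .
  show "D_ar \<G> R \<iota> c U U (\<lambda>m\<in>carrier U. m) = (\<lambda>m\<in>carrier (DO U). m)" if U: "TmS U" for U
    by (rule T_hom_descend_unique[OF reduction_D[OF U] D_ar_hom(1)[OF U U T_hom_id[OF U]] T_hom_id[OF reductionD(2)[OF reduction_D[OF U]]]])
      (simp add: D_ar_hom(2)[OF U U T_hom_id[OF U]] semilinD(1)[OF reductionD(3)[OF reduction_D[OF U]]])
  show "D_ar \<G> R \<iota> c U W (compose (carrier U) g f)
      = compose (carrier (DO U)) (D_ar \<G> R \<iota> c V W g) (D_ar \<G> R \<iota> c U V f)"
    if U: "TmS U" and V: "TmS V" and W: "TmS W" and f: "f \<in> T_hom \<G> CS U V" and g: "g \<in> T_hom \<G> CS V W" for U V W f g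
  proof (rule T_hom_descend_unique[OF reduction_D[OF U]])
    note gf = T_hom_compose[OF U f g]
    show "D_ar \<G> R \<iota> c U W (compose (carrier U) g f) \<in> T_hom \<G> R (DO U) (DO W)"
      by (rule D_ar_hom(1)[OF U W gf])
    show "compose (carrier (DO U)) (D_ar \<G> R \<iota> c V W g) (D_ar \<G> R \<iota> c U V f) \<in> T_hom \<G> R (DO U) (DO W)"
      by (rule T_hom_compose[OF reductionD(2)[OF reduction_D[OF U]] D_ar_hom(1)[OF U V f] D_ar_hom(1)[OF V W g]])
    fix u assume u: "u \<in> carrier U"
    then show "D_ar \<G> R \<iota> c U W (compose (carrier U) g f) (tinD U u)
        = compose (carrier (DO U)) (D_ar \<G> R \<iota> c V W g) (D_ar \<G> R \<iota> c U V f) (tinD U u)"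
      by (simp add: D_ar_hom(2)[OF U W gf] D_ar_hom(2)[OF U V f] D_ar_hom(2)[OF V W g] compose_eq
          semilinD(1)[OF reductionD(3)[OF reduction_D[OF U]]] semilinD(1)[OF T_homD(2)[OF f]])
  qed
qed

text \<open>The two sides of each law are equivariant and have the same reduction, so uniqueness of
  lifts applies.\<close>

lemma is_functor_M: "is_functor (catR \<G> R) (catS \<G> R \<iota> c) MO (M_ar \<G> R \<iota> c)"
  unfolding is_functor_def catS_def catR_def T_cat_simps mem_Collect_eq
proof (intro conjI ballI is_category_T_cat; (unfold mem_Collect_eq)?)
  show "TmS (MO V)" if "TmR V" for V using reductionD(1)[OF reduction_M(1)[OF that]] .
  show "M_ar \<G> R \<iota> c U V f \<in> T_hom \<G> CS (MO U) (MO V)" if "TmR U" "TmR V" "f \<in> T_hom \<G> R U V" for U V f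
    using M_ar_hom(1)[OF that] .
  show "M_ar \<G> R \<iota> c V V (\<lambda>m\<in>carrier V. m) = (\<lambda>m\<in>carrier (MO V). m)" if V: "TmR V" for V
  proof -
    note r = reduction_M(1)[OF V]
    show ?thesis
      by (rule T_hom_lift_unique[OF r reductionD(1)[OF r] M_ar_hom(1)[OF V V T_hom_id[OF V]] T_hom_id[OF reductionD(1)[OF r]]])
        (simp add: M_ar_hom(2)[OF V V T_hom_id[OF V]] semilinD(1)[OF reductionD(3)[OF r]])
  qed
  show "M_ar \<G> R \<iota> c U W (compose (carrier U) g f)
      = compose (carrier (MO U)) (M_ar \<G> R \<iota> c V W g) (M_ar \<G> R \<iota> c U V f)"
    if U: "TmR U" and V: "TmR V" and W: "TmR W" and f: "f \<in> T_hom \<G> R U V" and g: "g \<in> T_hom \<G> R V W" for U V W f g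
  proof (rule T_hom_lift_unique[OF reduction_M(1)[OF W] reductionD(1)[OF reduction_M(1)[OF U]]])
    note gf = T_hom_compose[OF U f g]
    show "M_ar \<G> R \<iota> c U W (compose (carrier U) g f) \<in> T_hom \<G> CS (MO U) (MO W)"
      by (rule M_ar_hom(1)[OF U W gf])
    show "compose (carrier (MO U)) (M_ar \<G> R \<iota> c V W g) (M_ar \<G> R \<iota> c U V f) \<in> T_hom \<G> CS (MO U) (MO W)"
      by (rule T_hom_compose[OF reductionD(1)[OF reduction_M(1)[OF U]] M_ar_hom(1)[OF U V f] M_ar_hom(1)[OF V W g]])
    fix u assume u: "u \<in> carrier (MO U)"
    then show "augM W (M_ar \<G> R \<iota> c U W (compose (carrier U) g f) u)
        = augM W (compose (carrier (MO U)) (M_ar \<G> R \<iota> c V W g) (M_ar \<G> R \<iota> c U V f) u)"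
      by (simp add: M_ar_hom(2)[OF U W gf] M_ar_hom(2)[OF U V f] M_ar_hom(2)[OF V W g] compose_eq
          semilinD(1)[OF reductionD(3)[OF reduction_M(1)[OF U]]] semilinD(1)[OF T_homD(2)[OF M_ar_hom(1)[OF U V f]]])
  qed
qed

text \<open>The inverse is the lift of the identity of \<open>V\<close> in the opposite direction:
  both composites reduce to the identity of \<open>V\<close>.\<close>

lemma isomorphism_lift:
  fixes U U' :: "('r, 'p, 'n, 'b) Smod"
  assumes r: "reduction U V q" and r': "reduction U' V q'"
    and g: "g \<in> T_hom \<G> CS U U'" "\<And>u. u \<in> carrier U \<Longrightarrow> q' (g u) = q u"
  shows "isomorphism_in (catS \<G> R \<iota> c) U U' g"
proof -
  note U = reductionD(1)[OF r] and U' = reductionD(1)[OF r'] and V = reductionD(2)[OF r]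
  obtain h where h: "h \<in> T_hom \<G> CS U' U" "\<And>u. u \<in> carrier U' \<Longrightarrow> q (h u) = q' u"
    using reduction_lift_exists[OF r' r T_hom_id[OF V]] semilinD(1)[OF reductionD(3)[OF r']] by fastforce
  note gc = semilinD(1)[OF T_homD(2)[OF g(1)]] semilinD(1)[OF T_homD(2)[OF h(1)]]
  have "compose (carrier U) h g = (\<lambda>m\<in>carrier U. m)"
    by (rule T_hom_lift_unique[OF r U T_hom_compose[OF U g(1) h(1)] T_hom_id[OF U]]) (simp add: compose_eq g(2) h(2) gc)
  moreover have "compose (carrier U') g h = (\<lambda>m\<in>carrier U'. m)"
    by (rule T_hom_lift_unique[OF r' U' T_hom_compose[OF U' h(1) g(1)] T_hom_id[OF U']]) (simp add: compose_eq g(2) h(2) gc)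
  ultimately show ?thesis
    using g(1) h(1) unfolding isomorphism_in_def catS_def T_cat_simps by blast
qed

text \<open>The inverse is the induced map in the opposite direction; the composites are identities
  on all values of \<open>q\<close> and of \<open>q'\<close>, which exhaust the two modules.\<close>

lemma isomorphism_descend:
  fixes U :: "('r, 'p, 'n, 'b) Smod"
  assumes r: "reduction U V q" and r': "reduction U V' q'"
    and f: "f \<in> T_hom \<G> R V V'" "\<And>u. u \<in> carrier U \<Longrightarrow> f (q u) = q' u"
  shows "isomorphism_in (catR \<G> R) V V' f"
proof -
  note V = reductionD(2)[OF r] and V' = reductionD(2)[OF r']
  obtain h where h: "h \<in> T_hom \<G> R V' V" "\<And>u. u \<in> carrier U \<Longrightarrow> h (q' u) = q u"
    using reduction_descend[OF r' r] by blast
  note qc = semilinD(1)[OF reductionD(3)[OF r]] semilinD(1)[OF reductionD(3)[OF r']]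
  have "compose (carrier V) h f = (\<lambda>m\<in>carrier V. m)"
    by (rule T_hom_descend_unique[OF r T_hom_compose[OF V f(1) h(1)] T_hom_id[OF V]]) (simp add: compose_eq f(2) h(2) qc)
  moreover have "compose (carrier V') f h = (\<lambda>m\<in>carrier V'. m)"
    by (rule T_hom_descend_unique[OF r' T_hom_compose[OF V' h(1) f(1)] T_hom_id[OF V']]) (simp add: compose_eq f(2) h(2) qc)
  ultimately show ?thesis
    using f(1) h(1) unfolding isomorphism_in_def catR_def T_cat_simps by blast
qed

text \<open>For naturality, both composites reduce to u |-> 1 \<otimes> f(u) in the image of D, so
  they agree by uniqueness of lifts.\<close>

lemma unit:
  "naturally_isomorphic (catS \<G> R \<iota> c) (catS \<G> R \<iota> c) (\<lambda>U. U) (\<lambda>U V f. f)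
    (\<lambda>U :: ('r, 'p, 'n, 'b) Smod. MO (DO U)) (\<lambda>U V f. M_ar \<G> R \<iota> c (DO U) (DO V) (D_ar \<G> R \<iota> c U V f))"
proof -
  have "\<exists>g\<in>T_hom \<G> CS U (MO (DO U)). \<forall>u\<in>carrier U. augM (DO U) (g u) = tinD U u" if U: "TmS U" for U :: "('r, 'p, 'n, 'b) Smod"
  proof -
    note r = reduction_D[OF U]
    show ?thesis
      using reduction_lift_exists[OF r reduction_M(1)[OF reductionD(2)[OF r]] T_hom_id[OF reductionD(2)[OF r]]]
        semilinD(1)[OF reductionD(3)[OF r]] by fastforce
  qed
  then have "\<forall>U\<in>{U :: ('r, 'p, 'n, 'b) Smod. TmS U}. \<exists>g. g \<in> T_hom \<G> CS U (MO (DO U)) \<and> (\<forall>u\<in>carrier U. augM (DO U) (g u) = tinD U u)"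
    by (intro ballI) (simp only: mem_Collect_eq Bex_def)
  then obtain \<eta> where "\<forall>U\<in>{U :: ('r, 'p, 'n, 'b) Smod. TmS U}. \<eta> U \<in> T_hom \<G> CS U (MO (DO U)) \<and> (\<forall>u\<in>carrier U. augM (DO U) (\<eta> U u) = tinD U u)"
    by (rule bchoice[THEN exE])
  then have \<eta>: "\<And>U. TmS U \<Longrightarrow> \<eta> U \<in> T_hom \<G> CS U (MO (DO U))"
    "\<And>U u. TmS U \<Longrightarrow> u \<in> carrier U \<Longrightarrow> augM (DO U) (\<eta> U u) = tinD U u" by simp_all
  have nat: "compose (carrier U) (\<eta> V) f
      = compose (carrier U) (M_ar \<G> R \<iota> c (DO U) (DO V) (D_ar \<G> R \<iota> c U V f)) (\<eta> U)"
    if U: "TmS U" and V: "TmS V" and f: "f \<in> T_hom \<G> CS U V" for U V :: "('r, 'p, 'n, 'b) Smod" and f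
  proof -
    note DU = reductionD(2)[OF reduction_D[OF U]] and DV = reductionD(2)[OF reduction_D[OF V]]
    note Df = D_ar_hom[OF U V f]
    note MDf = M_ar_hom[OF DU DV Df(1)]
    show ?thesis
      by (rule T_hom_lift_unique[OF reduction_M(1)[OF DV] U T_hom_compose[OF U f \<eta>(1)[OF V]] T_hom_compose[OF U \<eta>(1)[OF U] MDf(1)]])
        (simp add: compose_eq \<eta>(2)[OF V] semilinD(1)[OF T_homD(2)[OF f]] MDf(2) semilinD(1)[OF T_homD(2)[OF \<eta>(1)[OF U]]]
          \<eta>(2)[OF U] Df(2))
  qed
  have iso: "isomorphism_in (catS \<G> R \<iota> c) U (MO (DO U)) (\<eta> U)" if U: "TmS U" for U :: "('r, 'p, 'n, 'b) Smod"
    by (rule isomorphism_lift[OF reduction_D[OF U] reduction_M(1)[OF reductionD(2)[OF reduction_D[OF U]]] \<eta>(1)[OF U] \<eta>(2)[OF U]])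
  show ?thesis
    unfolding naturally_isomorphic_def
    by (rule exI[of _ \<eta>]) (use iso nat in \<open>simp add: catS_def T_cat_simps\<close>)
qed

text \<open>For naturality, both composites send 1 \<otimes> u to the value of \<open>f\<close> at
  the augmentation of \<open>u\<close>, and every element of D(M(U)) has the form 1 \<otimes> u
  because a reduction is surjective.\<close>

lemma counit:
  "naturally_isomorphic (catR \<G> R) (catR \<G> R) (\<lambda>V :: ('r, 'p, 'n, 'b) Rmod. DO (MO V))
    (\<lambda>U V f. D_ar \<G> R \<iota> c (MO U) (MO V) (M_ar \<G> R \<iota> c U V f)) (\<lambda>V. V) (\<lambda>U V f. f)"
proof -
  have "\<exists>f\<in>T_hom \<G> R (DO (MO V)) V. \<forall>u\<in>carrier (MO V). f (tinD (MO V) u) = augM V u" if V: "TmR V" for V :: "('r, 'p, 'n, 'b) Rmod"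
    using reduction_descend[OF reduction_D[OF reductionD(1)[OF reduction_M(1)[OF V]]] reduction_M(1)[OF V]] .
  then have "\<forall>V\<in>{V :: ('r, 'p, 'n, 'b) Rmod. TmR V}. \<exists>f. f \<in> T_hom \<G> R (DO (MO V)) V \<and> (\<forall>u\<in>carrier (MO V). f (tinD (MO V) u) = augM V u)"
    by (intro ballI) (simp only: mem_Collect_eq Bex_def)
  then obtain \<epsilon> where "\<forall>V\<in>{V :: ('r, 'p, 'n, 'b) Rmod. TmR V}. \<epsilon> V \<in> T_hom \<G> R (DO (MO V)) V \<and> (\<forall>u\<in>carrier (MO V). \<epsilon> V (tinD (MO V) u) = augM V u)"
    by (rule bchoice[THEN exE])
  then have \<epsilon>: "\<And>V. TmR V \<Longrightarrow> \<epsilon> V \<in> T_hom \<G> R (DO (MO V)) V"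
    "\<And>V u. TmR V \<Longrightarrow> u \<in> carrier (MO V) \<Longrightarrow> \<epsilon> V (tinD (MO V) u) = augM V u" by simp_all
  have nat: "compose (carrier (DO (MO U))) (\<epsilon> V) (D_ar \<G> R \<iota> c (MO U) (MO V) (M_ar \<G> R \<iota> c U V f))
      = compose (carrier (DO (MO U))) f (\<epsilon> U)"
    if U: "TmR U" and V: "TmR V" and f: "f \<in> T_hom \<G> R U V" for U V :: "('r, 'p, 'n, 'b) Rmod" and f
  proof -
    note MU = reductionD(1)[OF reduction_M(1)[OF U]] and MV = reductionD(1)[OF reduction_M(1)[OF V]]
    note Mf = M_ar_hom[OF U V f]
    note DMf = D_ar_hom[OF MU MV Mf(1)]
    note r = reduction_D[OF MU]
    show ?thesis
      by (rule T_hom_descend_unique[OF r T_hom_compose[OF reductionD(2)[OF r] DMf(1) \<epsilon>(1)[OF V]]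
            T_hom_compose[OF reductionD(2)[OF r] \<epsilon>(1)[OF U] f]])
        (simp add: compose_eq \<epsilon>(2)[OF V] \<epsilon>(2)[OF U] semilinD(1)[OF T_homD(2)[OF Mf(1)]] DMf(2) Mf(2)
          semilinD(1)[OF reductionD(3)[OF r]])
  qed
  have iso: "isomorphism_in (catR \<G> R) (DO (MO V)) V (\<epsilon> V)" if V: "TmR V" for V :: "('r, 'p, 'n, 'b) Rmod"
    by (rule isomorphism_descend[OF reduction_D[OF reductionD(1)[OF reduction_M(1)[OF V]]] reduction_M(1)[OF V] \<epsilon>(1)[OF V] \<epsilon>(2)[OF V]])
  show ?thesis
    unfolding naturally_isomorphic_def
    by (rule exI[of _ \<epsilon>]) (use iso nat in \<open>simp add: catR_def T_cat_simps\<close>)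
qed

end

theorem proposition3p7:
  fixes \<G> :: "('p :: prime_type, 'n :: finite) datum"
    and R :: "('r, 'p, 'n) pg_ring"
    and \<iota> :: "'p padic \<Rightarrow> 'p padic ^ 'n ^ 'n"
    and c :: "nat \<Rightarrow> nat"
  assumes "group_setting \<G>"
    and "equivariant_section \<G> \<iota>"
    and "admissible \<G> \<iota> c"
    and "phi_gamma_ring \<G> R"
  shows "quasi_inverse_equivalences
           (catS \<G> R \<iota> c :: (('r, 'p, 'n, 'b) Smod, _) category)
           (catR \<G> R :: (('r, 'p, 'n, 'b) Rmod, _) category)
           (D_ob \<G> R \<iota> c) (D_ar \<G> R \<iota> c) (M_ob \<G> R \<iota> c) (M_ar \<G> R \<iota> c)"
proof -
  have "phi_ring R" using assms(4) by (simp add: phi_gamma_ring_def)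
  then interpret skew_data \<G> \<iota> c R
    using assms by unfold_locales
  show ?thesis
    unfolding quasi_inverse_equivalences_def
    by (intro conjI is_functor_D is_functor_M unit counit)
qed

end
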